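(* Let $(B,\alpha_1,Z_1,\phi_1)$ and $(F,\alpha_2,Z_2,\phi_2)$ be two connected contact manifolds with structure tensors $\phi_1$ and $\phi_2$ respectively, and let $\rho:\pi_1(B)\to \mathrm{Cont}(F,\phi_2)$ be any representation. Let $\tilde\alpha_1,\tilde\phi_1$ be the lifts of $\alpha_1,\phi_1$ to the universal covering $\tilde B$. Then the contact pair structure $(\tilde\alpha_1,\alpha_2,\tilde\phi_1\oplus\phi_2)$ on $\tilde B\times F$ descends to a contact pair structure $(\tilde\alpha_1,\alpha_2,\tilde\phi_1\oplus\phi_2)_\rho$ on the total space $M_\rho=(\tilde B\times F)/\pi_1(B)$ of the flat bundle associated with $\rho$. Moreover, this contact pair structure on $M_\rho$ is normal if and only if $(B,\alpha_1,Z_1,\phi_1)$ and $(F,\alpha_2,Z_2,\phi_2)$ are both normal as almost contact structures.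
   Context: All objects are smooth. Almost contact structures. An almost contact structure on a manifold $M$ is a triple $(\alpha,Z,\phi)$ of a $1$-form $\alpha$, a vector field $Z$ and a field $\phi$ of endomorphisms of $TM$ with $\phi^2=-\mathrm{Id}+\alpha\otimes Z$, $\phi(Z)=0$, $\alpha(Z)=1$. It is normal if the almost complex structure on $M\times\mathbb{R}$ given by $X+f\frac{d}{dt}\mapsto \phi X-fZ+\alpha(X)\frac{d}{dt}$ is integrable. A contact manifold with structure tensor $\phi$ is a manifold with an almost contact structure $(\alpha,Z,\phi)$ where $\alpha$ is a contact form and $Z$ is its Reeb vector field. Contact pairs. A contact pair of type $(h,k)$ on a $(2h+2k+2)$-dimensional manifold $M$ is a pair $(\alpha_1,\alpha_2)$ of $1$-forms such that $\alpha_1\wedge(d\alpha_1)^h\wedge\alpha_2\wedge(d\alpha_2)^k$ is a volume form, $(d\alpha_1)^{h+1}=0$ and $(d\alpha_2)^{k+1}=0$. Its Reeb vector fields $Z_1,Z_2$ are uniquely determined by $\alpha_i(Z_j)=\delta_{ij}$ and $i_{Z_j}d\alpha_i=0$ for $i,j\in\{1,2\}$. A contact pair structure on $M$ is a triple $(\alpha_1,\alpha_2,\phi)$ where $(\alpha_1,\alpha_2)$ is a contact pair and $\phi$ is a tensor field of type $(1,1)$ with $\phi^2=-\mathrm{Id}+\alpha_1\otimes Z_1+\alpha_2\otimes Z_2$ and $\phi(Z_1)=\phi(Z_2)=0$. To it are associated the almost complex structures $J=\phi-\alpha_2\otimes Z_1+\alpha_1\otimes Z_2$ and $T=\phi+\alpha_2\otimes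 Z_1-\alpha_1\otimes Z_2$. The contact pair structure is called normal (a normal contact pair) if $J$ and $T$ are both integrable, i.e. the Nijenhuis tensors $N_J$ and $N_T$ vanish identically. Flat bundles. $\mathrm{Cont}(F,\phi_2)$ is the group of diffeomorphisms $f$ of $F$ with $f^*\alpha_2=\alpha_2$ and $f_*\circ\phi_2=\phi_2\circ f_*$. The group $\pi_1(B)$ acts on $\tilde B\times F$ by covering transformations on $\tilde B$ and via $\rho$ on $F$; $M_\rho$ is the quotient, a fibre bundle over $B$ with fibre $F$. On $\tilde B\times F$ the forms $\tilde\alpha_1,\alpha_2$ are understood as pulled back from the factors, and $\tilde\phi_1\oplus\phi_2$ acts on $T(\tilde B\times F)=T\tilde B\oplus TF$. *)

theory Defs
  imports "HOL-Analysis.Analysis" "HOL-Algebra.Bij"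
begin

section \<open>Smooth maps between open subsets of Euclidean spaces\<close>

text \<open>Only used for open \<open>S\<close>, where \<open>Ck_on n S f\<close> says that \<open>f\<close> is of class $C^n$ on \<open>S\<close>.\<close>

primrec Ck_on ::
  "nat \<Rightarrow> 'a::euclidean_space set \<Rightarrow> ('a \<Rightarrow> 'b::real_normed_vector) \<Rightarrow> bool" where
  "Ck_on 0 S f \<longleftrightarrow> continuous_on S f"
| "Ck_on (Suc n) S f \<longleftrightarrow> (\<forall>x\<in>S. f differentiable (at x)) \<and>
     (\<forall>v. Ck_on n S (\<lambda>x. frechet_derivative f (at x) v))"

definition smooth_on ::
  "'a::euclidean_space set \<Rightarrow> ('a \<Rightarrow> 'b::real_normed_vector) \<Rightarrow> bool" where
  "smooth_on S f \<longleftrightarrow> (\<forall>n. Ck_on n S f)"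


section \<open>Smooth manifolds\<close>

text \<open>
  A chart is its domain together with its coordinate map; the values of the coordinate map outside
  the domain are irrelevant. Besides an atlas, a manifold carries a preferred chart around each
  point. The preferred chart at \<open>p\<close> is used to identify the tangent space at \<open>p\<close> with the model
  space \<open>'e\<close>; hence tangent vectors at \<open>p\<close> are elements of \<open>'e\<close>, vector fields have type
  \<open>'a \<Rightarrow> 'e\<close>, 1-forms have type \<open>'a \<Rightarrow> 'e \<Rightarrow> real\<close> and endomorphism fields have
  type \<open>'a \<Rightarrow> 'e \<Rightarrow> 'e\<close>. Values of such fields at points outside the manifold are irrelevant. The
  preferred charts at different points are unrelated, so smoothness and derivatives of tensor fields
  are always expressed through their components in a fixed chart.
\<close>

type_synonym ('a, 'e) chart = "'a set \<times> ('a \<Rightarrow> 'e)"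

record ('a, 'e) manifold =
  mtop :: "'a topology"
  atlas :: "('a, 'e) chart set"
  chart_at :: "'a \<Rightarrow> ('a, 'e) chart"

abbreviation pts :: "('a, 'e) manifold \<Rightarrow> 'a set" where
  "pts M \<equiv> topspace (mtop M)"

definition chart_inv :: "('a, 'e) chart \<Rightarrow> 'e \<Rightarrow> 'a" where
  "chart_inv c = inv_into (fst c) (snd c)"

definition smooth_manifold :: "('a, 'e::euclidean_space) manifold \<Rightarrow> bool" where
  "smooth_manifold M \<longleftrightarrow>
     Hausdorff_space (mtop M) \<and> second_countable (mtop M) \<and>
     (\<forall>c\<in>atlas M. openin (mtop M) (fst c) \<and> open (snd c ` fst c) \<and>
        homeomorphic_map (subtopology (mtop M) (fst c)) (top_of_set (snd c ` fst c)) (snd c)) \<and>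
     (\<forall>p\<in>pts M. chart_at M p \<in> atlas M \<and> p \<in> fst (chart_at M p)) \<and>
     (\<forall>c\<in>atlas M. \<forall>d\<in>atlas M. smooth_on (snd c ` (fst c \<inter> fst d)) (snd d \<circ> chart_inv c))"

definition smooth_map_on ::
  "'a set \<Rightarrow> ('a, 'e::euclidean_space) manifold \<Rightarrow> ('b, 'g::euclidean_space) manifold
    \<Rightarrow> ('a \<Rightarrow> 'b) \<Rightarrow> bool" where
  "smooth_map_on U M N f \<longleftrightarrow>
     openin (mtop M) U \<and> continuous_map (subtopology (mtop M) U) (mtop N) f \<and>
     (\<forall>c\<in>atlas M. \<forall>d\<in>atlas N.
        smooth_on (snd c ` (U \<inter> fst c \<inter> f -` fst d)) (snd d \<circ> f \<circ> chart_inv c))"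

definition local_diffeo ::
  "('a, 'e::euclidean_space) manifold \<Rightarrow> ('b, 'g::euclidean_space) manifold
    \<Rightarrow> ('a \<Rightarrow> 'b) \<Rightarrow> bool" where
  "local_diffeo M N f \<longleftrightarrow>
     (\<forall>x\<in>pts M. \<exists>U. x \<in> U \<and> inj_on f U \<and>
        smooth_map_on U M N f \<and> smooth_map_on (f ` U) N M (inv_into U f))"

definition tangent_map ::
  "('a, 'e::euclidean_space) manifold \<Rightarrow> ('b, 'g::euclidean_space) manifold
    \<Rightarrow> ('a \<Rightarrow> 'b) \<Rightarrow> 'a \<Rightarrow> 'e \<Rightarrow> 'g" where
  "tangent_map M N f p =
     frechet_derivative (snd (chart_at N (f p)) \<circ> f \<circ> chart_inv (chart_at M p))
       (at (snd (chart_at M p) p))"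

definition real_line :: "(real, real) manifold" where
  "real_line = \<lparr>mtop = euclidean, atlas = {(UNIV, id)}, chart_at = (\<lambda>t. (UNIV, id))\<rparr>"

definition prod_chart :: "('a, 'e) chart \<Rightarrow> ('b, 'g) chart \<Rightarrow> ('a \<times> 'b, 'e \<times> 'g) chart" where
  "prod_chart c d = (fst c \<times> fst d, map_prod (snd c) (snd d))"

text \<open>
  With this choice of preferred charts the tangent space of a product at \<open>(p, q)\<close> is literally the
  product of the tangent spaces at \<open>p\<close> and at \<open>q\<close>.
\<close>

definition prod_manifold ::
  "('a, 'e) manifold \<Rightarrow> ('b, 'g) manifold \<Rightarrow> ('a \<times> 'b, 'e \<times> 'g) manifold" where
  "prod_manifold M N =
     \<lparr>mtop = prod_topology (mtop M) (mtop N),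
      atlas = {prod_chart c d | c d. c \<in> atlas M \<and> d \<in> atlas N},
      chart_at = (\<lambda>(p, q). prod_chart (chart_at M p) (chart_at N q))\<rparr>"

text \<open>
  The quotient of a manifold \<open>M\<close> by an equivalence relation \<open>R\<close> on its points. The points are the
  equivalence classes, with the quotient topology; the charts come from restrictions of charts of \<open>M\<close>
  to open sets that meet every class at most once.
\<close>

definition quotient_atlas ::
  "('a, 'e) manifold \<Rightarrow> 'a rel \<Rightarrow> ('a set, 'e) chart set" where
  "quotient_atlas M R =
     {((\<lambda>x. R `` {x}) ` W, f \<circ> inv_into W (\<lambda>x. R `` {x})) | W U f.
        (U, f) \<in> atlas M \<and> openin (mtop M) W \<and> W \<subseteq> U \<and> inj_on (\<lambda>x. R `` {x}) W}"

definition quotient_manifold :: "('a, 'e) manifold \<Rightarrow> 'a rel \<Rightarrow> ('a set, 'e) manifold" where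
  "quotient_manifold M R =
     \<lparr>mtop = topology (\<lambda>V. V \<subseteq> pts M // R \<and> openin (mtop M) (\<Union>V)),
      atlas = quotient_atlas M R,
      chart_at = (\<lambda>m. SOME c. c \<in> quotient_atlas M R \<and> m \<in> fst c)\<rparr>"


section \<open>Tensor fields\<close>

text \<open>
  The linear map sending a tangent vector at \<open>p\<close> to its components in the chart \<open>c\<close>, and its inverse.
\<close>

definition to_chart ::
  "('a, 'e::euclidean_space) manifold \<Rightarrow> ('a, 'e) chart \<Rightarrow> 'a \<Rightarrow> 'e \<Rightarrow> 'e" where
  "to_chart M c p =
     frechet_derivative (snd c \<circ> chart_inv (chart_at M p)) (at (snd (chart_at M p) p))"

definition of_chart ::
  "('a, 'e::euclidean_space) manifold \<Rightarrow> ('a, 'e) chart \<Rightarrow> 'a \<Rightarrow> 'e \<Rightarrow> 'e" where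
  "of_chart M c p = frechet_derivative (snd (chart_at M p) \<circ> chart_inv c) (at (snd c p))"

definition vf_rep ::
  "('a, 'e::euclidean_space) manifold \<Rightarrow> ('a, 'e) chart \<Rightarrow> ('a \<Rightarrow> 'e) \<Rightarrow> 'e \<Rightarrow> 'e" where
  "vf_rep M c X x = to_chart M c (chart_inv c x) (X (chart_inv c x))"

definition form_rep ::
  "('a, 'e::euclidean_space) manifold \<Rightarrow> ('a, 'e) chart \<Rightarrow> ('a \<Rightarrow> 'e \<Rightarrow> real)
    \<Rightarrow> 'e \<Rightarrow> 'e \<Rightarrow> real" where
  "form_rep M c \<alpha> x v = \<alpha> (chart_inv c x) (of_chart M c (chart_inv c x) v)"

definition endo_rep ::
  "('a, 'e::euclidean_space) manifold \<Rightarrow> ('a, 'e) chart \<Rightarrow> ('a \<Rightarrow> 'e \<Rightarrow> 'e)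
    \<Rightarrow> 'e \<Rightarrow> 'e \<Rightarrow> 'e" where
  "endo_rep M c \<phi> x v =
     to_chart M c (chart_inv c x) (\<phi> (chart_inv c x) (of_chart M c (chart_inv c x) v))"

definition smooth_vf_on ::
  "'a set \<Rightarrow> ('a, 'e::euclidean_space) manifold \<Rightarrow> ('a \<Rightarrow> 'e) \<Rightarrow> bool" where
  "smooth_vf_on U M X \<longleftrightarrow> (\<forall>c\<in>atlas M. smooth_on (snd c ` (U \<inter> fst c)) (vf_rep M c X))"

definition smooth_form ::
  "('a, 'e::euclidean_space) manifold \<Rightarrow> ('a \<Rightarrow> 'e \<Rightarrow> real) \<Rightarrow> bool" where
  "smooth_form M \<alpha> \<longleftrightarrow> (\<forall>p\<in>pts M. linear (\<alpha> p)) \<and>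
     (\<forall>c\<in>atlas M. \<forall>v. smooth_on (snd c ` fst c) (\<lambda>x. form_rep M c \<alpha> x v))"

definition smooth_endo ::
  "('a, 'e::euclidean_space) manifold \<Rightarrow> ('a \<Rightarrow> 'e \<Rightarrow> 'e) \<Rightarrow> bool" where
  "smooth_endo M \<phi> \<longleftrightarrow> (\<forall>p\<in>pts M. linear (\<phi> p)) \<and>
     (\<forall>c\<in>atlas M. \<forall>v. smooth_on (snd c ` fst c) (\<lambda>x. endo_rep M c \<phi> x v))"

text \<open>
  Lie bracket and exterior derivative at \<open>p\<close> are computed from the components in the preferred chart
  at \<open>p\<close>, in which the components of tangent vectors at \<open>p\<close> are these vectors themselves. The
  exterior derivative is normalized by
  $d\alpha(X,Y) = X(\alpha(Y)) - Y(\alpha(X)) - \alpha([X,Y])$.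
\<close>

definition lie_bracket ::
  "('a, 'e::euclidean_space) manifold \<Rightarrow> ('a \<Rightarrow> 'e) \<Rightarrow> ('a \<Rightarrow> 'e) \<Rightarrow> 'a \<Rightarrow> 'e" where
  "lie_bracket M X Y p =
     (let c = chart_at M p; x = snd c p in
        frechet_derivative (vf_rep M c Y) (at x) (X p)
        - frechet_derivative (vf_rep M c X) (at x) (Y p))"

definition ext_deriv ::
  "('a, 'e::euclidean_space) manifold \<Rightarrow> ('a \<Rightarrow> 'e \<Rightarrow> real) \<Rightarrow> 'a \<Rightarrow> 'e \<Rightarrow> 'e \<Rightarrow> real" where
  "ext_deriv M \<alpha> p u v =
     (let c = chart_at M p; x = snd c p in
        frechet_derivative (\<lambda>y. form_rep M c \<alpha> y v) (at x) u
        - frechet_derivative (\<lambda>y. form_rep M c \<alpha> y u) (at x) v)"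

definition nijenhuis ::
  "('a, 'e::euclidean_space) manifold \<Rightarrow> ('a \<Rightarrow> 'e \<Rightarrow> 'e) \<Rightarrow> ('a \<Rightarrow> 'e) \<Rightarrow> ('a \<Rightarrow> 'e)
    \<Rightarrow> 'a \<Rightarrow> 'e" where
  "nijenhuis M J X Y p =
     J p (J p (lie_bracket M X Y p))
     + lie_bracket M (\<lambda>q. J q (X q)) (\<lambda>q. J q (Y q)) p
     - J p (lie_bracket M (\<lambda>q. J q (X q)) Y p)
     - J p (lie_bracket M X (\<lambda>q. J q (Y q)) p)"

text \<open>
  Vanishing of the Nijenhuis tensor, tested on vector fields defined on arbitrary open subsets.
\<close>

definition integrable_structure ::
  "('a, 'e::euclidean_space) manifold \<Rightarrow> ('a \<Rightarrow> 'e \<Rightarrow> 'e) \<Rightarrow> bool" where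
  "integrable_structure M J \<longleftrightarrow>
     (\<forall>U X Y. openin (mtop M) U \<and> smooth_vf_on U M X \<and> smooth_vf_on U M Y \<longrightarrow>
        (\<forall>p\<in>U. nijenhuis M J X Y p = 0))"


section \<open>Exterior algebra\<close>

text \<open>
  A form of degree \<open>k\<close> on \<open>'e\<close> is a function of the first \<open>k\<close> entries of a sequence of vectors.
\<close>

type_synonym 'e ext_form = "(nat \<Rightarrow> 'e) \<Rightarrow> real"

definition wedge :: "nat \<Rightarrow> nat \<Rightarrow> 'e ext_form \<Rightarrow> 'e ext_form \<Rightarrow> 'e ext_form" where
  "wedge p q \<omega> \<eta> v =
     (\<Sum>\<sigma> | \<sigma> permutes {..<p + q}.
        of_int (sign \<sigma>) * \<omega> (\<lambda>i. v (\<sigma> i)) * \<eta> (\<lambda>i. v (\<sigma> (p + i)))) / (fact p * fact q)"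

primrec wedge_power :: "nat \<Rightarrow> 'e ext_form \<Rightarrow> nat \<Rightarrow> 'e ext_form" where
  "wedge_power p \<omega> 0 = (\<lambda>v. 1)"
| "wedge_power p \<omega> (Suc n) = wedge p (p * n) \<omega> (wedge_power p \<omega> n)"

definition form1 :: "('a \<Rightarrow> 'e \<Rightarrow> real) \<Rightarrow> 'a \<Rightarrow> 'e ext_form" where
  "form1 \<alpha> p v = \<alpha> p (v 0)"

definition dform ::
  "('a, 'e::euclidean_space) manifold \<Rightarrow> ('a \<Rightarrow> 'e \<Rightarrow> real) \<Rightarrow> 'a \<Rightarrow> 'e ext_form" where
  "dform M \<alpha> p v = ext_deriv M \<alpha> p (v 0) (v 1)"

text \<open>The form $\alpha\wedge(d\alpha)^n$ of degree $2n+1$.\<close>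

definition contact_volume ::
  "nat \<Rightarrow> ('a, 'e::euclidean_space) manifold \<Rightarrow> ('a \<Rightarrow> 'e \<Rightarrow> real) \<Rightarrow> 'a \<Rightarrow> 'e ext_form" where
  "contact_volume n M \<alpha> p = wedge 1 (2 * n) (form1 \<alpha> p) (wedge_power 2 (dform M \<alpha> p) n)"

text \<open>
  To be applied to a form whose degree is the dimension of \<open>M\<close>: such a form is a volume form iff it
  vanishes at no point.
\<close>

definition nowhere_zero :: "('a, 'e) manifold \<Rightarrow> ('a \<Rightarrow> 'e ext_form) \<Rightarrow> bool" where
  "nowhere_zero M \<omega> \<longleftrightarrow> (\<forall>p\<in>pts M. \<exists>v. \<omega> p v \<noteq> 0)"


section \<open>Almost contact structures and contact manifolds\<close>

definition almost_contact_structure ::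
  "('a, 'e::euclidean_space) manifold \<Rightarrow> ('a \<Rightarrow> 'e \<Rightarrow> real) \<Rightarrow> ('a \<Rightarrow> 'e)
    \<Rightarrow> ('a \<Rightarrow> 'e \<Rightarrow> 'e) \<Rightarrow> bool" where
  "almost_contact_structure M \<alpha> Z \<phi> \<longleftrightarrow>
     smooth_form M \<alpha> \<and> smooth_vf_on (pts M) M Z \<and> smooth_endo M \<phi> \<and>
     (\<forall>p\<in>pts M. (\<forall>v. \<phi> p (\<phi> p v) = - v + \<alpha> p v *\<^sub>R Z p) \<and> \<phi> p (Z p) = 0 \<and> \<alpha> p (Z p) = 1)"

definition cylinder_structure ::
  "('a \<Rightarrow> 'e \<Rightarrow> real) \<Rightarrow> ('a \<Rightarrow> 'e) \<Rightarrow> ('a \<Rightarrow> 'e \<Rightarrow> 'e)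
    \<Rightarrow> 'a \<times> real \<Rightarrow> 'e::real_vector \<times> real \<Rightarrow> 'e \<times> real" where
  "cylinder_structure \<alpha> Z \<phi> = (\<lambda>(p, t) (v, f). (\<phi> p v - f *\<^sub>R Z p, \<alpha> p v))"

definition normal_almost_contact ::
  "('a, 'e::euclidean_space) manifold \<Rightarrow> ('a \<Rightarrow> 'e \<Rightarrow> real) \<Rightarrow> ('a \<Rightarrow> 'e)
    \<Rightarrow> ('a \<Rightarrow> 'e \<Rightarrow> 'e) \<Rightarrow> bool" where
  "normal_almost_contact M \<alpha> Z \<phi> \<longleftrightarrow>
     almost_contact_structure M \<alpha> Z \<phi> \<and>
     integrable_structure (prod_manifold M real_line) (cylinder_structure \<alpha> Z \<phi>)"

definition contact_manifold ::
  "nat \<Rightarrow> ('a, 'e::euclidean_space) manifold \<Rightarrow> ('a \<Rightarrow> 'e \<Rightarrow> real) \<Rightarrow> ('a \<Rightarrow> 'e)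
    \<Rightarrow> ('a \<Rightarrow> 'e \<Rightarrow> 'e) \<Rightarrow> bool" where
  "contact_manifold n M \<alpha> Z \<phi> \<longleftrightarrow>
     smooth_manifold M \<and> DIM('e) = 2 * n + 1 \<and> almost_contact_structure M \<alpha> Z \<phi> \<and>
     nowhere_zero M (contact_volume n M \<alpha>) \<and>
     (\<forall>p\<in>pts M. \<forall>v. ext_deriv M \<alpha> p (Z p) v = 0)"


section \<open>Contact pairs\<close>

definition contact_pair ::
  "nat \<Rightarrow> nat \<Rightarrow> ('a, 'e::euclidean_space) manifold \<Rightarrow> ('a \<Rightarrow> 'e \<Rightarrow> real)
    \<Rightarrow> ('a \<Rightarrow> 'e \<Rightarrow> real) \<Rightarrow> bool" where
  "contact_pair h k M \<alpha>1 \<alpha>2 \<longleftrightarrow>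
     smooth_manifold M \<and> DIM('e) = 2 * h + 2 * k + 2 \<and>
     smooth_form M \<alpha>1 \<and> smooth_form M \<alpha>2 \<and>
     nowhere_zero M (\<lambda>p. wedge (2 * h + 1) (2 * k + 1)
       (contact_volume h M \<alpha>1 p) (contact_volume k M \<alpha>2 p)) \<and>
     (\<forall>p\<in>pts M. \<forall>v. wedge_power 2 (dform M \<alpha>1 p) (h + 1) v = 0) \<and>
     (\<forall>p\<in>pts M. \<forall>v. wedge_power 2 (dform M \<alpha>2 p) (k + 1) v = 0)"

text \<open>
  The Reeb vector fields of the contact pair \<open>(\<alpha>, \<beta>)\<close> are \<open>reeb_vf M \<alpha> \<beta>\<close> and \<open>reeb_vf M \<beta> \<alpha>\<close>.
\<close>

definition reeb_vf ::
  "('a, 'e::euclidean_space) manifold \<Rightarrow> ('a \<Rightarrow> 'e \<Rightarrow> real) \<Rightarrow> ('a \<Rightarrow> 'e \<Rightarrow> real) \<Rightarrow> 'a \<Rightarrow> 'e"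
  where
  "reeb_vf M \<alpha> \<beta> p =
     (THE z. \<alpha> p z = 1 \<and> \<beta> p z = 0 \<and>
        (\<forall>v. ext_deriv M \<alpha> p z v = 0) \<and> (\<forall>v. ext_deriv M \<beta> p z v = 0))"

definition contact_pair_structure ::
  "nat \<Rightarrow> nat \<Rightarrow> ('a, 'e::euclidean_space) manifold \<Rightarrow> ('a \<Rightarrow> 'e \<Rightarrow> real)
    \<Rightarrow> ('a \<Rightarrow> 'e \<Rightarrow> real) \<Rightarrow> ('a \<Rightarrow> 'e \<Rightarrow> 'e) \<Rightarrow> bool" where
  "contact_pair_structure h k M \<alpha>1 \<alpha>2 \<phi> \<longleftrightarrow>
     contact_pair h k M \<alpha>1 \<alpha>2 \<and> smooth_endo M \<phi> \<and>
     (\<forall>p\<in>pts M.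
        (\<forall>v. \<phi> p (\<phi> p v) = - v + \<alpha>1 p v *\<^sub>R reeb_vf M \<alpha>1 \<alpha>2 p + \<alpha>2 p v *\<^sub>R reeb_vf M \<alpha>2 \<alpha>1 p) \<and>
        \<phi> p (reeb_vf M \<alpha>1 \<alpha>2 p) = 0 \<and> \<phi> p (reeb_vf M \<alpha>2 \<alpha>1 p) = 0)"

definition pair_J ::
  "('a, 'e::euclidean_space) manifold \<Rightarrow> ('a \<Rightarrow> 'e \<Rightarrow> real) \<Rightarrow> ('a \<Rightarrow> 'e \<Rightarrow> real)
    \<Rightarrow> ('a \<Rightarrow> 'e \<Rightarrow> 'e) \<Rightarrow> 'a \<Rightarrow> 'e \<Rightarrow> 'e" where
  "pair_J M \<alpha>1 \<alpha>2 \<phi> p v =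
     \<phi> p v - \<alpha>2 p v *\<^sub>R reeb_vf M \<alpha>1 \<alpha>2 p + \<alpha>1 p v *\<^sub>R reeb_vf M \<alpha>2 \<alpha>1 p"

definition pair_T ::
  "('a, 'e::euclidean_space) manifold \<Rightarrow> ('a \<Rightarrow> 'e \<Rightarrow> real) \<Rightarrow> ('a \<Rightarrow> 'e \<Rightarrow> real)
    \<Rightarrow> ('a \<Rightarrow> 'e \<Rightarrow> 'e) \<Rightarrow> 'a \<Rightarrow> 'e \<Rightarrow> 'e" where
  "pair_T M \<alpha>1 \<alpha>2 \<phi> p v =
     \<phi> p v + \<alpha>2 p v *\<^sub>R reeb_vf M \<alpha>1 \<alpha>2 p - \<alpha>1 p v *\<^sub>R reeb_vf M \<alpha>2 \<alpha>1 p"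

definition normal_contact_pair ::
  "nat \<Rightarrow> nat \<Rightarrow> ('a, 'e::euclidean_space) manifold \<Rightarrow> ('a \<Rightarrow> 'e \<Rightarrow> real)
    \<Rightarrow> ('a \<Rightarrow> 'e \<Rightarrow> real) \<Rightarrow> ('a \<Rightarrow> 'e \<Rightarrow> 'e) \<Rightarrow> bool" where
  "normal_contact_pair h k M \<alpha>1 \<alpha>2 \<phi> \<longleftrightarrow>
     contact_pair_structure h k M \<alpha>1 \<alpha>2 \<phi> \<and>
     integrable_structure M (pair_J M \<alpha>1 \<alpha>2 \<phi>) \<and> integrable_structure M (pair_T M \<alpha>1 \<alpha>2 \<phi>)"


section \<open>Lifts, products and descent of tensor fields\<close>

definition pullback_form ::
  "('a, 'e::euclidean_space) manifold \<Rightarrow> ('b, 'g::euclidean_space) manifold \<Rightarrow> ('a \<Rightarrow> 'b)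
    \<Rightarrow> ('b \<Rightarrow> 'g \<Rightarrow> real) \<Rightarrow> 'a \<Rightarrow> 'e \<Rightarrow> real" where
  "pullback_form M N f \<alpha> p v = \<alpha> (f p) (tangent_map M N f p v)"

text \<open>The lift along a local diffeomorphism \<open>f\<close>.\<close>

definition lift_endo ::
  "('a, 'e::euclidean_space) manifold \<Rightarrow> ('b, 'g::euclidean_space) manifold \<Rightarrow> ('a \<Rightarrow> 'b)
    \<Rightarrow> ('b \<Rightarrow> 'g \<Rightarrow> 'g) \<Rightarrow> 'a \<Rightarrow> 'e \<Rightarrow> 'e" where
  "lift_endo M N f \<phi> p v =
     inv_into UNIV (tangent_map M N f p) (\<phi> (f p) (tangent_map M N f p v))"

definition sum_endo ::
  "('a \<Rightarrow> 'e \<Rightarrow> 'e) \<Rightarrow> ('b \<Rightarrow> 'g \<Rightarrow> 'g) \<Rightarrow> 'a \<times> 'b \<Rightarrow> 'e \<times> 'g \<Rightarrow> 'e \<times> 'g" where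
  "sum_endo \<phi> \<psi> = (\<lambda>(p, q) (u, v). (\<phi> p u, \<psi> q v))"

text \<open>
  \<open>(\<alpha>1, \<alpha>2, \<phi>)\<close> on \<open>P\<close> descends along the local diffeomorphism \<open>q\<close> to \<open>(\<beta>1, \<beta>2, \<psi>)\<close> on \<open>M\<close>.
\<close>

definition descends ::
  "('a, 'e::euclidean_space) manifold \<Rightarrow> ('b, 'g::euclidean_space) manifold \<Rightarrow> ('a \<Rightarrow> 'b)
    \<Rightarrow> ('a \<Rightarrow> 'e \<Rightarrow> real) \<Rightarrow> ('a \<Rightarrow> 'e \<Rightarrow> real) \<Rightarrow> ('a \<Rightarrow> 'e \<Rightarrow> 'e)
    \<Rightarrow> ('b \<Rightarrow> 'g \<Rightarrow> real) \<Rightarrow> ('b \<Rightarrow> 'g \<Rightarrow> real) \<Rightarrow> ('b \<Rightarrow> 'g \<Rightarrow> 'g) \<Rightarrow> bool" where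
  "descends P M q \<alpha>1 \<alpha>2 \<phi> \<beta>1 \<beta>2 \<psi> \<longleftrightarrow>
     local_diffeo P M q \<and> q ` pts P = pts M \<and>
     (\<forall>x\<in>pts P. \<forall>v.
        pullback_form P M q \<beta>1 x v = \<alpha>1 x v \<and>
        pullback_form P M q \<beta>2 x v = \<alpha>2 x v \<and>
        tangent_map P M q x (\<phi> x v) = \<psi> (q x) (tangent_map P M q x v))"


section \<open>Universal coverings and flat bundles\<close>

definition path_class :: "'a::topological_space set \<Rightarrow> (real \<Rightarrow> 'a) \<Rightarrow> (real \<Rightarrow> 'a) set" where
  "path_class S \<gamma> = {\<delta>. homotopic_paths S \<gamma> \<delta>}"

definition fundamental_group ::
  "'a::topological_space set \<Rightarrow> 'a \<Rightarrow> (real \<Rightarrow> 'a) set monoid" where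
  "fundamental_group S b =
     \<lparr>carrier = {path_class S \<gamma> | \<gamma>.
        path \<gamma> \<and> path_image \<gamma> \<subseteq> S \<and> pathstart \<gamma> = b \<and> pathfinish \<gamma> = b},
      mult = (\<lambda>G H. \<Union>\<gamma>\<in>G. \<Union>\<delta>\<in>H. path_class S (\<gamma> +++ \<delta>)),
      one = path_class S (\<lambda>t. b)\<rparr>"

text \<open>
  The library notions of covering space and simple connectedness concern subsets of a topological type;
  so the topologies of \<open>E\<close> and \<open>B\<close> are required to be the ones induced from the ambient types.
\<close>

definition universal_covering ::
  "('c::topological_space, 'e::euclidean_space) manifold \<Rightarrow> ('c \<Rightarrow> 'a)
    \<Rightarrow> ('a::topological_space, 'e) manifold \<Rightarrow> bool" where
  "universal_covering E p B \<longleftrightarrow>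
     smooth_manifold E \<and> smooth_manifold B \<and>
     mtop E = top_of_set (pts E) \<and> mtop B = top_of_set (pts B) \<and>
     covering_space (pts E) p (pts B) \<and> simply_connected (pts E) \<and> local_diffeo E B p"

definition covering_transformations ::
  "'c::topological_space set \<Rightarrow> ('c \<Rightarrow> 'a) \<Rightarrow> ('c \<Rightarrow> 'c) set" where
  "covering_transformations C p =
     {f \<in> Bij C. homeomorphism C C f (inv_into C f) \<and> (\<forall>x\<in>C. p (f x) = p x)}"

text \<open>
  The action of the fundamental group of the base, based at \<open>p e\<close>, on the universal covering space
  \<open>C\<close> with base point \<open>e\<close>: the class of a loop \<open>\<gamma>\<close> acts by the covering transformation that maps \<open>e\<close> to
  the endpoint of the lift of \<open>\<gamma>\<close> starting at \<open>e\<close>. As \<open>\<gamma> +++ \<delta>\<close> runs through \<open>\<gamma>\<close> first, this is a left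
  action.
\<close>

definition deck_action ::
  "'c::topological_space set \<Rightarrow> ('c \<Rightarrow> 'a::topological_space) \<Rightarrow> 'c \<Rightarrow> (real \<Rightarrow> 'a) set
    \<Rightarrow> 'c \<Rightarrow> 'c" where
  "deck_action C p e g =
     (THE f. f \<in> covering_transformations C p \<and>
        (\<exists>\<gamma>\<in>g. \<exists>\<eta>. path \<eta> \<and> path_image \<eta> \<subseteq> C \<and> pathstart \<eta> = e \<and>
           (\<forall>t\<in>{0..1}. p (\<eta> t) = \<gamma> t) \<and> f e = pathfinish \<eta>))"

definition Cont ::
  "('f, 'g::euclidean_space) manifold \<Rightarrow> ('f \<Rightarrow> 'g \<Rightarrow> real) \<Rightarrow> ('f \<Rightarrow> 'g \<Rightarrow> 'g) \<Rightarrow> ('f \<Rightarrow> 'f) monoid"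
  where
  "Cont F \<alpha> \<phi> = BijGroup (pts F)
     \<lparr>carrier := {f \<in> Bij (pts F).
        smooth_map_on (pts F) F F f \<and> smooth_map_on (pts F) F F (inv_into (pts F) f) \<and>
        (\<forall>p\<in>pts F. \<forall>v. pullback_form F F f \<alpha> p v = \<alpha> p v \<and>
           tangent_map F F f p (\<phi> p v) = \<phi> (f p) (tangent_map F F f p v))}\<rparr>"

definition orbit_rel ::
  "('c::topological_space, 'e) manifold \<Rightarrow> ('c \<Rightarrow> 'a::topological_space) \<Rightarrow> 'c
    \<Rightarrow> ('f, 'g) manifold \<Rightarrow> ((real \<Rightarrow> 'a) set \<Rightarrow> 'f \<Rightarrow> 'f) \<Rightarrow> ('c \<times> 'f) rel" where
  "orbit_rel E p e F \<rho> =
     {((x, y), (deck_action (pts E) p e g x, \<rho> g y)) | x y g.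
        x \<in> pts E \<and> y \<in> pts F \<and> g \<in> carrier (fundamental_group (p ` pts E) (p e))}"

definition flat_bundle ::
  "('c::topological_space, 'e) manifold \<Rightarrow> ('c \<Rightarrow> 'a::topological_space) \<Rightarrow> 'c
    \<Rightarrow> ('f, 'g) manifold \<Rightarrow> ((real \<Rightarrow> 'a) set \<Rightarrow> 'f \<Rightarrow> 'f) \<Rightarrow> (('c \<times> 'f) set, 'e \<times> 'g) manifold"
  where
  "flat_bundle E p e F \<rho> = quotient_manifold (prod_manifold E F) (orbit_rel E p e F \<rho>)"

definition flat_bundle_proj ::
  "('c::topological_space, 'e) manifold \<Rightarrow> ('c \<Rightarrow> 'a::topological_space) \<Rightarrow> 'c
    \<Rightarrow> ('f, 'g) manifold \<Rightarrow> ((real \<Rightarrow> 'a) set \<Rightarrow> 'f \<Rightarrow> 'f) \<Rightarrow> 'c \<times> 'f \<Rightarrow> ('c \<times> 'f) set" where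
  "flat_bundle_proj E p e F \<rho> x = orbit_rel E p e F \<rho> `` {x}"

end

theory Submission
  imports Defs
begin

text \<open>
  Write \<open>E\<close> for the universal covering of \<open>B\<close>. Contact pairs, their Reeb vector fields and
  integrability are local notions, so they carry over in both directions along the surjective local
  diffeomorphisms from \<open>E \<times> F\<close> onto \<open>B \<times> F\<close> and onto the flat bundle; the latter exists because the
  fundamental group acts freely and properly discontinuously on \<open>E\<close> by deck transformations. This
  leaves the contact pair $(\alpha_1, \alpha_2)$ on \<open>B \<times> F\<close>. There the vanishing of $N_J$, and
  likewise that of $N_T$, splits into the same three conditions on each factor,
  $N_\phi + d\alpha\otimes Z = 0$, $d\alpha(\phi\cdot,\cdot) + d\alpha(\cdot,\phi\cdot) = 0$ and
  $L_Z\phi = 0$, and the vanishing of the Nijenhuis tensor of $M\times\mathbb{R}$ amounts to these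
  conditions for an almost contact structure with $i_Z d\alpha = 0$.
\<close>

section \<open>Calculus on open sets\<close>

text \<open>Why the same three conditions appear everywhere: \<open>J\<close>, \<open>T\<close> and
  the structure on the cylinder are instances of one operator on a product, with mixed terms -s
  beta(v) Z and s alpha(u) W, and its Nijenhuis tensor uses only s * s = 1. For the cylinder the
  second factor is the line with dt, d/dt and 0, whose own conditions are trivial. Working on
  \<open>B \<times> F\<close> avoids lifting the Reeb field and the contact condition of
  \<open>B\<close> to \<open>E\<close>. The preferred charts at different points are unrelated, so
  every first-order statement is made for components in one fixed chart. Naturality under maps then
  produces second derivatives, which drop out by symmetry. Reeb fields are definite descriptions, so
  their existence and uniqueness must travel with the structure; smoothness of \<open>J\<close> and
  \<open>T\<close> travels with it too. On the topological side, deck transformations are built from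
  endpoints of lifted paths, freeness of the action rests on the contractibility of loops in
  \<open>E\<close>, and the quotient is Hausdorff because points are separated in \<open>B\<close>
  or, over the same point of \<open>B\<close>, in \<open>F\<close>.\<close>

abbreviation fderiv :: "('a::real_normed_vector \<Rightarrow> 'b::real_normed_vector) \<Rightarrow> 'a \<Rightarrow> 'a \<Rightarrow> 'b" where
  "fderiv f x \<equiv> frechet_derivative f (at x)"

lemma differentiable_cong_open:
  assumes "open S" "x \<in> S" "\<And>y. y \<in> S \<Longrightarrow> f y = g y"
  shows "f differentiable (at x) \<longleftrightarrow> g differentiable (at x)"
  unfolding differentiable_def
  using assms has_derivative_transform_within_open[of f _ x UNIV S g]
    has_derivative_transform_within_open[of g _ x UNIV S f] by auto

lemma fderiv_cong_open:
  assumes "open S" "x \<in> S" "\<And>y. y \<in> S \<Longrightarrow> f y = g y"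
  shows "fderiv f x = fderiv g x"
proof -
  have "(f has_derivative D) (at x) \<longleftrightarrow> (g has_derivative D) (at x)" for D
    using assms has_derivative_transform_within_open[of f _ x UNIV S g]
      has_derivative_transform_within_open[of g _ x UNIV S f] by auto
  then show ?thesis unfolding frechet_derivative_def by simp
qed

lemma has_fderiv: "f differentiable (at x) \<Longrightarrow> (f has_derivative fderiv f x) (at x)"
  by (simp add: frechet_derivative_works)

lemma fderiv_eqI: "(f has_derivative D) (at x) \<Longrightarrow> fderiv f x = D"
  by (rule frechet_derivative_at[symmetric])

lemma linear_fderiv: "f differentiable (at x) \<Longrightarrow> linear (fderiv f x)"
  by (rule linear_frechet_derivative)

lemma fderiv_comp:
  assumes "f differentiable (at x)" "g differentiable (at (f x))"
  shows "fderiv (g \<circ> f) x v = fderiv g (f x) (fderiv f x v)"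
  using frechet_derivative_compose[OF assms] by simp

section \<open>Closure properties of functions of class C^n and of smooth functions\<close>

lemma Ck_on_cong:
  assumes "open S" "\<And>y. y \<in> S \<Longrightarrow> f y = g y"
  shows "Ck_on n S f \<longleftrightarrow> Ck_on n S g"
  using assms(2)
proof (induction n arbitrary: f g)
  case 0
  then show ?case by (auto intro: continuous_on_cong)
next
  case (Suc n)
  have "Ck_on n S (\<lambda>x. fderiv f x v) \<longleftrightarrow> Ck_on n S (\<lambda>x. fderiv g x v)" for v
    by (rule Suc.IH) (simp add: fderiv_cong_open[OF assms(1) _ Suc.prems])
  then show ?case
    using differentiable_cong_open[OF assms(1) _ Suc.prems] by auto
qed

lemma Ck_on_subset: "Ck_on n S f \<Longrightarrow> T \<subseteq> S \<Longrightarrow> Ck_on n T f"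
  by (induction n arbitrary: f) (auto intro: continuous_on_subset)

lemma Ck_on_local:
  assumes "\<And>x. x \<in> S \<Longrightarrow> \<exists>T. open T \<and> x \<in> T \<and> Ck_on n T f"
  shows "Ck_on n S f"
  using assms
proof (induction n arbitrary: f)
  case 0
  then have "\<forall>x\<in>S. isCont f x"
    by (metis Ck_on.simps(1) continuous_on_eq_continuous_at)
  then show ?case by (simp add: continuous_at_imp_continuous_on)
next
  case (Suc n)
  have "Ck_on n S (\<lambda>x. fderiv f x v)" for v
    by (rule Suc.IH) (use Suc.prems in fastforce)
  then show ?case using Suc.prems by fastforce
qed

lemma Ck_on_Suc_imp: "Ck_on (Suc n) S f \<Longrightarrow> Ck_on n S f"
proof (induction n arbitrary: f)
  case 0
  then show ?case
    by (auto intro!: continuous_at_imp_continuous_on differentiable_imp_continuous_within)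
qed auto

lemma Ck_on_const: "Ck_on n S (\<lambda>x. c)"
  by (induction n arbitrary: c) auto

lemma Ck_on_bounded_linear: "bounded_linear f \<Longrightarrow> Ck_on n S f"
proof (cases n)
  case (Suc m)
  assume f: "bounded_linear f"
  have "fderiv f x = f" for x
    by (rule fderiv_eqI) (rule bounded_linear_imp_has_derivative[OF f])
  then show ?thesis
    using f by (auto simp: Suc Ck_on_const intro: bounded_linear_imp_differentiable)
qed (simp add: linear_continuous_on)

lemma Ck_on_add:
  assumes "open S" "Ck_on n S f" "Ck_on n S g"
  shows "Ck_on n S (\<lambda>x. f x + g x)"
  using assms(2,3)
proof (induction n arbitrary: f g)
  case (Suc n)
  have "fderiv (\<lambda>x. f x + g x) x v = fderiv f x v + fderiv g x v" if "x \<in> S" for x v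
    by (subst fderiv_eqI[where D = "\<lambda>v. fderiv f x v + fderiv g x v"])
      (use Suc.prems that in \<open>auto intro!: has_derivative_add has_fderiv\<close>)
  then have "Ck_on n S (\<lambda>x. fderiv (\<lambda>x. f x + g x) x v)" for v
    using Suc.IH[of "\<lambda>x. fderiv f x v" "\<lambda>x. fderiv g x v"] Suc.prems
    by (subst Ck_on_cong[OF assms(1)]) auto
  then show ?case using Suc.prems by auto
qed (auto intro: continuous_on_add)

lemma Ck_on_bilinear:
  assumes "open S" and pr: "bounded_bilinear pr" and "Ck_on n S f" "Ck_on n S g"
  shows "Ck_on n S (\<lambda>x. pr (f x) (g x))"
  using assms(3,4)
proof (induction n arbitrary: f g)
  case 0
  then show ?case by (auto intro: bounded_bilinear.continuous_on[OF pr])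
next
  case (Suc n)
  have d: "((\<lambda>x. pr (f x) (g x)) has_derivative (\<lambda>v. pr (f x) (fderiv g x v) + pr (fderiv f x v) (g x))) (at x)"
    if "x \<in> S" for x
    using Suc.prems that by (auto intro!: bounded_bilinear.FDERIV[OF pr] has_fderiv)
  have "Ck_on n S (\<lambda>x. pr (f x) (fderiv g x v) + pr (fderiv f x v) (g x))" for v
    using Suc.prems Ck_on_Suc_imp[OF Suc.prems(1)] Ck_on_Suc_imp[OF Suc.prems(2)]
    by (intro Ck_on_add[OF assms(1)] Suc.IH) auto
  then have "Ck_on n S (\<lambda>x. fderiv (\<lambda>x. pr (f x) (g x)) x v)" for v
    by (subst Ck_on_cong[OF assms(1)]) (auto simp: fderiv_eqI[OF d])
  then show ?case using d by (auto simp: differentiable_def)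
qed

lemma Ck_on_sum:
  assumes "open S" "finite I" "\<And>i. i \<in> I \<Longrightarrow> Ck_on n S (f i)"
  shows "Ck_on n S (\<lambda>x. \<Sum>i\<in>I. f i x)"
  using assms(2,3) by (induction I) (auto intro: Ck_on_const Ck_on_add[OF assms(1)])

text \<open>\<open>Ck_on\<close> differentiates only in fixed directions, whereas the chain rule
  takes the derivative of \<open>g\<close> in the direction \<open>fderiv f x v\<close>, which moves
  with \<open>x\<close>. Expanding that direction in the basis turns the derivative of
  \<open>g \<circ> f\<close> into a sum of products covered by the induction hypothesis and the
  closure lemmas.\<close>

lemma Ck_on_compose:
  fixes f :: "'a::euclidean_space \<Rightarrow> 'b::euclidean_space" and g :: "'b \<Rightarrow> 'c::real_normed_vector"
  assumes S: "open S" and T: "open T" and "f ` S \<subseteq> T" and "Ck_on n S f" "Ck_on n T g"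
  shows "Ck_on n S (g \<circ> f)"
  using assms(4,5)
proof (induction n arbitrary: g)
  case 0
  then show ?case
    using assms(3) continuous_on_compose continuous_on_subset unfolding Ck_on.simps by metis
next
  case (Suc n)
  have df: "f differentiable (at x)" and dg: "g differentiable (at (f x))" if "x \<in> S" for x
    using Suc.prems that assms(3) by auto
  have eq: "fderiv (g \<circ> f) x v = (\<Sum>i\<in>Basis. (fderiv f x v \<bullet> i) *\<^sub>R fderiv g (f x) i)"
    if "x \<in> S" for x v
  proof -
    have "fderiv (g \<circ> f) x v = fderiv g (f x) (\<Sum>i\<in>Basis. (fderiv f x v \<bullet> i) *\<^sub>R i)"
      by (simp add: fderiv_comp[OF df[OF that] dg[OF that]] euclidean_representation)
    also have "\<dots> = (\<Sum>i\<in>Basis. (fderiv f x v \<bullet> i) *\<^sub>R fderiv g (f x) i)"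
      using linear_fderiv[OF dg[OF that]] by (simp add: linear_sum linear_scale)
    finally show ?thesis by simp
  qed
  have "Ck_on n S (\<lambda>x. fderiv g (f x) i)" for i
    using Suc.IH[of "\<lambda>y. fderiv g y i"] Suc.prems Ck_on_Suc_imp by (auto simp: o_def)
  moreover have "Ck_on n S (\<lambda>x. fderiv f x v \<bullet> i)" for v i
    by (rule Ck_on_bilinear[OF S bounded_bilinear_inner]) (use Suc.prems in \<open>auto intro: Ck_on_const\<close>)
  ultimately have "Ck_on n S (\<lambda>x. \<Sum>i\<in>Basis. (fderiv f x v \<bullet> i) *\<^sub>R fderiv g (f x) i)" for v
    by (intro Ck_on_sum[OF S] Ck_on_bilinear[OF S bounded_bilinear_scaleR]) auto
  then have "Ck_on n S (\<lambda>x. fderiv (g \<circ> f) x v)" for v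
    by (subst Ck_on_cong[OF S eq]) auto
  then show ?case using differentiable_chain_at[OF df dg] unfolding Ck_on.simps by blast
qed

lemma smooth_on_cong:
  "open S \<Longrightarrow> (\<And>y. y \<in> S \<Longrightarrow> f y = g y) \<Longrightarrow> smooth_on S f \<longleftrightarrow> smooth_on S g"
  unfolding smooth_on_def using Ck_on_cong by metis

lemma smooth_on_subset: "smooth_on S f \<Longrightarrow> T \<subseteq> S \<Longrightarrow> smooth_on T f"
  unfolding smooth_on_def using Ck_on_subset by metis

lemma smooth_on_local:
  "(\<And>x. x \<in> S \<Longrightarrow> \<exists>T. open T \<and> x \<in> T \<and> smooth_on T f) \<Longrightarrow> smooth_on S f"
  unfolding smooth_on_def by (intro allI Ck_on_local) blast

lemma smooth_on_const: "smooth_on S (\<lambda>x. c)"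
  unfolding smooth_on_def by (simp add: Ck_on_const)

lemma smooth_on_bounded_linear: "bounded_linear f \<Longrightarrow> smooth_on S f"
  unfolding smooth_on_def by (simp add: Ck_on_bounded_linear)

lemma smooth_on_add:
  "open S \<Longrightarrow> smooth_on S f \<Longrightarrow> smooth_on S g \<Longrightarrow> smooth_on S (\<lambda>x. f x + g x)"
  unfolding smooth_on_def by (simp add: Ck_on_add)

lemma smooth_on_bilinear:
  "open S \<Longrightarrow> bounded_bilinear pr \<Longrightarrow> smooth_on S f \<Longrightarrow> smooth_on S g \<Longrightarrow> smooth_on S (\<lambda>x. pr (f x) (g x))"
  unfolding smooth_on_def by (simp add: Ck_on_bilinear)

lemmas smooth_on_scaleR = smooth_on_bilinear[OF _ bounded_bilinear_scaleR]

lemma smooth_on_sum: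
  "open S \<Longrightarrow> finite I \<Longrightarrow> (\<And>i. i \<in> I \<Longrightarrow> smooth_on S (f i)) \<Longrightarrow> smooth_on S (\<lambda>x. \<Sum>i\<in>I. f i x)"
  unfolding smooth_on_def by (simp add: Ck_on_sum)

lemma smooth_on_compose:
  fixes f :: "'a::euclidean_space \<Rightarrow> 'b::euclidean_space"
  shows "open S \<Longrightarrow> open T \<Longrightarrow> f ` S \<subseteq> T \<Longrightarrow> smooth_on S f \<Longrightarrow> smooth_on T g \<Longrightarrow> smooth_on S (g \<circ> f)"
  unfolding smooth_on_def using Ck_on_compose by blast

lemma smooth_on_linear_compose:
  fixes f :: "'a::euclidean_space \<Rightarrow> 'b::euclidean_space"
  assumes "open S" "smooth_on S f" "linear L"
  shows "smooth_on S (\<lambda>x. L (f x))"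
  using smooth_on_compose[OF assms(1) open_UNIV _ assms(2) smooth_on_bounded_linear, of L] assms(3)
  by (simp add: linear_conv_bounded_linear o_def)

lemma smooth_on_Pair:
  fixes f :: "'a::euclidean_space \<Rightarrow> 'b::euclidean_space" and g :: "'a \<Rightarrow> 'c::euclidean_space"
  assumes "open S" "smooth_on S f" "smooth_on S g"
  shows "smooth_on S (\<lambda>x. (f x, g x))"
proof -
  have "linear (\<lambda>u::'b. (u, 0::'c))" "linear (\<lambda>v::'c. (0::'b, v))"
    by (auto intro!: linearI)
  from smooth_on_add[OF assms(1) smooth_on_linear_compose[OF assms(1,2) this(1)]
      smooth_on_linear_compose[OF assms(1,3) this(2)]]
  show ?thesis by simp
qed

lemma smooth_on_differentiable: "smooth_on S f \<Longrightarrow> x \<in> S \<Longrightarrow> f differentiable (at x)"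
  unfolding smooth_on_def using Ck_on.simps(2) by blast

lemma smooth_on_continuous_on: "smooth_on S f \<Longrightarrow> continuous_on S f"
  unfolding smooth_on_def using Ck_on.simps(1) by blast

lemma smooth_on_fderiv: "smooth_on S f \<Longrightarrow> smooth_on S (\<lambda>x. fderiv f x v)"
  unfolding smooth_on_def using Ck_on.simps(2) by blast

section \<open>Fields of linear maps applied to varying vectors\<close>

lemma linear_apply_Basis:
  fixes L :: "'a::euclidean_space \<Rightarrow> 'b::real_vector"
  assumes "linear L"
  shows "L w = (\<Sum>i\<in>Basis. (w \<bullet> i) *\<^sub>R L i)"
  using linear_sum[OF assms, of "\<lambda>i. (w \<bullet> i) *\<^sub>R i" Basis]
  by (simp add: euclidean_representation linear_scale[OF assms])

text \<open>\<open>A\<close> is controlled only on fixed vectors; by linearity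
  \<open>A x (w x)\<close> is a finite sum of coefficients of \<open>w x\<close> times values of
  \<open>A x\<close> on basis vectors. Components of tensor fields are evaluated in this way on
  derivatives of maps.\<close>

lemma smooth_on_apply:
  fixes A :: "'a::euclidean_space \<Rightarrow> 'b::euclidean_space \<Rightarrow> 'c::real_normed_vector"
  assumes S: "open S" and A: "\<And>v. smooth_on S (\<lambda>x. A x v)" "\<And>x. x \<in> S \<Longrightarrow> linear (A x)"
    and w: "smooth_on S w"
  shows "smooth_on S (\<lambda>x. A x (w x))"
proof -
  have "smooth_on S (\<lambda>x. w x \<bullet> i)" for i
    by (rule smooth_on_bilinear[OF S bounded_bilinear_inner w smooth_on_const])
  then have "smooth_on S (\<lambda>x. \<Sum>i\<in>Basis. (w x \<bullet> i) *\<^sub>R A x i)"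
    by (intro smooth_on_sum S smooth_on_scaleR A) auto
  then show ?thesis
    by (subst smooth_on_cong[OF S linear_apply_Basis[OF A(2)]]) auto
qed

text \<open>The product rule for evaluation: the first summand freezes the vector, the second
  freezes the linear map. The basis expansion reduces it to products of scalars and vectors.\<close>

lemma has_derivative_apply:
  fixes A :: "'a::euclidean_space \<Rightarrow> 'b::euclidean_space \<Rightarrow> 'c::real_normed_vector"
  assumes S: "open S" "x \<in> S" and A: "\<And>v. (\<lambda>y. A y v) differentiable (at x)"
    "\<And>y. y \<in> S \<Longrightarrow> linear (A y)"
    and w: "w differentiable (at x)"
  shows "((\<lambda>y. A y (w y)) has_derivative (\<lambda>v. fderiv (\<lambda>y. A y (w x)) x v + A x (fderiv w x v))) (at x)"
proof -
  have 1: "((\<lambda>y. \<Sum>i\<in>Basis. (u y \<bullet> i) *\<^sub>R A y i) has_derivative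
      (\<lambda>v. \<Sum>i\<in>Basis. (u x \<bullet> i) *\<^sub>R fderiv (\<lambda>y. A y i) x v + (fderiv u x v \<bullet> i) *\<^sub>R A x i)) (at x)"
    if "u differentiable (at x)" for u :: "'a \<Rightarrow> 'b"
    by (rule has_derivative_sum)
      (auto intro!: derivative_eq_intros has_fderiv A that)
  have 2: "((\<lambda>y. A y (u y)) has_derivative
      (\<lambda>v. \<Sum>i\<in>Basis. (u x \<bullet> i) *\<^sub>R fderiv (\<lambda>y. A y i) x v + (fderiv u x v \<bullet> i) *\<^sub>R A x i)) (at x)"
    if "u differentiable (at x)" for u :: "'a \<Rightarrow> 'b"
    by (rule has_derivative_transform_within_open[OF 1[OF that] S])
      (simp add: linear_apply_Basis[OF A(2), symmetric])
  have 3: "fderiv (\<lambda>y. A y (w x)) x v = (\<Sum>i\<in>Basis. (w x \<bullet> i) *\<^sub>R fderiv (\<lambda>y. A y i) x v)" for v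
    using fderiv_eqI[OF 2[of "\<lambda>_. w x"]] by simp
  have 4: "A x (fderiv w x v) = (\<Sum>i\<in>Basis. (fderiv w x v \<bullet> i) *\<^sub>R A x i)" for v
    by (rule linear_apply_Basis[OF A(2)[OF S(2)]])
  show ?thesis using 2[OF w] by (simp add: 3 4 sum.distrib)
qed

lemmas fderiv_apply = fderiv_eqI[OF has_derivative_apply]

lemma linear_fderiv_arg:
  fixes A :: "'a::euclidean_space \<Rightarrow> 'b::real_vector \<Rightarrow> 'c::real_normed_vector"
  assumes S: "open S" "x \<in> S" and A: "\<And>v. (\<lambda>y. A y v) differentiable (at x)"
    "\<And>y. y \<in> S \<Longrightarrow> linear (A y)"
  shows "linear (\<lambda>w. fderiv (\<lambda>y. A y w) x v)"
proof (rule linearI)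
  fix u w and c :: real
  have "((\<lambda>y. A y u + A y w) has_derivative (\<lambda>v. fderiv (\<lambda>y. A y u) x v + fderiv (\<lambda>y. A y w) x v)) (at x)"
    by (intro has_derivative_add has_fderiv A)
  moreover have "fderiv (\<lambda>y. A y (u + w)) x = fderiv (\<lambda>y. A y u + A y w) x"
    by (rule fderiv_cong_open[OF S]) (simp add: linear_add A)
  ultimately show "fderiv (\<lambda>y. A y (u + w)) x v = fderiv (\<lambda>y. A y u) x v + fderiv (\<lambda>y. A y w) x v"
    by (simp add: fderiv_eqI)
  have "((\<lambda>y. c *\<^sub>R A y u) has_derivative (\<lambda>v. c *\<^sub>R fderiv (\<lambda>y. A y u) x v)) (at x)"
    by (intro has_derivative_scaleR_right has_fderiv A)
  moreover have "fderiv (\<lambda>y. A y (c *\<^sub>R u)) x = fderiv (\<lambda>y. c *\<^sub>R A y u) x"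
    by (rule fderiv_cong_open[OF S]) (simp add: linear_scale A)
  ultimately show "fderiv (\<lambda>y. A y (c *\<^sub>R u)) x v = c *\<^sub>R fderiv (\<lambda>y. A y u) x v"
    by (simp add: fderiv_eqI)
qed

subsection \<open>Symmetry of the second derivative\<close>

text \<open>The mean value theorem is applied twice: in the direction \<open>u\<close> to the first
  difference along \<open>v\<close>, then in the direction \<open>v\<close> to the derivative along
  \<open>u\<close>.\<close>

lemma second_difference_mean_value:
  fixes f :: "'a::euclidean_space \<Rightarrow> real"
  assumes h: "h > 0" and S: "\<And>s t. 0 \<le> s \<Longrightarrow> s \<le> h \<Longrightarrow> 0 \<le> t \<Longrightarrow> t \<le> h \<Longrightarrow> x + s *\<^sub>R u + t *\<^sub>R v \<in> S"
    and f: "Ck_on 2 S f"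
  shows "\<exists>s t. 0 < s \<and> s < h \<and> 0 < t \<and> t < h \<and>
    f (x + h *\<^sub>R u + h *\<^sub>R v) - f (x + h *\<^sub>R u) - f (x + h *\<^sub>R v) + f x
      = h * h * fderiv (\<lambda>y. fderiv f y u) (x + s *\<^sub>R u + t *\<^sub>R v) v"
proof -
  have f1: "f differentiable (at y)" and f2: "(\<lambda>y. fderiv f y u) differentiable (at y)" if "y \<in> S" for y
    using f that by (auto simp: numeral_2_eq_2)
  define g where "g s = f (x + s *\<^sub>R u + h *\<^sub>R v) - f (x + s *\<^sub>R u)" for s
  have d1: "((\<lambda>s. f (x + s *\<^sub>R u + t *\<^sub>R v)) has_real_derivative fderiv f (x + s *\<^sub>R u + t *\<^sub>R v) u) (at s)"
    if "0 \<le> s" "s \<le> h" "0 \<le> t" "t \<le> h" for s t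
  proof -
    have "(f has_derivative fderiv f (x + s *\<^sub>R u + t *\<^sub>R v)) (at (x + s *\<^sub>R u + t *\<^sub>R v))"
      by (rule has_fderiv[OF f1[OF S]]) (use that in auto)
    moreover have "((\<lambda>s. x + s *\<^sub>R u + t *\<^sub>R v) has_derivative (\<lambda>r. r *\<^sub>R u)) (at s)"
      by (auto intro!: derivative_eq_intros)
    ultimately have "((\<lambda>s. f (x + s *\<^sub>R u + t *\<^sub>R v)) has_derivative
        (\<lambda>r. fderiv f (x + s *\<^sub>R u + t *\<^sub>R v) (r *\<^sub>R u))) (at s)"
      using has_derivative_compose by fastforce
    then show ?thesis
      using linear_fderiv[OF f1[OF S[OF that]]]
      by (simp add: has_field_derivative_def linear_scale mult.commute[of _ "fderiv f _ u"])
  qed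
  have dg: "(g has_real_derivative (fderiv f (x + s *\<^sub>R u + h *\<^sub>R v) u - fderiv f (x + s *\<^sub>R u) u)) (at s)"
    if "0 \<le> s" "s \<le> h" for s
    unfolding g_def using d1[of s h] d1[of s 0] that h by (auto intro!: DERIV_diff)
  obtain s where s: "0 < s" "s < h"
    "g h - g 0 = (h - 0) * (fderiv f (x + s *\<^sub>R u + h *\<^sub>R v) u - fderiv f (x + s *\<^sub>R u) u)"
    using MVT2[OF h dg] by blast
  have dh: "((\<lambda>t. fderiv f (x + s *\<^sub>R u + t *\<^sub>R v) u) has_real_derivative
      fderiv (\<lambda>y. fderiv f y u) (x + s *\<^sub>R u + t *\<^sub>R v) v) (at t)"
    if "0 \<le> t" "t \<le> h" for t
  proof -
    have in_S: "x + s *\<^sub>R u + t *\<^sub>R v \<in> S" using S that s by auto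
    have "((\<lambda>y. fderiv f y u) has_derivative fderiv (\<lambda>y. fderiv f y u) (x + s *\<^sub>R u + t *\<^sub>R v))
        (at (x + s *\<^sub>R u + t *\<^sub>R v))"
      by (rule has_fderiv[OF f2[OF in_S]])
    moreover have "((\<lambda>t. x + s *\<^sub>R u + t *\<^sub>R v) has_derivative (\<lambda>r. r *\<^sub>R v)) (at t)"
      by (auto intro!: derivative_eq_intros)
    ultimately have "((\<lambda>t. fderiv f (x + s *\<^sub>R u + t *\<^sub>R v) u) has_derivative
        (\<lambda>r. fderiv (\<lambda>y. fderiv f y u) (x + s *\<^sub>R u + t *\<^sub>R v) (r *\<^sub>R v))) (at t)"
      using has_derivative_compose by fastforce
    then show ?thesis
      using linear_fderiv[OF f2[OF in_S]]
      by (simp add: has_field_derivative_def linear_scale mult.commute[of _ "fderiv _ _ v"])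
  qed
  obtain t where t: "0 < t" "t < h"
    "fderiv f (x + s *\<^sub>R u + h *\<^sub>R v) u - fderiv f (x + s *\<^sub>R u + 0 *\<^sub>R v) u
       = (h - 0) * fderiv (\<lambda>y. fderiv f y u) (x + s *\<^sub>R u + t *\<^sub>R v) v"
    using MVT2[OF h dh] by blast
  show ?thesis
    using s t by (intro exI[of _ s] exI[of _ t]) (simp add: g_def algebra_simps)
qed

text \<open>The second difference over a parallelogram does not change when \<open>u\<close> and
  \<open>v\<close> are exchanged, so a value of one mixed derivative near \<open>x\<close> equals a
  value of the other near \<open>x\<close>. Continuity moves both points to
  \<open>x\<close>.\<close>

lemma second_fderiv_symmetric_real:
  fixes f :: "'a::euclidean_space \<Rightarrow> real"
  assumes S: "open S" "x \<in> S" and f: "Ck_on 2 S f"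
  shows "fderiv (\<lambda>y. fderiv f y u) x v = fderiv (\<lambda>y. fderiv f y v) x u"
proof -
  define G where "G u v y = fderiv (\<lambda>y. fderiv f y u) y v" for u v y
  have cont: "isCont (G u v) x" for u v
  proof -
    have "continuous_on S (G u v)"
      using f by (simp add: numeral_2_eq_2 G_def)
    then show ?thesis using S continuous_on_eq_continuous_at by blast
  qed
  have main: "\<bar>G u v x - G v u x\<bar> \<le> 2 * e" if "e > 0" for e
  proof -
    obtain d1 where d1: "d1 > 0" "\<And>y. dist y x < d1 \<Longrightarrow> dist (G u v y) (G u v x) < e"
      using cont[of u v] \<open>e > 0\<close> unfolding continuous_at_eps_delta by blast
    obtain d2 where d2: "d2 > 0" "\<And>y. dist y x < d2 \<Longrightarrow> dist (G v u y) (G v u x) < e"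
      using cont[of v u] \<open>e > 0\<close> unfolding continuous_at_eps_delta by blast
    obtain d3 where d3: "d3 > 0" "ball x d3 \<subseteq> S"
      using S open_contains_ball by blast
    define d where "d = min d1 (min d2 d3)"
    have "d > 0" using d1 d2 d3 by (simp add: d_def)
    \<comment> \<open>This side length keeps the whole parallelogram within \<open>d / 2\<close> of
      \<open>x\<close>; the summand 1 avoids a division by zero for
      \<open>u = v = 0\<close>.\<close>
    define h where "h = d / (2 * (norm u + norm v + 1))"
    have pos: "norm u + norm v + 1 > 0" by (smt (verit) norm_ge_zero)
    have h: "h > 0" unfolding h_def using \<open>d > 0\<close> pos by simp
    have small: "dist (x + s *\<^sub>R u + t *\<^sub>R v) x < d" "dist (x + t *\<^sub>R v + s *\<^sub>R u) x < d"
      if "0 \<le> s" "s \<le> h" "0 \<le> t" "t \<le> h" for s t u' v'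
    proof -
      have "norm (s *\<^sub>R u + t *\<^sub>R v) \<le> h * norm u + h * norm v"
        using that by (intro order_trans[OF norm_triangle_ineq] add_mono) (auto intro: mult_right_mono)
      also have "\<dots> \<le> h * (norm u + norm v + 1)" using h by (simp add: algebra_simps)
      also have "\<dots> = d / 2" unfolding h_def using pos by (simp add: field_simps)
      also have "\<dots> < d" using \<open>d > 0\<close> by simp
      finally show "dist (x + s *\<^sub>R u + t *\<^sub>R v) x < d" "dist (x + t *\<^sub>R v + s *\<^sub>R u) x < d"
        by (simp_all add: dist_norm algebra_simps)
    qed
    have in_S: "y \<in> S" if "dist y x < d" for y
      using d3 that by (auto simp: d_def dist_commute)
    obtain s t where st: "0 < s" "s < h" "0 < t" "t < h"
      "f (x + h *\<^sub>R u + h *\<^sub>R v) - f (x + h *\<^sub>R u) - f (x + h *\<^sub>R v) + f x = h * h * G u v (x + s *\<^sub>R u + t *\<^sub>R v)"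
      using second_difference_mean_value[OF h _ f, of x u v] small(1) in_S unfolding G_def by blast
    obtain s' t' where st': "0 < s'" "s' < h" "0 < t'" "t' < h"
      "f (x + h *\<^sub>R v + h *\<^sub>R u) - f (x + h *\<^sub>R v) - f (x + h *\<^sub>R u) + f x = h * h * G v u (x + s' *\<^sub>R v + t' *\<^sub>R u)"
      using second_difference_mean_value[OF h _ f, of x v u] small(2) in_S unfolding G_def by blast
    have "h * h * G u v (x + s *\<^sub>R u + t *\<^sub>R v) = h * h * G v u (x + s' *\<^sub>R v + t' *\<^sub>R u)"
      using st(5) st'(5) by (simp add: algebra_simps)
    then have "G u v (x + s *\<^sub>R u + t *\<^sub>R v) = G v u (x + s' *\<^sub>R v + t' *\<^sub>R u)"
      using h by simp
    moreover have "dist (G u v (x + s *\<^sub>R u + t *\<^sub>R v)) (G u v x) < e"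
      using d1(2) small(1)[of s t] st by (auto simp: d_def)
    moreover have "dist (G v u (x + s' *\<^sub>R v + t' *\<^sub>R u)) (G v u x) < e"
      using d2(2) small(2)[of t' s'] st' by (auto simp: d_def)
    ultimately show ?thesis by (simp add: dist_real_def)
  qed
  have "\<bar>G u v x - G v u x\<bar> \<le> 0"
    by (rule field_le_epsilon) (use main[of "_ / 2"] in simp)
  then show ?thesis by (simp add: G_def)
qed

lemma second_fderiv_symmetric:
  fixes f :: "'a::euclidean_space \<Rightarrow> 'b::euclidean_space"
  assumes S: "open S" "x \<in> S" and f: "smooth_on S f"
  shows "fderiv (\<lambda>y. fderiv f y u) x v = fderiv (\<lambda>y. fderiv f y v) x u"
proof (rule euclidean_eqI)
  fix i :: 'b assume "i \<in> Basis"
  have inner: "fderiv (\<lambda>y. g y \<bullet> i) y v = fderiv g y v \<bullet> i" if "smooth_on S g" "y \<in> S" for g y v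
    by (subst fderiv_eqI[where D = "\<lambda>v. fderiv g y v \<bullet> i"])
      (use smooth_on_differentiable[OF that] in \<open>auto intro!: has_derivative_inner_left has_fderiv\<close>)
  have 2: "fderiv (\<lambda>y. fderiv (\<lambda>y. f y \<bullet> i) y u) x v = fderiv (\<lambda>y. fderiv f y u) x v \<bullet> i" for u v
    using fderiv_cong_open[OF S inner[OF f, where v = u]] inner[OF smooth_on_fderiv[OF f] S(2)] by simp
  have "smooth_on S (\<lambda>y. f y \<bullet> i)"
    by (rule smooth_on_bilinear[OF S(1) bounded_bilinear_inner f smooth_on_const])
  then have "Ck_on 2 S (\<lambda>y. f y \<bullet> i)" by (simp add: smooth_on_def)
  from second_fderiv_symmetric_real[OF S this, where u = u and v = v]
  show "fderiv (\<lambda>y. fderiv f y u) x v \<bullet> i = fderiv (\<lambda>y. fderiv f y v) x u \<bullet> i"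
    by (simp add: 2)
qed

section \<open>Exterior derivative and Nijenhuis tensor in coordinates\<close>

definition ext_deriv_coord ::
  "('e::euclidean_space \<Rightarrow> 'e \<Rightarrow> real) \<Rightarrow> 'e \<Rightarrow> 'e \<Rightarrow> 'e \<Rightarrow> real" where
  "ext_deriv_coord \<alpha> x u v = fderiv (\<lambda>y. \<alpha> y v) x u - fderiv (\<lambda>y. \<alpha> y u) x v"

text \<open>The Nijenhuis bracket of the constant fields \<open>u\<close> and \<open>v\<close>:
  their own bracket vanishes and only derivatives of \<open>J\<close> survive.\<close>

definition nijenhuis_coord ::
  "('e::euclidean_space \<Rightarrow> 'e \<Rightarrow> 'e) \<Rightarrow> 'e \<Rightarrow> 'e \<Rightarrow> 'e \<Rightarrow> 'e" where
  "nijenhuis_coord J x u v =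
     fderiv (\<lambda>y. J y v) x (J x u) - fderiv (\<lambda>y. J y u) x (J x v)
     + J x (fderiv (\<lambda>y. J y u) x v) - J x (fderiv (\<lambda>y. J y v) x u)"

lemma nijenhuis_coord_cong:
  assumes "open S" "x \<in> S" "\<And>y w. y \<in> S \<Longrightarrow> J y w = K y w"
  shows "nijenhuis_coord J x u v = nijenhuis_coord K x u v"
proof -
  have "fderiv (\<lambda>y. J y w) x = fderiv (\<lambda>y. K y w) x" for w
    by (rule fderiv_cong_open[OF assms(1,2)]) (rule assms(3))
  then show ?thesis using assms(2,3) by (simp add: nijenhuis_coord_def)
qed

text \<open>
  In the next two lemmas the second derivatives of \<open>g\<close> cancel because they are symmetric.
\<close>

lemma ext_deriv_coord_pullback:
  fixes g :: "'e::euclidean_space \<Rightarrow> 'g::euclidean_space"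
  assumes S: "open S" "x \<in> S" and T: "open T" "g ` S \<subseteq> T" and g: "smooth_on S g"
    and \<beta>: "\<And>w. smooth_on T (\<lambda>y. \<beta> y w)" "\<And>y. y \<in> T \<Longrightarrow> linear (\<beta> y)"
    and rel: "\<And>y w. y \<in> S \<Longrightarrow> \<alpha> y w = \<beta> (g y) (fderiv g y w)"
  shows "ext_deriv_coord \<alpha> x u v = ext_deriv_coord \<beta> (g x) (fderiv g x u) (fderiv g x v)"
proof -
  have gx: "g differentiable (at x)" "g x \<in> T" using smooth_on_differentiable[OF g S(2)] S T by auto
  have "fderiv (\<lambda>y. \<alpha> y w) x a = fderiv (\<lambda>z. \<beta> z (fderiv g x w)) (g x) (fderiv g x a)
      + \<beta> (g x) (fderiv (\<lambda>y. fderiv g y w) x a)" for w a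
  proof -
    have d: "(\<lambda>y. \<beta> (g y) w') differentiable (at x)"
      and e: "fderiv (\<lambda>y. \<beta> (g y) w') x a = fderiv (\<lambda>z. \<beta> z w') (g x) (fderiv g x a)" for w'
      using differentiable_chain_at[OF gx(1) smooth_on_differentiable[OF \<beta>(1) gx(2)]]
        fderiv_comp[OF gx(1) smooth_on_differentiable[OF \<beta>(1) gx(2)]] by (simp_all add: o_def)
    have "fderiv (\<lambda>y. \<alpha> y w) x a = fderiv (\<lambda>y. \<beta> (g y) (fderiv g y w)) x a"
      by (subst fderiv_cong_open[OF S rel]) auto
    also have "\<dots> = fderiv (\<lambda>y. \<beta> (g y) (fderiv g x w)) x a + \<beta> (g x) (fderiv (\<lambda>y. fderiv g y w) x a)"
      by (subst fderiv_apply[OF S d])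
        (use T \<beta>(2) smooth_on_differentiable[OF smooth_on_fderiv[OF g] S(2)] in auto)
    finally show ?thesis by (simp add: e)
  qed
  then show ?thesis
    by (simp add: ext_deriv_coord_def second_fderiv_symmetric[OF S g, of u v])
qed

lemma nijenhuis_coord_related:
  fixes g :: "'e::euclidean_space \<Rightarrow> 'g::euclidean_space"
  assumes S: "open S" "x \<in> S" and T: "open T" "g ` S \<subseteq> T" and g: "smooth_on S g"
    and J: "\<And>w. smooth_on S (\<lambda>y. J y w)" "\<And>y. y \<in> S \<Longrightarrow> linear (J y)"
    and K: "\<And>w. smooth_on T (\<lambda>y. K y w)" "\<And>y. y \<in> T \<Longrightarrow> linear (K y)"
    and rel: "\<And>y w. y \<in> S \<Longrightarrow> fderiv g y (J y w) = K (g y) (fderiv g y w)"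
  shows "fderiv g x (nijenhuis_coord J x u v) = nijenhuis_coord K (g x) (fderiv g x u) (fderiv g x v)"
proof -
  have gd: "g differentiable (at y)" if "y \<in> S" for y
    using smooth_on_differentiable[OF g that] .
  have gx: "g x \<in> T" using S T by auto
  note lin = linear_fderiv[OF gd[OF S(2)]]
  define D2 where "D2 w a = fderiv (\<lambda>y. fderiv g y w) x a" for w a
  have D2_sym: "D2 w a = D2 a w" for w a
    unfolding D2_def by (rule second_fderiv_symmetric[OF S g])
  \<comment> \<open>The relation \<open>rel\<close> on the fixed vector \<open>w\<close> is
    differentiated in the direction \<open>a\<close> and solved for the derivative of
    \<open>K\<close>; the second derivatives of \<open>g\<close> are collected in
    \<open>D2\<close>.\<close>
  have key: "fderiv (\<lambda>z. K z (fderiv g x w)) (g x) (fderiv g x a)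
      = D2 a (J x w) + fderiv g x (fderiv (\<lambda>y. J y w) x a) - K (g x) (D2 a w)" for w a
  proof -
    have d: "(\<lambda>y. K (g y) w') differentiable (at x)"
      and e: "fderiv (\<lambda>y. K (g y) w') x a = fderiv (\<lambda>z. K z w') (g x) (fderiv g x a)" for w'
      using differentiable_chain_at[OF gd[OF S(2)] smooth_on_differentiable[OF K(1) gx]]
        fderiv_comp[OF gd[OF S(2)] smooth_on_differentiable[OF K(1) gx]] by (simp_all add: o_def)
    have "fderiv (\<lambda>y. fderiv g y (J y w)) x a
        = fderiv (\<lambda>y. fderiv g y (J x w)) x a + fderiv g x (fderiv (\<lambda>y. J y w) x a)"
      using smooth_on_differentiable[OF smooth_on_fderiv[OF g] S(2)] linear_fderiv[OF gd]
        smooth_on_differentiable[OF J(1) S(2)]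
      by (subst fderiv_apply[OF S]) auto
    moreover have "fderiv (\<lambda>y. K (g y) (fderiv g y w)) x a
        = fderiv (\<lambda>y. K (g y) (fderiv g x w)) x a + K (g x) (fderiv (\<lambda>y. fderiv g y w) x a)"
      using smooth_on_differentiable[OF smooth_on_fderiv[OF g] S(2)] T K(2)
      by (subst fderiv_apply[OF S d]) auto
    moreover have "fderiv (\<lambda>y. fderiv g y (J y w)) x = fderiv (\<lambda>y. K (g y) (fderiv g y w)) x"
      by (rule fderiv_cong_open[OF S rel])
    ultimately show ?thesis by (simp add: e D2_def[symmetric] D2_sym[of a] eq_diff_eq)
  qed
  note linK = K(2)[OF gx]
  show ?thesis
    unfolding nijenhuis_coord_def rel[OF S(2), symmetric] key
    by (simp add: linear_add[OF lin] linear_diff[OF lin] linear_add[OF linK] linear_diff[OF linK]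
        rel[OF S(2)] D2_sym[of v] D2_sym[of "J x v"])
qed

section \<open>Products of almost contact structures at a point\<close>

text \<open>
  The first-order data at a point of an almost contact structure whose vector field annihilates the
  exterior derivative of its form: \<open>\<phi>'\<close>, \<open>\<alpha>'\<close> and \<open>Z'\<close> stand for the derivatives of \<open>\<phi>\<close>, \<open>\<alpha>\<close> and
  \<open>Z\<close> at the point, with the direction of differentiation as first argument.
\<close>

definition contact_jet ::
  "('e::real_vector \<Rightarrow> 'e) \<Rightarrow> ('e \<Rightarrow> 'e \<Rightarrow> 'e) \<Rightarrow> ('e \<Rightarrow> real) \<Rightarrow> ('e \<Rightarrow> 'e \<Rightarrow> real)
    \<Rightarrow> 'e \<Rightarrow> ('e \<Rightarrow> 'e) \<Rightarrow> bool" where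
  "contact_jet \<phi> \<phi>' \<alpha> \<alpha>' Z Z' \<longleftrightarrow>
     linear \<phi> \<and> (\<forall>a. linear (\<phi>' a)) \<and> (\<forall>u. linear (\<lambda>a. \<phi>' a u)) \<and>
     linear \<alpha> \<and> (\<forall>a. linear (\<alpha>' a)) \<and> (\<forall>u. linear (\<lambda>a. \<alpha>' a u)) \<and> linear Z' \<and>
     (\<forall>u. \<phi> (\<phi> u) = - u + \<alpha> u *\<^sub>R Z) \<and> \<phi> Z = 0 \<and> \<alpha> Z = 1 \<and> (\<forall>u. \<alpha> (\<phi> u) = 0) \<and>
     (\<forall>a. \<phi>' a Z + \<phi> (Z' a) = 0) \<and> (\<forall>a. \<alpha>' a Z + \<alpha> (Z' a) = 0) \<and>
     (\<forall>a u. \<alpha>' a (\<phi> u) + \<alpha> (\<phi>' a u) = 0) \<and> (\<forall>v. \<alpha>' Z v = \<alpha>' v Z)"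

text \<open>
  The three conditions say that $N_\phi + d\alpha\otimes Z$, $d\alpha(\phi\cdot,\cdot) +
  d\alpha(\cdot,\phi\cdot)$ and the Lie derivative of \<open>\<phi>\<close> along \<open>Z\<close> vanish.
\<close>

definition normal_jet ::
  "('e::real_vector \<Rightarrow> 'e) \<Rightarrow> ('e \<Rightarrow> 'e \<Rightarrow> 'e) \<Rightarrow> ('e \<Rightarrow> real) \<Rightarrow> ('e \<Rightarrow> 'e \<Rightarrow> real)
    \<Rightarrow> 'e \<Rightarrow> ('e \<Rightarrow> 'e) \<Rightarrow> bool" where
  "normal_jet \<phi> \<phi>' \<alpha> \<alpha>' Z Z' \<longleftrightarrow>
     (\<forall>u v. \<phi>' (\<phi> u) v - \<phi>' (\<phi> v) u + \<phi> (\<phi>' v u) - \<phi> (\<phi>' u v) + (\<alpha>' u v - \<alpha>' v u) *\<^sub>R Z = 0) \<and>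
     (\<forall>u v. \<alpha>' (\<phi> u) v - \<alpha>' (\<phi> v) u - \<alpha>' v (\<phi> u) + \<alpha>' u (\<phi> v) = 0) \<and>
     (\<forall>u. \<phi>' Z u - Z' (\<phi> u) + \<phi> (Z' u) = 0)"

text \<open>The values s = 1 and s = -1 give the two almost complex structures of a contact pair,
  and only \<open>s * s = 1\<close> enters, so both have the same obstruction. Each component of the
  tensor is the condition of its own factor, plus Lie derivative terms weighted by the form of the
  other factor, plus a multiple of the Reeb vector; suitable arguments isolate each of
  these.\<close>

lemma nijenhuis_product_jet:
  fixes \<phi> :: "'e::real_vector \<Rightarrow> 'e" and \<psi> :: "'g::real_vector \<Rightarrow> 'g" and s :: real
  assumes 1: "contact_jet \<phi> \<phi>' \<alpha> \<alpha>' Z Z'" and 2: "contact_jet \<psi> \<psi>' \<beta> \<beta>' W W'" and s: "s * s = 1"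
    and J: "\<And>u v. J (u, v) = (\<phi> u - (s * \<beta> v) *\<^sub>R Z, \<psi> v + (s * \<alpha> u) *\<^sub>R W)"
    and J': "\<And>a b u v. J' (a, b) (u, v) =
      (\<phi>' a u - (s * \<beta>' b v) *\<^sub>R Z - (s * \<beta> v) *\<^sub>R Z' a, \<psi>' b v + (s * \<alpha>' a u) *\<^sub>R W + (s * \<alpha> u) *\<^sub>R W' b)"
  shows "(\<forall>\<xi> \<eta>. J' (J \<xi>) \<eta> - J' (J \<eta>) \<xi> + J (J' \<eta> \<xi>) - J (J' \<xi> \<eta>) = 0) \<longleftrightarrow>
    normal_jet \<phi> \<phi>' \<alpha> \<alpha>' Z Z' \<and> normal_jet \<psi> \<psi>' \<beta> \<beta>' W W'"
proof -
  define A where "A u v = \<phi>' (\<phi> u) v - \<phi>' (\<phi> v) u + \<phi> (\<phi>' v u) - \<phi> (\<phi>' u v) + (\<alpha>' u v - \<alpha>' v u) *\<^sub>R Z" for u v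
  define B where "B u v = \<psi>' (\<psi> u) v - \<psi>' (\<psi> v) u + \<psi> (\<psi>' v u) - \<psi> (\<psi>' u v) + (\<beta>' u v - \<beta>' v u) *\<^sub>R W" for u v
  define a where "a u v = \<alpha>' (\<phi> u) v - \<alpha>' (\<phi> v) u - \<alpha>' v (\<phi> u) + \<alpha>' u (\<phi> v)" for u v
  define b where "b u v = \<beta>' (\<psi> u) v - \<beta>' (\<psi> v) u - \<beta>' v (\<psi> u) + \<beta>' u (\<psi> v)" for u v
  define L where "L u = \<phi>' Z u - Z' (\<phi> u) + \<phi> (Z' u)" for u
  define K where "K v = \<psi>' W v - W' (\<psi> v) + \<psi> (W' v)" for v
  have l1: "linear \<phi>" "\<And>a. linear (\<phi>' a)" "\<And>u. linear (\<lambda>a. \<phi>' a u)" "linear \<alpha>" "\<And>a. linear (\<alpha>' a)"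
      "\<And>u. linear (\<lambda>a. \<alpha>' a u)" "linear Z'"
    and e1: "\<And>u. \<phi> (\<phi> u) = - u + \<alpha> u *\<^sub>R Z" "\<phi> Z = 0" "\<alpha> Z = 1" "\<And>u. \<alpha> (\<phi> u) = 0"
    and d1: "\<And>a. \<phi>' a Z + \<phi> (Z' a) = 0" "\<And>a. \<alpha> (Z' a) = - \<alpha>' a Z"
      "\<And>a u. \<alpha> (\<phi>' a u) = - \<alpha>' a (\<phi> u)" "\<And>v. \<alpha>' Z v = \<alpha>' v Z"
    using 1 unfolding contact_jet_def by (auto simp: eq_neg_iff_add_eq_0 add.commute)
  have l2: "linear \<psi>" "\<And>a. linear (\<psi>' a)" "\<And>u. linear (\<lambda>a. \<psi>' a u)" "linear \<beta>" "\<And>a. linear (\<beta>' a)"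
      "\<And>u. linear (\<lambda>a. \<beta>' a u)" "linear W'"
    and e2: "\<And>u. \<psi> (\<psi> u) = - u + \<beta> u *\<^sub>R W" "\<psi> W = 0" "\<beta> W = 1" "\<And>u. \<beta> (\<psi> u) = 0"
    and d2: "\<And>a. \<psi>' a W + \<psi> (W' a) = 0" "\<And>a. \<beta> (W' a) = - \<beta>' a W"
      "\<And>a u. \<beta> (\<psi>' a u) = - \<beta>' a (\<psi> u)" "\<And>v. \<beta>' W v = \<beta>' v W"
    using 2 unfolding contact_jet_def by (auto simp: eq_neg_iff_add_eq_0 add.commute)
  have s2: "s * (s * r) = r" for r using s by (simp flip: mult.assoc)
  note lin = linear_add[OF l1(1)] linear_add[OF l1(2)] linear_add[OF l1(3)] linear_add[OF l1(4)]
    linear_add[OF l1(5)] linear_add[OF l1(6)] linear_add[OF l1(7)]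
    linear_diff[OF l1(1)] linear_diff[OF l1(2)] linear_diff[OF l1(3)] linear_diff[OF l1(4)]
    linear_diff[OF l1(5)] linear_diff[OF l1(6)] linear_diff[OF l1(7)]
    linear_scale[OF l1(1)] linear_scale[OF l1(2)] linear_scale[OF l1(3)] linear_scale[OF l1(4)]
    linear_scale[OF l1(5)] linear_scale[OF l1(6)] linear_scale[OF l1(7)]
    linear_add[OF l2(1)] linear_add[OF l2(2)] linear_add[OF l2(3)] linear_add[OF l2(4)]
    linear_add[OF l2(5)] linear_add[OF l2(6)] linear_add[OF l2(7)]
    linear_diff[OF l2(1)] linear_diff[OF l2(2)] linear_diff[OF l2(3)] linear_diff[OF l2(4)]
    linear_diff[OF l2(5)] linear_diff[OF l2(6)] linear_diff[OF l2(7)]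
    linear_scale[OF l2(1)] linear_scale[OF l2(2)] linear_scale[OF l2(3)] linear_scale[OF l2(4)]
    linear_scale[OF l2(5)] linear_scale[OF l2(6)] linear_scale[OF l2(7)]
  have N: "J' (J (u, v)) (w, z) - J' (J (w, z)) (u, v) + J (J' (w, z) (u, v)) - J (J' (u, v) (w, z))
      = (A u w + (s * \<beta> z) *\<^sub>R L u - (s * \<beta> v) *\<^sub>R L w - (s * b v z) *\<^sub>R Z,
         B v z - (s * \<alpha> w) *\<^sub>R K v + (s * \<alpha> u) *\<^sub>R K z + (s * a u w) *\<^sub>R W)" for u v w z
    unfolding J J' A_def B_def a_def b_def L_def K_def
    by (simp add: lin e1 e2 d1 d2 s2 algebra_simps)
  show ?thesis (is "?N \<longleftrightarrow> ?R")
  proof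
    assume ?N
    then have Z0: "A u w + (s * \<beta> z) *\<^sub>R L u - (s * \<beta> v) *\<^sub>R L w - (s * b v z) *\<^sub>R Z = 0"
      "B v z - (s * \<alpha> w) *\<^sub>R K v + (s * \<alpha> u) *\<^sub>R K z + (s * a u w) *\<^sub>R W = 0" for u v w z
      using N[of u v w z] by (auto simp: zero_prod_def)
    note z = linear_0[OF l1(1)] linear_0[OF l1(2)] linear_0[OF l1(3)] linear_0[OF l1(4)]
      linear_0[OF l1(5)] linear_0[OF l1(6)] linear_0[OF l1(7)]
      linear_0[OF l2(1)] linear_0[OF l2(2)] linear_0[OF l2(3)] linear_0[OF l2(4)]
      linear_0[OF l2(5)] linear_0[OF l2(6)] linear_0[OF l2(7)]
    have s0: "s \<noteq> 0" using s by auto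
    have W0: "W \<noteq> 0" "Z \<noteq> 0" using e1 e2 z by auto
    have b0: "b v 0 = 0" "b 0 v = 0" "a u 0 = 0" "a 0 u = 0" for u v
      unfolding a_def b_def by (simp_all add: z)
    have A0: "A u 0 = 0" "B v 0 = 0" "A 0 w = 0" "B 0 z = 0" "L 0 = 0" "K 0 = 0" for u v w z
      unfolding A_def B_def L_def K_def by (simp_all add: z)
    \<comment> \<open>Arguments tangent to a single factor leave the tensor of that factor in its
      own component and, in the other component, only a multiple of the other Reeb vector.\<close>
    have "A u w = 0" "B v z = 0" for u w v z
      using Z0(1)[of u w 0 0] Z0(2)[of v z 0 0] by (auto simp: z b0)
    moreover have "a u w = 0" "b v z = 0" for u w v z
      using Z0(2)[where v = 0 and z = 0 and u = u and w = w] Z0(1)[where u = 0 and w = 0 and v = v and z = z]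
        W0 s0 by (auto simp: z A0)
    \<comment> \<open>Pairing with the Reeb vector of the other factor, on which its form is 1,
      leaves the Lie derivative term alone.\<close>
    moreover have "L u = 0" "K v = 0" for u v
      using Z0(1)[where u = u and w = 0 and v = 0 and z = W] Z0(2)[where u = Z and w = 0 and v = 0 and z = v] s0
      by (auto simp: z A0 e1 e2 b0)
    ultimately show ?R
      unfolding normal_jet_def A_def B_def a_def b_def L_def K_def by blast
  next
    assume ?R
    then have "A u v = 0" "B w z = 0" "a u v = 0" "b w z = 0" "L u = 0" "K w = 0" for u v w z
      unfolding normal_jet_def A_def B_def a_def b_def L_def K_def by blast+
    then show ?N using N by (auto simp: zero_prod_def)
  qed
qed

section \<open>Charts and smooth maps\<close>

lemma chart_openin: "smooth_manifold M \<Longrightarrow> c \<in> atlas M \<Longrightarrow> openin (mtop M) (fst c)"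
  by (simp add: smooth_manifold_def)

lemma chart_subset: "smooth_manifold M \<Longrightarrow> c \<in> atlas M \<Longrightarrow> fst c \<subseteq> pts M"
  by (simp add: chart_openin openin_subset)

lemma chart_homeomorphic:
  "smooth_manifold M \<Longrightarrow> c \<in> atlas M \<Longrightarrow>
    homeomorphic_map (subtopology (mtop M) (fst c)) (top_of_set (snd c ` fst c)) (snd c)"
  by (simp add: smooth_manifold_def)

lemma chart_inj: "smooth_manifold M \<Longrightarrow> c \<in> atlas M \<Longrightarrow> inj_on (snd c) (fst c)"
  using homeomorphic_imp_injective_map[OF chart_homeomorphic] chart_subset
  by (metis topspace_subtopology_subset)

lemma chart_inv_left [simp]:
  "smooth_manifold M \<Longrightarrow> c \<in> atlas M \<Longrightarrow> p \<in> fst c \<Longrightarrow> chart_inv c (snd c p) = p"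
  by (simp add: chart_inv_def chart_inj)

lemma chart_inv_in: "s \<in> snd c ` fst c \<Longrightarrow> chart_inv c s \<in> fst c"
  by (simp add: chart_inv_def inv_into_into)

lemma chart_at_atlas: "smooth_manifold M \<Longrightarrow> p \<in> pts M \<Longrightarrow> chart_at M p \<in> atlas M"
  by (simp add: smooth_manifold_def)

lemma chart_at_mem: "smooth_manifold M \<Longrightarrow> p \<in> pts M \<Longrightarrow> p \<in> fst (chart_at M p)"
  by (simp add: smooth_manifold_def)

lemma open_chart_image:
  assumes M: "smooth_manifold M" "c \<in> atlas M" and U: "openin (mtop M) U"
  shows "open (snd c ` (U \<inter> fst c))"
proof -
  have "openin (subtopology (mtop M) (fst c)) (U \<inter> fst c)"
    using U by (auto simp: openin_subtopology)
  then have "openin (top_of_set (snd c ` fst c)) (snd c ` (U \<inter> fst c))"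
    using homeomorphic_imp_open_map[OF chart_homeomorphic[OF M]] by (simp add: open_map_def)
  moreover have "open (snd c ` fst c)" using M by (simp add: smooth_manifold_def)
  ultimately show ?thesis by (metis openin_open_trans)
qed

lemma openin_chart_vimage:
  assumes M: "smooth_manifold M" "c \<in> atlas M" and T: "open T"
  shows "openin (mtop M) (fst c \<inter> snd c -` T)"
proof -
  have "continuous_map (subtopology (mtop M) (fst c)) euclidean (snd c)"
    using homeomorphic_imp_continuous_map[OF chart_homeomorphic[OF M]]
    by (simp add: continuous_map_in_subtopology)
  then have "openin (subtopology (mtop M) (fst c)) {x \<in> topspace (subtopology (mtop M) (fst c)). snd c x \<in> T}"
    by (rule openin_continuous_map_preimage) (use T in \<open>simp flip: open_openin\<close>)
  then have "openin (mtop M) {x \<in> topspace (subtopology (mtop M) (fst c)). snd c x \<in> T}"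
    by (rule openin_trans_full) (rule chart_openin[OF M])
  moreover have "{x \<in> topspace (subtopology (mtop M) (fst c)). snd c x \<in> T} = fst c \<inter> snd c -` T"
    using chart_subset[OF M] by auto
  ultimately show ?thesis by simp
qed

section \<open>Smooth maps in local coordinates\<close>

lemma smooth_map_on_openin_vimage:
  assumes f: "smooth_map_on U M N f" and V: "openin (mtop N) V"
  shows "openin (mtop M) (U \<inter> f -` V)"
proof -
  have U: "openin (mtop M) U" and c: "continuous_map (subtopology (mtop M) U) (mtop N) f"
    using f by (auto simp: smooth_map_on_def)
  have "openin (subtopology (mtop M) U) {x \<in> topspace (subtopology (mtop M) U). f x \<in> V}"
    using c V by (rule openin_continuous_map_preimage)
  then have "openin (mtop M) {x \<in> topspace (subtopology (mtop M) U). f x \<in> V}"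
    by (rule openin_trans_full) (rule U)
  moreover have "{x \<in> topspace (subtopology (mtop M) U). f x \<in> V} = U \<inter> f -` V"
    using openin_subset[OF U] by auto
  ultimately show ?thesis by simp
qed

lemma smooth_map_on_open: "smooth_map_on U M N f \<Longrightarrow> openin (mtop M) U"
  by (simp add: smooth_map_on_def)

lemma smooth_map_on_pts: "smooth_map_on U M N f \<Longrightarrow> x \<in> U \<Longrightarrow> f x \<in> pts N"
  unfolding smooth_map_on_def continuous_map_def
  using openin_subset by fastforce

text \<open>Supplies a coordinate neighbourhood on which the representative of \<open>f\<close> is
  smooth and all chart inverses cancel; every coordinate computation below starts from it.\<close>

lemma smooth_map_on_rep:
  assumes M: "smooth_manifold M" "c \<in> atlas M" and N: "smooth_manifold N" "d \<in> atlas N"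
    and f: "smooth_map_on U M N f" and x: "x \<in> U" "x \<in> fst c" "f x \<in> fst d"
  obtains S where "open S" "snd c x \<in> S" "S \<subseteq> snd c ` (U \<inter> fst c)" "smooth_on S (snd d \<circ> f \<circ> chart_inv c)"
    "\<And>s. s \<in> S \<Longrightarrow> chart_inv c s \<in> U \<inter> fst c \<and> snd c (chart_inv c s) = s \<and> f (chart_inv c s) \<in> fst d"
proof
  let ?S = "snd c ` (U \<inter> fst c \<inter> f -` fst d)"
  have "openin (mtop M) (U \<inter> f -` fst d)"
    by (rule smooth_map_on_openin_vimage[OF f chart_openin[OF N]])
  from open_chart_image[OF M this] show "open ?S"
    by (simp add: Int_assoc Int_commute Int_left_commute)
  show "snd c x \<in> ?S" "?S \<subseteq> snd c ` (U \<inter> fst c)" using x by auto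
  show "smooth_on ?S (snd d \<circ> f \<circ> chart_inv c)"
    using f M N by (simp add: smooth_map_on_def)
  show "chart_inv c s \<in> U \<inter> fst c \<and> snd c (chart_inv c s) = s \<and> f (chart_inv c s) \<in> fst d"
    if "s \<in> ?S" for s using that M by auto
qed

lemma smooth_map_onI:
  assumes M: "smooth_manifold M" and U: "openin (mtop M) U"
    and c: "continuous_map (subtopology (mtop M) U) (mtop N) f"
    and l: "\<And>x c d. x \<in> U \<Longrightarrow> c \<in> atlas M \<Longrightarrow> d \<in> atlas N \<Longrightarrow> x \<in> fst c \<Longrightarrow> f x \<in> fst d \<Longrightarrow>
      \<exists>S. open S \<and> snd c x \<in> S \<and> smooth_on S (snd d \<circ> f \<circ> chart_inv c)"
  shows "smooth_map_on U M N f"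
  unfolding smooth_map_on_def
proof (intro conjI ballI U c)
  fix c d assume "c \<in> atlas M" "d \<in> atlas N"
  then show "smooth_on (snd c ` (U \<inter> fst c \<inter> f -` fst d)) (snd d \<circ> f \<circ> chart_inv c)"
    by (intro smooth_on_local) (auto intro: l)
qed

lemma smooth_map_on_subset:
  assumes f: "smooth_map_on U M N f" and V: "openin (mtop M) V" "V \<subseteq> U"
  shows "smooth_map_on V M N f"
  unfolding smooth_map_on_def
proof (intro conjI ballI V(1))
  show "continuous_map (subtopology (mtop M) V) (mtop N) f"
    using f V(2) continuous_map_from_subtopology_mono unfolding smooth_map_on_def by blast
  fix c d assume "c \<in> atlas M" "d \<in> atlas N"
  then have "smooth_on (snd c ` (U \<inter> fst c \<inter> f -` fst d)) (snd d \<circ> f \<circ> chart_inv c)"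
    using f by (simp add: smooth_map_on_def)
  then show "smooth_on (snd c ` (V \<inter> fst c \<inter> f -` fst d)) (snd d \<circ> f \<circ> chart_inv c)"
    by (rule smooth_on_subset) (use V in auto)
qed

lemma smooth_map_on_cong:
  assumes M: "smooth_manifold M" and N: "smooth_manifold N"
    and f: "smooth_map_on U M N f" and eq: "\<And>x. x \<in> U \<Longrightarrow> f x = g x"
  shows "smooth_map_on U M N g"
proof (rule smooth_map_onI[OF M smooth_map_on_open[OF f]])
  show "continuous_map (subtopology (mtop M) U) (mtop N) g"
    using f continuous_map_eq[of _ _ f g] eq unfolding smooth_map_on_def by fastforce
  fix x c d assume x: "x \<in> U" "c \<in> atlas M" "d \<in> atlas N" "x \<in> fst c" "g x \<in> fst d"
  then have "f x \<in> fst d" by (simp add: eq)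
  from smooth_map_on_rep[OF M x(2) N x(3) f x(1,4) this] obtain S
    where S: "open S" "snd c x \<in> S" "S \<subseteq> snd c ` (U \<inter> fst c)" "smooth_on S (snd d \<circ> f \<circ> chart_inv c)"
    "\<And>s. s \<in> S \<Longrightarrow> chart_inv c s \<in> U \<inter> fst c \<and> snd c (chart_inv c s) = s \<and> f (chart_inv c s) \<in> fst d"
    by metis
  have "smooth_on S (snd d \<circ> g \<circ> chart_inv c)"
    by (subst smooth_on_cong[OF S(1), of _ "snd d \<circ> f \<circ> chart_inv c"]) (use S eq in auto)
  then show "\<exists>S. open S \<and> snd c x \<in> S \<and> smooth_on S (snd d \<circ> g \<circ> chart_inv c)"
    using S by blast
qed

lemma smooth_map_on_compose:
  assumes M: "smooth_manifold M" and N: "smooth_manifold N" and L: "smooth_manifold L"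
    and f: "smooth_map_on U M N f" and g: "smooth_map_on V N L g" and UV: "f ` U \<subseteq> V"
  shows "smooth_map_on U M L (g \<circ> f)"
proof (rule smooth_map_onI[OF M smooth_map_on_open[OF f]])
  have "continuous_map (subtopology (mtop M) U) (subtopology (mtop N) V) f"
    using f UV openin_subset unfolding smooth_map_on_def continuous_map_in_subtopology by fastforce
  then show "continuous_map (subtopology (mtop M) U) (mtop L) (g \<circ> f)"
    using g continuous_map_compose unfolding smooth_map_on_def by blast
  fix x c e assume x: "x \<in> U" "c \<in> atlas M" "e \<in> atlas L" "x \<in> fst c" "(g \<circ> f) x \<in> fst e"
  have fx: "f x \<in> pts N" using smooth_map_on_pts[OF f] x by simp
  define d where "d = chart_at N (f x)"
  have d: "d \<in> atlas N" "f x \<in> fst d" using chart_at_atlas[OF N fx] chart_at_mem[OF N fx] by (auto simp: d_def)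
  from smooth_map_on_rep[OF M x(2) N d(1) f x(1,4) d(2)] obtain S
    where S: "open S" "snd c x \<in> S" "smooth_on S (snd d \<circ> f \<circ> chart_inv c)"
    "\<And>s. s \<in> S \<Longrightarrow> chart_inv c s \<in> U \<inter> fst c \<and> snd c (chart_inv c s) = s \<and> f (chart_inv c s) \<in> fst d"
    by metis
  from smooth_map_on_rep[OF N d(1) L x(3) g _ d(2)] x UV obtain T
    where T: "open T" "snd d (f x) \<in> T" "smooth_on T (snd e \<circ> g \<circ> chart_inv d)"
    by (metis comp_apply image_subset_iff)
  let ?f = "snd d \<circ> f \<circ> chart_inv c" and ?g = "snd e \<circ> g \<circ> chart_inv d"
  \<comment> \<open>\<open>S\<close> is shrunk so that the representative of \<open>f\<close> takes
    its values where the representative of \<open>g\<close> is known to be smooth.\<close>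
  define S' where "S' = S \<inter> ?f -` T"
  have S': "open S'" unfolding S'_def
    using continuous_on_open_vimage[OF S(1)] smooth_on_continuous_on[OF S(3)] T(1)
    by (metis Int_commute)
  have "smooth_on S' (?g \<circ> ?f)"
    by (rule smooth_on_compose[OF S' T(1) _ smooth_on_subset[OF S(3)] T(3)]) (auto simp: S'_def)
  moreover have "(?g \<circ> ?f) s = (snd e \<circ> (g \<circ> f) \<circ> chart_inv c) s" if "s \<in> S'" for s
    using that S(4)[of s] N d by (simp add: S'_def)
  ultimately have "smooth_on S' (snd e \<circ> (g \<circ> f) \<circ> chart_inv c)"
    by (subst smooth_on_cong[OF S', symmetric]) auto
  moreover have "snd c x \<in> S'" using S T x M by (simp add: S'_def)
  ultimately show "\<exists>S. open S \<and> snd c x \<in> S \<and> smooth_on S (snd e \<circ> (g \<circ> f) \<circ> chart_inv c)"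
    using S' by blast
qed

lemma smooth_map_on_id:
  assumes M: "smooth_manifold M" and U: "openin (mtop M) U"
  shows "smooth_map_on U M M id"
proof (rule smooth_map_onI[OF M U])
  show "continuous_map (subtopology (mtop M) U) (mtop M) id"
    by (simp add: continuous_map_from_subtopology)
  fix x c d assume x: "x \<in> U" "c \<in> atlas M" "d \<in> atlas M" "x \<in> fst c" "id x \<in> fst d"
  have "open (snd c ` (fst d \<inter> fst c))" using open_chart_image[OF M x(2) chart_openin[OF M x(3)]] .
  moreover have "smooth_on (snd c ` (fst c \<inter> fst d)) (snd d \<circ> chart_inv c)"
    using M x by (simp add: smooth_manifold_def)
  ultimately show "\<exists>S. open S \<and> snd c x \<in> S \<and> smooth_on S (snd d \<circ> id \<circ> chart_inv c)"
    using x by (intro exI[of _ "snd c ` (fst c \<inter> fst d)"]) (auto simp: Int_commute)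
qed

subsection \<open>Derivatives in charts\<close>

text \<open>For \<open>f = id\<close> this yields \<open>to_chart\<close> and
  \<open>of_chart\<close>, and between preferred charts it yields \<open>tangent_map\<close>, so
  that one chain rule serves all three.\<close>

definition chart_deriv ::
  "('a \<Rightarrow> 'b) \<Rightarrow> ('b, 'g::euclidean_space) chart \<Rightarrow> ('a, 'e::euclidean_space) chart \<Rightarrow> 'a \<Rightarrow> 'e \<Rightarrow> 'g" where
  "chart_deriv f d c x = fderiv (snd d \<circ> f \<circ> chart_inv c) (snd c x)"

lemma to_chart_eq: "to_chart M c p = chart_deriv id c (chart_at M p) p"
  by (simp add: to_chart_def chart_deriv_def)

lemma of_chart_eq: "of_chart M c p = chart_deriv id (chart_at M p) c p"
  by (simp add: of_chart_def chart_deriv_def)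

lemma tangent_map_eq: "tangent_map M N f p = chart_deriv f (chart_at N (f p)) (chart_at M p) p"
  by (simp add: tangent_map_def chart_deriv_def)

lemma chart_deriv_linear:
  assumes "smooth_manifold M" "c \<in> atlas M" "smooth_manifold N" "d \<in> atlas N"
    "smooth_map_on U M N f" "x \<in> U" "x \<in> fst c" "f x \<in> fst d"
  shows "linear (chart_deriv f d c x)"
proof -
  obtain S where "open S" "snd c x \<in> S" "smooth_on S (snd d \<circ> f \<circ> chart_inv c)"
    using smooth_map_on_rep[OF assms] by metis
  then show ?thesis
    unfolding chart_deriv_def by (intro linear_fderiv smooth_on_differentiable)
qed

lemma chart_deriv_compose:
  assumes M: "smooth_manifold M" "c \<in> atlas M" and N: "smooth_manifold N" "d \<in> atlas N"
    and L: "smooth_manifold L" "e \<in> atlas L"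
    and f: "smooth_map_on U M N f" and g: "smooth_map_on V N L g"
    and x: "x \<in> U" "f x \<in> V" "x \<in> fst c" "f x \<in> fst d" "g (f x) \<in> fst e"
  shows "chart_deriv (g \<circ> f) e c x v = chart_deriv g e d (f x) (chart_deriv f d c x v)"
proof -
  from smooth_map_on_rep[OF M N f x(1,3,4)] obtain S
    where S: "open S" "snd c x \<in> S" "smooth_on S (snd d \<circ> f \<circ> chart_inv c)"
    "\<And>s. s \<in> S \<Longrightarrow> chart_inv c s \<in> U \<inter> fst c \<and> snd c (chart_inv c s) = s \<and> f (chart_inv c s) \<in> fst d"
    by metis
  from smooth_map_on_rep[OF N L g x(2,4,5)] obtain T
    where T: "open T" "snd d (f x) \<in> T" "smooth_on T (snd e \<circ> g \<circ> chart_inv d)"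
    by metis
  let ?f = "snd d \<circ> f \<circ> chart_inv c" and ?g = "snd e \<circ> g \<circ> chart_inv d"
  have fx: "?f (snd c x) = snd d (f x)" using M x by simp
  have "fderiv (snd e \<circ> (g \<circ> f) \<circ> chart_inv c) (snd c x) = fderiv (?g \<circ> ?f) (snd c x)"
    by (rule fderiv_cong_open[OF S(1,2)]) (use S N x in auto)
  then show ?thesis
    unfolding chart_deriv_def
    by (simp only: fderiv_comp smooth_on_differentiable[OF S(3,2)] smooth_on_differentiable[OF T(3,2)] fx)
qed

lemma chart_deriv_cong:
  assumes M: "smooth_manifold M" "c \<in> atlas M" and U: "openin (mtop M) U" "x \<in> U" "x \<in> fst c"
    and eq: "\<And>y. y \<in> U \<Longrightarrow> f y = g y"
  shows "chart_deriv f d c x = chart_deriv g d c x"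
  unfolding chart_deriv_def
  by (rule fderiv_cong_open[OF open_chart_image[OF M U(1)]]) (use M U eq in auto)

lemma chart_deriv_id:
  assumes M: "smooth_manifold M" "c \<in> atlas M" and x: "x \<in> fst c"
  shows "chart_deriv id c c x v = v"
proof -
  have "fderiv (snd c \<circ> id \<circ> chart_inv c) (snd c x) = fderiv (\<lambda>y. y) (snd c x)"
    by (rule fderiv_cong_open[OF open_chart_image[OF M chart_openin[OF M]]])
      (use x M in auto)
  then show ?thesis by (simp add: chart_deriv_def)
qed

text \<open>
  A pair of mutually inverse smooth maps between open subsets; unlike \<open>local_diffeo\<close> this notion is
  symmetric in the two manifolds.
\<close>

definition diffeo_pair ::
  "('a, 'e::euclidean_space) manifold \<Rightarrow> ('b, 'g::euclidean_space) manifold \<Rightarrow> 'a set \<Rightarrow> 'b set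
    \<Rightarrow> ('a \<Rightarrow> 'b) \<Rightarrow> ('b \<Rightarrow> 'a) \<Rightarrow> bool" where
  "diffeo_pair M N U V f g \<longleftrightarrow>
     smooth_manifold M \<and> smooth_manifold N \<and> smooth_map_on U M N f \<and> smooth_map_on V N M g \<and>
     f ` U = V \<and> g ` V = U \<and> (\<forall>x\<in>U. g (f x) = x) \<and> (\<forall>y\<in>V. f (g y) = y)"

lemma diffeo_pair_sym: "diffeo_pair M N U V f g \<Longrightarrow> diffeo_pair N M V U g f"
  by (auto simp: diffeo_pair_def)

lemma local_diffeo_pair:
  assumes MN: "smooth_manifold M" "smooth_manifold N" and f: "local_diffeo M N f" "x \<in> pts M"
  obtains U where "x \<in> U" "diffeo_pair M N U (f ` U) f (inv_into U f)"
proof -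
  obtain U where U: "x \<in> U" "inj_on f U" "smooth_map_on U M N f" "smooth_map_on (f ` U) N M (inv_into U f)"
    using f unfolding local_diffeo_def by blast
  have "diffeo_pair M N U (f ` U) f (inv_into U f)"
    unfolding diffeo_pair_def using MN U by (auto simp: f_inv_into_f inv_into_image_cancel)
  with U(1) show ?thesis by (rule that)
qed

lemma diffeo_pair_pts:
  assumes "diffeo_pair M N U V f g" "x \<in> U"
  shows "x \<in> pts M" "f x \<in> pts N" "f x \<in> V"
  using assms smooth_map_on_pts unfolding diffeo_pair_def by fastforce+

lemma diffeo_pair_chart_deriv:
  assumes D: "diffeo_pair M N U V f g" and x: "x \<in> U" "x \<in> fst c" "f x \<in> fst d"
    and c: "c \<in> atlas M" and d: "d \<in> atlas N"
  shows "chart_deriv g c d (f x) (chart_deriv f d c x v) = v"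
proof -
  have M: "smooth_manifold M" and N: "smooth_manifold N"
    and f: "smooth_map_on U M N f" and g: "smooth_map_on V N M g"
    and fU: "f ` U = V" and gf: "\<And>x. x \<in> U \<Longrightarrow> g (f x) = x"
    using D by (auto simp: diffeo_pair_def)
  have "chart_deriv g c d (f x) (chart_deriv f d c x v) = chart_deriv (g \<circ> f) c c x v"
    by (rule chart_deriv_compose[OF M c N d M c f g, symmetric]) (use x fU gf in auto)
  also have "\<dots> = chart_deriv id c c x v"
    by (subst chart_deriv_cong[OF M c smooth_map_on_open[OF f] x(1,2), of "g \<circ> f" id]) (use gf in auto)
  finally show ?thesis by (simp add: chart_deriv_id[OF M c x(2)])
qed

lemma diffeo_pair_tangent_map:
  assumes D: "diffeo_pair M N U V f g" and x: "x \<in> U"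
  shows "tangent_map N M g (f x) (tangent_map M N f x v) = v"
    and "linear (tangent_map M N f x)" and "bij (tangent_map M N f x)"
proof -
  have 1: "tangent_map N M g (f x) (tangent_map M N f x v) = v"
    if D: "diffeo_pair M N U V f g" and x: "x \<in> U" for M N U V f g x v
  proof -
    have [simp]: "g (f x) = x" and MN: "smooth_manifold M" "smooth_manifold N"
      using D x by (auto simp: diffeo_pair_def)
    note p = diffeo_pair_pts[OF D x]
    show ?thesis
      using diffeo_pair_chart_deriv[OF D x chart_at_mem[OF MN(1) p(1)] chart_at_mem[OF MN(2) p(2)]
          chart_at_atlas[OF MN(1) p(1)] chart_at_atlas[OF MN(2) p(2)]]
      by (simp add: tangent_map_eq)
  qed
  show "tangent_map N M g (f x) (tangent_map M N f x v) = v"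
    by (rule 1[OF D x])
  have MN: "smooth_manifold M" "smooth_manifold N" "smooth_map_on U M N f"
    using D by (auto simp: diffeo_pair_def)
  note p = diffeo_pair_pts[OF D x]
  show "linear (tangent_map M N f x)"
    unfolding tangent_map_eq
    by (rule chart_deriv_linear[OF MN(1) chart_at_atlas[OF MN(1) p(1)] MN(2) chart_at_atlas[OF MN(2) p(2)]
          MN(3) x chart_at_mem[OF MN(1) p(1)] chart_at_mem[OF MN(2) p(2)]])
  have "g (f x) = x" using D x by (auto simp: diffeo_pair_def)
  then have "tangent_map M N f x (tangent_map N M g (f x) w) = w" for w
    using 1[OF diffeo_pair_sym[OF D] p(3)] by simp
  with 1[OF D x] show "bij (tangent_map M N f x)"
    by (intro bijI injI) (metis, metis surjI)
qed

lemma tangent_map_compose: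
  assumes M: "smooth_manifold M" and N: "smooth_manifold N" and L: "smooth_manifold L"
    and f: "smooth_map_on U M N f" and g: "smooth_map_on V N L g" and x: "x \<in> U" "f x \<in> V"
  shows "tangent_map M L (g \<circ> f) x v = tangent_map N L g (f x) (tangent_map M N f x v)"
proof -
  have p: "x \<in> pts M" "f x \<in> pts N" "g (f x) \<in> pts L"
    using smooth_map_on_pts[OF f x(1)] smooth_map_on_pts[OF g x(2)] x
      openin_subset[OF smooth_map_on_open[OF f]] by auto
  show ?thesis
    using chart_deriv_compose[OF M chart_at_atlas[OF M p(1)] N chart_at_atlas[OF N p(2)]
        L chart_at_atlas[OF L p(3)] f g x chart_at_mem[OF M p(1)] chart_at_mem[OF N p(2)] chart_at_mem[OF L p(3)]]
    by (simp add: tangent_map_eq)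
qed

lemma tangent_map_cong:
  assumes M: "smooth_manifold M" and U: "openin (mtop M) U" "x \<in> U"
    and eq: "\<And>y. y \<in> U \<Longrightarrow> f y = g y"
  shows "tangent_map M N f x = tangent_map M N g x"
proof -
  have p: "x \<in> pts M" using U openin_subset by blast
  show ?thesis
    using chart_deriv_cong[OF M chart_at_atlas[OF M p] U chart_at_mem[OF M p] eq] eq[OF U(2)]
    by (simp add: tangent_map_eq)
qed

text \<open>The chain rule for \<open>id \<circ> id\<close>, read between the chart \<open>c\<close>
  and the preferred chart.\<close>

lemma to_of_chart:
  assumes M: "smooth_manifold M" "c \<in> atlas M" and x: "x \<in> fst c"
  shows "to_chart M c x (of_chart M c x v) = v" and "of_chart M c x (to_chart M c x v) = v"
    and "linear (to_chart M c x)" and "linear (of_chart M c x)"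
proof -
  have p: "x \<in> pts M" using chart_subset[OF M] x by auto
  note a = chart_at_atlas[OF M(1) p] and m = chart_at_mem[OF M(1) p]
  note i = smooth_map_on_id[OF M(1) openin_topspace]
  show "to_chart M c x (of_chart M c x v) = v" "of_chart M c x (to_chart M c x v) = v"
    using chart_deriv_compose[OF M M(1) a M i i p, of v] chart_deriv_compose[OF M(1) a M M(1) a i i p, of v]
      chart_deriv_id[OF M x] chart_deriv_id[OF M(1) a m] p m x
    by (simp_all add: to_chart_eq of_chart_eq)
  show "linear (to_chart M c x)" "linear (of_chart M c x)"
    unfolding to_chart_eq of_chart_eq
    using chart_deriv_linear[OF M(1) a M i p] chart_deriv_linear[OF M M(1) a i p] x m by auto
qed

lemma to_chart_at: "smooth_manifold M \<Longrightarrow> x \<in> pts M \<Longrightarrow> to_chart M (chart_at M x) x v = v"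
  by (simp add: to_chart_eq chart_deriv_id chart_at_atlas chart_at_mem)

lemma of_chart_at: "smooth_manifold M \<Longrightarrow> x \<in> pts M \<Longrightarrow> of_chart M (chart_at M x) x v = v"
  by (simp add: of_chart_eq chart_deriv_id chart_at_atlas chart_at_mem)

text \<open>Both sides are the derivative of \<open>f\<close> from the chart \<open>c\<close> to the
  preferred chart at \<open>f x\<close>, factored once through \<open>f \<circ> id\<close> and once
  through \<open>id \<circ> f\<close>.\<close>

lemma tangent_map_of_chart:
  assumes M: "smooth_manifold M" "c \<in> atlas M" and N: "smooth_manifold N" "d \<in> atlas N"
    and f: "smooth_map_on U M N f" and x: "x \<in> U" "x \<in> fst c" "f x \<in> fst d"
  shows "tangent_map M N f x (of_chart M c x w) = of_chart N d (f x) (chart_deriv f d c x w)"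
proof -
  have p: "x \<in> pts M" "f x \<in> pts N"
    using chart_subset[OF M] x smooth_map_on_pts[OF f x(1)] by auto
  note a = chart_at_atlas[OF M(1) p(1)] and m = chart_at_mem[OF M(1) p(1)]
  note b = chart_at_atlas[OF N(1) p(2)] and n = chart_at_mem[OF N(1) p(2)]
  note i = smooth_map_on_id[OF M(1) openin_topspace] and j = smooth_map_on_id[OF N(1) openin_topspace]
  have "tangent_map M N f x (of_chart M c x w) = chart_deriv (f \<circ> id) (chart_at N (f x)) c x w"
    using chart_deriv_compose[OF M M(1) a N(1) b i f p(1)] x m n by (simp add: tangent_map_eq of_chart_eq)
  also have "\<dots> = chart_deriv (id \<circ> f) (chart_at N (f x)) c x w" by simp
  also have "\<dots> = of_chart N d (f x) (chart_deriv f d c x w)"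
    using chart_deriv_compose[OF M N N(1) b f j x(1) p(2) x(2,3)] n by (simp add: of_chart_eq)
  finally show ?thesis .
qed

lemma to_chart_tangent_map:
  assumes M: "smooth_manifold M" "c \<in> atlas M" and N: "smooth_manifold N" "d \<in> atlas N"
    and f: "smooth_map_on U M N f" and x: "x \<in> U" "x \<in> fst c" "f x \<in> fst d"
  shows "to_chart N d (f x) (tangent_map M N f x v) = chart_deriv f d c x (to_chart M c x v)"
  using tangent_map_of_chart[OF assms, of "to_chart M c x v"]
  by (metis to_of_chart(1)[OF N x(3)] to_of_chart(2)[OF M x(2)])

section \<open>Tensor fields along local diffeomorphisms\<close>

text \<open>A version on subsets, since fields are compared along diffeomorphisms that exist only
  between open subsets.\<close>

definition smooth_form_on ::
  "'a set \<Rightarrow> ('a, 'e::euclidean_space) manifold \<Rightarrow> ('a \<Rightarrow> 'e \<Rightarrow> real) \<Rightarrow> bool" where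
  "smooth_form_on U M \<alpha> \<longleftrightarrow> (\<forall>p\<in>U. linear (\<alpha> p)) \<and>
     (\<forall>c\<in>atlas M. \<forall>v. smooth_on (snd c ` (U \<inter> fst c)) (\<lambda>x. form_rep M c \<alpha> x v))"

definition smooth_endo_on ::
  "'a set \<Rightarrow> ('a, 'e::euclidean_space) manifold \<Rightarrow> ('a \<Rightarrow> 'e \<Rightarrow> 'e) \<Rightarrow> bool" where
  "smooth_endo_on U M \<phi> \<longleftrightarrow> (\<forall>p\<in>U. linear (\<phi> p)) \<and>
     (\<forall>c\<in>atlas M. \<forall>v. smooth_on (snd c ` (U \<inter> fst c)) (\<lambda>x. endo_rep M c \<phi> x v))"

lemma smooth_form_iff: "smooth_manifold M \<Longrightarrow> smooth_form M \<alpha> \<longleftrightarrow> smooth_form_on (pts M) M \<alpha>"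
  unfolding smooth_form_def smooth_form_on_def using chart_subset[of M] by (auto simp: Int_absorb1)

lemma smooth_endo_iff: "smooth_manifold M \<Longrightarrow> smooth_endo M \<phi> \<longleftrightarrow> smooth_endo_on (pts M) M \<phi>"
  unfolding smooth_endo_def smooth_endo_on_def using chart_subset[of M] by (auto simp: Int_absorb1)

lemma smooth_form_on_subset: "smooth_form_on U M \<alpha> \<Longrightarrow> V \<subseteq> U \<Longrightarrow> smooth_form_on V M \<alpha>"
  unfolding smooth_form_on_def by (blast intro: smooth_on_subset)

lemma smooth_endo_on_subset: "smooth_endo_on U M \<phi> \<Longrightarrow> V \<subseteq> U \<Longrightarrow> smooth_endo_on V M \<phi>"
  unfolding smooth_endo_on_def by (blast intro: smooth_on_subset)

lemma smooth_form_on_local: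
  assumes M: "smooth_manifold M"
    and l: "\<And>p. p \<in> U \<Longrightarrow> \<exists>W. openin (mtop M) W \<and> p \<in> W \<and> smooth_form_on W M \<alpha>"
  shows "smooth_form_on U M \<alpha>"
  unfolding smooth_form_on_def
proof (intro conjI ballI allI smooth_on_local)
  fix c v x assume "c \<in> atlas M" "x \<in> snd c ` (U \<inter> fst c)"
  then obtain p W where "p \<in> U" "p \<in> fst c" "x = snd c p" "openin (mtop M) W" "p \<in> W" "smooth_form_on W M \<alpha>"
    using l by blast
  with open_chart_image[OF M \<open>c \<in> atlas M\<close>] \<open>c \<in> atlas M\<close>
  show "\<exists>T. open T \<and> x \<in> T \<and> smooth_on T (\<lambda>x. form_rep M c \<alpha> x v)"
    unfolding smooth_form_on_def by blast
qed (use l in \<open>auto simp: smooth_form_on_def\<close>)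

lemma smooth_endo_on_local:
  assumes M: "smooth_manifold M"
    and l: "\<And>p. p \<in> U \<Longrightarrow> \<exists>W. openin (mtop M) W \<and> p \<in> W \<and> smooth_endo_on W M \<phi>"
  shows "smooth_endo_on U M \<phi>"
  unfolding smooth_endo_on_def
proof (intro conjI ballI allI smooth_on_local)
  fix c v x assume "c \<in> atlas M" "x \<in> snd c ` (U \<inter> fst c)"
  then obtain p W where "p \<in> U" "p \<in> fst c" "x = snd c p" "openin (mtop M) W" "p \<in> W" "smooth_endo_on W M \<phi>"
    using l by blast
  with open_chart_image[OF M \<open>c \<in> atlas M\<close>] \<open>c \<in> atlas M\<close>
  show "\<exists>T. open T \<and> x \<in> T \<and> smooth_on T (\<lambda>x. endo_rep M c \<phi> x v)"
    unfolding smooth_endo_on_def by blast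
qed (use l in \<open>auto simp: smooth_endo_on_def\<close>)

lemma linear_form_rep:
  assumes M: "smooth_manifold M" "c \<in> atlas M" and \<alpha>: "\<And>p. p \<in> U \<Longrightarrow> linear (\<alpha> p)"
    and s: "s \<in> snd c ` (U \<inter> fst c)"
  shows "linear (form_rep M c \<alpha> s)"
proof -
  have "chart_inv c s \<in> U" "chart_inv c s \<in> fst c" using s M by auto
  from linear_compose[OF to_of_chart(4)[OF M this(2)] \<alpha>[OF this(1)]] show ?thesis
    by (simp add: o_def form_rep_def[abs_def])
qed

lemma linear_endo_rep:
  assumes M: "smooth_manifold M" "c \<in> atlas M" and \<phi>: "\<And>p. p \<in> U \<Longrightarrow> linear (\<phi> p)"
    and s: "s \<in> snd c ` (U \<inter> fst c)"
  shows "linear (endo_rep M c \<phi> s)"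
proof -
  have "chart_inv c s \<in> U" "chart_inv c s \<in> fst c" using s M by auto
  from linear_compose[OF linear_compose[OF to_of_chart(4)[OF M this(2)] \<phi>[OF this(1)]] to_of_chart(3)[OF M this(2)]]
  show ?thesis by (simp add: o_def endo_rep_def[abs_def])
qed

text \<open>Turns the pointwise relation, stated in preferred charts, into the relation between
  components in fixed charts that \<open>ext_deriv_coord_pullback\<close> assumes.\<close>

lemma form_rep_related:
  assumes M: "smooth_manifold M" "c \<in> atlas M" and N: "smooth_manifold N" "d \<in> atlas N"
    and f: "smooth_map_on U M N f"
    and rel: "\<And>x v. x \<in> U \<Longrightarrow> \<alpha> x v = \<beta> (f x) (tangent_map M N f x v)"
    and s: "chart_inv c s \<in> U \<inter> fst c \<and> snd c (chart_inv c s) = s \<and> f (chart_inv c s) \<in> fst d"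
  shows "form_rep M c \<alpha> s w = form_rep N d \<beta> ((snd d \<circ> f \<circ> chart_inv c) s) (fderiv (snd d \<circ> f \<circ> chart_inv c) s w)"
  using tangent_map_of_chart[OF M N f, of "chart_inv c s" w] rel[of "chart_inv c s"] s N
  by (simp add: form_rep_def chart_deriv_def)

lemma endo_rep_related:
  assumes M: "smooth_manifold M" "c \<in> atlas M" and N: "smooth_manifold N" "d \<in> atlas N"
    and f: "smooth_map_on U M N f"
    and rel: "\<And>x v. x \<in> U \<Longrightarrow> tangent_map M N f x (\<phi> x v) = \<psi> (f x) (tangent_map M N f x v)"
    and s: "chart_inv c s \<in> U \<inter> fst c \<and> snd c (chart_inv c s) = s \<and> f (chart_inv c s) \<in> fst d"
  shows "fderiv (snd d \<circ> f \<circ> chart_inv c) s (endo_rep M c \<phi> s w)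
    = endo_rep N d \<psi> ((snd d \<circ> f \<circ> chart_inv c) s) (fderiv (snd d \<circ> f \<circ> chart_inv c) s w)"
  using tangent_map_of_chart[OF M N f, of "chart_inv c s" w]
    to_chart_tangent_map[OF M N f, of "chart_inv c s" "\<phi> (chart_inv c s) (of_chart M c (chart_inv c s) w)"]
    rel[of "chart_inv c s"] s N
  by (simp add: endo_rep_def chart_deriv_def)

text \<open>The components of the pullback are those of \<beta> along the representative of
  \<open>f\<close>, evaluated on its derivative. The map is a general smooth one because the
  projections of a product are treated in the same way as local diffeomorphisms.\<close>

lemma smooth_form_on_pullback:
  assumes M: "smooth_manifold M" and N: "smooth_manifold N"
    and f: "smooth_map_on U M N f" and V: "openin (mtop N) V" "f ` U \<subseteq> V" and \<beta>: "smooth_form_on V N \<beta>"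
    and lin: "\<And>x. x \<in> U \<Longrightarrow> linear (tangent_map M N f x)"
    and rel: "\<And>x v. x \<in> U \<Longrightarrow> \<alpha> x v = \<beta> (f x) (tangent_map M N f x v)"
  shows "smooth_form_on U M \<alpha>"
  unfolding smooth_form_on_def
proof (intro conjI ballI allI smooth_on_local)
  fix x assume "x \<in> U"
  then have "\<alpha> x = \<beta> (f x) \<circ> tangent_map M N f x" "linear (\<beta> (f x))"
    using rel \<beta> V by (auto simp: smooth_form_on_def)
  then show "linear (\<alpha> x)" using linear_compose[OF lin[OF \<open>x \<in> U\<close>]] by simp
next
  fix c v t assume c: "c \<in> atlas M" and "t \<in> snd c ` (U \<inter> fst c)"
  then obtain x where x: "x \<in> U" "x \<in> fst c" "t = snd c x" by blast
  have fx: "f x \<in> pts N" using smooth_map_on_pts[OF f x(1)] .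
  define d where "d = chart_at N (f x)"
  have d: "d \<in> atlas N" "f x \<in> fst d" using chart_at_atlas[OF N fx] chart_at_mem[OF N fx] by (auto simp: d_def)
  let ?f = "snd d \<circ> f \<circ> chart_inv c"
  from smooth_map_on_rep[OF M c N d(1) f x(1,2) d(2)] obtain S
    where S: "open S" "snd c x \<in> S" "smooth_on S ?f"
    "\<And>s. s \<in> S \<Longrightarrow> chart_inv c s \<in> U \<inter> fst c \<and> snd c (chart_inv c s) = s \<and> f (chart_inv c s) \<in> fst d"
    by metis
  define T where "T = snd d ` (V \<inter> fst d)"
  have T: "open T" "?f ` S \<subseteq> T"
    using open_chart_image[OF N d(1) V(1)] S(4) V(2) by (auto simp: T_def)
  have b: "smooth_on T (\<lambda>y. form_rep N d \<beta> y w)" "y \<in> T \<Longrightarrow> linear (form_rep N d \<beta> y)" for w y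
    using \<beta> d linear_form_rep[OF N d(1)] unfolding smooth_form_on_def T_def by blast+
  have "smooth_on S (\<lambda>s. form_rep N d \<beta> (?f s) (fderiv ?f s v))"
  proof (rule smooth_on_apply[OF S(1), where A = "\<lambda>s. form_rep N d \<beta> (?f s)"])
    show "smooth_on S (\<lambda>s. form_rep N d \<beta> (?f s) w)" for w
      using smooth_on_compose[OF S(1) T S(3) b(1)[of w]] by (simp add: o_def)
    show "linear (form_rep N d \<beta> (?f s))" if "s \<in> S" for s
      using b(2) T(2) that by blast
    show "smooth_on S (\<lambda>s. fderiv ?f s v)"
      by (rule smooth_on_fderiv[OF S(3)])
  qed
  moreover have "form_rep M c \<alpha> s v = form_rep N d \<beta> (?f s) (fderiv ?f s v)" if "s \<in> S" for s
    by (rule form_rep_related[OF M c N d(1) f _ S(4)[OF that]]) (rule rel)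
  ultimately have "smooth_on S (\<lambda>s. form_rep M c \<alpha> s v)"
    by (subst smooth_on_cong[OF S(1)]) auto
  then show "\<exists>T. open T \<and> t \<in> T \<and> smooth_on T (\<lambda>s. form_rep M c \<alpha> s v)"
    using S x by blast
qed

text \<open>Here the inverse map is essential: it writes \<phi> as \<psi> conjugated by tangent
  maps, and so expresses the components of \<phi> through smooth ones.\<close>

lemma smooth_endo_on_related:
  assumes D: "diffeo_pair M N U V f g" and \<psi>: "smooth_endo_on V N \<psi>"
    and rel: "\<And>x v. x \<in> U \<Longrightarrow> tangent_map M N f x (\<phi> x v) = \<psi> (f x) (tangent_map M N f x v)"
  shows "smooth_endo_on U M \<phi>"
  unfolding smooth_endo_on_def
proof (intro conjI ballI allI smooth_on_local)
  have M: "smooth_manifold M" and N: "smooth_manifold N"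
    and f: "smooth_map_on U M N f" and g: "smooth_map_on V N M g"
    and fU: "f ` U = V" and gf: "\<And>x. x \<in> U \<Longrightarrow> g (f x) = x"
    using D by (auto simp: diffeo_pair_def)
  {
    fix x assume x: "x \<in> U"
    have "\<phi> x = (\<lambda>v. tangent_map N M g (f x) (\<psi> (f x) (tangent_map M N f x v)))"
      using diffeo_pair_tangent_map(1)[OF D x] rel[OF x] by metis
    moreover have "linear (\<psi> (f x))" "linear (tangent_map N M g (f x))" "linear (tangent_map M N f x)"
      using \<psi> fU x diffeo_pair_tangent_map(2)[OF diffeo_pair_sym[OF D]] diffeo_pair_tangent_map(2)[OF D x]
      by (auto simp: smooth_endo_on_def)
    ultimately show "linear (\<phi> x)"
      using linear_compose[of "\<lambda>v. \<psi> (f x) (tangent_map M N f x v)" "tangent_map N M g (f x)"]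
        linear_compose[of "tangent_map M N f x" "\<psi> (f x)"] by (simp add: o_def)
  next
    fix c v t assume c: "c \<in> atlas M" and "t \<in> snd c ` (U \<inter> fst c)"
    then obtain x where x: "x \<in> U" "x \<in> fst c" "t = snd c x" by blast
    have fx: "f x \<in> pts N" "f x \<in> V" "g (f x) \<in> fst c" using diffeo_pair_pts[OF D x(1)] gf x by auto
    define d where "d = chart_at N (f x)"
    have d: "d \<in> atlas N" "f x \<in> fst d"
      using chart_at_atlas[OF N fx(1)] chart_at_mem[OF N fx(1)] by (auto simp: d_def)
    let ?f = "snd d \<circ> f \<circ> chart_inv c" and ?g = "snd c \<circ> g \<circ> chart_inv d"
    from smooth_map_on_rep[OF M c N d(1) f x(1,2) d(2)] obtain S0
      where S0: "open S0" "snd c x \<in> S0" "smooth_on S0 ?f"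
      "\<And>s. s \<in> S0 \<Longrightarrow> chart_inv c s \<in> U \<inter> fst c \<and> snd c (chart_inv c s) = s \<and> f (chart_inv c s) \<in> fst d"
      by metis
    from smooth_map_on_rep[OF N d(1) M c g fx(2) d(2) fx(3)] obtain T
      where T: "open T" "snd d (f x) \<in> T" "T \<subseteq> snd d ` (V \<inter> fst d)" "smooth_on T ?g"
      by metis
    define S where "S = S0 \<inter> ?f -` T"
    have S: "open S" unfolding S_def
      using continuous_on_open_vimage[OF S0(1)] smooth_on_continuous_on[OF S0(3)] T(1)
      by (metis Int_commute)
    have Sf: "smooth_on S ?f" and ST: "?f ` S \<subseteq> T" and xS: "snd c x \<in> S"
      using smooth_on_subset[OF S0(3)] S0 T x M c by (auto simp: S_def)
    have b: "smooth_on T (\<lambda>y. endo_rep N d \<psi> y w)" "y \<in> T \<Longrightarrow> linear (endo_rep N d \<psi> y)" for w y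
      using \<psi> d linear_endo_rep[OF N d(1), of V \<psi> y] T(3) smooth_on_subset unfolding smooth_endo_on_def by blast+
    have "smooth_on S (\<lambda>s. fderiv ?g (?f s) (endo_rep N d \<psi> (?f s) (fderiv ?f s v)))"
    proof (rule smooth_on_apply[OF S, where A = "\<lambda>s. fderiv ?g (?f s)"])
      show "smooth_on S (\<lambda>s. fderiv ?g (?f s) w)" for w
        using smooth_on_compose[OF S T(1) ST Sf smooth_on_fderiv[OF T(4), of w]] by (simp add: o_def)
      show "linear (fderiv ?g (?f s))" if "s \<in> S" for s
        using ST that by (intro linear_fderiv smooth_on_differentiable[OF T(4)]) blast
      show "smooth_on S (\<lambda>s. endo_rep N d \<psi> (?f s) (fderiv ?f s v))"
      proof (rule smooth_on_apply[OF S, where A = "\<lambda>s. endo_rep N d \<psi> (?f s)"])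
        show "smooth_on S (\<lambda>s. endo_rep N d \<psi> (?f s) w)" for w
          using smooth_on_compose[OF S T(1) ST Sf b(1)[of w]] by (simp add: o_def)
        show "linear (endo_rep N d \<psi> (?f s))" if "s \<in> S" for s
          using b(2) ST that by blast
        show "smooth_on S (\<lambda>s. fderiv ?f s v)"
          by (rule smooth_on_fderiv[OF Sf])
      qed
    qed
    moreover have "endo_rep M c \<phi> s v = fderiv ?g (?f s) (endo_rep N d \<psi> (?f s) (fderiv ?f s v))"
      if "s \<in> S" for s
    proof -
      have s: "chart_inv c s \<in> U \<inter> fst c \<and> snd c (chart_inv c s) = s \<and> f (chart_inv c s) \<in> fst d"
        using S0(4) that by (auto simp: S_def)
      show ?thesis
        using diffeo_pair_chart_deriv[OF D _ _ _ c d(1), of "chart_inv c s" "endo_rep M c \<phi> s v"] s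
          endo_rep_related[OF M c N d(1) f rel s, of v] by (simp add: chart_deriv_def)
    qed
    ultimately have "smooth_on S (\<lambda>s. endo_rep M c \<phi> s v)"
      by (subst smooth_on_cong[OF S]) auto
    then show "\<exists>T. open T \<and> t \<in> T \<and> smooth_on T (\<lambda>s. endo_rep M c \<phi> s v)"
      using S xS x by blast
  }
qed

section \<open>Naturality of the exterior derivative and of the Nijenhuis tensor\<close>

lemma ext_deriv_eq: "ext_deriv M \<alpha> p u v = ext_deriv_coord (form_rep M (chart_at M p) \<alpha>) (snd (chart_at M p) p) u v"
  by (simp add: ext_deriv_def ext_deriv_coord_def Let_def)

text \<open>In the preferred charts at \<open>x\<close> and \<open>f x\<close> the tangent map is
  the derivative of the representative, so the naturality of the coordinate formula applies as it
  stands.\<close>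

lemma ext_deriv_pullback:
  assumes M: "smooth_manifold M" and N: "smooth_manifold N"
    and f: "smooth_map_on U M N f" and V: "openin (mtop N) V" "f ` U \<subseteq> V" and \<beta>: "smooth_form_on V N \<beta>"
    and rel: "\<And>x v. x \<in> U \<Longrightarrow> \<alpha> x v = \<beta> (f x) (tangent_map M N f x v)" and x: "x \<in> U"
  shows "ext_deriv M \<alpha> x u v = ext_deriv N \<beta> (f x) (tangent_map M N f x u) (tangent_map M N f x v)"
proof -
  have p: "x \<in> pts M" "f x \<in> pts N"
    using openin_subset[OF smooth_map_on_open[OF f]] smooth_map_on_pts[OF f x] x by auto
  define c d where "c = chart_at M x" and "d = chart_at N (f x)"
  have c: "c \<in> atlas M" "x \<in> fst c" and d: "d \<in> atlas N" "f x \<in> fst d"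
    using chart_at_atlas[OF M p(1)] chart_at_mem[OF M p(1)] chart_at_atlas[OF N p(2)] chart_at_mem[OF N p(2)]
    by (auto simp: c_def d_def)
  let ?f = "snd d \<circ> f \<circ> chart_inv c"
  from smooth_map_on_rep[OF M c(1) N d(1) f x c(2) d(2)] obtain S
    where S: "open S" "snd c x \<in> S" "smooth_on S ?f"
    "\<And>s. s \<in> S \<Longrightarrow> chart_inv c s \<in> U \<inter> fst c \<and> snd c (chart_inv c s) = s \<and> f (chart_inv c s) \<in> fst d"
    by metis
  define T where "T = snd d ` (V \<inter> fst d)"
  have T: "open T" "?f ` S \<subseteq> T"
    using open_chart_image[OF N d(1) V(1)] S(4) V(2) by (auto simp: T_def)
  have b: "smooth_on T (\<lambda>y. form_rep N d \<beta> y w)" "y \<in> T \<Longrightarrow> linear (form_rep N d \<beta> y)" for w y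
    using \<beta> d linear_form_rep[OF N d(1)] unfolding smooth_form_on_def T_def by blast+
  have "form_rep M c \<alpha> s w = form_rep N d \<beta> (?f s) (fderiv ?f s w)" if "s \<in> S" for s w
    by (rule form_rep_related[OF M c(1) N d(1) f _ S(4)[OF that]]) (rule rel)
  from ext_deriv_coord_pullback[OF S(1,2) T S(3) b this]
  have "ext_deriv_coord (form_rep M c \<alpha>) (snd c x) u v
    = ext_deriv_coord (form_rep N d \<beta>) (?f (snd c x)) (fderiv ?f (snd c x) u) (fderiv ?f (snd c x) v)"
    by blast
  moreover have "?f (snd c x) = snd d (f x)" using M c by simp
  ultimately show ?thesis
    by (simp add: ext_deriv_eq tangent_map_eq chart_deriv_def flip: c_def d_def)
qed

text \<open>The value of the tensor on two tangent vectors, computed by extending them with constant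
  components in the preferred chart at the point.\<close>

definition nijenhuis_at ::
  "('a, 'e::euclidean_space) manifold \<Rightarrow> ('a \<Rightarrow> 'e \<Rightarrow> 'e) \<Rightarrow> 'a \<Rightarrow> 'e \<Rightarrow> 'e \<Rightarrow> 'e" where
  "nijenhuis_at M J p u v = nijenhuis_coord (endo_rep M (chart_at M p) J) (snd (chart_at M p) p) u v"

lemma nijenhuis_at_related:
  assumes D: "diffeo_pair M N U V f g" and \<phi>: "smooth_endo_on U M \<phi>" and \<psi>: "smooth_endo_on V N \<psi>"
    and rel: "\<And>x v. x \<in> U \<Longrightarrow> tangent_map M N f x (\<phi> x v) = \<psi> (f x) (tangent_map M N f x v)"
    and x: "x \<in> U"
  shows "tangent_map M N f x (nijenhuis_at M \<phi> x u v)
    = nijenhuis_at N \<psi> (f x) (tangent_map M N f x u) (tangent_map M N f x v)"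
proof -
  have M: "smooth_manifold M" and N: "smooth_manifold N"
    and f: "smooth_map_on U M N f" and g: "smooth_map_on V N M g" and fU: "f ` U = V"
    using D by (auto simp: diffeo_pair_def)
  have p: "x \<in> pts M" "f x \<in> pts N"
    using diffeo_pair_pts[OF D x] by auto
  define c d where "c = chart_at M x" and "d = chart_at N (f x)"
  have c: "c \<in> atlas M" "x \<in> fst c" and d: "d \<in> atlas N" "f x \<in> fst d"
    using chart_at_atlas[OF M p(1)] chart_at_mem[OF M p(1)] chart_at_atlas[OF N p(2)] chart_at_mem[OF N p(2)]
    by (auto simp: c_def d_def)
  let ?f = "snd d \<circ> f \<circ> chart_inv c"
  from smooth_map_on_rep[OF M c(1) N d(1) f x c(2) d(2)] obtain S
    where S: "open S" "snd c x \<in> S" "smooth_on S ?f" "S \<subseteq> snd c ` (U \<inter> fst c)"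
    "\<And>s. s \<in> S \<Longrightarrow> chart_inv c s \<in> U \<inter> fst c \<and> snd c (chart_inv c s) = s \<and> f (chart_inv c s) \<in> fst d"
    by metis
  define T where "T = snd d ` (V \<inter> fst d)"
  have T: "open T" "?f ` S \<subseteq> T"
    using open_chart_image[OF N d(1) smooth_map_on_open[OF g]] S(5) fU by (auto simp: T_def)
  have a: "smooth_on S (\<lambda>y. endo_rep M c \<phi> y w)" "y \<in> S \<Longrightarrow> linear (endo_rep M c \<phi> y)" for w y
    using \<phi> c linear_endo_rep[OF M c(1), of U \<phi> y] S(4) smooth_on_subset unfolding smooth_endo_on_def by blast+
  have b: "smooth_on T (\<lambda>y. endo_rep N d \<psi> y w)" "y \<in> T \<Longrightarrow> linear (endo_rep N d \<psi> y)" for w y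
    using \<psi> d linear_endo_rep[OF N d(1), of V \<psi> y] unfolding smooth_endo_on_def T_def by blast+
  have "fderiv ?f s (endo_rep M c \<phi> s w) = endo_rep N d \<psi> (?f s) (fderiv ?f s w)" if "s \<in> S" for s w
    by (rule endo_rep_related[OF M c(1) N d(1) f _ S(5)[OF that]]) (rule rel)
  from nijenhuis_coord_related[OF S(1,2) T S(3) a b this]
  have "fderiv ?f (snd c x) (nijenhuis_coord (endo_rep M c \<phi>) (snd c x) u v)
    = nijenhuis_coord (endo_rep N d \<psi>) (?f (snd c x)) (fderiv ?f (snd c x) u) (fderiv ?f (snd c x) v)"
    by blast
  moreover have "?f (snd c x) = snd d (f x)" using M c by simp
  ultimately show ?thesis
    by (simp add: nijenhuis_at_def tangent_map_eq chart_deriv_def flip: c_def d_def)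
qed

text \<open>
  The Nijenhuis tensor is tensorial, hence determined by vector fields with constant components in a
  chart.
\<close>

lemma nijenhuis_eq:
  assumes M: "smooth_manifold M" and J: "smooth_endo M J"
    and U: "openin (mtop M) U" and X: "smooth_vf_on U M X" and Y: "smooth_vf_on U M Y" and p: "p \<in> U"
  shows "nijenhuis M J X Y p = nijenhuis_at M J p (X p) (Y p)"
proof -
  have pM: "p \<in> pts M" using openin_subset[OF U] p by auto
  define c x where "c = chart_at M p" and "x = snd c p"
  have c: "c \<in> atlas M" "p \<in> fst c"
    using chart_at_atlas[OF M pM] chart_at_mem[OF M pM] by (auto simp: c_def)
  define S where "S = snd c ` fst c"
  have S: "open S" "x \<in> S"
    using open_chart_image[OF M c(1) chart_openin[OF M c(1)]] c by (auto simp: S_def x_def)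
  have x_inv: "chart_inv c x = p" using M c by (simp add: x_def)
  let ?J = "endo_rep M c J"
  have Jd: "(\<lambda>y. ?J y v) differentiable (at x)" "y \<in> S \<Longrightarrow> linear (?J y)" for v y
    using J c S smooth_on_differentiable linear_endo_rep[OF M c(1), of "fst c" J] chart_subset[OF M c(1)]
    unfolding smooth_endo_def S_def by blast+
  have Jx: "?J x = J p"
    unfolding endo_rep_def[abs_def] x_inv
    unfolding c_def by (simp add: to_chart_at[OF M pM] of_chart_at[OF M pM])
  have JX: "((\<lambda>y. vf_rep M c (\<lambda>q. J q (Z q)) y) has_derivative
      (\<lambda>a. fderiv (\<lambda>y. ?J y (Z p)) x a + J p (fderiv (vf_rep M c Z) x a))) (at x)"
    if Z: "smooth_vf_on U M Z" for Z
  proof -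
    have Zx: "vf_rep M c Z x = Z p"
      unfolding vf_rep_def x_inv unfolding c_def by (rule to_chart_at[OF M pM])
    have "vf_rep M c Z differentiable (at x)"
      using Z c p by (intro smooth_on_differentiable) (auto simp: smooth_vf_on_def x_def)
    from has_derivative_apply[OF S Jd this]
    have "((\<lambda>y. ?J y (vf_rep M c Z y)) has_derivative
      (\<lambda>a. fderiv (\<lambda>y. ?J y (Z p)) x a + J p (fderiv (vf_rep M c Z) x a))) (at x)"
      by (simp add: Zx Jx)
    moreover have "?J y (vf_rep M c Z y) = vf_rep M c (\<lambda>q. J q (Z q)) y" if "y \<in> S" for y
      using to_of_chart(2)[OF M c(1)] chart_inv_in[of y c] that
      by (simp add: endo_rep_def vf_rep_def S_def)
    ultimately show ?thesis
      using has_derivative_transform_within_open[OF _ S] by blast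
  qed
  have lin: "linear (J p)" using J pM by (simp add: smooth_endo_def)
  \<comment> \<open>The product rule also produces derivatives of \<open>X\<close> and
    \<open>Y\<close>; over the four terms of the Nijenhuis tensor these cancel, and only derivatives
    of \<open>J\<close> remain.\<close>
  show ?thesis
    unfolding nijenhuis_def nijenhuis_at_def nijenhuis_coord_def lie_bracket_def Let_def
      c_def[symmetric] x_def[symmetric] fderiv_eqI[OF JX[OF X]] fderiv_eqI[OF JX[OF Y]] Jx
    by (simp add: linear_add[OF lin] linear_diff[OF lin] algebra_simps)
qed

text \<open>In another chart the components of this field are the derivative of the transition map
  in the direction \<open>u\<close>.\<close>

lemma smooth_vf_const:
  assumes M: "smooth_manifold M" and c: "c \<in> atlas M"
  shows "smooth_vf_on (fst c) M (\<lambda>q. of_chart M c q u)"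
  unfolding smooth_vf_on_def
proof
  fix d assume d: "d \<in> atlas M"
  note i = smooth_map_on_id[OF M openin_topspace]
  let ?t = "snd d \<circ> chart_inv c" and ?t' = "snd c \<circ> chart_inv d"
  define S T where "S = snd c ` (fst c \<inter> fst d)" and "T = snd d ` (fst c \<inter> fst d)"
  have ST: "open S" "open T"
    using open_chart_image[OF M c chart_openin[OF M d]] open_chart_image[OF M d chart_openin[OF M c]]
    by (auto simp: S_def T_def Int_commute)
  have t: "smooth_on S ?t" "smooth_on T ?t'"
  proof -
    have "smooth_on (snd a ` (fst a \<inter> fst b)) (snd b \<circ> chart_inv a)" if "a \<in> atlas M" "b \<in> atlas M" for a b
      using M that by (simp add: smooth_manifold_def)
    from this[OF c d] this[OF d c] show "smooth_on S ?t" "smooth_on T ?t'"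
      by (simp_all add: S_def T_def Int_commute)
  qed
  have "?t' ` T \<subseteq> S"
    using M d by (auto simp: S_def T_def)
  from smooth_on_compose[OF ST(2,1) this t(2) smooth_on_fderiv[OF t(1)]]
  have "smooth_on T (\<lambda>y. fderiv ?t (?t' y) u)" by (simp add: o_def)
  moreover have "vf_rep M d (\<lambda>q. of_chart M c q u) y = fderiv ?t (?t' y) u" if "y \<in> T" for y
  proof -
    define q where "q = chart_inv d y"
    have q: "q \<in> fst c" "q \<in> fst d" using that M d by (auto simp: T_def q_def)
    have p: "q \<in> pts M" using chart_subset[OF M c] q by auto
    have "to_chart M d q (of_chart M c q u) = chart_deriv (id \<circ> id) d c q u"
      unfolding to_chart_eq of_chart_eq
      using chart_deriv_compose[OF M c M chart_at_atlas[OF M p] M d i i p, of u] q chart_at_mem[OF M p] p by simp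
    then show ?thesis by (simp add: vf_rep_def q_def chart_deriv_def)
  qed
  ultimately show "smooth_on (snd d ` (fst c \<inter> fst d)) (vf_rep M d (\<lambda>q. of_chart M c q u))"
    unfolding T_def[symmetric] by (subst smooth_on_cong[OF ST(2)]) auto
qed

text \<open>Replaces the test on all local vector fields by an algebraic condition at each point:
  fields that are constant in a chart realize every pair of tangent vectors.\<close>

lemma integrable_structure_iff:
  assumes M: "smooth_manifold M" and J: "smooth_endo M J"
  shows "integrable_structure M J \<longleftrightarrow> (\<forall>p\<in>pts M. \<forall>u v. nijenhuis_at M J p u v = 0)"
proof
  assume "\<forall>p\<in>pts M. \<forall>u v. nijenhuis_at M J p u v = 0"
  then show "integrable_structure M J"
    unfolding integrable_structure_def using nijenhuis_eq[OF M J] openin_subset by fastforce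
next
  assume I: "integrable_structure M J"
  show "\<forall>p\<in>pts M. \<forall>u v. nijenhuis_at M J p u v = 0"
  proof (intro ballI allI)
    fix p u v assume p: "p \<in> pts M"
    define c where "c = chart_at M p"
    have c: "c \<in> atlas M" "p \<in> fst c"
      using chart_at_atlas[OF M p] chart_at_mem[OF M p] by (auto simp: c_def)
    have X: "smooth_vf_on (fst c) M (\<lambda>q. of_chart M c q u)" for u
      by (rule smooth_vf_const[OF M c(1)])
    have "nijenhuis_at M J p u v = nijenhuis M J (\<lambda>q. of_chart M c q u) (\<lambda>q. of_chart M c q v) p"
      using nijenhuis_eq[OF M J chart_openin[OF M c(1)] X X c(2), of u v] of_chart_at[OF M p]
      by (simp add: c_def)
    also have "\<dots> = 0"
      using I X chart_openin[OF M c(1)] c(2) unfolding integrable_structure_def by blast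
    finally show "nijenhuis_at M J p u v = 0" .
  qed
qed

section \<open>Alternating multilinear forms\<close>

text \<open>Forms are functions of whole sequences, so a form of degree \<open>m\<close> is also
  required to ignore all entries from index \<open>m\<close> on.\<close>

definition multilinear_form :: "nat \<Rightarrow> 'e::real_vector ext_form \<Rightarrow> bool" where
  "multilinear_form m \<omega> \<longleftrightarrow> (\<forall>v w. (\<forall>i<m. v i = w i) \<longrightarrow> \<omega> v = \<omega> w) \<and>
     (\<forall>v. \<forall>j<m. linear (\<lambda>x. \<omega> (v(j := x))))"

definition alternating_form :: "nat \<Rightarrow> 'e ext_form \<Rightarrow> bool" where
  "alternating_form m \<omega> \<longleftrightarrow>
     (\<forall>v \<sigma>. \<sigma> permutes {..<m} \<longrightarrow> \<omega> (\<lambda>i. v (\<sigma> i)) = of_int (sign \<sigma>) * \<omega> v)"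

text \<open>For an alternating form this says that the interior product with \<open>x\<close>
  vanishes; imposed on every slot, it passes to wedge products without any signs.\<close>

definition annihilates :: "'e \<Rightarrow> nat \<Rightarrow> 'e ext_form \<Rightarrow> bool" where
  "annihilates x m \<omega> \<longleftrightarrow> (\<forall>v. \<forall>j<m. v j = x \<longrightarrow> \<omega> v = 0)"

lemma multilinear_form_cong:
  "multilinear_form m \<omega> \<Longrightarrow> (\<And>i. i < m \<Longrightarrow> v i = w i) \<Longrightarrow> \<omega> v = \<omega> w"
  by (simp add: multilinear_form_def)

lemma multilinear_form_linear:
  "multilinear_form m \<omega> \<Longrightarrow> j < m \<Longrightarrow> linear (\<lambda>x. \<omega> (v(j := x)))"
  by (simp add: multilinear_form_def)

lemma alternating_formD:
  "alternating_form m \<omega> \<Longrightarrow> \<sigma> permutes {..<m} \<Longrightarrow> \<omega> (\<lambda>i. v (\<sigma> i)) = of_int (sign \<sigma>) * \<omega> v"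
  by (simp add: alternating_form_def)

lemma annihilatesD: "annihilates x m \<omega> \<Longrightarrow> j < m \<Longrightarrow> v j = x \<Longrightarrow> \<omega> v = 0"
  by (simp add: annihilates_def)

text \<open>A permutation \<tau> of the arguments is absorbed by replacing \<sigma> with
  \<open>\<tau> \<circ> \<sigma>\<close> in the sum over all permutations, at the price of the sign
  of \<tau>.\<close>

lemma wedge_alternating: "alternating_form (p + q) (wedge p q \<omega> \<eta>)"
  unfolding alternating_form_def
proof (intro allI impI)
  fix v :: "nat \<Rightarrow> 'a" and \<tau> assume \<tau>: "\<tau> permutes {..<p + q}"
  let ?P = "{\<sigma>. \<sigma> permutes {..<p + q}}"
  let ?t = "\<lambda>\<sigma>. of_int (sign \<sigma>) * \<omega> (\<lambda>i. v (\<sigma> i)) * \<eta> (\<lambda>i. v (\<sigma> (p + i)))"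
  have "(\<Sum>\<sigma>\<in>?P. of_int (sign \<sigma>) * \<omega> (\<lambda>i. v (\<tau> (\<sigma> i))) * \<eta> (\<lambda>i. v (\<tau> (\<sigma> (p + i)))))
      = (\<Sum>\<sigma>\<in>?P. of_int (sign \<tau>) * ?t (\<tau> \<circ> \<sigma>))"
  proof (rule sum.cong[OF refl])
    fix \<sigma> assume "\<sigma> \<in> ?P"
    then have "permutation \<sigma>" "permutation \<tau>" using \<tau> permutation_permutes by blast+
    then have "of_int (sign \<sigma>) = (of_int (sign \<tau>) * of_int (sign (\<tau> \<circ> \<sigma>)) :: real)"
      by (simp add: sign_compose sign_idempotent flip: of_int_mult mult.assoc)
    then show "of_int (sign \<sigma>) * \<omega> (\<lambda>i. v (\<tau> (\<sigma> i))) * \<eta> (\<lambda>i. v (\<tau> (\<sigma> (p + i)))) = of_int (sign \<tau>) * ?t (\<tau> \<circ> \<sigma>)"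
      by simp
  qed
  also have "\<dots> = of_int (sign \<tau>) * (\<Sum>\<sigma>\<in>?P. ?t (\<tau> \<circ> \<sigma>))"
    by (simp add: sum_distrib_left)
  also have "(\<Sum>\<sigma>\<in>?P. ?t (\<tau> \<circ> \<sigma>)) = sum ?t ?P"
  proof (rule sum.reindex_bij_betw)
    show "bij_betw ((\<circ>) \<tau>) ?P ?P"
    proof (rule bij_betw_byWitness[where f' = "\<lambda>\<sigma>. inv_into UNIV \<tau> \<circ> \<sigma>"])
      show "\<forall>\<sigma>\<in>?P. inv_into UNIV \<tau> \<circ> (\<tau> \<circ> \<sigma>) = \<sigma>" "\<forall>\<sigma>\<in>?P. \<tau> \<circ> (inv_into UNIV \<tau> \<circ> \<sigma>) = \<sigma>"
        using permutes_inv_o[OF \<tau>] by (simp_all flip: comp_assoc)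
    qed (use \<tau> permutes_compose permutes_inv in blast)+
  qed
  finally show "wedge p q \<omega> \<eta> (\<lambda>i. v (\<tau> i)) = of_int (sign \<tau>) * wedge p q \<omega> \<eta> v"
    by (simp add: wedge_def)
qed

text \<open>In the summand of each permutation the argument with index \<open>j\<close> occurs
  exactly once, in a slot of one of the two factors, so each summand is linear in it.\<close>

lemma wedge_multilinear:
  assumes \<omega>: "multilinear_form p \<omega>" and \<eta>: "multilinear_form q \<eta>"
  shows "multilinear_form (p + q) (wedge p q \<omega> \<eta>)"
  unfolding multilinear_form_def
proof (intro conjI allI impI)
  fix v w :: "nat \<Rightarrow> 'a" assume vw: "\<forall>i<p + q. v i = w i"
  have "\<omega> (\<lambda>i. v (\<sigma> i)) = \<omega> (\<lambda>i. w (\<sigma> i)) \<and> \<eta> (\<lambda>i. v (\<sigma> (p + i))) = \<eta> (\<lambda>i. w (\<sigma> (p + i)))"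
    if "\<sigma> permutes {..<p + q}" for \<sigma>
  proof -
    have "\<sigma> i < p + q" if "i < p + q" for i
      using permutes_in_image[OF \<open>\<sigma> permutes _\<close>, of i] that by simp
    then show ?thesis
      using vw by (auto intro!: multilinear_form_cong[OF \<omega>] multilinear_form_cong[OF \<eta>])
  qed
  then show "wedge p q \<omega> \<eta> v = wedge p q \<omega> \<eta> w"
    by (simp add: wedge_def)
next
  fix v :: "nat \<Rightarrow> 'a" and j assume j: "j < p + q"
  have t: "linear (\<lambda>x. \<omega> (\<lambda>i. (v(j := x)) (\<sigma> i)) * \<eta> (\<lambda>i. (v(j := x)) (\<sigma> (p + i))))"
    if \<sigma>: "\<sigma> permutes {..<p + q}" for \<sigma>
  proof -
    obtain i where i: "\<sigma> i = j" "i < p + q"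
      using \<sigma> j by (metis lessThan_iff permutes_def permutes_in_image)
    have inj: "\<sigma> a = j \<longleftrightarrow> a = i" for a
      using \<sigma> i(1) by (metis permutes_def)
    show ?thesis
    proof (cases "i < p")
      case True
      have "(\<lambda>a. (v(j := x)) (\<sigma> a)) = (\<lambda>a. v (\<sigma> a))(i := x)"
        "(\<lambda>a. (v(j := x)) (\<sigma> (p + a))) = (\<lambda>a. v (\<sigma> (p + a)))" for x
        using True by (auto simp: inj fun_eq_iff)
      moreover have "linear (\<lambda>x. \<omega> ((\<lambda>a. v (\<sigma> a))(i := x)))"
        by (rule multilinear_form_linear[OF \<omega> True])
      ultimately show ?thesis
        by (simp add: linear_iff algebra_simps)
    next
      case False
      define b where "b = i - p"
      have b: "i = p + b" "b < q" using False i by (auto simp: b_def)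
      have "(\<lambda>a. (v(j := x)) (\<sigma> (p + a))) = (\<lambda>a. v (\<sigma> (p + a)))(b := x)" for x
        by (auto simp: inj b fun_eq_iff)
      moreover have "\<omega> (\<lambda>a. (v(j := x)) (\<sigma> a)) = \<omega> (\<lambda>a. v (\<sigma> a))" for x
        by (rule multilinear_form_cong[OF \<omega>]) (use False in \<open>auto simp: inj\<close>)
      moreover have "linear (\<lambda>x. \<eta> ((\<lambda>a. v (\<sigma> (p + a)))(b := x)))"
        by (rule multilinear_form_linear[OF \<eta> b(2)])
      ultimately show ?thesis
        by (simp add: linear_iff algebra_simps)
    qed
  qed
  show "linear (\<lambda>x. wedge p q \<omega> \<eta> (v(j := x)))"
  proof (rule linearI)
    fix x y and c :: real
    let ?F = "\<lambda>\<sigma> x. \<omega> (\<lambda>i. (v(j := x)) (\<sigma> i)) * \<eta> (\<lambda>i. (v(j := x)) (\<sigma> (p + i)))"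
    have w: "wedge p q \<omega> \<eta> (v(j := x)) = (\<Sum>\<sigma> | \<sigma> permutes {..<p + q}. of_int (sign \<sigma>) * ?F \<sigma> x) / (fact p * fact q)" for x
      by (simp only: wedge_def mult.assoc)
    show "wedge p q \<omega> \<eta> (v(j := x + y)) = wedge p q \<omega> \<eta> (v(j := x)) + wedge p q \<omega> \<eta> (v(j := y))"
      unfolding w add_divide_distrib[symmetric] sum.distrib[symmetric]
      by (intro arg_cong2[where f = "(/)"] sum.cong refl) (use linear_add[OF t] in \<open>simp only: mem_Collect_eq distrib_left\<close>)
    show "wedge p q \<omega> \<eta> (v(j := c *\<^sub>R x)) = c *\<^sub>R wedge p q \<omega> \<eta> (v(j := x))"
      unfolding w real_scaleR_def times_divide_eq_right sum_distrib_left
      by (intro arg_cong2[where f = "(/)"] sum.cong refl)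
        (use linear_scale[OF t] in \<open>simp only: mem_Collect_eq real_scaleR_def mult.left_commute\<close>)
  qed
qed

text \<open>In every summand \<open>x\<close> fills a slot of one of the two factors, and that
  factor vanishes.\<close>

lemma wedge_annihilates:
  assumes "annihilates x p \<omega>" "annihilates x q \<eta>"
  shows "annihilates x (p + q) (wedge p q \<omega> \<eta>)"
  unfolding annihilates_def
proof (intro allI impI)
  fix v j assume j: "j < p + q" "v j = x"
  have "\<omega> (\<lambda>i. v (\<sigma> i)) * \<eta> (\<lambda>i. v (\<sigma> (p + i))) = 0" if \<sigma>: "\<sigma> permutes {..<p + q}" for \<sigma>
  proof -
    obtain i where i: "\<sigma> i = j" "i < p + q"
      using \<sigma> j by (metis lessThan_iff permutes_def permutes_in_image)
    show ?thesis
    proof (cases "i < p")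
      case True
      then have "\<omega> (\<lambda>i. v (\<sigma> i)) = 0"
        using assms(1) i j by (auto simp: annihilates_def)
      then show ?thesis by simp
    next
      case False
      then have "i - p < q" "v (\<sigma> (p + (i - p))) = x" using i j by auto
      then have "\<eta> (\<lambda>i. v (\<sigma> (p + i))) = 0"
        by (rule annihilatesD[OF assms(2)])
      then show ?thesis by simp
    qed
  qed
  then have "of_int (sign \<sigma>) * \<omega> (\<lambda>i. v (\<sigma> i)) * \<eta> (\<lambda>i. v (\<sigma> (p + i))) = 0"
    if "\<sigma> permutes {..<p + q}" for \<sigma>
    using that by (simp add: mult.assoc)
  then show "wedge p q \<omega> \<eta> v = 0"
    unfolding wedge_def by (subst sum.neutral) auto
qed

lemma wedge_power_alternating: "alternating_form (p * n) (wedge_power p \<omega> n)"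
  by (cases n) (auto simp: alternating_form_def[of 0] wedge_alternating)

lemma wedge_power_multilinear:
  "multilinear_form p \<omega> \<Longrightarrow> multilinear_form (p * n) (wedge_power p \<omega> n)"
  by (induction n) (auto simp: multilinear_form_def[of 0] wedge_multilinear)

lemma wedge_power_annihilates:
  "annihilates x p \<omega> \<Longrightarrow> annihilates x (p * n) (wedge_power p \<omega> n)"
  by (induction n) (auto simp: annihilates_def[of _ 0] wedge_annihilates)

lemma wedge_pullback:
  "wedge p q (\<lambda>v. \<omega> (\<lambda>i. L (v i))) (\<lambda>v. \<eta> (\<lambda>i. L (v i))) v = wedge p q \<omega> \<eta> (\<lambda>i. L (v i))"
  by (simp add: wedge_def)

lemma wedge_power_pullback:
  "wedge_power p (\<lambda>v. \<omega> (\<lambda>i. L (v i))) n v = wedge_power p \<omega> n (\<lambda>i. L (v i))"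
proof (induction n arbitrary: v)
  case (Suc n)
  have "wedge_power p (\<lambda>v. \<omega> (\<lambda>i. L (v i))) n = (\<lambda>v. wedge_power p \<omega> n (\<lambda>i. L (v i)))"
    using Suc by blast
  then show ?case by (simp add: wedge_pullback)
qed simp

section \<open>Linear algebra of nonzero alternating forms\<close>

lemma multilinear_form_sum:
  assumes "multilinear_form m \<omega>" "j < m"
  shows "\<omega> (v(j := \<Sum>i\<in>I. a i *\<^sub>R y i)) = (\<Sum>i\<in>I. a i * \<omega> (v(j := y i)))"
proof -
  have "linear (\<lambda>x. \<omega> (v(j := x)))"
    by (rule multilinear_form_linear[OF assms])
  from linear_sum[OF this, of "\<lambda>i. a i *\<^sub>R y i" I] linear_scale[OF this]
  show ?thesis by simp
qed

lemma multilinear_form_zero: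
  assumes "multilinear_form m \<omega>" "j < m" "v j = 0"
  shows "\<omega> v = 0"
  \<comment> \<open>The zero vector is taken as the empty linear combination.\<close>
  using multilinear_form_sum[OF assms(1,2), of v _ _ "{}"] assms(3) fun_upd_triv[of v j] by simp

lemma alternating_form_repeated:
  assumes "alternating_form m \<omega>" "i < m" "j < m" "i \<noteq> j" "v i = v j"
  shows "\<omega> v = 0"
proof -
  let ?\<tau> = "Transposition.transpose i j"
  have "?\<tau> permutes {..<m}" using assms by (simp add: permutes_swap_id)
  then have "\<omega> (\<lambda>a. v (?\<tau> a)) = of_int (sign ?\<tau>) * \<omega> v"
    by (rule alternating_formD[OF assms(1)])
  moreover have "(\<lambda>a. v (?\<tau> a)) = v"
    using assms(5) by (auto simp: fun_eq_iff Transposition.transpose_def)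
  ultimately show ?thesis using assms(4) by (simp add: sign_swap_id)
qed

text \<open>If one of the vectors were a combination of the others, expanding it would leave only
  terms with a repeated argument.\<close>

lemma nonzero_form_independent:
  assumes \<omega>: "multilinear_form m \<omega>" "alternating_form m \<omega>" and nz: "\<omega> v \<noteq> 0"
  shows "inj_on v {..<m}" and "independent (v ` {..<m})"
proof -
  show inj: "inj_on v {..<m}"
    using alternating_form_repeated[OF \<omega>(2)] nz unfolding inj_on_def by blast
  show "independent (v ` {..<m})"
  proof
    assume "dependent (v ` {..<m})"
    then obtain j where j: "j < m" "v j \<in> span (v ` {..<m} - {v j})"
      unfolding dependent_def by auto
    have "v ` {..<m} - {v j} = v ` ({..<m} - {j})"
      using inj j(1) by (auto simp: inj_on_def)
    then obtain a where "v j = (\<Sum>x\<in>v ` ({..<m} - {j}). a x *\<^sub>R x)"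
      using j(2) span_finite[of "v ` ({..<m} - {j})"] by auto
    also have "\<dots> = (\<Sum>i\<in>{..<m} - {j}. a (v i) *\<^sub>R v i)"
      using inj by (subst sum.reindex) (auto intro: inj_on_subset)
    finally have "\<omega> v = \<omega> (v(j := \<Sum>i\<in>{..<m} - {j}. a (v i) *\<^sub>R v i))"
      by (metis fun_upd_triv)
    also have "\<dots> = (\<Sum>i\<in>{..<m} - {j}. a (v i) * \<omega> (v(j := v i)))"
      by (rule multilinear_form_sum[OF \<omega>(1) j(1)])
    also have "\<dots> = 0"
      using j(1) alternating_form_repeated[OF \<omega>(2)] by (intro sum.neutral) fastforce
    finally show False using nz by simp
  qed
qed

text \<open>Makes the power (d\<alpha>)^(n+1), of degree 2n+2, vanish on a contact manifold of
  dimension 2n+1.\<close>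

lemma form_zero_of_degree_gt_dim:
  fixes \<omega> :: "'e::euclidean_space ext_form"
  assumes \<omega>: "multilinear_form m \<omega>" "alternating_form m \<omega>" and m: "DIM('e) < m"
  shows "\<omega> v = 0"
proof (rule ccontr)
  assume nz: "\<omega> v \<noteq> 0"
  have "card (v ` {..<m}) \<le> DIM('e)"
    using independent_bound[OF nonzero_form_independent(2)[OF \<omega> nz]] by simp
  then show False
    using card_image[OF nonzero_form_independent(1)[OF \<omega> nz]] m by simp
qed

text \<open>The vectors \<open>v i\<close> form a basis, and putting \<open>x\<close> into slot
  \<open>j\<close> returns the coefficient of \<open>x\<close> along \<open>v j\<close> times
  \<open>\<omega> v\<close>; so all coefficients vanish. The uniqueness of Reeb vectors rests on
  this.\<close>

lemma annihilates_top_form: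
  fixes \<omega> :: "'e::euclidean_space ext_form"
  assumes \<omega>: "multilinear_form m \<omega>" "alternating_form m \<omega>" and m: "m = DIM('e)"
    and nz: "\<omega> v \<noteq> 0" and x: "annihilates x m \<omega>"
  shows "x = 0"
proof -
  note inj = nonzero_form_independent(1)[OF \<omega> nz] and ind = nonzero_form_independent(2)[OF \<omega> nz]
  have "card (v ` {..<m}) = DIM('e)" using card_image[OF inj] m by simp
  then have "x \<in> span (v ` {..<m})"
    using card_ge_dim_independent[of "v ` {..<m}" UNIV] ind by auto
  then obtain a where "x = (\<Sum>y\<in>v ` {..<m}. a y *\<^sub>R y)"
    using span_finite[of "v ` {..<m}"] by auto
  also have "\<dots> = (\<Sum>i\<in>{..<m}. a (v i) *\<^sub>R v i)"
    using inj by (subst sum.reindex) auto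
  finally have x_eq: "x = (\<Sum>i\<in>{..<m}. a (v i) *\<^sub>R v i)" .
  have "a (v j) = 0" if "j < m" for j
  proof -
    have "0 = \<omega> (v(j := x))" using x that by (simp add: annihilates_def)
    also have "\<dots> = (\<Sum>i\<in>{..<m}. a (v i) * \<omega> (v(j := v i)))"
      unfolding x_eq by (rule multilinear_form_sum[OF \<omega>(1) that])
    also have "\<dots> = (\<Sum>i\<in>{..<m}. if i = j then a (v j) * \<omega> v else 0)"
    proof (intro sum.cong refl)
      fix i assume "i \<in> {..<m}"
      then have "\<omega> (v(j := v i)) = 0" if "i \<noteq> j"
        using that \<open>j < m\<close> by (intro alternating_form_repeated[OF \<omega>(2), of i j]) auto
      then show "a (v i) * \<omega> (v(j := v i)) = (if i = j then a (v j) * \<omega> v else 0)"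
        by auto
    qed
    also have "\<dots> = a (v j) * \<omega> v" using that by simp
    finally show ?thesis using nz by simp
  qed
  then show ?thesis by (simp add: x_eq)
qed

text \<open>
  Evaluated at \<open>(v\<^sub>0, 0), \<dots>, (v\<^sub>p\<^sub>-\<^sub>1, 0), (0, w\<^sub>0), \<dots>, (0, w\<^sub>q\<^sub>-\<^sub>1)\<close>, the only nonzero terms of the wedge product are the
  permutations that preserve the first block, and all of these terms are equal.
\<close>

lemma wedge_product_nonzero:
  fixes \<omega> :: "'e::real_vector ext_form" and \<eta> :: "'g::real_vector ext_form"
  assumes \<omega>: "multilinear_form p \<omega>" "alternating_form p \<omega>" "\<omega> v \<noteq> 0"
    and \<eta>: "multilinear_form q \<eta>" "alternating_form q \<eta>" "\<eta> w \<noteq> 0"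
  shows "\<exists>u. wedge p q (\<lambda>u. \<omega> (\<lambda>i. fst (u i))) (\<lambda>u. \<eta> (\<lambda>i. snd (u i))) u \<noteq> 0"
proof -
  define u where "u i = (if i < p then (v i, 0) else (0, w (i - p)))" for i
  let ?P = "{\<sigma>. \<sigma> permutes {..<p + q}}"
  let ?Q = "{\<sigma> \<in> ?P. \<sigma> ` {..<p} = {..<p}}"
  let ?t = "\<lambda>\<sigma>. of_int (sign \<sigma>) * \<omega> (\<lambda>i. fst (u (\<sigma> i))) * \<eta> (\<lambda>i. snd (u (\<sigma> (p + i))))"
  have preserve: "?t \<sigma> = \<omega> v * \<eta> w" if "\<sigma> \<in> ?Q" for \<sigma>
  proof -
    have \<sigma>: "\<sigma> permutes {..<p + q}" and im: "\<sigma> ` {..<p} = {..<p}" using that by auto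
    have inj: "inj \<sigma>" using \<sigma> by (rule permutes_inj)
    have lt: "\<sigma> i < p \<longleftrightarrow> i < p" for i
      using im inj by (metis imageE image_eqI injD lessThan_iff)
    have lt2: "\<sigma> i < p + q \<longleftrightarrow> i < p + q" for i
      using permutes_in_image[OF \<sigma>, of i] by simp
    \<comment> \<open>A permutation that preserves the first block is the product of its
      restrictions \<open>\<sigma>1\<close> and \<open>\<sigma>2\<close> to the two blocks;
      \<open>\<tau>\<close> is \<open>\<sigma>2\<close> shifted down to the indices below
      \<open>q\<close>, which are the ones that \<eta> uses.\<close>
    define \<sigma>1 where "\<sigma>1 i = (if i < p then \<sigma> i else i)" for i
    define \<sigma>2 where "\<sigma>2 i = (if i < p then i else \<sigma> i)" for i
    define \<tau> where "\<tau> i = (if i < q then \<sigma> (p + i) - p else i)" for i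
    have p1: "\<sigma>1 permutes {..<p}"
    proof (rule bij_imp_permutes)
      show "bij_betw \<sigma>1 {..<p} {..<p}"
        using inj im by (auto simp: bij_betw_def inj_on_def \<sigma>1_def image_def)
    qed (auto simp: \<sigma>1_def)
    have le: "p \<le> \<sigma> (p + i)" for i using lt[of "p + i"] by simp
    have p\<tau>: "\<tau> permutes {..<q}"
    proof (rule bij_imp_permutes)
      have i\<tau>: "inj_on \<tau> {..<q}"
      proof (rule inj_onI)
        fix x y assume "x \<in> {..<q}" "y \<in> {..<q}" "\<tau> x = \<tau> y"
        then have "\<sigma> (p + x) - p = \<sigma> (p + y) - p" by (simp only: \<tau>_def lessThan_iff if_True)
        then have "\<sigma> (p + x) = \<sigma> (p + y)" using le[of x] le[of y] by linarith
        from injD[OF inj this] show "x = y" by (rule add_left_imp_eq)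
      qed
      moreover have "\<tau> ` {..<q} \<subseteq> {..<q}"
      proof
        fix y assume "y \<in> \<tau> ` {..<q}"
        then obtain x where "x < q" "y = \<sigma> (p + x) - p" by (auto simp: \<tau>_def)
        moreover have "\<sigma> (p + x) < p + q" using \<open>x < q\<close> by (simp only: lt2 nat_add_left_cancel_less)
        ultimately show "y \<in> {..<q}" using le[of x] unfolding lessThan_iff by linarith
      qed
      ultimately show "bij_betw \<tau> {..<q} {..<q}"
        using endo_inj_surj[of "{..<q}" \<tau>] by (simp add: bij_betw_def)
    qed (auto simp: \<tau>_def)
    have \<sigma>2: "\<sigma>2 = map_permutation {..<q} (\<lambda>i. p + i) \<tau>"
    proof
      fix a
      show "\<sigma>2 a = map_permutation {..<q} (\<lambda>i. p + i) \<tau> a"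
      proof (cases "a \<in> (\<lambda>i. p + i) ` {..<q}")
        case True
        then obtain i where i: "i < q" "a = p + i" by auto
        then have "map_permutation {..<q} (\<lambda>i. p + i) \<tau> a = p + \<tau> i"
          by (simp add: map_permutation_apply)
        then show ?thesis using i le[of i] by (simp add: \<sigma>2_def \<tau>_def)
      next
        case False
        then have "\<not> (p \<le> a \<and> a < p + q)"
          by (metis imageI le_add_diff_inverse lessThan_iff nat_add_left_cancel_less)
        then have "\<sigma>2 a = a" using \<sigma> by (auto simp: \<sigma>2_def permutes_def)
        moreover have "map_permutation {..<q} (\<lambda>i. p + i) \<tau> a = a"
          using False by (simp add: map_permutation_def restrict_id_def)
        ultimately show ?thesis by simp
      qed
    qed
    have s2: "sign \<sigma>2 = sign \<tau>"
      unfolding \<sigma>2 by (rule sign_map_permutation) (use p\<tau> in auto)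
    have "\<sigma>2 permutes (\<lambda>i. p + i) ` {..<q}"
      unfolding \<sigma>2 by (rule map_permutation_permutes) (use p\<tau> in \<open>auto intro: inj_on_imp_bij_betw\<close>)
    then have "permutation \<sigma>1" "permutation \<sigma>2"
      using p1 permutation_permutes by blast+
    moreover have "\<sigma> = \<sigma>1 \<circ> \<sigma>2"
      using lt by (auto simp: fun_eq_iff \<sigma>1_def \<sigma>2_def)
    ultimately have s: "sign \<sigma> = sign \<sigma>1 * sign \<tau>"
      by (simp add: sign_compose s2)
    have "\<omega> (\<lambda>i. fst (u (\<sigma> i))) = \<omega> (\<lambda>i. v (\<sigma>1 i))"
      by (rule multilinear_form_cong[OF \<omega>(1)]) (auto simp: u_def \<sigma>1_def lt)
    then have o: "\<omega> (\<lambda>i. fst (u (\<sigma> i))) = of_int (sign \<sigma>1) * \<omega> v"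
      by (simp only: alternating_formD[OF \<omega>(2) p1])
    have "\<eta> (\<lambda>i. snd (u (\<sigma> (p + i)))) = \<eta> (\<lambda>i. w (\<tau> i))"
      by (rule multilinear_form_cong[OF \<eta>(1)]) (auto simp: u_def \<tau>_def lt)
    then have e: "\<eta> (\<lambda>i. snd (u (\<sigma> (p + i)))) = of_int (sign \<tau>) * \<eta> w"
      by (simp only: alternating_formD[OF \<eta>(2) p\<tau>])
    \<comment> \<open>Each of the two signs occurs twice, once in the sign of \<sigma> and once from
      the alternation of a factor, and so cancels.\<close>
    define a b :: real where "a = of_int (sign \<sigma>1)" and "b = of_int (sign \<tau>)"
    have "a * a = 1" "b * b = 1"
      by (simp_all add: a_def b_def sign_idempotent flip: of_int_mult)
    moreover have "a * b * (a * \<omega> v) * (b * \<eta> w) = (a * a) * (b * b) * (\<omega> v * \<eta> w)"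
      by (simp only: ac_simps)
    ultimately show ?thesis unfolding o e s of_int_mult by (simp add: a_def b_def)
  qed
  \<comment> \<open>Such a permutation puts a vector of the second block, whose first component is
    zero, into a slot of \<omega>.\<close>
  have other: "?t \<sigma> = 0" if "\<sigma> \<in> ?P - ?Q" for \<sigma>
  proof -
    have \<sigma>: "\<sigma> permutes {..<p + q}" and "\<sigma> ` {..<p} \<noteq> {..<p}" using that by auto
    then have "\<not> \<sigma> ` {..<p} \<subseteq> {..<p}"
      using endo_inj_surj[of "{..<p}" \<sigma>] inj_on_subset[OF permutes_inj[OF \<sigma>]] by auto
    then obtain i where "i < p" "\<not> \<sigma> i < p" by auto
    then have "\<omega> (\<lambda>i. fst (u (\<sigma> i))) = 0"
      by (intro multilinear_form_zero[OF \<omega>(1), of i]) (auto simp: u_def)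
    then show ?thesis by simp
  qed
  have fin: "finite ?P" by (rule finite_permutations) simp
  have "sum ?t ?P = sum ?t ?Q"
    by (rule sum.mono_neutral_right[OF fin]) (use other in auto)
  also have "\<dots> = real (card ?Q) * (\<omega> v * \<eta> w)"
    using preserve by simp
  finally have S: "sum ?t ?P = real (card ?Q) * (\<omega> v * \<eta> w)" .
  \<comment> \<open>All remaining terms are equal; the identity shows that their number is not
    zero.\<close>
  have "id \<in> ?Q" by (simp add: permutes_id)
  then have "card ?Q \<noteq> 0" using fin by (metis (no_types, lifting) card_0_eq empty_iff finite_subset mem_Collect_eq subsetI)
  then have "wedge p q (\<lambda>u. \<omega> (\<lambda>i. fst (u i))) (\<lambda>u. \<eta> (\<lambda>i. snd (u i))) u \<noteq> 0"
    using S \<omega>(3) \<eta>(3) by (simp add: wedge_def)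
  then show ?thesis by (rule exI[of _ u])
qed

section \<open>Contact volume forms at a point\<close>

lemma form1_multilinear: "linear (\<alpha> p) \<Longrightarrow> multilinear_form 1 (form1 \<alpha> p)"
  by (simp add: multilinear_form_def form1_def)

lemma contact_volume_alternating: "alternating_form (2 * n + 1) (contact_volume n M \<alpha> p)"
  using wedge_alternating[of 1 "2 * n"] unfolding contact_volume_def by simp

lemma contact_volume_multilinear:
  "linear (\<alpha> p) \<Longrightarrow> multilinear_form 2 (dform M \<alpha> p) \<Longrightarrow>
    multilinear_form (2 * n + 1) (contact_volume n M \<alpha> p)"
  using wedge_multilinear[OF form1_multilinear wedge_power_multilinear, of \<alpha> p 2 "dform M \<alpha> p" n]
  unfolding contact_volume_def by simp

lemma contact_volume_annihilates:
  assumes "\<alpha> p x = 0" "\<And>v. ext_deriv M \<alpha> p x v = 0"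
  shows "annihilates x (2 * n + 1) (contact_volume n M \<alpha> p)"
proof -
  have "ext_deriv M \<alpha> p v x = 0" for v
    using assms(2)[of v] by (simp add: ext_deriv_def Let_def)
  then have "annihilates x 1 (form1 \<alpha> p)" "annihilates x 2 (dform M \<alpha> p)"
    using assms by (auto simp: annihilates_def form1_def dform_def numeral_2_eq_2 less_Suc_eq)
  from wedge_annihilates[OF this(1) wedge_power_annihilates[OF this(2), of n]] show ?thesis
    unfolding contact_volume_def by simp
qed

text \<open>Wedge products are natural under composition of all arguments with any map
  \<open>L\<close>. The pointwise form serves both tangent maps and the linear projections of a
  product.\<close>

lemma contact_volume_pullback:
  assumes "\<And>v. \<alpha> x v = \<beta> y (L v)" "\<And>u v. ext_deriv M \<alpha> x u v = ext_deriv N \<beta> y (L u) (L v)"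
  shows "contact_volume n M \<alpha> x v = contact_volume n N \<beta> y (\<lambda>i. L (v i))"
    and "wedge_power 2 (dform M \<alpha> x) n v = wedge_power 2 (dform N \<beta> y) n (\<lambda>i. L (v i))"
proof -
  have 1: "form1 \<alpha> x = (\<lambda>v. form1 \<beta> y (\<lambda>i. L (v i)))" "dform M \<alpha> x = (\<lambda>v. dform N \<beta> y (\<lambda>i. L (v i)))"
    using assms by (auto simp: form1_def dform_def)
  show 2: "wedge_power 2 (dform M \<alpha> x) n v = wedge_power 2 (dform N \<beta> y) n (\<lambda>i. L (v i))" for v
    unfolding 1 by (rule wedge_power_pullback)
  have "wedge_power 2 (dform M \<alpha> x) n = (\<lambda>v. wedge_power 2 (dform N \<beta> y) n (\<lambda>i. L (v i)))"
    using 2 by blast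
  then show "contact_volume n M \<alpha> x v = contact_volume n N \<beta> y (\<lambda>i. L (v i))"
    unfolding contact_volume_def 1(1) by (simp only: wedge_pullback)
qed

text \<open>Each of the two terms of d\<alpha> is linear in one argument because derivatives are
  linear in the direction, and in the other because the components of \<alpha> are linear.\<close>

lemma dform_multilinear:
  assumes M: "smooth_manifold M" and \<alpha>: "smooth_form M \<alpha>" and p: "p \<in> pts M"
  shows "multilinear_form 2 (dform M \<alpha> p)"
proof -
  define c where "c = chart_at M p"
  have c: "c \<in> atlas M" "p \<in> fst c"
    using chart_at_atlas[OF M p] chart_at_mem[OF M p] by (auto simp: c_def)
  let ?a = "form_rep M c \<alpha>" and ?x = "snd c p"
  have S: "open (snd c ` fst c)" "?x \<in> snd c ` fst c"
    using open_chart_image[OF M c(1) chart_openin[OF M c(1)]] c by auto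
  have d: "(\<lambda>y. ?a y v) differentiable (at ?x)" for v
    using \<alpha> c S(2) smooth_on_differentiable unfolding smooth_form_def by blast
  have lin: "linear (?a y)" if "y \<in> snd c ` fst c" for y
    using \<alpha> chart_subset[OF M c(1)] linear_form_rep[OF M c(1), of "fst c" \<alpha> y] that
    unfolding smooth_form_def by auto
  have 1: "linear (\<lambda>v. fderiv (\<lambda>y. ?a y v) ?x u)" for u
    by (rule linear_fderiv_arg[OF S d lin])
  have 2: "linear (\<lambda>u. fderiv (\<lambda>y. ?a y v) ?x u)" for v
    by (rule linear_fderiv[OF d])
  have "linear (ext_deriv M \<alpha> p u)" "linear (\<lambda>u. ext_deriv M \<alpha> p u v)" for u v
    unfolding ext_deriv_def Let_def c_def[symmetric]
    using linear_compose_sub[OF 1[of u] 2[of u]] linear_compose_sub[OF 2[of v] 1[of v]]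
    by (simp_all add: fun_eq_iff)
  then show ?thesis
    by (auto simp: multilinear_form_def dform_def numeral_2_eq_2 less_Suc_eq)
qed

section \<open>Products of manifolds\<close>

lemma prod_manifold_sel [simp]:
  "mtop (prod_manifold M N) = prod_topology (mtop M) (mtop N)"
  "chart_at (prod_manifold M N) (x, y) = prod_chart (chart_at M x) (chart_at N y)"
  "e \<in> atlas (prod_manifold M N) \<longleftrightarrow> (\<exists>c d. e = prod_chart c d \<and> c \<in> atlas M \<and> d \<in> atlas N)"
  by (auto simp: prod_manifold_def)

lemma prod_chart_sel [simp]:
  "fst (prod_chart c d) = fst c \<times> fst d"
  "snd (prod_chart c d) = map_prod (snd c) (snd d)"
  by (simp_all add: prod_chart_def)

lemma chart_inv_prod_chart:
  assumes M: "smooth_manifold M" "c \<in> atlas M" and N: "smooth_manifold N" "d \<in> atlas N"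
    and z: "fst z \<in> snd c ` fst c" "snd z \<in> snd d ` fst d"
  shows "chart_inv (prod_chart c d) z = (chart_inv c (fst z), chart_inv d (snd z))"
proof -
  have "inj_on (map_prod (snd c) (snd d)) (fst c \<times> fst d)"
    using chart_inj[OF M] chart_inj[OF N] by (auto simp: inj_on_def)
  moreover have "(chart_inv c (fst z), chart_inv d (snd z)) \<in> fst c \<times> fst d"
    "map_prod (snd c) (snd d) (chart_inv c (fst z), chart_inv d (snd z)) = z"
    using z M N by (auto simp: prod_eq_iff)
  ultimately show ?thesis
    unfolding chart_inv_def[of "prod_chart c d"] prod_chart_sel by (rule inv_into_f_eq)
qed

lemma smooth_on_map_prod:
  fixes f :: "'a::euclidean_space \<Rightarrow> 'c::euclidean_space" and g :: "'b::euclidean_space \<Rightarrow> 'd::euclidean_space"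
  assumes "open S" "open T" "smooth_on S f" "smooth_on T g"
  shows "smooth_on (S \<times> T) (map_prod f g)"
proof -
  note o = open_Times[OF assms(1,2)]
  have "smooth_on (S \<times> T) (f \<circ> fst)"
    by (rule smooth_on_compose[OF o assms(1) _ smooth_on_bounded_linear[OF bounded_linear_fst] assms(3)]) auto
  moreover have "smooth_on (S \<times> T) (g \<circ> snd)"
    by (rule smooth_on_compose[OF o assms(2) _ smooth_on_bounded_linear[OF bounded_linear_snd] assms(4)]) auto
  ultimately show ?thesis
    using smooth_on_Pair[OF o] by (simp add: map_prod_def case_prod_unfold o_def)
qed

lemma second_countable_prod:
  assumes "second_countable X" "second_countable Y"
  shows "second_countable (prod_topology X Y)"
proof -
  obtain A where A: "countable A" "\<And>V. V \<in> A \<Longrightarrow> openin X V"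
    "\<And>U x. openin X U \<Longrightarrow> x \<in> U \<Longrightarrow> \<exists>V\<in>A. x \<in> V \<and> V \<subseteq> U"
    using assms(1) unfolding second_countable_def by metis
  obtain B where B: "countable B" "\<And>V. V \<in> B \<Longrightarrow> openin Y V"
    "\<And>U x. openin Y U \<Longrightarrow> x \<in> U \<Longrightarrow> \<exists>V\<in>B. x \<in> V \<and> V \<subseteq> U"
    using assms(2) unfolding second_countable_def by metis
  show ?thesis
    unfolding second_countable_def
  proof (intro exI conjI ballI allI impI)
    show "countable ((\<lambda>(U, V). U \<times> V) ` (A \<times> B))" using A(1) B(1) by simp
    show "openin (prod_topology X Y) W" if "W \<in> (\<lambda>(U, V). U \<times> V) ` (A \<times> B)" for W
      using that A(2) B(2) by (auto simp: openin_prod_Times_iff)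
    fix W z assume W: "openin (prod_topology X Y) W \<and> z \<in> W"
    obtain x y where z: "z = (x, y)" by fastforce
    obtain U V where UV: "openin X U" "openin Y V" "x \<in> U" "y \<in> V" "U \<times> V \<subseteq> W"
      using W z unfolding openin_prod_topology_alt by blast
    obtain U' V' where "U' \<in> A" "x \<in> U'" "U' \<subseteq> U" "V' \<in> B" "y \<in> V'" "V' \<subseteq> V"
      using A(3)[OF UV(1,3)] B(3)[OF UV(2,4)] by metis
    then show "\<exists>V\<in>(\<lambda>(U, V). U \<times> V) ` (A \<times> B). z \<in> V \<and> V \<subseteq> W"
      using UV(5) z by (intro bexI[of _ "U' \<times> V'"]) auto
  qed
qed

lemma smooth_manifold_prod:
  assumes M: "smooth_manifold M" and N: "smooth_manifold N"
  shows "smooth_manifold (prod_manifold M N)"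
  unfolding smooth_manifold_def
proof (intro conjI ballI)
  let ?P = "prod_manifold M N"
  show "Hausdorff_space (mtop ?P)" "second_countable (mtop ?P)"
    using M N by (auto simp: smooth_manifold_def Hausdorff_space_prod_topology second_countable_prod)
  {
    fix e assume "e \<in> atlas ?P"
    then obtain c d where e: "e = prod_chart c d" and c: "c \<in> atlas M" and d: "d \<in> atlas N" by auto
    have im: "snd e ` fst e = snd c ` fst c \<times> snd d ` fst d"
      by (auto simp: e map_prod_def image_iff)
    show "openin (mtop ?P) (fst e)"
      using chart_openin[OF M c] chart_openin[OF N d] by (simp add: e openin_prod_Times_iff)
    show "open (snd e ` fst e)"
      using M N c d by (simp add: im open_Times smooth_manifold_def)
    obtain f g where "homeomorphic_maps (subtopology (mtop M) (fst c)) (top_of_set (snd c ` fst c)) (snd c) f"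
      "homeomorphic_maps (subtopology (mtop N) (fst d)) (top_of_set (snd d ` fst d)) (snd d) g"
      using chart_homeomorphic[OF M c] chart_homeomorphic[OF N d] unfolding homeomorphic_map_maps by blast
    then have "homeomorphic_maps (prod_topology (subtopology (mtop M) (fst c)) (subtopology (mtop N) (fst d)))
        (prod_topology (top_of_set (snd c ` fst c)) (top_of_set (snd d ` fst d)))
        (\<lambda>(x, y). (snd c x, snd d y)) (\<lambda>(x, y). (f x, g y))"
      by (simp only: homeomorphic_maps_prod simp_thms)
    then have "homeomorphic_map (subtopology (mtop ?P) (fst e)) (top_of_set (snd e ` fst e)) (snd e)"
      unfolding homeomorphic_map_maps im by (auto simp: e subtopology_Times map_prod_def)
    then show "homeomorphic_map (subtopology (mtop ?P) (fst e)) (top_of_set (snd e ` fst e)) (snd e)" .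
    fix e' assume "e' \<in> atlas ?P"
    then obtain c' d' where e': "e' = prod_chart c' d'" and c': "c' \<in> atlas M" and d': "d' \<in> atlas N" by auto
    let ?S = "snd c ` (fst c \<inter> fst c')" and ?T = "snd d ` (fst d \<inter> fst d')"
    have o: "open ?S" "open ?T"
      using open_chart_image[OF M c chart_openin[OF M c']] open_chart_image[OF N d chart_openin[OF N d']]
      by (simp_all add: Int_commute)
    have dom: "snd e ` (fst e \<inter> fst e') = ?S \<times> ?T"
      by (auto simp: e e' map_prod_def image_iff)
    have eq: "map_prod (snd c' \<circ> chart_inv c) (snd d' \<circ> chart_inv d) z = (snd e' \<circ> chart_inv e) z"
      if "z \<in> ?S \<times> ?T" for z
    proof -
      have "fst z \<in> snd c ` fst c" "snd z \<in> snd d ` fst d" using that by auto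
      from chart_inv_prod_chart[OF M c N d this] show ?thesis
        by (simp add: e e' map_prod_def case_prod_unfold)
    qed
    have "smooth_on (?S \<times> ?T) (map_prod (snd c' \<circ> chart_inv c) (snd d' \<circ> chart_inv d))"
      by (rule smooth_on_map_prod[OF o]) (use M N c c' d d' in \<open>auto simp: smooth_manifold_def\<close>)
    then show "smooth_on (snd e ` (fst e \<inter> fst e')) (snd e' \<circ> chart_inv e)"
      unfolding dom by (subst smooth_on_cong[OF open_Times[OF o], symmetric]) (use eq in auto)
  }
  fix z assume "z \<in> pts ?P"
  then obtain x y where z: "z = (x, y)" and p: "x \<in> pts M" "y \<in> pts N" by auto
  show "chart_at ?P z \<in> atlas ?P" "z \<in> fst (chart_at ?P z)"
    using chart_at_atlas[OF M p(1)] chart_at_atlas[OF N p(2)] chart_at_mem[OF M p(1)] chart_at_mem[OF N p(2)]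
    unfolding z prod_manifold_sel prod_chart_sel by blast+
qed

lemma smooth_manifold_real_line: "smooth_manifold real_line"
proof -
  have "chart_inv (UNIV, id :: real \<Rightarrow> real) = id"
    by (auto simp: chart_inv_def fun_eq_iff inv_into_f_eq)
  moreover have "second_countable (euclidean :: real topology)"
  proof -
    obtain B :: "real set set" where B: "countable B" "topological_basis B"
      using ex_countable_basis by blast
    then show ?thesis
      unfolding second_countable_def open_openin[symmetric]
      by (intro exI[of _ B]) (metis topological_basis_open topological_basisE)
  qed
  moreover have "smooth_on UNIV (id :: real \<Rightarrow> real)"
    unfolding id_def by (rule smooth_on_bounded_linear) (rule bounded_linear_ident)
  ultimately show ?thesis
    unfolding smooth_manifold_def real_line_def
    by (auto simp: homeomorphic_map_id Hausdorff_space_euclidean)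
qed

section \<open>Product maps and projections\<close>

lemma smooth_map_on_map_prod:
  assumes M: "smooth_manifold M" and N: "smooth_manifold N"
    and M': "smooth_manifold M'" and N': "smooth_manifold N'"
    and f: "smooth_map_on U M M' f" and g: "smooth_map_on V N N' g"
  shows "smooth_map_on (U \<times> V) (prod_manifold M N) (prod_manifold M' N') (map_prod f g)"
proof (rule smooth_map_onI[OF smooth_manifold_prod[OF M N]])
  show "openin (mtop (prod_manifold M N)) (U \<times> V)"
    using smooth_map_on_open[OF f] smooth_map_on_open[OF g] by (simp add: openin_prod_Times_iff)
  have "continuous_map (prod_topology (subtopology (mtop M) U) (subtopology (mtop N) V))
      (prod_topology (mtop M') (mtop N')) (\<lambda>(x, y). (f x, g y))"
    using f g by (simp add: smooth_map_on_def continuous_map_prod_top)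
  then show "continuous_map (subtopology (mtop (prod_manifold M N)) (U \<times> V)) (mtop (prod_manifold M' N')) (map_prod f g)"
    by (simp add: subtopology_Times map_prod_def)
  fix z e e' assume z: "z \<in> U \<times> V" and e: "e \<in> atlas (prod_manifold M N)" "z \<in> fst e"
    and e': "e' \<in> atlas (prod_manifold M' N')" "map_prod f g z \<in> fst e'"
  obtain c d where cd: "e = prod_chart c d" "c \<in> atlas M" "d \<in> atlas N" using e by auto
  obtain c' d' where cd': "e' = prod_chart c' d'" "c' \<in> atlas M'" "d' \<in> atlas N'" using e' by auto
  have z': "fst z \<in> U" "snd z \<in> V" "fst z \<in> fst c" "snd z \<in> fst d" "f (fst z) \<in> fst c'" "g (snd z) \<in> fst d'"
    using z e e' cd cd' by auto
  obtain S where S: "open S" "snd c (fst z) \<in> S" "S \<subseteq> snd c ` (U \<inter> fst c)" "smooth_on S (snd c' \<circ> f \<circ> chart_inv c)"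
    by (rule smooth_map_on_rep[OF M cd(2) M' cd'(2) f z'(1,3,5)]) blast
  obtain T where T: "open T" "snd d (snd z) \<in> T" "T \<subseteq> snd d ` (V \<inter> fst d)" "smooth_on T (snd d' \<circ> g \<circ> chart_inv d)"
    by (rule smooth_map_on_rep[OF N cd(3) N' cd'(3) g z'(2,4,6)]) blast
  have "smooth_on (S \<times> T) (map_prod (snd c' \<circ> f \<circ> chart_inv c) (snd d' \<circ> g \<circ> chart_inv d))"
    by (rule smooth_on_map_prod[OF S(1) T(1) S(4) T(4)])
  moreover have "map_prod (snd c' \<circ> f \<circ> chart_inv c) (snd d' \<circ> g \<circ> chart_inv d) y
      = (snd e' \<circ> map_prod f g \<circ> chart_inv e) y" if "y \<in> S \<times> T" for y
  proof -
    have "fst y \<in> snd c ` fst c" "snd y \<in> snd d ` fst d" using that S(3) T(3) by auto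
    from chart_inv_prod_chart[OF M cd(2) N cd(3) this] show ?thesis
      by (simp add: cd cd' map_prod_def case_prod_unfold)
  qed
  ultimately have "smooth_on (S \<times> T) (snd e' \<circ> map_prod f g \<circ> chart_inv e)"
    by (subst smooth_on_cong[OF open_Times[OF S(1) T(1)], symmetric]) auto
  moreover have "snd e z \<in> S \<times> T" using S(2) T(2) by (cases z) (auto simp: cd)
  ultimately show "\<exists>S. open S \<and> snd e z \<in> S \<and> smooth_on S (snd e' \<circ> map_prod f g \<circ> chart_inv e)"
    using open_Times[OF S(1) T(1)] by (intro exI[of _ "S \<times> T"] conjI)
qed

lemma fderiv_map_prod:
  assumes "f differentiable (at x)" "g differentiable (at y)"
  shows "fderiv (map_prod f g) (x, y) (u, v) = (fderiv f x u, fderiv g y v)"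
proof -
  have "(map_prod f g has_derivative (\<lambda>w. (fderiv f x (fst w), fderiv g y (snd w)))) (at (x, y))"
    unfolding map_prod_def case_prod_unfold
    using has_derivative_compose[OF bounded_linear_imp_has_derivative[OF bounded_linear_fst], of f _ "(x, y)" UNIV]
      has_derivative_compose[OF bounded_linear_imp_has_derivative[OF bounded_linear_snd], of g _ "(x, y)" UNIV]
      has_fderiv[OF assms(1)] has_fderiv[OF assms(2)]
    by (intro has_derivative_Pair) auto
  from fderiv_eqI[OF this] show ?thesis by simp
qed

lemma chart_deriv_map_prod:
  assumes M: "smooth_manifold M" "c \<in> atlas M" and N: "smooth_manifold N" "d \<in> atlas N"
    and M': "smooth_manifold M'" "c' \<in> atlas M'" and N': "smooth_manifold N'" "d' \<in> atlas N'"
    and f: "smooth_map_on U M M' f" "x \<in> U" "x \<in> fst c" "f x \<in> fst c'"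
    and g: "smooth_map_on V N N' g" "y \<in> V" "y \<in> fst d" "g y \<in> fst d'"
  shows "chart_deriv (map_prod f g) (prod_chart c' d') (prod_chart c d) (x, y) (u, v)
    = (chart_deriv f c' c x u, chart_deriv g d' d y v)"
proof -
  obtain S where S: "open S" "snd c x \<in> S" "S \<subseteq> snd c ` (U \<inter> fst c)" "smooth_on S (snd c' \<circ> f \<circ> chart_inv c)"
    by (rule smooth_map_on_rep[OF M M' f]) blast
  obtain T where T: "open T" "snd d y \<in> T" "T \<subseteq> snd d ` (V \<inter> fst d)" "smooth_on T (snd d' \<circ> g \<circ> chart_inv d)"
    by (rule smooth_map_on_rep[OF N N' g]) blast
  have "fderiv (snd (prod_chart c' d') \<circ> map_prod f g \<circ> chart_inv (prod_chart c d)) (snd c x, snd d y)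
      = fderiv (map_prod (snd c' \<circ> f \<circ> chart_inv c) (snd d' \<circ> g \<circ> chart_inv d)) (snd c x, snd d y)"
  proof (rule fderiv_cong_open[OF open_Times[OF S(1) T(1)]])
    fix z assume "z \<in> S \<times> T"
    then have "fst z \<in> snd c ` fst c" "snd z \<in> snd d ` fst d" using S(3) T(3) by auto
    from chart_inv_prod_chart[OF M N this]
    show "(snd (prod_chart c' d') \<circ> map_prod f g \<circ> chart_inv (prod_chart c d)) z
        = map_prod (snd c' \<circ> f \<circ> chart_inv c) (snd d' \<circ> g \<circ> chart_inv d) z"
      by (simp add: map_prod_def case_prod_unfold)
  qed (use S T in auto)
  then show ?thesis
    using fderiv_map_prod[OF smooth_on_differentiable[OF S(4,2)] smooth_on_differentiable[OF T(4,2)]]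
    by (simp add: chart_deriv_def)
qed

lemma tangent_map_map_prod:
  assumes M: "smooth_manifold M" and N: "smooth_manifold N"
    and M': "smooth_manifold M'" and N': "smooth_manifold N'"
    and f: "smooth_map_on U M M' f" "x \<in> U" and g: "smooth_map_on V N N' g" "y \<in> V"
  shows "tangent_map (prod_manifold M N) (prod_manifold M' N') (map_prod f g) (x, y) (u, v)
    = (tangent_map M M' f x u, tangent_map N N' g y v)"
proof -
  have p: "x \<in> pts M" "f x \<in> pts M'" "y \<in> pts N" "g y \<in> pts N'"
    using smooth_map_on_pts[OF f] smooth_map_on_pts[OF g] f g openin_subset[OF smooth_map_on_open[OF f(1)]]
      openin_subset[OF smooth_map_on_open[OF g(1)]] by auto
  show ?thesis
    using chart_deriv_map_prod[OF M chart_at_atlas[OF M p(1)] N chart_at_atlas[OF N p(3)]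
        M' chart_at_atlas[OF M' p(2)] N' chart_at_atlas[OF N' p(4)]
        f chart_at_mem[OF M p(1)] chart_at_mem[OF M' p(2)] g chart_at_mem[OF N p(3)] chart_at_mem[OF N' p(4)]]
    by (simp add: tangent_map_eq)
qed

lemma diffeo_pair_map_prod:
  assumes "diffeo_pair M M' U U' f f'" "diffeo_pair N N' V V' g g'"
  shows "diffeo_pair (prod_manifold M N) (prod_manifold M' N') (U \<times> V) (U' \<times> V') (map_prod f g) (map_prod f' g')"
  using assms unfolding diffeo_pair_def
  by (auto intro!: smooth_manifold_prod smooth_map_on_map_prod simp: image_iff)

lemma diffeo_pair_local_diffeo:
  assumes "\<And>x. x \<in> pts M \<Longrightarrow> \<exists>U V g. x \<in> U \<and> diffeo_pair M N U V f g"
  shows "local_diffeo M N f"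
  unfolding local_diffeo_def
proof
  fix x assume "x \<in> pts M"
  then obtain U V g where x: "x \<in> U" and D: "diffeo_pair M N U V f g" using assms by blast
  have inj: "inj_on f U" and fU: "f ` U = V" and M: "smooth_manifold M" and N: "smooth_manifold N"
    and f: "smooth_map_on U M N f" and g: "smooth_map_on V N M g"
    using D unfolding diffeo_pair_def by (auto intro: inj_on_inverseI)
  have "g y = inv_into U f y" if "y \<in> V" for y
    using D that inj unfolding diffeo_pair_def by (metis image_eqI inv_into_f_eq)
  from smooth_map_on_cong[OF N M g this] x f inj fU
  show "\<exists>U. x \<in> U \<and> inj_on f U \<and> smooth_map_on U M N f \<and> smooth_map_on (f ` U) N M (inv_into U f)"
    by (intro exI[of _ U]) auto
qed

lemma local_diffeo_map_prod_id:
  assumes M: "smooth_manifold M" and M': "smooth_manifold M'" and N: "smooth_manifold N"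
    and f: "local_diffeo M M' f"
  shows "local_diffeo (prod_manifold M N) (prod_manifold M' N) (map_prod f id)"
proof (rule diffeo_pair_local_diffeo)
  fix z assume "z \<in> pts (prod_manifold M N)"
  then have z: "fst z \<in> pts M" "snd z \<in> pts N" by auto
  obtain U where "fst z \<in> U" "diffeo_pair M M' U (f ` U) f (inv_into U f)"
    using local_diffeo_pair[OF M M' f z(1)] by blast
  moreover have "diffeo_pair N N (pts N) (pts N) id id"
    unfolding diffeo_pair_def using N smooth_map_on_id[OF N openin_topspace] by auto
  ultimately show "\<exists>U V g. z \<in> U \<and> diffeo_pair (prod_manifold M N) (prod_manifold M' N) U V (map_prod f id) g"
    using diffeo_pair_map_prod z by (metis mem_Times_iff)
qed

text \<open>Both changes of chart are chart derivatives of the identity, written as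
  \<open>map_prod id id\<close>.\<close>

lemma to_chart_prod:
  assumes M: "smooth_manifold M" "c \<in> atlas M" and N: "smooth_manifold N" "d \<in> atlas N"
    and x: "x \<in> fst c" and y: "y \<in> fst d"
  shows "to_chart (prod_manifold M N) (prod_chart c d) (x, y) (u, v) = (to_chart M c x u, to_chart N d y v)"
    and "of_chart (prod_manifold M N) (prod_chart c d) (x, y) (u, v) = (of_chart M c x u, of_chart N d y v)"
proof -
  have p: "x \<in> pts M" "y \<in> pts N" using chart_subset[OF M] chart_subset[OF N] x y by auto
  note i = smooth_map_on_id[OF M(1) openin_topspace] and j = smooth_map_on_id[OF N(1) openin_topspace]
  note a = chart_at_atlas[OF M(1) p(1)] chart_at_atlas[OF N(1) p(2)]
  note m = chart_at_mem[OF M(1) p(1)] chart_at_mem[OF N(1) p(2)]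
  have id: "map_prod id id = (id :: 'x \<times> 'y \<Rightarrow> 'x \<times> 'y)" by (simp add: prod.map_id0)
  show "to_chart (prod_manifold M N) (prod_chart c d) (x, y) (u, v) = (to_chart M c x u, to_chart N d y v)"
    using chart_deriv_map_prod[OF M(1) a(1) N(1) a(2) M N i p(1) m(1) _ j p(2) m(2), unfolded id] x y
    by (simp add: to_chart_eq)
  show "of_chart (prod_manifold M N) (prod_chart c d) (x, y) (u, v) = (of_chart M c x u, of_chart N d y v)"
    using chart_deriv_map_prod[OF M N M(1) a(1) N(1) a(2) i p(1) x _ j p(2) y, unfolded id] m
    by (simp add: of_chart_eq)
qed

lemma smooth_map_on_fst_snd:
  assumes M: "smooth_manifold M" and N: "smooth_manifold N"
  shows "smooth_map_on (pts (prod_manifold M N)) (prod_manifold M N) M fst"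
    and "smooth_map_on (pts (prod_manifold M N)) (prod_manifold M N) N snd"
proof -
  let ?P = "prod_manifold M N"
  note P = smooth_manifold_prod[OF M N]
  have cont: "continuous_map (subtopology (mtop ?P) (pts ?P)) (mtop M) fst"
      "continuous_map (subtopology (mtop ?P) (pts ?P)) (mtop N) snd"
    by (intro continuous_map_from_subtopology, simp add: continuous_map_fst continuous_map_snd)+
  have main: "(\<forall>a\<in>atlas M. fst z \<in> fst a \<longrightarrow> (\<exists>S. open S \<and> snd e z \<in> S \<and> smooth_on S (snd a \<circ> fst \<circ> chart_inv e)))
    \<and> (\<forall>a\<in>atlas N. snd z \<in> fst a \<longrightarrow> (\<exists>S. open S \<and> snd e z \<in> S \<and> smooth_on S (snd a \<circ> snd \<circ> chart_inv e)))"
    if e: "e \<in> atlas ?P" "z \<in> fst e" for z e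
  proof (intro conjI ballI impI)
    obtain c d where cd: "e = prod_chart c d" "c \<in> atlas M" "d \<in> atlas N" using e by auto
    let ?S = "snd c ` fst c" and ?T = "snd d ` fst d"
    have o: "open ?S" "open ?T" using M N cd by (auto simp: smooth_manifold_def)
    have inv: "chart_inv e y = (chart_inv c (fst y), chart_inv d (snd y))" if "y \<in> ?S \<times> ?T" for y
      unfolding cd(1) by (rule chart_inv_prod_chart[OF M cd(2) N cd(3)]) (use that in auto)
    have ze: "snd e z \<in> ?S \<times> ?T" using e by (cases z) (auto simp: cd)
    show "\<exists>S. open S \<and> snd e z \<in> S \<and> smooth_on S (snd a \<circ> fst \<circ> chart_inv e)"
      if a: "a \<in> atlas M" "fst z \<in> fst a" for a
    proof -
      let ?A = "snd c ` (fst c \<inter> fst a)"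
      have A: "open ?A" using open_chart_image[OF M cd(2) chart_openin[OF M a(1)]] by (simp add: Int_commute)
      have sa: "smooth_on ?A (snd a \<circ> chart_inv c)" using M cd a by (simp add: smooth_manifold_def)
      note oA = open_Times[OF A o(2)]
      have "smooth_on (?A \<times> ?T) ((snd a \<circ> chart_inv c) \<circ> fst)"
        by (rule smooth_on_compose[OF oA A _ smooth_on_bounded_linear[OF bounded_linear_fst] sa]) auto
      then have "smooth_on (?A \<times> ?T) (snd a \<circ> fst \<circ> chart_inv e)"
        by (subst smooth_on_cong[OF oA, of _ "(snd a \<circ> chart_inv c) \<circ> fst"]) (use inv in auto)
      moreover have "snd e z \<in> ?A \<times> ?T" using e a by (cases z) (auto simp: cd)
      ultimately show ?thesis using oA by (intro exI[of _ "?A \<times> ?T"] conjI)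
    qed
    show "\<exists>S. open S \<and> snd e z \<in> S \<and> smooth_on S (snd a \<circ> snd \<circ> chart_inv e)"
      if a: "a \<in> atlas N" "snd z \<in> fst a" for a
    proof -
      let ?A = "snd d ` (fst d \<inter> fst a)"
      have A: "open ?A" using open_chart_image[OF N cd(3) chart_openin[OF N a(1)]] by (simp add: Int_commute)
      have sa: "smooth_on ?A (snd a \<circ> chart_inv d)" using N cd a by (simp add: smooth_manifold_def)
      note oA = open_Times[OF o(1) A]
      have "smooth_on (?S \<times> ?A) ((snd a \<circ> chart_inv d) \<circ> snd)"
        by (rule smooth_on_compose[OF oA A _ smooth_on_bounded_linear[OF bounded_linear_snd] sa]) auto
      then have "smooth_on (?S \<times> ?A) (snd a \<circ> snd \<circ> chart_inv e)"
        by (subst smooth_on_cong[OF oA, of _ "(snd a \<circ> chart_inv d) \<circ> snd"]) (use inv in auto)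
      moreover have "snd e z \<in> ?S \<times> ?A" using e a by (cases z) (auto simp: cd)
      ultimately show ?thesis using oA by (intro exI[of _ "?S \<times> ?A"] conjI)
    qed
  qed
  show "smooth_map_on (pts ?P) ?P M fst"
    by (rule smooth_map_onI[OF P openin_topspace cont(1)]) (use main in blast)
  show "smooth_map_on (pts ?P) ?P N snd"
    by (rule smooth_map_onI[OF P openin_topspace cont(2)]) (use main in blast)
qed

text \<open>In product charts the projections are represented by the linear maps \<open>fst\<close>
  and \<open>snd\<close> themselves.\<close>

lemma tangent_map_fst_snd:
  assumes M: "smooth_manifold M" and N: "smooth_manifold N" and p: "x \<in> pts M" "y \<in> pts N"
  shows "tangent_map (prod_manifold M N) M fst (x, y) = fst"
    and "tangent_map (prod_manifold M N) N snd (x, y) = snd"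
proof -
  define c d where "c = chart_at M x" and "d = chart_at N y"
  have c: "c \<in> atlas M" "x \<in> fst c" and d: "d \<in> atlas N" "y \<in> fst d"
    using chart_at_atlas[OF M p(1)] chart_at_mem[OF M p(1)] chart_at_atlas[OF N p(2)] chart_at_mem[OF N p(2)]
    by (auto simp: c_def d_def)
  let ?S = "snd c ` fst c" and ?T = "snd d ` fst d"
  have o: "open (?S \<times> ?T)" using M N c d by (auto simp: smooth_manifold_def intro: open_Times)
  have z: "(snd c x, snd d y) \<in> ?S \<times> ?T" using c d by auto
  have inv: "chart_inv (prod_chart c d) z = (chart_inv c (fst z), chart_inv d (snd z))" if "z \<in> ?S \<times> ?T" for z
    by (rule chart_inv_prod_chart[OF M c(1) N d(1)]) (use that in auto)
  have "fderiv (snd c \<circ> fst \<circ> chart_inv (prod_chart c d)) (snd c x, snd d y) = fderiv fst (snd c x, snd d y)"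
    by (rule fderiv_cong_open[OF o z]) (use inv M N c d in auto)
  then show "tangent_map (prod_manifold M N) M fst (x, y) = fst"
    using fderiv_eqI[OF bounded_linear_imp_has_derivative[OF bounded_linear_fst]]
    by (simp add: tangent_map_def c_def d_def)
  have "fderiv (snd d \<circ> snd \<circ> chart_inv (prod_chart c d)) (snd c x, snd d y) = fderiv snd (snd c x, snd d y)"
    by (rule fderiv_cong_open[OF o z]) (use inv M N c d in auto)
  then show "tangent_map (prod_manifold M N) N snd (x, y) = snd"
    using fderiv_eqI[OF bounded_linear_imp_has_derivative[OF bounded_linear_snd]]
    by (simp add: tangent_map_def c_def d_def)
qed

section \<open>Contact pair structures along local diffeomorphisms\<close>

text \<open>Named so that unique solvability can be stated; \<open>reeb_vf\<close> is a definite
  description, about which nothing is known otherwise.\<close>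

definition reeb_cond ::
  "('a, 'e::euclidean_space) manifold \<Rightarrow> ('a \<Rightarrow> 'e \<Rightarrow> real) \<Rightarrow> ('a \<Rightarrow> 'e \<Rightarrow> real) \<Rightarrow> 'a \<Rightarrow> 'e \<Rightarrow> bool" where
  "reeb_cond M \<alpha> \<beta> p z \<longleftrightarrow> \<alpha> p z = 1 \<and> \<beta> p z = 0 \<and>
     (\<forall>v. ext_deriv M \<alpha> p z v = 0) \<and> (\<forall>v. ext_deriv M \<beta> p z v = 0)"

lemma reeb_vf_eq: "reeb_vf M \<alpha> \<beta> p = (THE z. reeb_cond M \<alpha> \<beta> p z)"
  by (simp add: reeb_vf_def reeb_cond_def)

definition contact_pair_at ::
  "nat \<Rightarrow> nat \<Rightarrow> ('a, 'e::euclidean_space) manifold \<Rightarrow> ('a \<Rightarrow> 'e \<Rightarrow> real)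
    \<Rightarrow> ('a \<Rightarrow> 'e \<Rightarrow> real) \<Rightarrow> ('a \<Rightarrow> 'e \<Rightarrow> 'e) \<Rightarrow> 'a \<Rightarrow> bool" where
  "contact_pair_at h k M \<alpha> \<beta> \<phi> p \<longleftrightarrow>
     (\<exists>v. wedge (2 * h + 1) (2 * k + 1) (contact_volume h M \<alpha> p) (contact_volume k M \<beta> p) v \<noteq> 0) \<and>
     (\<forall>v. wedge_power 2 (dform M \<alpha> p) (h + 1) v = 0) \<and>
     (\<forall>v. wedge_power 2 (dform M \<beta> p) (k + 1) v = 0) \<and>
     (\<exists>!z. reeb_cond M \<alpha> \<beta> p z) \<and> (\<exists>!z. reeb_cond M \<beta> \<alpha> p z) \<and>
     (\<forall>v. \<phi> p (\<phi> p v) = - v + \<alpha> p v *\<^sub>R reeb_vf M \<alpha> \<beta> p + \<beta> p v *\<^sub>R reeb_vf M \<beta> \<alpha> p) \<and>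
     \<phi> p (reeb_vf M \<alpha> \<beta> p) = 0 \<and> \<phi> p (reeb_vf M \<beta> \<alpha> p) = 0"

text \<open>
  Besides the conditions of a contact pair structure, existence and uniqueness of the Reeb vector
  fields and smoothness of the two almost complex structures are recorded, so that all of these carry
  over along local diffeomorphisms together.
\<close>

definition contact_pair_on ::
  "'a set \<Rightarrow> nat \<Rightarrow> nat \<Rightarrow> ('a, 'e::euclidean_space) manifold \<Rightarrow> ('a \<Rightarrow> 'e \<Rightarrow> real)
    \<Rightarrow> ('a \<Rightarrow> 'e \<Rightarrow> real) \<Rightarrow> ('a \<Rightarrow> 'e \<Rightarrow> 'e) \<Rightarrow> bool" where
  "contact_pair_on U h k M \<alpha> \<beta> \<phi> \<longleftrightarrow>
     smooth_form_on U M \<alpha> \<and> smooth_form_on U M \<beta> \<and> smooth_endo_on U M \<phi> \<and>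
     smooth_endo_on U M (pair_J M \<alpha> \<beta> \<phi>) \<and> smooth_endo_on U M (pair_T M \<alpha> \<beta> \<phi>) \<and>
     (\<forall>p\<in>U. contact_pair_at h k M \<alpha> \<beta> \<phi> p)"

lemma contact_pair_structureI:
  fixes M :: "('a, 'e::euclidean_space) manifold"
  assumes M: "smooth_manifold M" and "DIM('e) = 2 * h + 2 * k + 2" and C: "contact_pair_on (pts M) h k M \<alpha> \<beta> \<phi>"
  shows "contact_pair_structure h k M \<alpha> \<beta> \<phi>"
  using assms
  by (simp add: contact_pair_structure_def contact_pair_def contact_pair_on_def contact_pair_at_def
      nowhere_zero_def smooth_form_iff[OF M] smooth_endo_iff[OF M])

lemma contact_pair_on_subset:
  assumes "contact_pair_on U h k M \<alpha> \<beta> \<phi>" "V \<subseteq> U"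
  shows "contact_pair_on V h k M \<alpha> \<beta> \<phi>"
  using assms by (auto simp: contact_pair_on_def intro: smooth_form_on_subset smooth_endo_on_subset)

lemma contact_pair_on_local:
  assumes M: "smooth_manifold M"
    and l: "\<And>p. p \<in> U \<Longrightarrow> \<exists>W. openin (mtop M) W \<and> p \<in> W \<and> contact_pair_on W h k M \<alpha> \<beta> \<phi>"
  shows "contact_pair_on U h k M \<alpha> \<beta> \<phi>"
  unfolding contact_pair_on_def
proof (intro conjI ballI)
  show "smooth_form_on U M \<alpha>" "smooth_form_on U M \<beta>"
    by (rule smooth_form_on_local[OF M], use l contact_pair_on_def in metis)+
  show "smooth_endo_on U M \<phi>" "smooth_endo_on U M (pair_J M \<alpha> \<beta> \<phi>)" "smooth_endo_on U M (pair_T M \<alpha> \<beta> \<phi>)"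
    by (rule smooth_endo_on_local[OF M], use l contact_pair_on_def in metis)+
  show "contact_pair_at h k M \<alpha> \<beta> \<phi> p" if "p \<in> U" for p
    using l[OF that] contact_pair_on_def by metis
qed

lemma bij_ex1:
  assumes "bij L"
  shows "(\<exists>!z. P (L z)) \<longleftrightarrow> (\<exists>!z. P z)"
proof
  assume "\<exists>!z. P (L z)"
  then obtain z where z: "P (L z)" "\<And>y. P (L y) \<Longrightarrow> y = z" by blast
  show "\<exists>!z. P z"
  proof (rule ex1I[of P, OF z(1)])
    fix w assume "P w"
    moreover obtain y where "w = L y" using bij_is_surj[OF assms] by (metis surjD)
    ultimately show "w = L z" using z(2) by simp
  qed
next
  assume "\<exists>!z. P z"
  then obtain w where w: "P w" "\<And>y. P y \<Longrightarrow> y = w" by blast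
  obtain y where y: "w = L y" using bij_is_surj[OF assms] by (metis surjD)
  show "\<exists>!z. P (L z)"
  proof (rule ex1I[of _ y])
    show "P (L y)" using w(1) y by simp
    fix z assume "P (L z)"
    then have "L z = L y" using w(2) y by simp
    then show "z = y" by (rule injD[OF bij_is_inj[OF assms]])
  qed
qed

text \<open>The four Reeb conditions are natural under the bijective tangent map. Unique solvability
  therefore transfers, and with it each definite description satisfies the conditions that identify
  its counterpart.\<close>

lemma reeb_vf_transfer:
  assumes D: "diffeo_pair M N U V f g"
    and s: "smooth_form_on V N \<beta>1" "smooth_form_on V N \<beta>2"
    and r1: "\<And>x v. x \<in> U \<Longrightarrow> \<alpha>1 x v = \<beta>1 (f x) (tangent_map M N f x v)"
    and r2: "\<And>x v. x \<in> U \<Longrightarrow> \<alpha>2 x v = \<beta>2 (f x) (tangent_map M N f x v)"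
    and x: "x \<in> U"
  shows "(\<exists>!z. reeb_cond M \<alpha>1 \<alpha>2 x z) \<longleftrightarrow> (\<exists>!z. reeb_cond N \<beta>1 \<beta>2 (f x) z)"
    and "\<exists>!z. reeb_cond M \<alpha>1 \<alpha>2 x z \<Longrightarrow> reeb_vf N \<beta>1 \<beta>2 (f x) = tangent_map M N f x (reeb_vf M \<alpha>1 \<alpha>2 x)"
proof -
  have M: "smooth_manifold M" and N: "smooth_manifold N"
    and f: "smooth_map_on U M N f" and V: "openin (mtop N) V" "f ` U \<subseteq> V"
    using D smooth_map_on_open by (auto simp: diffeo_pair_def)
  let ?L = "tangent_map M N f x"
  have bij: "bij ?L" by (rule diffeo_pair_tangent_map(3)[OF D x])
  have e1: "ext_deriv M \<alpha>1 x u v = ext_deriv N \<beta>1 (f x) (?L u) (?L v)" for u v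
    by (rule ext_deriv_pullback[OF M N f V s(1) r1 x])
  have e2: "ext_deriv M \<alpha>2 x u v = ext_deriv N \<beta>2 (f x) (?L u) (?L v)" for u v
    by (rule ext_deriv_pullback[OF M N f V s(2) r2 x])
  have surj: "(\<forall>v. P (?L v)) \<longleftrightarrow> (\<forall>w. P w)" for P
    using bij by (metis bij_pointE)
  have ex1: "(\<exists>!z. P (?L z)) \<longleftrightarrow> (\<exists>!z. P z)" for P
    by (rule bij_ex1[OF bij])
  have eq: "reeb_cond M \<alpha>1 \<alpha>2 x z \<longleftrightarrow> reeb_cond N \<beta>1 \<beta>2 (f x) (?L z)" for z
    unfolding reeb_cond_def e1 e2 r1[OF x] r2[OF x]
    using surj[of "\<lambda>w. ext_deriv N \<beta>1 (f x) (?L z) w = 0"] surj[of "\<lambda>w. ext_deriv N \<beta>2 (f x) (?L z) w = 0"]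
    by simp
  show "(\<exists>!z. reeb_cond M \<alpha>1 \<alpha>2 x z) \<longleftrightarrow> (\<exists>!z. reeb_cond N \<beta>1 \<beta>2 (f x) z)"
    unfolding eq by (rule ex1)
  assume ex: "\<exists>!z. reeb_cond M \<alpha>1 \<alpha>2 x z"
  then have "reeb_cond M \<alpha>1 \<alpha>2 x (reeb_vf M \<alpha>1 \<alpha>2 x)"
    unfolding reeb_vf_eq by (rule theI')
  then have 1: "reeb_cond N \<beta>1 \<beta>2 (f x) (?L (reeb_vf M \<alpha>1 \<alpha>2 x))" by (simp add: eq)
  moreover have "\<exists>!z. reeb_cond N \<beta>1 \<beta>2 (f x) z"
    using ex unfolding eq by (simp only: ex1)
  ultimately show "reeb_vf N \<beta>1 \<beta>2 (f x) = ?L (reeb_vf M \<alpha>1 \<alpha>2 x)"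
    unfolding reeb_vf_eq[of N] by (rule the1_equality[rotated])
qed

lemma pair_structures_related:
  assumes lin: "linear L"
    and "\<beta>1 y (L v) = \<alpha>1 x v" "\<beta>2 y (L v) = \<alpha>2 x v" "L (\<phi> x v) = \<psi> y (L v)"
    and "reeb_vf N \<beta>1 \<beta>2 y = L (reeb_vf M \<alpha>1 \<alpha>2 x)" "reeb_vf N \<beta>2 \<beta>1 y = L (reeb_vf M \<alpha>2 \<alpha>1 x)"
  shows "L (pair_J M \<alpha>1 \<alpha>2 \<phi> x v) = pair_J N \<beta>1 \<beta>2 \<psi> y (L v)"
    and "L (pair_T M \<alpha>1 \<alpha>2 \<phi> x v) = pair_T N \<beta>1 \<beta>2 \<psi> y (L v)"
  using assms(2-)
  by (simp_all add: pair_J_def pair_T_def linear_add[OF lin] linear_diff[OF lin] linear_scale[OF lin])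

text \<open>Pullback along one diffeomorphism: the forms and their wedge powers are natural, and
  identities between vectors are checked after applying the injective tangent map.\<close>

lemma contact_pair_on_transfer:
  assumes D: "diffeo_pair M N U V f g" and C: "contact_pair_on V h k N \<beta>1 \<beta>2 \<psi>"
    and r1: "\<And>x v. x \<in> U \<Longrightarrow> \<alpha>1 x v = \<beta>1 (f x) (tangent_map M N f x v)"
    and r2: "\<And>x v. x \<in> U \<Longrightarrow> \<alpha>2 x v = \<beta>2 (f x) (tangent_map M N f x v)"
    and r3: "\<And>x v. x \<in> U \<Longrightarrow> tangent_map M N f x (\<phi> x v) = \<psi> (f x) (tangent_map M N f x v)"
  shows "contact_pair_on U h k M \<alpha>1 \<alpha>2 \<phi>"
proof -
  have M: "smooth_manifold M" and N: "smooth_manifold N"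
    and f: "smooth_map_on U M N f" and V: "openin (mtop N) V" "f ` U \<subseteq> V"
    using D smooth_map_on_open by (auto simp: diffeo_pair_def)
  have s: "smooth_form_on V N \<beta>1" "smooth_form_on V N \<beta>2" and sp: "smooth_endo_on V N \<psi>"
    "smooth_endo_on V N (pair_J N \<beta>1 \<beta>2 \<psi>)" "smooth_endo_on V N (pair_T N \<beta>1 \<beta>2 \<psi>)"
    using C by (auto simp: contact_pair_on_def)
  note lin = diffeo_pair_tangent_map(2)[OF D]
  have C': "(\<exists>v. wedge (2 * h + 1) (2 * k + 1) (contact_volume h N \<beta>1 p) (contact_volume k N \<beta>2 p) v \<noteq> 0)"
        "(\<forall>v. wedge_power 2 (dform N \<beta>1 p) (h + 1) v = 0)"
        "(\<forall>v. wedge_power 2 (dform N \<beta>2 p) (k + 1) v = 0)"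
        "(\<exists>!z. reeb_cond N \<beta>1 \<beta>2 p z)" "(\<exists>!z. reeb_cond N \<beta>2 \<beta>1 p z)"
        "(\<forall>v. \<psi> p (\<psi> p v) = - v + \<beta>1 p v *\<^sub>R reeb_vf N \<beta>1 \<beta>2 p + \<beta>2 p v *\<^sub>R reeb_vf N \<beta>2 \<beta>1 p)"
        "\<psi> p (reeb_vf N \<beta>1 \<beta>2 p) = 0" "\<psi> p (reeb_vf N \<beta>2 \<beta>1 p) = 0" if "p \<in> V" for p
    using C that by (simp_all add: contact_pair_on_def contact_pair_at_def)
  have fV: "f x \<in> V" if "x \<in> U" for x using V that by auto
  have ex: "\<exists>!z. reeb_cond M \<alpha>1 \<alpha>2 x z" "\<exists>!z. reeb_cond M \<alpha>2 \<alpha>1 x z" if "x \<in> U" for x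
  proof -
    show "\<exists>!z. reeb_cond M \<alpha>1 \<alpha>2 x z"
      by (rule iffD2[OF reeb_vf_transfer(1)[OF D s r1 r2 that] C'(4)[OF fV[OF that]]])
    show "\<exists>!z. reeb_cond M \<alpha>2 \<alpha>1 x z"
      by (rule iffD2[OF reeb_vf_transfer(1)[OF D s(2,1) r2 r1 that] C'(5)[OF fV[OF that]]])
  qed
  have rb: "reeb_vf N \<beta>1 \<beta>2 (f x) = tangent_map M N f x (reeb_vf M \<alpha>1 \<alpha>2 x)"
    "reeb_vf N \<beta>2 \<beta>1 (f x) = tangent_map M N f x (reeb_vf M \<alpha>2 \<alpha>1 x)" if "x \<in> U" for x
  proof -
    show "reeb_vf N \<beta>1 \<beta>2 (f x) = tangent_map M N f x (reeb_vf M \<alpha>1 \<alpha>2 x)"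
      by (rule reeb_vf_transfer(2)[OF D s r1 r2 that ex(1)[OF that]])
    show "reeb_vf N \<beta>2 \<beta>1 (f x) = tangent_map M N f x (reeb_vf M \<alpha>2 \<alpha>1 x)"
      by (rule reeb_vf_transfer(2)[OF D s(2,1) r2 r1 that ex(2)[OF that]])
  qed
  have JT: "tangent_map M N f x (pair_J M \<alpha>1 \<alpha>2 \<phi> x v) = pair_J N \<beta>1 \<beta>2 \<psi> (f x) (tangent_map M N f x v)"
    "tangent_map M N f x (pair_T M \<alpha>1 \<alpha>2 \<phi> x v) = pair_T N \<beta>1 \<beta>2 \<psi> (f x) (tangent_map M N f x v)"
    if "x \<in> U" for x v
    by (rule pair_structures_related[where L = "tangent_map M N f x"];
        simp add: lin[OF that] rb[OF that] r1[OF that] r2[OF that] r3[OF that])+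
  have pt: "contact_pair_at h k M \<alpha>1 \<alpha>2 \<phi> x" if x: "x \<in> U" for x
    unfolding contact_pair_at_def
  proof (intro conjI allI)
    let ?L = "tangent_map M N f x"
    have bij: "bij ?L" by (rule diffeo_pair_tangent_map(3)[OF D x])
    note l = lin[OF x]
    have e1: "ext_deriv M \<alpha>1 x u v = ext_deriv N \<beta>1 (f x) (?L u) (?L v)" for u v
    by (rule ext_deriv_pullback[OF M N f V s(1) r1 x])
  have e2: "ext_deriv M \<alpha>2 x u v = ext_deriv N \<beta>2 (f x) (?L u) (?L v)" for u v
    by (rule ext_deriv_pullback[OF M N f V s(2) r2 x])
    note v1 = contact_volume_pullback[OF r1[OF x] e1] and v2 = contact_volume_pullback[OF r2[OF x] e2]
    have w: "contact_volume h M \<alpha>1 x = (\<lambda>v. contact_volume h N \<beta>1 (f x) (\<lambda>i. ?L (v i)))"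
      "contact_volume k M \<alpha>2 x = (\<lambda>v. contact_volume k N \<beta>2 (f x) (\<lambda>i. ?L (v i)))"
      using v1 v2 by blast+
    obtain u where u: "wedge (2 * h + 1) (2 * k + 1) (contact_volume h N \<beta>1 (f x)) (contact_volume k N \<beta>2 (f x)) u \<noteq> 0"
      using C'(1)[OF fV[OF x]] by blast
    \<comment> \<open>The nonzero value at \<open>u\<close> is attained on \<open>M\<close> at the
      preimages of the vectors \<open>u i\<close> under the tangent map.\<close>
    have "(\<lambda>i. ?L (inv_into UNIV ?L (u i))) = u"
      using bij by (simp add: bij_is_surj surj_f_inv_f)
    then have "wedge (2 * h + 1) (2 * k + 1) (contact_volume h M \<alpha>1 x) (contact_volume k M \<alpha>2 x) (\<lambda>i. inv_into UNIV ?L (u i)) \<noteq> 0"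
      unfolding w wedge_pullback using u by simp
    then show "\<exists>v. wedge (2 * h + 1) (2 * k + 1) (contact_volume h M \<alpha>1 x) (contact_volume k M \<alpha>2 x) v \<noteq> 0"
      by blast
    show "wedge_power 2 (dform M \<alpha>1 x) (h + 1) v = 0" "wedge_power 2 (dform M \<alpha>2 x) (k + 1) v = 0" for v
      unfolding v1(2) v2(2) using C'(2,3)[OF fV[OF x]] by blast+
    show "\<exists>!z. reeb_cond M \<alpha>1 \<alpha>2 x z" "\<exists>!z. reeb_cond M \<alpha>2 \<alpha>1 x z" by (rule ex[OF x])+
    have inj: "?L a = ?L b \<Longrightarrow> a = b" for a b using bij by (metis bij_def injD)
    show "\<phi> x (\<phi> x v) = - v + \<alpha>1 x v *\<^sub>R reeb_vf M \<alpha>1 \<alpha>2 x + \<alpha>2 x v *\<^sub>R reeb_vf M \<alpha>2 \<alpha>1 x" for v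
      by (rule inj) (use C'(6)[OF fV[OF x]] in \<open>simp add: r3[OF x] linear_add[OF l] linear_neg[OF l] linear_diff[OF l] linear_scale[OF l]
        rb[OF x] r1[OF x] r2[OF x]\<close>)
    show "\<phi> x (reeb_vf M \<alpha>1 \<alpha>2 x) = 0" "\<phi> x (reeb_vf M \<alpha>2 \<alpha>1 x) = 0"
      by (rule inj, use C'(7,8)[OF fV[OF x]] in \<open>simp add: r3[OF x] linear_0[OF l] rb[OF x]\<close>)+
  qed
  have "smooth_form_on U M \<alpha>1" "smooth_form_on U M \<alpha>2"
    by (rule smooth_form_on_pullback[OF M N f V s(1) lin r1], assumption+)
      (rule smooth_form_on_pullback[OF M N f V s(2) lin r2], assumption+)
  moreover have "smooth_endo_on U M \<phi>" "smooth_endo_on U M (pair_J M \<alpha>1 \<alpha>2 \<phi>)"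
    "smooth_endo_on U M (pair_T M \<alpha>1 \<alpha>2 \<phi>)"
    by (rule smooth_endo_on_related[OF D sp(1) r3] smooth_endo_on_related[OF D sp(2) JT(1)]
      smooth_endo_on_related[OF D sp(3) JT(2)], assumption)+
  ultimately show ?thesis
    using pt by (simp add: contact_pair_on_def)
qed

text \<open>Reverses the relations, so that \<open>contact_pair_on_transfer\<close> can be used for
  the inverse map \<open>g\<close> as well.\<close>

lemma diffeo_pair_rel_sym:
  assumes D: "diffeo_pair M N U V f g" and y: "y \<in> V"
  shows "(\<And>x v. x \<in> U \<Longrightarrow> \<alpha> x v = \<beta> (f x) (tangent_map M N f x v)) \<Longrightarrow> \<beta> y w = \<alpha> (g y) (tangent_map N M g y w)"
    and "(\<And>x v. x \<in> U \<Longrightarrow> tangent_map M N f x (\<phi> x v) = \<psi> (f x) (tangent_map M N f x v)) \<Longrightarrow>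
      tangent_map N M g y (\<psi> y w) = \<phi> (g y) (tangent_map N M g y w)"
proof -
  have gy: "g y \<in> U" "f (g y) = y" using D y by (auto simp: diffeo_pair_def)
  have fg: "tangent_map M N f (g y) (tangent_map N M g y w) = w" for w
    using diffeo_pair_tangent_map(1)[OF diffeo_pair_sym[OF D] y] .
  have gf: "tangent_map N M g y (tangent_map M N f (g y) w) = w" for w
    using diffeo_pair_tangent_map(1)[OF D gy(1)] gy(2) by simp
  show "\<beta> y w = \<alpha> (g y) (tangent_map N M g y w)"
    if "\<And>x v. x \<in> U \<Longrightarrow> \<alpha> x v = \<beta> (f x) (tangent_map M N f x v)"
    using that[OF gy(1), of "tangent_map N M g y w"] by (simp add: gy fg)
  show "tangent_map N M g y (\<psi> y w) = \<phi> (g y) (tangent_map N M g y w)"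
    if "\<And>x v. x \<in> U \<Longrightarrow> tangent_map M N f x (\<phi> x v) = \<psi> (f x) (tangent_map M N f x v)"
    using arg_cong[OF that[OF gy(1), of "tangent_map N M g y w"], of "tangent_map N M g y"] by (simp add: gy fg gf)
qed

text \<open>The tangent map is a linear bijection intertwining the two tensors, so they vanish
  together at \<open>x\<close> and \<open>f x\<close>; surjectivity of \<open>f\<close> reaches
  every point of \<open>N\<close>.\<close>

lemma nijenhuis_vanish_related:
  assumes M: "smooth_manifold M" and N: "smooth_manifold N" and f: "local_diffeo M N f" "f ` pts M = pts N"
    and J: "smooth_endo M J" and K: "smooth_endo N K"
    and r: "\<And>x v. x \<in> pts M \<Longrightarrow> tangent_map M N f x (J x v) = K (f x) (tangent_map M N f x v)"
  shows "integrable_structure M J \<longleftrightarrow> integrable_structure N K"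
proof -
  have pt: "(\<forall>u v. nijenhuis_at M J x u v = 0) \<longleftrightarrow> (\<forall>u v. nijenhuis_at N K (f x) u v = 0)"
    if x: "x \<in> pts M" for x
  proof -
    obtain U where U: "x \<in> U" and D: "diffeo_pair M N U (f ` U) f (inv_into U f)"
      using local_diffeo_pair[OF M N f(1) x] by blast
    have sub: "U \<subseteq> pts M" "f ` U \<subseteq> pts N"
      using diffeo_pair_pts[OF D] by auto
    have JU: "smooth_endo_on U M J" "smooth_endo_on (f ` U) N K"
      using J K sub smooth_endo_on_subset unfolding smooth_endo_iff[OF M] smooth_endo_iff[OF N] by blast+
    let ?L = "tangent_map M N f x"
    have bij: "bij ?L" and lin: "linear ?L" using diffeo_pair_tangent_map[OF D U] by auto
    have "?L (nijenhuis_at M J x u v) = nijenhuis_at N K (f x) (?L u) (?L v)" for u v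
      by (rule nijenhuis_at_related[OF D JU r U]) (use sub in auto)
    moreover have "?L w = 0 \<longleftrightarrow> w = 0" for w
      using bij linear_0[OF lin] by (metis bij_def injD)
    ultimately have "(\<forall>u v. nijenhuis_at M J x u v = 0) \<longleftrightarrow> (\<forall>u v. nijenhuis_at N K (f x) (?L u) (?L v) = 0)"
      by metis
    also have "\<dots> \<longleftrightarrow> (\<forall>u v. nijenhuis_at N K (f x) u v = 0)"
      using bij by (metis bij_pointE)
    finally show ?thesis .
  qed
  show ?thesis
    unfolding integrable_structure_iff[OF M J] integrable_structure_iff[OF N K] f(2)[symmetric]
    using pt by blast
qed

text \<open>All conditions are local, so they pass from \<open>N\<close> to \<open>M\<close> along
  restrictions of \<open>f\<close> and from \<open>M\<close> to \<open>N\<close> along the inverses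
  of these restrictions. As the Reeb fields correspond, \<open>pair_J\<close> and
  \<open>pair_T\<close> do too.\<close>

lemma contact_pair_on_related:
  assumes M: "smooth_manifold M" and N: "smooth_manifold N" and f: "local_diffeo M N f" "f ` pts M = pts N"
    and r1: "\<And>x v. x \<in> pts M \<Longrightarrow> \<alpha>1 x v = \<beta>1 (f x) (tangent_map M N f x v)"
    and r2: "\<And>x v. x \<in> pts M \<Longrightarrow> \<alpha>2 x v = \<beta>2 (f x) (tangent_map M N f x v)"
    and r3: "\<And>x v. x \<in> pts M \<Longrightarrow> tangent_map M N f x (\<phi> x v) = \<psi> (f x) (tangent_map M N f x v)"
  shows "contact_pair_on (pts M) h k M \<alpha>1 \<alpha>2 \<phi> \<longleftrightarrow> contact_pair_on (pts N) h k N \<beta>1 \<beta>2 \<psi>"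
    and "contact_pair_on (pts N) h k N \<beta>1 \<beta>2 \<psi> \<Longrightarrow>
      integrable_structure M (pair_J M \<alpha>1 \<alpha>2 \<phi>) \<longleftrightarrow> integrable_structure N (pair_J N \<beta>1 \<beta>2 \<psi>)"
    and "contact_pair_on (pts N) h k N \<beta>1 \<beta>2 \<psi> \<Longrightarrow>
      integrable_structure M (pair_T M \<alpha>1 \<alpha>2 \<phi>) \<longleftrightarrow> integrable_structure N (pair_T N \<beta>1 \<beta>2 \<psi>)"
proof -
  have loc: "\<exists>U. x \<in> U \<and> U \<subseteq> pts M \<and> f ` U \<subseteq> pts N \<and> diffeo_pair M N U (f ` U) f (inv_into U f)"
    if "x \<in> pts M" for x
    using local_diffeo_pair[OF M N f(1) that] diffeo_pair_pts by (metis image_subsetI subsetI)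
  show iff: "contact_pair_on (pts M) h k M \<alpha>1 \<alpha>2 \<phi> \<longleftrightarrow> contact_pair_on (pts N) h k N \<beta>1 \<beta>2 \<psi>"
  proof
    assume C: "contact_pair_on (pts N) h k N \<beta>1 \<beta>2 \<psi>"
    show "contact_pair_on (pts M) h k M \<alpha>1 \<alpha>2 \<phi>"
    proof (rule contact_pair_on_local[OF M])
      fix x assume "x \<in> pts M"
      then obtain U where U: "x \<in> U" "U \<subseteq> pts M" "f ` U \<subseteq> pts N" and D: "diffeo_pair M N U (f ` U) f (inv_into U f)"
        using loc by blast
      have "contact_pair_on U h k M \<alpha>1 \<alpha>2 \<phi>"
        by (rule contact_pair_on_transfer[OF D contact_pair_on_subset[OF C U(3)]]) (use U r1 r2 r3 in auto)
      moreover have "openin (mtop M) U" using D by (auto simp: diffeo_pair_def smooth_map_on_open)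
      ultimately show "\<exists>W. openin (mtop M) W \<and> x \<in> W \<and> contact_pair_on W h k M \<alpha>1 \<alpha>2 \<phi>"
        using U by blast
    qed
  next
    assume C: "contact_pair_on (pts M) h k M \<alpha>1 \<alpha>2 \<phi>"
    show "contact_pair_on (pts N) h k N \<beta>1 \<beta>2 \<psi>"
    proof (rule contact_pair_on_local[OF N])
      fix y assume "y \<in> pts N"
      then obtain x where x: "x \<in> pts M" "y = f x" using f(2) by blast
      then obtain U where U: "x \<in> U" "U \<subseteq> pts M" "f ` U \<subseteq> pts N" and D: "diffeo_pair M N U (f ` U) f (inv_into U f)"
        using loc by blast
      have "contact_pair_on (f ` U) h k N \<beta>1 \<beta>2 \<psi>"
      proof (rule contact_pair_on_transfer[OF diffeo_pair_sym[OF D] contact_pair_on_subset[OF C U(2)]])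
        fix z w assume z: "z \<in> f ` U"
        show "\<beta>1 z w = \<alpha>1 (inv_into U f z) (tangent_map N M (inv_into U f) z w)"
          by (rule diffeo_pair_rel_sym(1)[OF D z]) (use r1 U in auto)
        show "\<beta>2 z w = \<alpha>2 (inv_into U f z) (tangent_map N M (inv_into U f) z w)"
          by (rule diffeo_pair_rel_sym(1)[OF D z]) (use r2 U in auto)
        show "tangent_map N M (inv_into U f) z (\<psi> z w) = \<phi> (inv_into U f z) (tangent_map N M (inv_into U f) z w)"
          by (rule diffeo_pair_rel_sym(2)[OF D z]) (use r3 U in auto)
      qed
      moreover have "openin (mtop N) (f ` U)" using D by (auto simp: diffeo_pair_def smooth_map_on_open)
      ultimately show "\<exists>W. openin (mtop N) W \<and> y \<in> W \<and> contact_pair_on W h k N \<beta>1 \<beta>2 \<psi>"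
        using U x by blast
    qed
  qed
  assume CN: "contact_pair_on (pts N) h k N \<beta>1 \<beta>2 \<psi>"
  then have CM: "contact_pair_on (pts M) h k M \<alpha>1 \<alpha>2 \<phi>" by (simp add: iff)
  have JT: "tangent_map M N f x (pair_J M \<alpha>1 \<alpha>2 \<phi> x v) = pair_J N \<beta>1 \<beta>2 \<psi> (f x) (tangent_map M N f x v)"
    "tangent_map M N f x (pair_T M \<alpha>1 \<alpha>2 \<phi> x v) = pair_T N \<beta>1 \<beta>2 \<psi> (f x) (tangent_map M N f x v)"
    if x: "x \<in> pts M" for x v
  proof -
    obtain U where U: "x \<in> U" "U \<subseteq> pts M" "f ` U \<subseteq> pts N" and D: "diffeo_pair M N U (f ` U) f (inv_into U f)"
      using loc[OF x] by blast
    have s: "smooth_form_on (f ` U) N \<beta>1" "smooth_form_on (f ` U) N \<beta>2"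
      using CN U(3) by (auto simp: contact_pair_on_def intro: smooth_form_on_subset)
    have ex: "\<exists>!z. reeb_cond M \<alpha>1 \<alpha>2 x z" "\<exists>!z. reeb_cond M \<alpha>2 \<alpha>1 x z"
      using CM x by (simp_all add: contact_pair_on_def contact_pair_at_def)
    have rb: "reeb_vf N \<beta>1 \<beta>2 (f x) = tangent_map M N f x (reeb_vf M \<alpha>1 \<alpha>2 x)"
      "reeb_vf N \<beta>2 \<beta>1 (f x) = tangent_map M N f x (reeb_vf M \<alpha>2 \<alpha>1 x)"
      by (rule reeb_vf_transfer(2)[OF D s _ _ U(1) ex(1)] reeb_vf_transfer(2)[OF D s(2,1) _ _ U(1) ex(2)];
          use r1 r2 U in auto)+
    show "tangent_map M N f x (pair_J M \<alpha>1 \<alpha>2 \<phi> x v) = pair_J N \<beta>1 \<beta>2 \<psi> (f x) (tangent_map M N f x v)"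
      "tangent_map M N f x (pair_T M \<alpha>1 \<alpha>2 \<phi> x v) = pair_T N \<beta>1 \<beta>2 \<psi> (f x) (tangent_map M N f x v)"
      by (rule pair_structures_related[where L = "tangent_map M N f x"];
          simp add: diffeo_pair_tangent_map(2)[OF D U(1)] rb r1[OF x] r2[OF x] r3[OF x])+
  qed
  have e: "smooth_endo M (pair_J M \<alpha>1 \<alpha>2 \<phi>)" "smooth_endo M (pair_T M \<alpha>1 \<alpha>2 \<phi>)"
    "smooth_endo N (pair_J N \<beta>1 \<beta>2 \<psi>)" "smooth_endo N (pair_T N \<beta>1 \<beta>2 \<psi>)"
    using CM CN by (simp_all add: contact_pair_on_def smooth_endo_iff[OF M] smooth_endo_iff[OF N])
  show "integrable_structure M (pair_J M \<alpha>1 \<alpha>2 \<phi>) \<longleftrightarrow> integrable_structure N (pair_J N \<beta>1 \<beta>2 \<psi>)"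
    by (rule nijenhuis_vanish_related[OF M N f e(1,3) JT(1)])
  show "integrable_structure M (pair_T M \<alpha>1 \<alpha>2 \<phi>) \<longleftrightarrow> integrable_structure N (pair_T N \<beta>1 \<beta>2 \<psi>)"
    by (rule nijenhuis_vanish_related[OF M N f e(2,4) JT(2)])
qed

section \<open>Products of contact manifolds\<close>

text \<open>One operator for four uses: on a product of contact manifolds s = 1 gives
  \<open>pair_J\<close>, s = -1 gives \<open>pair_T\<close> and s = 0 the direct sum; s = 1 with the
  real line as second factor gives \<open>cylinder_structure\<close>.\<close>

definition twisted_sum ::
  "real \<Rightarrow> ('a \<Rightarrow> 'e \<Rightarrow> real) \<Rightarrow> ('a \<Rightarrow> 'e::real_vector) \<Rightarrow> ('a \<Rightarrow> 'e \<Rightarrow> 'e)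
    \<Rightarrow> ('b \<Rightarrow> 'g \<Rightarrow> real) \<Rightarrow> ('b \<Rightarrow> 'g::real_vector) \<Rightarrow> ('b \<Rightarrow> 'g \<Rightarrow> 'g) \<Rightarrow> 'a \<times> 'b \<Rightarrow> 'e \<times> 'g \<Rightarrow> 'e \<times> 'g" where
  "twisted_sum s \<alpha> Z \<phi> \<beta> W \<psi> z w =
     (\<phi> (fst z) (fst w) - (s * \<beta> (snd z) (snd w)) *\<^sub>R Z (fst z),
      \<psi> (snd z) (snd w) + (s * \<alpha> (fst z) (fst w)) *\<^sub>R W (snd z))"

lemma endo_rep_twisted_sum:
  assumes M: "smooth_manifold M" "c \<in> atlas M" and N: "smooth_manifold N" "d \<in> atlas N"
    and z: "z \<in> (snd c ` fst c) \<times> (snd d ` fst d)"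
  shows "endo_rep (prod_manifold M N) (prod_chart c d) (twisted_sum s \<alpha> Z \<phi> \<beta> W \<psi>) z w =
    (endo_rep M c \<phi> (fst z) (fst w) - (s * form_rep N d \<beta> (snd z) (snd w)) *\<^sub>R vf_rep M c Z (fst z),
     endo_rep N d \<psi> (snd z) (snd w) + (s * form_rep M c \<alpha> (fst z) (fst w)) *\<^sub>R vf_rep N d W (snd z))"
proof -
  obtain a b u v where zw: "z = (a, b)" "w = (u, v)" by fastforce
  have i: "chart_inv (prod_chart c d) (a, b) = (chart_inv c a, chart_inv d b)"
    using chart_inv_prod_chart[OF M N, of "(a, b)"] z zw by auto
  have m: "chart_inv c a \<in> fst c" "chart_inv d b \<in> fst d" using z zw M N by auto
  note l = to_of_chart(3)[OF M m(1)] to_of_chart(3)[OF N m(2)]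
  show ?thesis
    by (simp add: zw endo_rep_def i to_chart_prod[OF M N m] twisted_sum_def form_rep_def vf_rep_def
        linear_diff[OF l(1)] linear_add[OF l(2)] linear_scale[OF l(1)] linear_scale[OF l(2)])
qed

lemma smooth_vf_rep:
  "smooth_manifold M \<Longrightarrow> smooth_vf_on (pts M) M Z \<Longrightarrow> c \<in> atlas M \<Longrightarrow> smooth_on (snd c ` fst c) (vf_rep M c Z)"
  unfolding smooth_vf_on_def using chart_subset by (metis Int_absorb1)

lemma smooth_endo_twisted_sum:
  fixes M :: "('a, 'e::euclidean_space) manifold" and N :: "('b, 'g::euclidean_space) manifold"
  assumes M: "smooth_manifold M" and N: "smooth_manifold N"
    and 1: "smooth_form M \<alpha>" "smooth_vf_on (pts M) M Z" "smooth_endo M \<phi>"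
    and 2: "smooth_form N \<beta>" "smooth_vf_on (pts N) N W" "smooth_endo N \<psi>"
  shows "smooth_endo (prod_manifold M N) (twisted_sum s \<alpha> Z \<phi> \<beta> W \<psi>)"
  unfolding smooth_endo_def
proof (intro conjI ballI allI)
  fix z assume "z \<in> pts (prod_manifold M N)"
  then have "linear (\<phi> (fst z))" "linear (\<alpha> (fst z))" "linear (\<psi> (snd z))" "linear (\<beta> (snd z))"
    using 1 2 by (auto simp: smooth_endo_def smooth_form_def)
  then show "linear (twisted_sum s \<alpha> Z \<phi> \<beta> W \<psi> z)"
    unfolding twisted_sum_def[abs_def]
    by (intro linearI) (simp_all add: linear_add linear_scale algebra_simps)
next
  fix e and w :: "'e \<times> 'g" assume "e \<in> atlas (prod_manifold M N)"
  then obtain c d where e: "e = prod_chart c d" and c: "c \<in> atlas M" and d: "d \<in> atlas N" by auto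
  obtain u v where w: "w = (u, v)" by fastforce
  let ?S = "snd c ` fst c" and ?T = "snd d ` fst d"
  have S: "open ?S" and T: "open ?T" using M N c d by (auto simp: smooth_manifold_def)
  note ST = open_Times[OF S T]
  have f: "smooth_on (?S \<times> ?T) (\<lambda>z. g (fst z))" if "smooth_on ?S g" for g :: "'e \<Rightarrow> 'x::euclidean_space"
    using smooth_on_compose[OF ST S _ smooth_on_bounded_linear[OF bounded_linear_fst] that]
    by (force simp: o_def)
  have f2: "smooth_on (?S \<times> ?T) (\<lambda>z. g (snd z))" if "smooth_on ?T g" for g :: "'g \<Rightarrow> 'x::euclidean_space"
    using smooth_on_compose[OF ST T _ smooth_on_bounded_linear[OF bounded_linear_snd] that]
    by (force simp: o_def)
  have reps: "smooth_on ?S (\<lambda>y. endo_rep M c \<phi> y u)" "smooth_on ?S (\<lambda>y. form_rep M c \<alpha> y u)"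
    "smooth_on ?S (vf_rep M c Z)" "smooth_on ?T (\<lambda>y. endo_rep N d \<psi> y v)"
    "smooth_on ?T (\<lambda>y. form_rep N d \<beta> y v)" "smooth_on ?T (vf_rep N d W)"
    using 1 2 c d smooth_vf_rep[OF M] smooth_vf_rep[OF N] by (auto simp: smooth_endo_def smooth_form_def)
  have m: "smooth_on (?S \<times> ?T) (\<lambda>z. r * g z)" if "smooth_on (?S \<times> ?T) g" for r and g :: "'e \<times> 'g \<Rightarrow> real"
    by (rule smooth_on_bilinear[OF ST bounded_bilinear_mult smooth_on_const that])
  have "smooth_on (?S \<times> ?T) (\<lambda>z.
    (endo_rep M c \<phi> (fst z) u + ((-s) * form_rep N d \<beta> (snd z) v) *\<^sub>R vf_rep M c Z (fst z),
     endo_rep N d \<psi> (snd z) v + (s * form_rep M c \<alpha> (fst z) u) *\<^sub>R vf_rep N d W (snd z)))"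
    by (intro smooth_on_Pair[OF ST] smooth_on_add[OF ST] smooth_on_scaleR[OF ST] m
        f[OF reps(1)] f[OF reps(2)] f[OF reps(3)] f2[OF reps(4)] f2[OF reps(5)] f2[OF reps(6)])
  moreover have "snd e ` fst e = ?S \<times> ?T" by (auto simp: e map_prod_def image_iff)
  ultimately show "smooth_on (snd e ` fst e) (\<lambda>x. endo_rep (prod_manifold M N) e (twisted_sum s \<alpha> Z \<phi> \<beta> W \<psi>) x w)"
    by (simp only:) (subst smooth_on_cong[OF ST], auto simp: e w endo_rep_twisted_sum[OF M c N d])
qed

definition normal_at ::
  "('a, 'e::euclidean_space) manifold \<Rightarrow> ('a \<Rightarrow> 'e \<Rightarrow> real) \<Rightarrow> ('a \<Rightarrow> 'e) \<Rightarrow> ('a \<Rightarrow> 'e \<Rightarrow> 'e) \<Rightarrow> 'a \<Rightarrow> bool" where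
  "normal_at M \<alpha> Z \<phi> p \<longleftrightarrow> (let c = chart_at M p; x = snd c p in
     normal_jet (endo_rep M c \<phi> x) (\<lambda>a u. fderiv (\<lambda>y. endo_rep M c \<phi> y u) x a)
       (form_rep M c \<alpha> x) (\<lambda>a u. fderiv (\<lambda>y. form_rep M c \<alpha> y u) x a)
       (vf_rep M c Z x) (fderiv (vf_rep M c Z) x))"

text \<open>Computing the third power of \<open>\<phi> p\<close> at \<open>u\<close> in two ways
  leaves \<open>\<alpha> p (\<phi> p u)\<close> times the nonzero vector \<open>Z p\<close>.\<close>

lemma almost_contact_form_endo:
  assumes "almost_contact_structure M \<alpha> Z \<phi>" "p \<in> pts M"
  shows "\<alpha> p (\<phi> p u) = 0"
proof -
  have lin: "linear (\<phi> p)" "linear (\<alpha> p)" and sq: "\<And>v. \<phi> p (\<phi> p v) = - v + \<alpha> p v *\<^sub>R Z p"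
    and Z: "\<phi> p (Z p) = 0" "\<alpha> p (Z p) = 1"
    using assms by (auto simp: almost_contact_structure_def smooth_form_def smooth_endo_def)
  have "\<phi> p (\<phi> p (\<phi> p u)) = - \<phi> p u"
    by (subst sq[of u]) (simp only: linear_add[OF lin(1)] linear_neg[OF lin(1)] linear_scale[OF lin(1)] Z, simp)
  then have "\<alpha> p (\<phi> p u) *\<^sub>R Z p = 0" using sq[of "\<phi> p u"] by simp
  moreover have "Z p \<noteq> 0" using Z(2) linear_0[OF lin(2)] by auto
  ultimately show ?thesis by simp
qed

text \<open>The algebraic identities hold on a whole chart domain, so \<phi>(Z) = 0, \<alpha>(Z) = 1
  and the vanishing of \<alpha> on the image of \<phi> may be differentiated by the product rule.
  The last condition of the jet is i_Z d\<alpha> = 0 at \<open>p\<close>.\<close>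

lemma contact_jet_at:
  assumes M: "smooth_manifold M" and A: "almost_contact_structure M \<alpha> Z \<phi>"
    and R: "\<And>v. ext_deriv M \<alpha> p (Z p) v = 0" and p: "p \<in> pts M"
  defines "c \<equiv> chart_at M p"
  shows "contact_jet (endo_rep M c \<phi> (snd c p)) (\<lambda>a u. fderiv (\<lambda>y. endo_rep M c \<phi> y u) (snd c p) a)
    (form_rep M c \<alpha> (snd c p)) (\<lambda>a u. fderiv (\<lambda>y. form_rep M c \<alpha> y u) (snd c p) a)
    (vf_rep M c Z (snd c p)) (fderiv (vf_rep M c Z) (snd c p))"
proof -
  have c: "c \<in> atlas M" "p \<in> fst c"
    using chart_at_atlas[OF M p] chart_at_mem[OF M p] by (auto simp: c_def)
  define x S where "x = snd c p" and "S = snd c ` fst c"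
  let ?E = "endo_rep M c \<phi>" and ?A = "form_rep M c \<alpha>" and ?Z = "vf_rep M c Z"
  have S: "open S" "x \<in> S" using M c by (auto simp: S_def x_def smooth_manifold_def)
  have A': "smooth_form M \<alpha>" "smooth_vf_on (pts M) M Z" "smooth_endo M \<phi>"
    using A by (auto simp: almost_contact_structure_def)
  have lE: "linear (?E y)" and lA: "linear (?A y)" if "y \<in> S" for y
  proof -
    have y: "y \<in> snd c ` (pts M \<inter> fst c)"
      using that chart_subset[OF M c(1)] by (auto simp: S_def)
    show "linear (?E y)" "linear (?A y)"
      using linear_endo_rep[OF M c(1) _ y] linear_form_rep[OF M c(1) _ y] A'
      by (auto simp: smooth_form_def smooth_endo_def)
  qed
  have dE: "(\<lambda>y. ?E y u) differentiable (at x)" and dA: "(\<lambda>y. ?A y u) differentiable (at x)"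
    and dZ: "?Z differentiable (at x)" for u
    by (rule smooth_on_differentiable[OF _ S(2)],
        use A' c smooth_vf_rep[OF M A'(2) c(1)] in \<open>simp add: S_def smooth_form_def smooth_endo_def\<close>)+
  have alg: "?E y (?E y u) = - u + ?A y u *\<^sub>R ?Z y" "?E y (?Z y) = 0" "?A y (?Z y) = 1" "?A y (?E y u) = 0"
    if "y \<in> S" for y u
  proof -
    have q: "chart_inv c y \<in> fst c" "chart_inv c y \<in> pts M"
      using that M c chart_subset[OF M c(1)] by (auto simp: S_def)
    note t = to_of_chart[OF M c(1) q(1)]
    show "?E y (?E y u) = - u + ?A y u *\<^sub>R ?Z y" "?E y (?Z y) = 0" "?A y (?Z y) = 1" "?A y (?E y u) = 0"
      using A q(2) almost_contact_form_endo[OF A q(2)]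
      by (simp_all add: endo_rep_def form_rep_def vf_rep_def t(1,2) almost_contact_structure_def
          linear_add[OF t(3)] linear_diff[OF t(3)] linear_scale[OF t(3)] linear_neg[OF t(3)] linear_0[OF t(3)])
  qed
  have d1: "fderiv (\<lambda>y. ?E y (?Z x)) x a + ?E x (fderiv ?Z x a) = 0" for a
  proof -
    have "fderiv (\<lambda>y. ?E y (?Z y)) x = fderiv (\<lambda>y. 0) x"
      by (rule fderiv_cong_open[OF S]) (rule alg(2))
    moreover have "fderiv (\<lambda>y. ?E y (?Z y)) x a = fderiv (\<lambda>y. ?E y (?Z x)) x a + ?E x (fderiv ?Z x a)"
      by (subst fderiv_apply[OF S dE lE dZ]) auto
    ultimately show ?thesis by simp
  qed
  have d2: "fderiv (\<lambda>y. ?A y (?Z x)) x a + ?A x (fderiv ?Z x a) = 0" for a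
  proof -
    have "fderiv (\<lambda>y. ?A y (?Z y)) x = fderiv (\<lambda>y. 1) x"
      by (rule fderiv_cong_open[OF S]) (rule alg(3))
    moreover have "fderiv (\<lambda>y. ?A y (?Z y)) x a = fderiv (\<lambda>y. ?A y (?Z x)) x a + ?A x (fderiv ?Z x a)"
      by (subst fderiv_apply[OF S dA lA dZ]) auto
    ultimately show ?thesis by simp
  qed
  have d3: "fderiv (\<lambda>y. ?A y (?E x u)) x a + ?A x (fderiv (\<lambda>y. ?E y u) x a) = 0" for a u
  proof -
    have "fderiv (\<lambda>y. ?A y (?E y u)) x = fderiv (\<lambda>y. 0) x"
      by (rule fderiv_cong_open[OF S]) (rule alg(4))
    moreover have "fderiv (\<lambda>y. ?A y (?E y u)) x a = fderiv (\<lambda>y. ?A y (?E x u)) x a + ?A x (fderiv (\<lambda>y. ?E y u) x a)"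
      by (subst fderiv_apply[OF S dA lA dE]) auto
    ultimately show ?thesis by simp
  qed
  have "chart_inv c x = p" using M c by (simp add: x_def)
  then have "?Z x = Z p" unfolding vf_rep_def using to_chart_at[OF M p] by (simp add: c_def)
  then have r: "fderiv (\<lambda>y. ?A y v) x (?Z x) = fderiv (\<lambda>y. ?A y (?Z x)) x v" for v
    using R[of v] by (simp add: ext_deriv_def Let_def x_def flip: c_def)
  show ?thesis
    unfolding contact_jet_def x_def[symmetric]
    using lE[OF S(2)] lA[OF S(2)] linear_fderiv[OF dE] linear_fderiv[OF dA] linear_fderiv[OF dZ]
      linear_fderiv_arg[OF S dE lE] linear_fderiv_arg[OF S dA lA] alg[OF S(2)] d1 d2 d3 r
    by simp
qed

text \<open>In a product chart the components of the twisted sum are products of components of the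
  factors in separate variables, so their derivative has exactly the shape of \<open>J'\<close> in
  \<open>nijenhuis_product_jet\<close>.\<close>

lemma nijenhuis_twisted_sum:
  fixes M :: "('a, 'e::euclidean_space) manifold" and N :: "('b, 'g::euclidean_space) manifold"
  assumes M: "smooth_manifold M" and A: "almost_contact_structure M \<alpha> Z \<phi>"
    and RM: "\<And>v. ext_deriv M \<alpha> p (Z p) v = 0" and p: "p \<in> pts M"
    and N: "smooth_manifold N" and B: "almost_contact_structure N \<beta> W \<psi>"
    and RN: "\<And>v. ext_deriv N \<beta> q (W q) v = 0" and q: "q \<in> pts N" and s: "s * s = 1"
  shows "(\<forall>\<xi> \<eta>. nijenhuis_at (prod_manifold M N) (twisted_sum s \<alpha> Z \<phi> \<beta> W \<psi>) (p, q) \<xi> \<eta> = 0) \<longleftrightarrow>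
    normal_at M \<alpha> Z \<phi> p \<and> normal_at N \<beta> W \<psi> q"
proof -
  define c x where "c = chart_at M p" and "x = snd c p"
  define d y where "d = chart_at N q" and "y = snd d q"
  have c: "c \<in> atlas M" "p \<in> fst c" and d: "d \<in> atlas N" "q \<in> fst d"
    using chart_at_atlas[OF M p] chart_at_mem[OF M p] chart_at_atlas[OF N q] chart_at_mem[OF N q]
    by (auto simp: c_def d_def)
  let ?S = "snd c ` fst c" and ?T = "snd d ` fst d"
  have ST: "open (?S \<times> ?T)" "(x, y) \<in> ?S \<times> ?T"
    using M N c d by (auto simp: smooth_manifold_def x_def y_def intro: open_Times)
  let ?K = "endo_rep (prod_manifold M N) (prod_chart c d) (twisted_sum s \<alpha> Z \<phi> \<beta> W \<psi>)"
  have dE: "(\<lambda>y. endo_rep M c \<phi> y u) differentiable (at x)" and dA: "(\<lambda>y. form_rep M c \<alpha> y u) differentiable (at x)"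
    and dZ: "vf_rep M c Z differentiable (at x)" for u
    using A c smooth_vf_rep[OF M _ c(1), of Z]
    by (auto simp: x_def almost_contact_structure_def smooth_form_def smooth_endo_def intro!: smooth_on_differentiable)
  have dF: "(\<lambda>y. endo_rep N d \<psi> y u) differentiable (at y)" and dB: "(\<lambda>y. form_rep N d \<beta> y u) differentiable (at y)"
    and dW: "vf_rep N d W differentiable (at y)" for u
    using B d smooth_vf_rep[OF N _ d(1), of W]
    by (auto simp: y_def almost_contact_structure_def smooth_form_def smooth_endo_def intro!: smooth_on_differentiable)
  have hf: "((\<lambda>z. g (fst z)) has_derivative (\<lambda>a. fderiv g x (fst a))) (at (x, y))"
    if "g differentiable (at x)" for g :: "'e \<Rightarrow> 'x::real_normed_vector"
    using has_derivative_compose[OF bounded_linear_imp_has_derivative[OF bounded_linear_fst], of g _ "(x, y)" UNIV]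
      has_fderiv[OF that] by simp
  have hs: "((\<lambda>z. g (snd z)) has_derivative (\<lambda>a. fderiv g y (snd a))) (at (x, y))"
    if "g differentiable (at y)" for g :: "'g \<Rightarrow> 'x::real_normed_vector"
    using has_derivative_compose[OF bounded_linear_imp_has_derivative[OF bounded_linear_snd], of g _ "(x, y)" UNIV]
      has_fderiv[OF that] by simp
  have K: "?K (x, y) (u, v) = (endo_rep M c \<phi> x u - (s * form_rep N d \<beta> y v) *\<^sub>R vf_rep M c Z x,
      endo_rep N d \<psi> y v + (s * form_rep M c \<alpha> x u) *\<^sub>R vf_rep N d W y)" for u v
    by (simp add: endo_rep_twisted_sum[OF M c(1) N d(1) ST(2)])
  have K': "fderiv (\<lambda>z. ?K z (u, v)) (x, y) (a, b) =
    (fderiv (\<lambda>y. endo_rep M c \<phi> y u) x a - (s * fderiv (\<lambda>y. form_rep N d \<beta> y v) y b) *\<^sub>R vf_rep M c Z x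
       - (s * form_rep N d \<beta> y v) *\<^sub>R fderiv (vf_rep M c Z) x a,
     fderiv (\<lambda>y. endo_rep N d \<psi> y v) y b + (s * fderiv (\<lambda>y. form_rep M c \<alpha> y u) x a) *\<^sub>R vf_rep N d W y
       + (s * form_rep M c \<alpha> x u) *\<^sub>R fderiv (vf_rep N d W) y b)" (is "_ = ?R (a, b)") for u v a b
  proof -
    have "((\<lambda>z. (endo_rep M c \<phi> (fst z) u - (s * form_rep N d \<beta> (snd z) v) *\<^sub>R vf_rep M c Z (fst z),
        endo_rep N d \<psi> (snd z) v + (s * form_rep M c \<alpha> (fst z) u) *\<^sub>R vf_rep N d W (snd z)))
      has_derivative (\<lambda>w.
        (fderiv (\<lambda>y. endo_rep M c \<phi> y u) x (fst w) - ((s * form_rep N d \<beta> y v) *\<^sub>R fderiv (vf_rep M c Z) x (fst w)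
            + (s * fderiv (\<lambda>y. form_rep N d \<beta> y v) y (snd w)) *\<^sub>R vf_rep M c Z x),
         fderiv (\<lambda>y. endo_rep N d \<psi> y v) y (snd w) + ((s * form_rep M c \<alpha> x u) *\<^sub>R fderiv (vf_rep N d W) y (snd w)
            + (s * fderiv (\<lambda>y. form_rep M c \<alpha> y u) x (fst w)) *\<^sub>R vf_rep N d W y)))) (at (x, y))"
      using hf[OF dE] hf[OF dA] hf[OF dZ] hs[OF dF] hs[OF dB] hs[OF dW]
      by (auto intro!: derivative_eq_intros)
    then have "((\<lambda>z. ?K z (u, v)) has_derivative (\<lambda>w.
        (fderiv (\<lambda>y. endo_rep M c \<phi> y u) x (fst w) - ((s * form_rep N d \<beta> y v) *\<^sub>R fderiv (vf_rep M c Z) x (fst w)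
            + (s * fderiv (\<lambda>y. form_rep N d \<beta> y v) y (snd w)) *\<^sub>R vf_rep M c Z x),
         fderiv (\<lambda>y. endo_rep N d \<psi> y v) y (snd w) + ((s * form_rep M c \<alpha> x u) *\<^sub>R fderiv (vf_rep N d W) y (snd w)
            + (s * fderiv (\<lambda>y. form_rep M c \<alpha> y u) x (fst w)) *\<^sub>R vf_rep N d W y)))) (at (x, y))"
      by (rule has_derivative_transform_within_open[OF _ ST])
        (simp add: endo_rep_twisted_sum[OF M c(1) N d(1)])
    from fderiv_eqI[OF this] show ?thesis by (simp add: algebra_simps)
  qed
  note jets = contact_jet_at[OF M A RM p, folded c_def, folded x_def] contact_jet_at[OF N B RN q, folded d_def, folded y_def]
  from nijenhuis_product_jet[OF jets s, of "?K (x, y)" "\<lambda>a w. fderiv (\<lambda>z. ?K z w) (x, y) a", OF K K']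
  show ?thesis
    by (simp add: nijenhuis_at_def nijenhuis_coord_def normal_at_def Let_def flip: c_def d_def x_def y_def)
qed

lemma integrable_twisted_sum:
  assumes M: "smooth_manifold M" and A: "almost_contact_structure M \<alpha> Z \<phi>"
    and RM: "\<And>p v. p \<in> pts M \<Longrightarrow> ext_deriv M \<alpha> p (Z p) v = 0"
    and N: "smooth_manifold N" and B: "almost_contact_structure N \<beta> W \<psi>"
    and RN: "\<And>q v. q \<in> pts N \<Longrightarrow> ext_deriv N \<beta> q (W q) v = 0" and s: "s * s = 1"
  shows "integrable_structure (prod_manifold M N) (twisted_sum s \<alpha> Z \<phi> \<beta> W \<psi>) \<longleftrightarrow>
    (\<forall>p\<in>pts M. \<forall>q\<in>pts N. normal_at M \<alpha> Z \<phi> p \<and> normal_at N \<beta> W \<psi> q)"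
proof -
  have "smooth_endo (prod_manifold M N) (twisted_sum s \<alpha> Z \<phi> \<beta> W \<psi>)"
    using A B by (intro smooth_endo_twisted_sum[OF M N]) (auto simp: almost_contact_structure_def)
  from integrable_structure_iff[OF smooth_manifold_prod[OF M N] this]
  have "integrable_structure (prod_manifold M N) (twisted_sum s \<alpha> Z \<phi> \<beta> W \<psi>) \<longleftrightarrow>
    (\<forall>p\<in>pts M. \<forall>q\<in>pts N. \<forall>\<xi> \<eta>. nijenhuis_at (prod_manifold M N) (twisted_sum s \<alpha> Z \<phi> \<beta> W \<psi>) (p, q) \<xi> \<eta> = 0)"
    by (simp only: prod_manifold_sel topspace_prod_topology split_paired_Ball_Sigma)
  then show ?thesis
    using nijenhuis_twisted_sum[OF M A RM _ N B RN _ s] by simp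
qed

section \<open>The cylinder as a product with the real line\<close>

lemma real_line_reps:
  assumes "c \<in> atlas real_line"
  shows "form_rep real_line c (\<lambda>_ v. v) y v = v" "vf_rep real_line c (\<lambda>_. 1) y = 1"
    "endo_rep real_line c (\<lambda>_ _. 0) y v = 0"
proof -
  have c: "c = (UNIV, id)" using assms by (simp add: real_line_def)
  have i: "chart_inv (UNIV, id :: real \<Rightarrow> real) = id"
    by (auto simp: chart_inv_def fun_eq_iff inv_into_f_eq)
  have "of_chart real_line c p = id" "to_chart real_line c p = id" for p
    by (simp_all add: of_chart_def to_chart_def real_line_def c i)
  then show "form_rep real_line c (\<lambda>_ v. v) y v = v" "vf_rep real_line c (\<lambda>_. 1) y = 1"
    "endo_rep real_line c (\<lambda>_ _. 0) y v = 0"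
    by (simp_all add: form_rep_def vf_rep_def endo_rep_def)
qed

text \<open>The line carries dt, d/dt and the zero endomorphism. Their components do not depend on
  the point, so every derivative in the conditions vanishes.\<close>

lemma real_line_contact:
  shows "almost_contact_structure real_line (\<lambda>_ v. v) (\<lambda>_. 1) (\<lambda>_ _. 0)"
    and "ext_deriv real_line (\<lambda>_ v. v) q u v = 0"
    and "normal_at real_line (\<lambda>_ v. v) (\<lambda>_. 1) (\<lambda>_ _. 0) q"
proof -
  have q: "chart_at real_line q \<in> atlas real_line" by (simp add: real_line_def)
  have v: "vf_rep real_line c (\<lambda>_. 1) = (\<lambda>_. 1)" if "c \<in> atlas real_line" for c
    using real_line_reps(2)[OF that] by blast
  show "almost_contact_structure real_line (\<lambda>_ v. v) (\<lambda>_. 1) (\<lambda>_ _. 0)"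
    by (auto simp: almost_contact_structure_def smooth_form_def smooth_vf_on_def smooth_endo_def
        real_line_reps v smooth_on_const linear_zero intro: linear_ident)
  show "ext_deriv real_line (\<lambda>_ v. v) q u v = 0"
    by (simp add: ext_deriv_def Let_def real_line_reps[OF q])
  show "normal_at real_line (\<lambda>_ v. v) (\<lambda>_. 1) (\<lambda>_ _. 0) q"
    by (simp add: normal_at_def Let_def real_line_reps[OF q] v[OF q] normal_jet_def)
qed

text \<open>The cylinder structure is a twisted sum with the line; since the line satisfies its own
  conditions, only those on \<open>M\<close> remain.\<close>

lemma normal_almost_contact_iff:
  assumes M: "smooth_manifold M" and A: "almost_contact_structure M \<alpha> Z \<phi>"
    and RM: "\<And>p v. p \<in> pts M \<Longrightarrow> ext_deriv M \<alpha> p (Z p) v = 0"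
  shows "normal_almost_contact M \<alpha> Z \<phi> \<longleftrightarrow> (\<forall>p\<in>pts M. normal_at M \<alpha> Z \<phi> p)"
proof -
  have "cylinder_structure \<alpha> Z \<phi> = twisted_sum 1 \<alpha> Z \<phi> (\<lambda>_ v. v) (\<lambda>_. 1) (\<lambda>_ _. 0)"
    by (auto simp: cylinder_structure_def twisted_sum_def fun_eq_iff)
  moreover have "pts real_line \<noteq> {}" by (simp add: real_line_def)
  ultimately show ?thesis
    using integrable_twisted_sum[OF M A RM smooth_manifold_real_line real_line_contact(1,2), of 1] A
      real_line_contact(3) by (auto simp: normal_almost_contact_def)
qed

lemma endo_rep_cong:
  assumes "smooth_manifold M" "c \<in> atlas M" "\<And>p. p \<in> U \<Longrightarrow> \<phi> p = \<psi> p" "x \<in> snd c ` (U \<inter> fst c)"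
  shows "endo_rep M c \<phi> x v = endo_rep M c \<psi> x v"
proof -
  have "chart_inv c x \<in> U" using assms by auto
  then show ?thesis using assms(3) by (simp add: endo_rep_def)
qed

text \<open>The Reeb vectors of a product are computed only at points of the manifold, so
  \<open>pair_J\<close> and \<open>pair_T\<close> agree with twisted sums only there.\<close>

lemma smooth_endo_cong:
  assumes M: "smooth_manifold M" and J: "smooth_endo M J" and eq: "\<And>p. p \<in> pts M \<Longrightarrow> J p = K p"
  shows "smooth_endo M K" "integrable_structure M J \<longleftrightarrow> integrable_structure M K"
proof -
  have sub: "fst c \<inter> pts M = fst c" if "c \<in> atlas M" for c using chart_subset[OF M that] by auto
  have rep: "endo_rep M c J x v = endo_rep M c K x v" if "c \<in> atlas M" "x \<in> snd c ` fst c" for c x v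
  proof (rule endo_rep_cong[OF M that(1) eq])
    show "x \<in> snd c ` (pts M \<inter> fst c)" using that(2) sub[OF that(1)] by (simp add: Int_commute)
  qed
  have o: "open (snd c ` fst c)" if "c \<in> atlas M" for c using M that by (simp add: smooth_manifold_def)
  show K: "smooth_endo M K"
    unfolding smooth_endo_def
  proof (intro conjI ballI allI)
    show "linear (K p)" if "p \<in> pts M" for p using J eq that by (auto simp: smooth_endo_def)
    show "smooth_on (snd c ` fst c) (\<lambda>x. endo_rep M c K x v)" if "c \<in> atlas M" for c v
      using smooth_on_cong[OF o[OF that], of "\<lambda>x. endo_rep M c J x v" "\<lambda>x. endo_rep M c K x v"] rep[OF that] J that
      by (simp add: smooth_endo_def)
  qed
  have "nijenhuis_at M J p u v = nijenhuis_at M K p u v" if "p \<in> pts M" for p u v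
    unfolding nijenhuis_at_def
  proof (rule nijenhuis_coord_cong[OF o])
    show "chart_at M p \<in> atlas M" "snd (chart_at M p) p \<in> snd (chart_at M p) ` fst (chart_at M p)"
      using chart_at_atlas[OF M that] chart_at_mem[OF M that] by simp_all
    show "endo_rep M (chart_at M p) J y w = endo_rep M (chart_at M p) K y w"
      if "y \<in> snd (chart_at M p) ` fst (chart_at M p)" for y w
      by (rule rep[OF chart_at_atlas[OF M \<open>p \<in> pts M\<close>] that])
  qed
  then show "integrable_structure M J \<longleftrightarrow> integrable_structure M K"
    unfolding integrable_structure_iff[OF M J] integrable_structure_iff[OF M K] by simp
qed

text \<open>Two facts go beyond unfolding: (d\<alpha>)^(n+1) vanishes because its degree exceeds the
  dimension, and a vector in the kernels of \<alpha> and d\<alpha> annihilates the volume form and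
  is therefore zero.\<close>

lemma contact_manifoldD:
  fixes M :: "('a, 'e::euclidean_space) manifold"
  assumes C: "contact_manifold n M \<alpha> Z \<phi>"
  shows "smooth_manifold M" "DIM('e) = 2 * n + 1" "almost_contact_structure M \<alpha> Z \<phi>"
    "smooth_form M \<alpha>" "smooth_vf_on (pts M) M Z" "smooth_endo M \<phi>"
    and "\<And>p. p \<in> pts M \<Longrightarrow> \<exists>v. contact_volume n M \<alpha> p v \<noteq> 0"
    and "\<And>p v. p \<in> pts M \<Longrightarrow> ext_deriv M \<alpha> p (Z p) v = 0"
    and "\<And>p v. p \<in> pts M \<Longrightarrow> \<phi> p (\<phi> p v) = - v + \<alpha> p v *\<^sub>R Z p"
    and "\<And>p. p \<in> pts M \<Longrightarrow> \<phi> p (Z p) = 0" "\<And>p. p \<in> pts M \<Longrightarrow> \<alpha> p (Z p) = 1"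
    and "\<And>p. p \<in> pts M \<Longrightarrow> linear (\<alpha> p)" "\<And>p. p \<in> pts M \<Longrightarrow> linear (\<phi> p)"
    and "\<And>p. p \<in> pts M \<Longrightarrow> multilinear_form (2 * n + 1) (contact_volume n M \<alpha> p)"
    and "\<And>p v. p \<in> pts M \<Longrightarrow> wedge_power 2 (dform M \<alpha> p) (n + 1) v = 0"
    and "\<And>p u. p \<in> pts M \<Longrightarrow> \<alpha> p u = 0 \<Longrightarrow> (\<And>v. ext_deriv M \<alpha> p u v = 0) \<Longrightarrow> u = 0"
proof -
  show M: "smooth_manifold M" and dim: "DIM('e) = 2 * n + 1" and acs: "almost_contact_structure M \<alpha> Z \<phi>"
    and vol: "\<And>p. p \<in> pts M \<Longrightarrow> \<exists>v. contact_volume n M \<alpha> p v \<noteq> 0"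
    and "\<And>p v. p \<in> pts M \<Longrightarrow> ext_deriv M \<alpha> p (Z p) v = 0"
    using C by (auto simp: contact_manifold_def nowhere_zero_def)
  show s: "smooth_form M \<alpha>" "smooth_vf_on (pts M) M Z" "smooth_endo M \<phi>"
    and "\<And>p v. p \<in> pts M \<Longrightarrow> \<phi> p (\<phi> p v) = - v + \<alpha> p v *\<^sub>R Z p"
    and "\<And>p. p \<in> pts M \<Longrightarrow> \<phi> p (Z p) = 0" "\<And>p. p \<in> pts M \<Longrightarrow> \<alpha> p (Z p) = 1"
    using acs by (auto simp: almost_contact_structure_def)
  show lin: "\<And>p. p \<in> pts M \<Longrightarrow> linear (\<alpha> p)" "\<And>p. p \<in> pts M \<Longrightarrow> linear (\<phi> p)"
    using s by (auto simp: smooth_form_def smooth_endo_def)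
  note d = dform_multilinear[OF M s(1)]
  show mult: "multilinear_form (2 * n + 1) (contact_volume n M \<alpha> p)" if "p \<in> pts M" for p
    by (rule contact_volume_multilinear[OF lin(1)[OF that] d[OF that]])
  show "wedge_power 2 (dform M \<alpha> p) (n + 1) v = 0" if "p \<in> pts M" for p v
    by (rule form_zero_of_degree_gt_dim[OF wedge_power_multilinear[OF d[OF that]] wedge_power_alternating])
      (simp add: dim)
  show "u = 0" if "p \<in> pts M" "\<alpha> p u = 0" "\<And>v. ext_deriv M \<alpha> p u v = 0" for p u
  proof -
    from vol[OF that(1)] obtain v where "contact_volume n M \<alpha> p v \<noteq> 0" by blast
    then show ?thesis
      using annihilates_top_form[OF mult[OF that(1)] contact_volume_alternating _ _
          contact_volume_annihilates[OF that(2,3)]] dim by simp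
  qed
qed

text \<open>The Reeb fields of the product are \<open>(Z, 0)\<close> and \<open>(0, W)\<close>,
  which identifies \<open>pair_J\<close> and \<open>pair_T\<close> with twisted sums. The
  projections pull back each form together with its exterior derivative, so the other conditions
  reduce to the factors.\<close>

lemma contact_pair_on_prod:
  fixes B :: "('a, 'e::euclidean_space) manifold" and F :: "('b, 'g::euclidean_space) manifold"
  assumes B: "contact_manifold h B \<alpha> Z \<phi>" and F: "contact_manifold k F \<beta> W \<psi>"
  defines "P \<equiv> prod_manifold B F"
    and "a \<equiv> \<lambda>z w. \<alpha> (fst z) (fst w)" and "b \<equiv> \<lambda>z w. \<beta> (snd z) (snd w)"
  shows "contact_pair_on (pts P) h k P a b (sum_endo \<phi> \<psi>)"
    and "integrable_structure P (pair_J P a b (sum_endo \<phi> \<psi>)) \<longleftrightarrow>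
      (\<forall>p\<in>pts B. \<forall>q\<in>pts F. normal_at B \<alpha> Z \<phi> p \<and> normal_at F \<beta> W \<psi> q)"
    and "integrable_structure P (pair_T P a b (sum_endo \<phi> \<psi>)) \<longleftrightarrow>
      (\<forall>p\<in>pts B. \<forall>q\<in>pts F. normal_at B \<alpha> Z \<phi> p \<and> normal_at F \<beta> W \<psi> q)"
proof -
  note cB = contact_manifoldD[OF B] and cF = contact_manifoldD[OF F]
  note MB = cB(1) and MF = cF(1)
  have P: "smooth_manifold P" unfolding P_def by (rule smooth_manifold_prod[OF MB MF])
  have ptsP: "z \<in> pts P \<longleftrightarrow> fst z \<in> pts B \<and> snd z \<in> pts F" for z
    by (cases z) (simp add: P_def)
  have fs: "smooth_map_on (pts P) P B fst" "smooth_map_on (pts P) P F snd"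
    unfolding P_def by (rule smooth_map_on_fst_snd[OF MB MF])+
  have T: "tangent_map P B fst z = fst" "tangent_map P F snd z = snd" if "z \<in> pts P" for z
    using tangent_map_fst_snd[OF MB MF, of "fst z" "snd z"] that unfolding ptsP by (simp_all add: P_def)
  have im: "fst ` pts P \<subseteq> pts B" "snd ` pts P \<subseteq> pts F" by (auto simp: P_def)
  have ra: "a z w = \<alpha> (fst z) (tangent_map P B fst z w)" and rb: "b z w = \<beta> (snd z) (tangent_map P F snd z w)"
    if "z \<in> pts P" for z w
    by (simp_all add: T[OF that] a_def b_def)
  have sB: "smooth_form_on (pts B) B \<alpha>" and sF: "smooth_form_on (pts F) F \<beta>"
    using cB(4) cF(4) smooth_form_iff MB MF by auto
  have sa: "smooth_form_on (pts P) P a" "smooth_form_on (pts P) P b"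
    using T linear_fst linear_snd
    by (auto intro!: smooth_form_on_pullback[OF P MB fs(1) openin_topspace im(1) sB _ ra]
        smooth_form_on_pullback[OF P MF fs(2) openin_topspace im(2) sF _ rb])
  have ea: "ext_deriv P a z u v = ext_deriv B \<alpha> (fst z) (fst u) (fst v)" if "z \<in> pts P" for z u v
    using ext_deriv_pullback[OF P MB fs(1) openin_topspace im(1) sB ra that] by (simp add: T[OF that])
  have eb: "ext_deriv P b z u v = ext_deriv F \<beta> (snd z) (snd u) (snd v)" if "z \<in> pts P" for z u v
    using ext_deriv_pullback[OF P MF fs(2) openin_topspace im(2) sF rb that] by (simp add: T[OF that])
  have e0: "ext_deriv B \<alpha> p 0 v = 0" if "p \<in> pts B" for p v
  proof -
    have "ext_deriv B \<alpha> p 0 v = dform B \<alpha> p (\<lambda>i. if i = 0 then 0 else v)" by (simp add: dform_def)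
    also have "\<dots> = 0"
      by (rule multilinear_form_zero[OF dform_multilinear[OF MB cB(4) that], of 0]) auto
    finally show ?thesis .
  qed
  have e0': "ext_deriv F \<beta> p 0 v = 0" if "p \<in> pts F" for p v
  proof -
    have "ext_deriv F \<beta> p 0 v = dform F \<beta> p (\<lambda>i. if i = 0 then 0 else v)" by (simp add: dform_def)
    also have "\<dots> = 0"
      by (rule multilinear_form_zero[OF dform_multilinear[OF MF cF(4) that], of 0]) auto
    finally show ?thesis .
  qed
  \<comment> \<open>For the converse, \<open>fst w - Z (fst z)\<close> and \<open>snd w\<close> lie
    in the kernels of the form of their factor and of its derivative, and hence vanish.\<close>
  have R1: "reeb_cond P a b z w \<longleftrightarrow> w = (Z (fst z), 0)" if z: "z \<in> pts P" for z w
  proof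
    have p: "fst z \<in> pts B" "snd z \<in> pts F" using z ptsP by auto
    note l = cB(12)[OF p(1)] cF(12)[OF p(2)]
    show "reeb_cond P a b z w" if "w = (Z (fst z), 0)"
      using that p cB(8,11) linear_0[OF l(2)] e0'
      by (simp add: reeb_cond_def ea[OF z] eb[OF z]) (simp add: a_def b_def)
    assume R: "reeb_cond P a b z w"
    have "ext_deriv B \<alpha> (fst z) (fst w) v = 0" for v
      using R ea[OF z, of w "(v, 0)"] by (simp add: reeb_cond_def)
    then have "ext_deriv B \<alpha> (fst z) (fst w - Z (fst z)) v = 0" for v
    proof -
      have "linear (\<lambda>u. dform B \<alpha> (fst z) ((\<lambda>i. v)(0 := u)))"
        by (rule multilinear_form_linear[OF dform_multilinear[OF MB cB(4) p(1)]]) simp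
      from linear_diff[OF this, of "fst w" "Z (fst z)"] \<open>\<And>v. ext_deriv B \<alpha> (fst z) (fst w) v = 0\<close> cB(8)[OF p(1)]
      show ?thesis by (simp add: dform_def)
    qed
    moreover have "\<alpha> (fst z) (fst w - Z (fst z)) = 0"
      using R linear_diff[OF l(1)] cB(11)[OF p(1)] by (simp add: reeb_cond_def a_def)
    ultimately have "fst w - Z (fst z) = 0" by (intro cB(16)[OF p(1)])
    moreover have "ext_deriv F \<beta> (snd z) (snd w) v = 0" for v
      using R eb[OF z, of w "(0, v)"] by (simp add: reeb_cond_def)
    then have "snd w = 0"
      using R by (intro cF(16)[OF p(2)]) (auto simp: reeb_cond_def b_def)
    ultimately show "w = (Z (fst z), 0)" by (simp add: prod_eq_iff)
  qed
  have R2: "reeb_cond P b a z w \<longleftrightarrow> w = (0, W (snd z))" if z: "z \<in> pts P" for z w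
  proof
    have p: "fst z \<in> pts B" "snd z \<in> pts F" using z ptsP by auto
    note l = cB(12)[OF p(1)] cF(12)[OF p(2)]
    show "reeb_cond P b a z w" if "w = (0, W (snd z))"
      using that p cF(8,11) linear_0[OF l(1)] e0
      by (simp add: reeb_cond_def ea[OF z] eb[OF z]) (simp add: a_def b_def)
    assume R: "reeb_cond P b a z w"
    have "ext_deriv F \<beta> (snd z) (snd w) v = 0" for v
      using R eb[OF z, of w "(0, v)"] by (simp add: reeb_cond_def)
    then have "ext_deriv F \<beta> (snd z) (snd w - W (snd z)) v = 0" for v
    proof -
      have "linear (\<lambda>u. dform F \<beta> (snd z) ((\<lambda>i. v)(0 := u)))"
        by (rule multilinear_form_linear[OF dform_multilinear[OF MF cF(4) p(2)]]) simp
      from linear_diff[OF this, of "snd w" "W (snd z)"] \<open>\<And>v. ext_deriv F \<beta> (snd z) (snd w) v = 0\<close> cF(8)[OF p(2)]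
      show ?thesis by (simp add: dform_def)
    qed
    moreover have "\<beta> (snd z) (snd w - W (snd z)) = 0"
      using R linear_diff[OF l(2)] cF(11)[OF p(2)] by (simp add: reeb_cond_def b_def)
    ultimately have "snd w - W (snd z) = 0" by (intro cF(16)[OF p(2)])
    moreover have "ext_deriv B \<alpha> (fst z) (fst w) v = 0" for v
      using R ea[OF z, of w "(v, 0)"] by (simp add: reeb_cond_def)
    then have "fst w = 0"
      using R by (intro cB(16)[OF p(1)]) (auto simp: reeb_cond_def a_def)
    ultimately show "w = (0, W (snd z))" by (simp add: prod_eq_iff)
  qed
  have reeb: "reeb_vf P a b z = (Z (fst z), 0)" "reeb_vf P b a z = (0, W (snd z))" if "z \<in> pts P" for z
    unfolding reeb_vf_eq by (rule the_equality; simp add: R1[OF that] R2[OF that])+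
  \<comment> \<open>The case s = 0 supplies the smoothness of the direct sum without a separate
    argument.\<close>
  have sum0: "twisted_sum 0 \<alpha> Z \<phi> \<beta> W \<psi> = sum_endo \<phi> \<psi>"
    by (auto simp: twisted_sum_def sum_endo_def fun_eq_iff)
  have J: "twisted_sum 1 \<alpha> Z \<phi> \<beta> W \<psi> z = pair_J P a b (sum_endo \<phi> \<psi>) z"
    "twisted_sum (-1) \<alpha> Z \<phi> \<beta> W \<psi> z = pair_T P a b (sum_endo \<phi> \<psi>) z" if "z \<in> pts P" for z
    by (rule ext, simp only: pair_J_def pair_T_def reeb[OF that],
        simp add: twisted_sum_def sum_endo_def case_prod_unfold a_def b_def)+
  have st: "smooth_endo P (twisted_sum s \<alpha> Z \<phi> \<beta> W \<psi>)" for s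
    unfolding P_def by (rule smooth_endo_twisted_sum[OF MB MF cB(4-6) cF(4-6)])
  have it: "integrable_structure P (twisted_sum s \<alpha> Z \<phi> \<beta> W \<psi>) \<longleftrightarrow>
      (\<forall>p\<in>pts B. \<forall>q\<in>pts F. normal_at B \<alpha> Z \<phi> p \<and> normal_at F \<beta> W \<psi> q)" if "s * s = 1" for s
    unfolding P_def by (rule integrable_twisted_sum[OF MB cB(3,8) MF cF(3,8) that])
  note cJ = smooth_endo_cong[OF P st J(1)] and cT = smooth_endo_cong[OF P st J(2)]
  show "integrable_structure P (pair_J P a b (sum_endo \<phi> \<psi>)) \<longleftrightarrow>
      (\<forall>p\<in>pts B. \<forall>q\<in>pts F. normal_at B \<alpha> Z \<phi> p \<and> normal_at F \<beta> W \<psi> q)"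
    using cJ(2) it[of 1] by simp
  show "integrable_structure P (pair_T P a b (sum_endo \<phi> \<psi>)) \<longleftrightarrow>
      (\<forall>p\<in>pts B. \<forall>q\<in>pts F. normal_at B \<alpha> Z \<phi> p \<and> normal_at F \<beta> W \<psi> q)"
    using cT(2) it[of "-1"] by simp
  have pt: "contact_pair_at h k P a b (sum_endo \<phi> \<psi>) z" if z: "z \<in> pts P" for z
    unfolding contact_pair_at_def
  proof (intro conjI allI)
    have p: "fst z \<in> pts B" "snd z \<in> pts F" using z ptsP by auto
    have va: "contact_volume h P a z v = contact_volume h B \<alpha> (fst z) (\<lambda>i. fst (v i))"
      "wedge_power 2 (dform P a z) n v = wedge_power 2 (dform B \<alpha> (fst z)) n (\<lambda>i. fst (v i))" for v n
      using contact_volume_pullback[where \<alpha> = a and x = z and \<beta> = \<alpha> and y = "fst z" and L = fst, OF _ ea[OF z]]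
      by (simp_all add: a_def)
    have vb: "contact_volume k P b z v = contact_volume k F \<beta> (snd z) (\<lambda>i. snd (v i))"
      "wedge_power 2 (dform P b z) n v = wedge_power 2 (dform F \<beta> (snd z)) n (\<lambda>i. snd (v i))" for v n
      using contact_volume_pullback[where \<alpha> = b and x = z and \<beta> = \<beta> and y = "snd z" and L = snd, OF _ eb[OF z]]
      by (simp_all add: b_def)
    obtain v w where "contact_volume h B \<alpha> (fst z) v \<noteq> 0" "contact_volume k F \<beta> (snd z) w \<noteq> 0"
      using cB(7)[OF p(1)] cF(7)[OF p(2)] by blast
    from wedge_product_nonzero[OF cB(14)[OF p(1)] contact_volume_alternating this(1)
        cF(14)[OF p(2)] contact_volume_alternating this(2)]
    show "\<exists>v. wedge (2 * h + 1) (2 * k + 1) (contact_volume h P a z) (contact_volume k P b z) v \<noteq> 0"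
      by (simp add: va(1)[abs_def] vb(1)[abs_def])
    show "wedge_power 2 (dform P a z) (h + 1) v = 0" "wedge_power 2 (dform P b z) (k + 1) v = 0" for v
      unfolding va(2) vb(2) by (rule cB(15)[OF p(1)] cF(15)[OF p(2)])+
    show "\<exists>!w. reeb_cond P a b z w" "\<exists>!w. reeb_cond P b a z w"
      by (simp_all add: R1[OF z] R2[OF z])
    show "sum_endo \<phi> \<psi> z (sum_endo \<phi> \<psi> z v) = - v + a z v *\<^sub>R reeb_vf P a b z + b z v *\<^sub>R reeb_vf P b a z" for v
      using cB(9)[OF p(1)] cF(9)[OF p(2)]
      unfolding reeb[OF z] by (simp add: sum_endo_def case_prod_unfold a_def b_def prod_eq_iff)
    show "sum_endo \<phi> \<psi> z (reeb_vf P a b z) = 0" "sum_endo \<phi> \<psi> z (reeb_vf P b a z) = 0"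
      using cB(10)[OF p(1)] cF(10)[OF p(2)] linear_0[OF cB(13)[OF p(1)]] linear_0[OF cF(13)[OF p(2)]]
      unfolding reeb[OF z] by (simp_all add: sum_endo_def case_prod_unfold zero_prod_def)
  qed
  show "contact_pair_on (pts P) h k P a b (sum_endo \<phi> \<psi>)"
    using sa st[of 0] cJ(1) cT(1) pt by (simp add: contact_pair_on_def smooth_endo_iff[OF P] sum0)
qed

section \<open>Quotient manifolds\<close>

text \<open>Only the local traces of a group action are assumed, so no group appears below.
  \<open>local_action\<close> makes the projection open and the transition maps smooth,
  \<open>locally_inj\<close> provides charts, and \<open>separated\<close> gives the Hausdorff
  property.\<close>

locale smooth_quotient =
  fixes M :: "('a, 'e::euclidean_space) manifold" and R :: "'a rel"
  assumes smooth: "smooth_manifold M" and equiv: "equiv (pts M) R"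
    and local_action: "\<And>x x'. (x, x') \<in> R \<Longrightarrow>
      \<exists>U s. x \<in> U \<and> smooth_map_on U M M s \<and> s x = x' \<and> (\<forall>y\<in>U. (y, s y) \<in> R)"
    and locally_inj: "\<And>x. x \<in> pts M \<Longrightarrow>
      \<exists>W. openin (mtop M) W \<and> x \<in> W \<and> inj_on (\<lambda>x. R `` {x}) W"
    and separated: "\<And>x x'. x \<in> pts M \<Longrightarrow> x' \<in> pts M \<Longrightarrow> (x, x') \<notin> R \<Longrightarrow>
      \<exists>V V'. openin (mtop M) V \<and> openin (mtop M) V' \<and> x \<in> V \<and> x' \<in> V' \<and> (\<forall>y\<in>V. \<forall>y'\<in>V'. (y, y') \<notin> R)"
begin

definition proj :: "'a \<Rightarrow> 'a set" where "proj = (\<lambda>x. R `` {x})"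
abbreviation Q :: "('a set, 'e) manifold" where "Q \<equiv> quotient_manifold M R"

lemma rel_pts: "(x, y) \<in> R \<Longrightarrow> x \<in> pts M \<and> y \<in> pts M"
  using equiv by (auto dest: equiv_type)

lemma proj_eq: "x \<in> pts M \<Longrightarrow> y \<in> pts M \<Longrightarrow> proj x = proj y \<longleftrightarrow> (x, y) \<in> R"
  unfolding proj_def by (rule eq_equiv_class_iff[OF equiv])

lemma proj_rel: "(x, y) \<in> R \<Longrightarrow> proj x = proj y"
  using proj_eq rel_pts by blast

lemma mem_quotient: "C \<in> pts M // R \<longleftrightarrow> (\<exists>x\<in>pts M. C = proj x)"
  by (auto simp: quotient_def proj_def)

lemma class_self: "x \<in> pts M \<Longrightarrow> x \<in> proj x"
  unfolding proj_def by (rule equiv_class_self[OF equiv])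

lemma proj_inj: "x \<in> pts M \<Longrightarrow> \<exists>W. openin (mtop M) W \<and> x \<in> W \<and> inj_on proj W"
  unfolding proj_def by (rule locally_inj)

lemma Union_classes:
  assumes "V \<subseteq> pts M // R"
  shows "\<Union>V = {x \<in> pts M. proj x \<in> V}"
proof (rule subset_antisym; rule subsetI)
  fix x assume "x \<in> \<Union>V"
  then obtain C where "C \<in> V" "x \<in> C" by blast
  moreover obtain y where "C = proj y" "y \<in> pts M" using assms calculation mem_quotient by blast
  moreover have "(y, x) \<in> R" using calculation by (simp add: proj_def)
  ultimately show "x \<in> {x \<in> pts M. proj x \<in> V}" using proj_rel[of y x] rel_pts[of y x] by auto
next
  fix x assume "x \<in> {x \<in> pts M. proj x \<in> V}"
  then show "x \<in> \<Union>V" using class_self by blast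
qed

lemma openin_Q: "openin (mtop Q) V \<longleftrightarrow> V \<subseteq> pts M // R \<and> openin (mtop M) {x \<in> pts M. proj x \<in> V}"
proof -
  let ?L = "\<lambda>V. V \<subseteq> pts M // R \<and> openin (mtop M) (\<Union>V)"
  have "istopology ?L"
    unfolding istopology_def
  proof (intro conjI allI impI)
    fix S T assume S: "S \<subseteq> pts M // R \<and> openin (mtop M) (\<Union>S)" and T: "T \<subseteq> pts M // R \<and> openin (mtop M) (\<Union>T)"
    then show "S \<inter> T \<subseteq> pts M // R" by blast
    \<comment> \<open>Both sides are preimages under \<open>proj\<close>, since a point lies in only
      one class.\<close>
    have "\<Union>(S \<inter> T) = \<Union>S \<inter> \<Union>T"
      using S T Union_classes[of S] Union_classes[of T] Union_classes[of "S \<inter> T"] by auto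
    then show "openin (mtop M) (\<Union>(S \<inter> T))" using S T by (simp add: openin_Int)
  next
    fix \<K> assume K: "\<forall>K\<in>\<K>. K \<subseteq> pts M // R \<and> openin (mtop M) (\<Union>K)"
    then show "\<Union>\<K> \<subseteq> pts M // R" by blast
    have "\<Union>(\<Union>\<K>) = \<Union>((\<lambda>K. \<Union>K) ` \<K>)" by blast
    then show "openin (mtop M) (\<Union>(\<Union>\<K>))" using K by (auto intro: openin_Union)
  qed
  then have "openin (mtop Q) V \<longleftrightarrow> ?L V"
    by (simp add: quotient_manifold_def topology_inverse')
  then show ?thesis using Union_classes by auto
qed

lemma pts_Q: "pts Q = pts M // R"
proof -
  have "{x \<in> pts M. proj x \<in> pts M // R} = pts M"
    unfolding mem_quotient by blast
  then have "openin (mtop Q) (pts M // R)"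
    unfolding openin_Q by simp
  then show ?thesis using openin_Q by (metis openin_subset openin_topspace subset_antisym)
qed

lemma proj_pts: "x \<in> pts M \<Longrightarrow> proj x \<in> pts Q"
  unfolding pts_Q mem_quotient by blast

lemma proj_image: "proj ` pts M = pts Q"
  unfolding pts_Q by (auto simp: mem_quotient)

lemma proj_continuous: "continuous_map (mtop M) (mtop Q) proj"
  unfolding continuous_map_def using proj_pts openin_Q by auto

text \<open>The saturation of \<open>V\<close> is open: around each of its points it contains the
  preimage of \<open>V\<close> under a smooth map that stays inside the classes.\<close>

lemma proj_open:
  assumes V: "openin (mtop M) V"
  shows "openin (mtop Q) (proj ` V)"
  unfolding openin_Q
proof
  have sub: "V \<subseteq> pts M" by (rule openin_subset[OF V])
  then show "proj ` V \<subseteq> pts M // R" unfolding image_subset_iff mem_quotient by blast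
  show "openin (mtop M) {x \<in> pts M. proj x \<in> proj ` V}"
  proof (subst openin_subopen, intro ballI)
    fix x assume "x \<in> {x \<in> pts M. proj x \<in> proj ` V}"
    then obtain y where y: "x \<in> pts M" "y \<in> V" "proj x = proj y" by blast
    then have "(x, y) \<in> R" using proj_eq sub by blast
    then obtain U s where s: "x \<in> U" "smooth_map_on U M M s" "s x = y" "\<forall>y\<in>U. (y, s y) \<in> R"
      using local_action by blast
    have "openin (mtop M) (U \<inter> s -` V)" by (rule smooth_map_on_openin_vimage[OF s(2) V])
    moreover have "U \<inter> s -` V \<subseteq> {x \<in> pts M. proj x \<in> proj ` V}"
      using s(4) proj_rel rel_pts by blast
    ultimately show "\<exists>T. openin (mtop M) T \<and> x \<in> T \<and> T \<subseteq> {x \<in> pts M. proj x \<in> proj ` V}"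
      using s y by (intro exI[of _ "U \<inter> s -` V"]) auto
  qed
qed

lemma atlas_Q: "e \<in> atlas Q \<longleftrightarrow>
    (\<exists>W c. c \<in> atlas M \<and> openin (mtop M) W \<and> W \<subseteq> fst c \<and> inj_on proj W \<and> e = (proj ` W, snd c \<circ> inv_into W proj))"
  unfolding quotient_manifold_def quotient_atlas_def proj_def by auto

text \<open>Near \<open>x\<close> the map \<open>inv_into W' proj \<circ> proj\<close> agrees with a smooth map that moves points within their classes.\<close>

lemma local_section_smooth:
  assumes c: "c \<in> atlas M" "x \<in> fst c" and c': "c' \<in> atlas M" "x' \<in> fst c'"
    and W': "openin (mtop M) W'" "inj_on proj W'" "x' \<in> W'" and eq: "proj x = proj x'"
  shows "\<exists>S. open S \<and> snd c x \<in> S \<and> S \<subseteq> snd c ` fst c \<and> smooth_on S (snd c' \<circ> inv_into W' proj \<circ> proj \<circ> chart_inv c)"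
proof -
  have "x \<in> pts M" "x' \<in> pts M" using chart_subset[OF smooth c(1)] chart_subset[OF smooth c'(1)] c c' by auto
  then have "(x, x') \<in> R" using eq proj_eq by blast
  then obtain U s where s: "x \<in> U" "smooth_map_on U M M s" "s x = x'" "\<forall>y\<in>U. (y, s y) \<in> R"
    using local_action by blast
  let ?U = "U \<inter> s -` W'"
  have "smooth_map_on ?U M M s"
    by (rule smooth_map_on_subset[OF s(2) smooth_map_on_openin_vimage[OF s(2) W'(1)]]) auto
  from smooth_map_on_rep[OF smooth c(1) smooth c'(1) this _ c(2)] obtain S
    where S: "open S" "snd c x \<in> S" "S \<subseteq> snd c ` (?U \<inter> fst c)" "smooth_on S (snd c' \<circ> s \<circ> chart_inv c)"
      "\<And>t. t \<in> S \<Longrightarrow> chart_inv c t \<in> ?U \<inter> fst c \<and> snd c (chart_inv c t) = t \<and> s (chart_inv c t) \<in> fst c'"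
    using s(1,3) W'(3) c'(2) by (metis IntI vimageI)
  have "inv_into W' proj (proj (chart_inv c t)) = s (chart_inv c t)" if "t \<in> S" for t
  proof -
    have "proj (chart_inv c t) = proj (s (chart_inv c t))" "s (chart_inv c t) \<in> W'"
      using S(5)[OF that] s(4) proj_rel by auto
    then show ?thesis using W'(2) by (simp only: inv_into_f_f)
  qed
  then have "smooth_on S (snd c' \<circ> inv_into W' proj \<circ> proj \<circ> chart_inv c)"
    by (subst smooth_on_cong[OF S(1), of _ "snd c' \<circ> s \<circ> chart_inv c"]) (use S in auto)
  then show ?thesis using S by blast
qed

lemma chart_inv_Q:
  assumes c: "c \<in> atlas M" and W: "W \<subseteq> fst c" "inj_on proj W" and y: "y \<in> W"
  shows "chart_inv (proj ` W, snd c \<circ> inv_into W proj) (snd c y) = proj y"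
proof -
  have "inj_on (snd c \<circ> inv_into W proj) (proj ` W)"
    by (rule comp_inj_on[OF inj_on_inv_into])
      (use inj_on_subset[OF chart_inj[OF smooth c] W(1)] inv_into_image_cancel[OF W(2)] in simp_all)
  moreover have "(snd c \<circ> inv_into W proj) (proj y) = snd c y"
    using W y by simp
  ultimately show ?thesis
    unfolding chart_inv_def fst_conv snd_conv by (intro inv_into_f_eq) (use y in auto)
qed

lemma proj_homeomorphic:
  assumes W: "openin (mtop M) W" "inj_on proj W"
  shows "homeomorphic_map (subtopology (mtop Q) (proj ` W)) (subtopology (mtop M) W) (inv_into W proj)"
proof -
  have sub: "W \<subseteq> pts M" using openin_subset[OF W(1)] .
  then have subQ: "proj ` W \<subseteq> pts Q" using proj_pts by auto
  have "homeomorphic_map (subtopology (mtop M) W) (subtopology (mtop Q) (proj ` W)) proj"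
  proof (rule bijective_open_imp_homeomorphic_map)
    show "continuous_map (subtopology (mtop M) W) (subtopology (mtop Q) (proj ` W)) proj"
      using continuous_map_from_subtopology[OF proj_continuous] by (auto simp: continuous_map_in_subtopology)
    show "open_map (subtopology (mtop M) W) (subtopology (mtop Q) (proj ` W)) proj"
      unfolding open_map_def
    proof (intro allI impI)
      fix T assume "openin (subtopology (mtop M) W) T"
      then have "openin (mtop M) T" "T \<subseteq> W" using W(1) by (auto simp: openin_open_subtopology)
      then show "openin (subtopology (mtop Q) (proj ` W)) (proj ` T)"
        using proj_open by (subst openin_subtopology) (auto intro!: exI[of _ "proj ` T"])
    qed
    show "proj ` topspace (subtopology (mtop M) W) = topspace (subtopology (mtop Q) (proj ` W))"
      using sub subQ by (simp add: Int_absorb1)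
    show "inj_on proj (topspace (subtopology (mtop M) W))"
      using W(2) sub by (simp add: Int_absorb1)
  qed
  then obtain g where g: "homeomorphic_maps (subtopology (mtop M) W) (subtopology (mtop Q) (proj ` W)) proj g"
    unfolding homeomorphic_map_maps by blast
  then have "homeomorphic_map (subtopology (mtop Q) (proj ` W)) (subtopology (mtop M) W) g"
    by (simp add: homeomorphic_maps_map)
  moreover have "g y = inv_into W proj y" if "y \<in> topspace (subtopology (mtop Q) (proj ` W))" for y
  proof -
    have "y \<in> proj ` W" using that by simp
    then obtain x where "x \<in> W" "y = proj x" by (rule imageE)
    then show ?thesis using g W(2) sub by (auto simp: homeomorphic_maps_def)
  qed
  ultimately show ?thesis by (rule homeomorphic_map_eq) 
qed

text \<open>Second countability passes along the open surjection \<open>proj\<close>, and a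
  transition map is locally the coordinate expression of a smooth map that moves points inside their
  classes.\<close>

lemma smooth_Q: "smooth_manifold Q"
  unfolding smooth_manifold_def
proof (intro conjI ballI)
  show "Hausdorff_space (mtop Q)"
    unfolding Hausdorff_space_def
  proof (intro allI impI)
    fix C C' assume CC: "C \<in> pts Q \<and> C' \<in> pts Q \<and> C \<noteq> C'"
    then obtain x x' where x: "x \<in> pts M" "x' \<in> pts M" "C = proj x" "C' = proj x'"
      unfolding pts_Q mem_quotient by blast
    then have "(x, x') \<notin> R" using CC proj_eq by blast
    then obtain V V' where V: "openin (mtop M) V" "openin (mtop M) V'" "x \<in> V" "x' \<in> V'"
      "\<forall>y\<in>V. \<forall>y'\<in>V'. (y, y') \<notin> R"
      using separated[OF x(1,2)] by blast
    have "proj y \<noteq> proj y'" if "y \<in> V" "y' \<in> V'" for y y'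
      using V that proj_eq openin_subset by blast
    then have "disjnt (proj ` V) (proj ` V')" unfolding disjnt_iff by blast
    then show "\<exists>U V. openin (mtop Q) U \<and> openin (mtop Q) V \<and> C \<in> U \<and> C' \<in> V \<and> disjnt U V"
      using V x proj_open by blast
  qed
  have "open_map (mtop M) (mtop Q) proj" unfolding open_map_def using proj_open by blast
  moreover have "second_countable (mtop M)" using smooth by (simp add: smooth_manifold_def)
  ultimately show "second_countable (mtop Q)"
    using second_countable_open_map_image[OF proj_continuous _ proj_image] by blast
  {
    fix e assume "e \<in> atlas Q"
    then obtain W c where c: "c \<in> atlas M" and W: "openin (mtop M) W" "W \<subseteq> fst c" "inj_on proj W"
      and e: "e = (proj ` W, snd c \<circ> inv_into W proj)"
      unfolding atlas_Q by blast
    have im: "snd e ` fst e = snd c ` W"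
      by (simp only: e fst_conv snd_conv image_comp[symmetric] inv_into_image_cancel[OF W(3) order_refl])
    show "openin (mtop Q) (fst e)" using proj_open[OF W(1)] by (simp add: e)
    have oW: "open (snd c ` W)"
      using open_chart_image[OF smooth c W(1)] W(2) by (simp add: Int_absorb2)
    then show "open (snd e ` fst e)" by (simp add: im)
    have "homeomorphic_map (subtopology (subtopology (mtop M) (fst c)) W) (subtopology (top_of_set (snd c ` fst c)) (snd c ` W)) (snd c)"
      by (rule homeomorphic_map_subtopologies[OF chart_homeomorphic[OF smooth c]])
        (use W(2) chart_subset[OF smooth c] in auto)
    moreover have "fst c \<inter> W = W" "snd c ` fst c \<inter> snd c ` W = snd c ` W" using W(2) by auto
    ultimately have "homeomorphic_map (subtopology (mtop M) W) (top_of_set (snd c ` W)) (snd c)"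
      by (simp only: subtopology_subtopology)
    from homeomorphic_map_compose[OF proj_homeomorphic[OF W(1,3)] this]
    show "homeomorphic_map (subtopology (mtop Q) (fst e)) (top_of_set (snd e ` fst e)) (snd e)"
      by (simp only: im) (simp add: e)
    fix e' assume "e' \<in> atlas Q"
    then obtain W' c' where c': "c' \<in> atlas M" and W': "openin (mtop M) W'" "W' \<subseteq> fst c'" "inj_on proj W'"
      and e': "e' = (proj ` W', snd c' \<circ> inv_into W' proj)"
      unfolding atlas_Q by blast
    show "smooth_on (snd e ` (fst e \<inter> fst e')) (snd e' \<circ> chart_inv e)"
    proof (rule smooth_on_local)
      fix t assume "t \<in> snd e ` (fst e \<inter> fst e')"
      then obtain m where m: "m \<in> proj ` W" "m \<in> proj ` W'" "t = snd c (inv_into W proj m)"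
        by (auto simp: e e')
      then obtain x x' where "x \<in> W" "x' \<in> W'" "m = proj x" "m = proj x'" by blast
      with m(3) W(3) have x: "x \<in> W" "x' \<in> W'" "proj x = proj x'" "t = snd c x"
        by simp_all
      from local_section_smooth[OF c _ c' _ W'(1,3) x(2,3)] obtain S
        where S: "open S" "snd c x \<in> S" "smooth_on S (snd c' \<circ> inv_into W' proj \<circ> proj \<circ> chart_inv c)"
        using x W W' by blast
      have o: "open (S \<inter> snd c ` W)" using S(1) oW by blast
      have "smooth_on (S \<inter> snd c ` W) (snd c' \<circ> inv_into W' proj \<circ> proj \<circ> chart_inv c)"
        by (rule smooth_on_subset[OF S(3)]) simp
      moreover have "(snd c' \<circ> inv_into W' proj \<circ> proj \<circ> chart_inv c) s = (snd e' \<circ> chart_inv e) s"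
        if "s \<in> S \<inter> snd c ` W" for s
      proof -
        obtain y where y: "y \<in> W" "s = snd c y" using \<open>s \<in> S \<inter> snd c ` W\<close> by blast
        then have "chart_inv c s = y" using W(2) smooth c by auto
        then show ?thesis using chart_inv_Q[OF c W(2,3) y(1)] y by (simp add: e e')
      qed
      ultimately have "smooth_on (S \<inter> snd c ` W) (snd e' \<circ> chart_inv e)"
        by (subst smooth_on_cong[OF o, symmetric]) auto
      then show "\<exists>T. open T \<and> t \<in> T \<and> smooth_on T (snd e' \<circ> chart_inv e)"
        using o S x by (intro exI[of _ "S \<inter> snd c ` W"]) auto
    qed
  }
  fix m assume "m \<in> pts Q"
  then obtain x where x: "x \<in> pts M" "m = proj x" unfolding pts_Q mem_quotient by blast
  obtain W where W: "openin (mtop M) W" "x \<in> W" "inj_on proj W" using proj_inj[OF x(1)] by blast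
  let ?c = "chart_at M x"
  note c = chart_at_atlas[OF smooth x(1)] chart_at_mem[OF smooth x(1)]
  have "(proj ` (W \<inter> fst ?c), snd ?c \<circ> inv_into (W \<inter> fst ?c) proj) \<in> atlas Q"
    unfolding atlas_Q using W c chart_openin[OF smooth c(1)]
    by (intro exI[of _ "W \<inter> fst ?c"] exI[of _ ?c]) (auto intro: inj_on_subset)
  moreover have "m \<in> proj ` (W \<inter> fst ?c)" using x W c by auto
  ultimately have "\<exists>e. e \<in> quotient_atlas M R \<and> m \<in> fst e"
    by (intro exI[of _ "(proj ` (W \<inter> fst ?c), snd ?c \<circ> inv_into (W \<inter> fst ?c) proj)"])
      (simp add: quotient_manifold_def)
  from someI_ex[OF this] show "chart_at Q m \<in> atlas Q" "m \<in> fst (chart_at Q m)"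
    by (simp_all add: quotient_manifold_def)
qed

text \<open>Both directions reduce to \<open>local_section_smooth\<close>: a chart of the quotient
  is itself a local inverse of \<open>proj\<close> followed by a chart of \<open>M\<close>.\<close>

lemma proj_local_diffeo: "local_diffeo M Q proj"
  unfolding local_diffeo_def
proof
  fix x assume "x \<in> pts M"
  then obtain W where W: "openin (mtop M) W" "x \<in> W" "inj_on proj W" using proj_inj by blast
  have "smooth_map_on W M Q proj"
  proof (rule smooth_map_onI[OF smooth W(1)])
    show "continuous_map (subtopology (mtop M) W) (mtop Q) proj"
      by (rule continuous_map_from_subtopology[OF proj_continuous])
    fix y c e assume y: "y \<in> W" "c \<in> atlas M" "e \<in> atlas Q" "y \<in> fst c" "proj y \<in> fst e"
    then obtain W' c' where c': "c' \<in> atlas M" and W': "openin (mtop M) W'" "W' \<subseteq> fst c'" "inj_on proj W'"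
      and e: "e = (proj ` W', snd c' \<circ> inv_into W' proj)"
      unfolding atlas_Q by blast
    obtain y' where y': "y' \<in> W'" "proj y = proj y'" using y(5) by (auto simp: e)
    show "\<exists>S. open S \<and> snd c y \<in> S \<and> smooth_on S (snd e \<circ> proj \<circ> chart_inv c)"
      using local_section_smooth[OF y(2,4) c' _ W'(1,3) y'] W'(2) y'(1) by (auto simp: e)
  qed
  moreover have "smooth_map_on (proj ` W) Q M (inv_into W proj)"
  proof (rule smooth_map_onI[OF smooth_Q proj_open[OF W(1)]])
    show "continuous_map (subtopology (mtop Q) (proj ` W)) (mtop M) (inv_into W proj)"
      using homeomorphic_imp_continuous_map[OF proj_homeomorphic[OF W(1,3)]]
      by (simp add: continuous_map_in_subtopology)
    fix m e c assume m: "m \<in> proj ` W" "e \<in> atlas Q" "c \<in> atlas M" "m \<in> fst e" "inv_into W proj m \<in> fst c"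
    then obtain W' c' where c': "c' \<in> atlas M" and W': "openin (mtop M) W'" "W' \<subseteq> fst c'" "inj_on proj W'"
      and e: "e = (proj ` W', snd c' \<circ> inv_into W' proj)"
      unfolding atlas_Q by blast
    obtain y' where y': "y' \<in> W'" "m = proj y'" using m(4) by (auto simp: e)
    define y where "y = inv_into W proj m"
    have y: "y \<in> W" "proj y' = proj y"
      unfolding y_def using inv_into_into[OF m(1)] f_inv_into_f[OF m(1)] y'(2) by simp_all
    from local_section_smooth[OF c' _ m(3) _ W(1,3) y] obtain S where
      S: "open S" "snd c' y' \<in> S" "smooth_on S (snd c \<circ> inv_into W proj \<circ> proj \<circ> chart_inv c')"
      using W'(2) y'(1) m(5) by (auto simp: y_def)
    have oW: "open (snd c' ` W')"
      using open_chart_image[OF smooth c' W'(1)] W'(2) by (simp add: Int_absorb2)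
    have o: "open (S \<inter> snd c' ` W')" using S(1) oW by blast
    have "smooth_on (S \<inter> snd c' ` W') (snd c \<circ> inv_into W proj \<circ> proj \<circ> chart_inv c')"
      by (rule smooth_on_subset[OF S(3)]) simp
    moreover have "(snd c \<circ> inv_into W proj \<circ> proj \<circ> chart_inv c') s = (snd c \<circ> inv_into W proj \<circ> chart_inv e) s"
      if "s \<in> S \<inter> snd c' ` W'" for s
    proof -
      obtain z where z: "z \<in> W'" "s = snd c' z" using \<open>s \<in> S \<inter> snd c' ` W'\<close> by blast
      then have "chart_inv c' s = z" using W'(2) smooth c' by auto
      then show ?thesis using chart_inv_Q[OF c' W'(2,3) z(1)] z by (simp add: e)
    qed
    ultimately have "smooth_on (S \<inter> snd c' ` W') (snd c \<circ> inv_into W proj \<circ> chart_inv e)"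
      by (subst smooth_on_cong[OF o, symmetric]) auto
    moreover have "snd e m \<in> S \<inter> snd c' ` W'" using y' S W'(3) by (simp add: e)
    ultimately show "\<exists>S. open S \<and> snd e m \<in> S \<and> smooth_on S (snd c \<circ> inv_into W proj \<circ> chart_inv e)"
      using o by blast
  qed
  ultimately show "\<exists>U. x \<in> U \<and> inj_on proj U \<and> smooth_map_on U M Q proj \<and> smooth_map_on (proj ` U) Q M (inv_into U proj)"
    using W by blast
qed

end

section \<open>Covering spaces of topological spaces\<close>

text \<open>
  The library proves the lifting theorems for covering spaces only for subsets of normed spaces, so
  the ones needed here are proved for arbitrary topological spaces.
\<close>

lemma covering_space_sheets:
  assumes "covering_space C p S" "z \<in> S"
  obtains T \<V> where "z \<in> T" "openin (top_of_set S) T" "\<Union>\<V> = C \<inter> p -` T"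
    "\<And>u. u \<in> \<V> \<Longrightarrow> openin (top_of_set C) u" "pairwise disjnt \<V>"
    "\<And>u. u \<in> \<V> \<Longrightarrow> \<exists>q. homeomorphism u T p q"
  using assms unfolding covering_space_def by metis

text \<open>The set where the two lifts agree is open and closed: near a point of agreement both
  stay in one sheet, on which \<open>p\<close> is injective, and near a point of disagreement they
  stay in disjoint sheets.\<close>

lemma covering_lift_unique:
  fixes g1 g2 :: "'x::topological_space \<Rightarrow> 'c::topological_space"
  assumes cov: "covering_space C p S" and T: "connected T"
    and g1: "continuous_on T g1" "g1 \<in> T \<rightarrow> C" and g2: "continuous_on T g2" "g2 \<in> T \<rightarrow> C"
    and eq: "\<And>x. x \<in> T \<Longrightarrow> p (g1 x) = p (g2 x)" and a: "a \<in> T" "g1 a = g2 a" and x: "x \<in> T"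
  shows "g1 x = g2 x"
proof -
  define A where "A = {x \<in> T. g1 x = g2 x}"
  have nbhd: "\<exists>N. openin (top_of_set T) N \<and> y \<in> N \<and> (if y \<in> A then N \<subseteq> A else N \<subseteq> T - A)" if y: "y \<in> T" for y
  proof -
    have "p (g1 y) \<in> S" using y g1(2) covering_space_imp_surjective[OF cov] by blast
    then obtain V \<V> where V: "p (g1 y) \<in> V" "\<Union>\<V> = C \<inter> p -` V"
      and op: "\<And>u. u \<in> \<V> \<Longrightarrow> openin (top_of_set C) u" and dis: "pairwise disjnt \<V>"
      and hom: "\<And>u. u \<in> \<V> \<Longrightarrow> \<exists>q. homeomorphism u V p q"
      by (rule covering_space_sheets[OF cov]) blast
    have "g1 y \<in> \<Union>\<V>" "g2 y \<in> \<Union>\<V>" using V y g1(2) g2(2) eq by auto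
    then obtain u1 u2 where u: "g1 y \<in> u1" "u1 \<in> \<V>" "g2 y \<in> u2" "u2 \<in> \<V>" by blast
    define N where "N = (T \<inter> g1 -` u1) \<inter> (T \<inter> g2 -` u2)"
    have N: "openin (top_of_set T) N" "y \<in> N"
      unfolding N_def using y u op[OF u(2)] op[OF u(4)]
      by (auto intro!: openin_Int continuous_openin_preimage[OF g1] continuous_openin_preimage[OF g2])
    have inj: "w = w'" if "w \<in> u1" "w' \<in> u1" "p w = p w'" for w w'
      using hom[OF u(2)] that unfolding homeomorphism_def by metis
    show ?thesis
    proof (cases "y \<in> A")
      case True
      then have "u1 = u2" using u dis unfolding A_def pairwise_def disjnt_iff by fastforce
      then have "N \<subseteq> A" using inj eq by (auto simp: N_def A_def)
      then show ?thesis using True N by auto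
    next
      case False
      then have "u1 \<noteq> u2" using inj u eq[OF y] y by (auto simp: A_def)
      then have "disjnt u1 u2" using dis u by (auto simp: pairwise_def)
      then have "N \<subseteq> T - A" by (auto simp: N_def A_def disjnt_iff)
      then show ?thesis using False N by auto
    qed
  qed
  have "openin (top_of_set T) A"
    by (subst openin_subopen) (use nbhd in \<open>fastforce simp: A_def\<close>)
  moreover have "openin (top_of_set T) (T - A)"
    by (subst openin_subopen) (use nbhd in fastforce)
  then have "closedin (top_of_set T) A" by (simp add: closedin_def A_def)
  ultimately have "A = {} \<or> A = T" using T by (simp add: connected_clopen)
  then show ?thesis using a x by (auto simp: A_def)
qed

text \<open>All starting points of \<open>D\<close> and all points over them are allowed, so that a
  lift on one piece can be continued on an adjacent piece from any common point.\<close>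

definition lift_property :: "'c::topological_space set \<Rightarrow> ('c \<Rightarrow> 'a) \<Rightarrow> (real \<times> real \<Rightarrow> 'a) \<Rightarrow> (real \<times> real) set \<Rightarrow> bool" where
  "lift_property C p h D \<longleftrightarrow> (\<forall>z\<in>D. \<forall>a\<in>C. p a = h z \<longrightarrow>
     (\<exists>k. continuous_on D k \<and> k \<in> D \<rightarrow> C \<and> (\<forall>w\<in>D. p (k w) = h w) \<and> k z = a))"

text \<open>The lift on one piece is continued from a common point. Uniqueness on the connected
  intersection makes the two lifts agree there, and closedness of the pieces makes the glued map
  continuous.\<close>

lemma lift_property_Un:
  assumes cov: "covering_space C p S" and D: "lift_property C p h D1" "lift_property C p h D2"
    and cl: "closed D1" "closed D2" and con: "connected (D1 \<inter> D2)" "D1 \<inter> D2 \<noteq> {}"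
  shows "lift_property C p h (D1 \<union> D2)"
proof -
  have main: "\<exists>k. continuous_on (D1 \<union> D2) k \<and> k \<in> D1 \<union> D2 \<rightarrow> C \<and> (\<forall>w\<in>D1 \<union> D2. p (k w) = h w) \<and> k z = a"
    if D: "lift_property C p h D1" "lift_property C p h D2" and cl: "closed D1" "closed D2"
      and con: "connected (D1 \<inter> D2)" "D1 \<inter> D2 \<noteq> {}" and z: "z \<in> D1" "a \<in> C" "p a = h z"
    for D1 D2 z a
  proof -
    obtain k1 where k1: "continuous_on D1 k1" "k1 \<in> D1 \<rightarrow> C" "\<And>w. w \<in> D1 \<Longrightarrow> p (k1 w) = h w" "k1 z = a"
      using D(1) z unfolding lift_property_def by metis
    obtain w where w: "w \<in> D1" "w \<in> D2" using con(2) by blast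
    have "k1 w \<in> C" "p (k1 w) = h w" using k1 w by auto
    then obtain k2 where k2: "continuous_on D2 k2" "k2 \<in> D2 \<rightarrow> C" "\<And>w. w \<in> D2 \<Longrightarrow> p (k2 w) = h w" "k2 w = k1 w"
      using D(2) w(2) unfolding lift_property_def by metis
    have "k1 y = k2 y" if "y \<in> D1 \<inter> D2" for y
      by (rule covering_lift_unique[OF cov con(1), of k1 k2 w])
        (use k1 k2 w that in \<open>auto intro: continuous_on_subset\<close>)
    then have "continuous_on (D1 \<union> D2) (\<lambda>x. if x \<in> D1 then k1 x else k2 x)"
      by (intro continuous_on_cases cl k1(1) k2(1)) auto
    then show ?thesis
      using k1 k2 z by (intro exI[of _ "\<lambda>x. if x \<in> D1 then k1 x else k2 x"]) auto
  qed
  show ?thesis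
    unfolding lift_property_def
  proof (intro ballI impI)
    fix z a assume z: "z \<in> D1 \<union> D2" "a \<in> C" "p a = h z"
    show "\<exists>k. continuous_on (D1 \<union> D2) k \<and> k \<in> D1 \<union> D2 \<rightarrow> C \<and> (\<forall>w\<in>D1 \<union> D2. p (k w) = h w) \<and> k z = a"
    proof (cases "z \<in> D1")
      case True
      then show ?thesis by (intro main D cl con z)
    next
      case False
      then have "z \<in> D2" using z by simp
      from main[OF D(2,1) cl(2,1) _ _ this z(2,3)] con show ?thesis by (simp add: Un_commute Int_commute)
    qed
  qed
qed

text \<open>A small subset of the square goes into one evenly covered set and lifts by the inverse
  of a sheet. A bisection argument in the second coordinate assembles strips of full height, and one
  in the first coordinate assembles the square.\<close>

lemma lift_property_square:
  assumes cov: "covering_space C p S" and h: "continuous_on ({0..1} \<times> {0..1}) h" "h \<in> {0..1} \<times> {0..1} \<rightarrow> S"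
  shows "lift_property C p h ({0..1} \<times> {0..1})"
proof -
  let ?I = "{0..1::real} \<times> {0..1::real}"
  have small: "\<exists>e>0. \<forall>D. D \<subseteq> ?I \<and> (\<forall>(s, t)\<in>D. \<bar>s - x\<bar> < e \<and> \<bar>t - y\<bar> < e) \<longrightarrow> lift_property C p h D"
    if xy: "(x, y) \<in> ?I" for x y
  proof -
    have "h (x, y) \<in> S" using h(2) xy by blast
    then obtain T \<V> where T: "h (x, y) \<in> T" "openin (top_of_set S) T" "\<Union>\<V> = C \<inter> p -` T"
      and hom: "\<And>u. u \<in> \<V> \<Longrightarrow> \<exists>q. homeomorphism u T p q"
      by (rule covering_space_sheets[OF cov]) blast
    have "openin (top_of_set ?I) (?I \<inter> h -` T)" by (rule continuous_openin_preimage[OF h T(2)])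
    then obtain N where N: "open N" "?I \<inter> h -` T = ?I \<inter> N" by (auto simp: openin_open)
    have "(x, y) \<in> N" using N(2) xy T(1) by blast
    then obtain A B where AB: "open A" "open B" "x \<in> A" "y \<in> B" "A \<times> B \<subseteq> N"
      using open_prod_elim[OF N(1)] by (metis mem_Sigma_iff)
    obtain e1 where e1: "e1 > 0" "\<And>s. dist s x < e1 \<Longrightarrow> s \<in> A" using AB(1,3) unfolding open_dist by metis
    obtain e2 where e2: "e2 > 0" "\<And>s. dist s y < e2 \<Longrightarrow> s \<in> B" using AB(2,4) unfolding open_dist by metis
    have "lift_property C p h D" if D: "D \<subseteq> ?I" "\<forall>(s, t)\<in>D. \<bar>s - x\<bar> < min e1 e2 \<and> \<bar>t - y\<bar> < min e1 e2" for D
      unfolding lift_property_def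
    proof (intro ballI impI)
      fix z a assume z: "z \<in> D" "a \<in> C" "p a = h z"
      have DT: "w \<in> ?I" "h w \<in> T" if "w \<in> D" for w
      proof -
        have "w \<in> A \<times> B" using D(2) that e1(2) e2(2) by (cases w) (auto simp: dist_real_def)
        then show "w \<in> ?I" "h w \<in> T" using N(2) AB(5) D(1) that by blast+
      qed
      have "a \<in> \<Union>\<V>" using T(3) z DT(2)[OF z(1)] by auto
      then obtain u where u: "u \<in> \<V>" "a \<in> u" by blast
      obtain q where q: "homeomorphism u T p q" using hom[OF u(1)] by blast
      have uC: "u \<subseteq> C" using T(3) u(1) by blast
      have "continuous_on D (\<lambda>w. q (h w))"
        by (rule continuous_on_compose2[of T q]) (use q DT(2) continuous_on_subset[OF h(1) D(1)] in \<open>auto simp: homeomorphism_def\<close>)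
      moreover have "q (h w) \<in> C \<and> p (q (h w)) = h w" if "w \<in> D" for w
        using q DT(2)[OF that] uC by (auto simp: homeomorphism_def)
      moreover have "q (h z) = a" using q u(2) z(3) by (metis homeomorphism_apply1)
      ultimately show "\<exists>k. continuous_on D k \<and> k \<in> D \<rightarrow> C \<and> (\<forall>w\<in>D. p (k w) = h w) \<and> k z = a"
        by (intro exI[of _ "\<lambda>w. q (h w)"]) auto
    qed
    then show ?thesis using e1(1) e2(1) by (intro exI[of _ "min e1 e2"]) auto
  qed
  \<comment> \<open>The width \<open>d\<close> has to serve the full height at once; gluing two
    rectangles takes the minimum of their widths.\<close>
  have strip: "\<exists>d>0. \<forall>s s'. 0 \<le> s \<and> s \<le> x \<and> x \<le> s' \<and> s' \<le> 1 \<and> s' - s < d \<longrightarrow> lift_property C p h ({s..s'} \<times> {0..1})"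
    if x: "0 \<le> x" "x \<le> 1" for x :: real
  proof -
    let ?P = "\<lambda>t t'. 0 \<le> t \<and> t' \<le> 1 \<longrightarrow>
      (\<exists>d>0. \<forall>s s'. 0 \<le> s \<and> s \<le> x \<and> x \<le> s' \<and> s' \<le> 1 \<and> s' - s < d \<longrightarrow> lift_property C p h ({s..s'} \<times> {t..t'}))"
    have "?P 0 1"
    proof (rule Bolzano[where P = ?P])
      fix t1 t2 t3 assume trans: "?P t1 t2" "?P t2 t3" "t1 \<le> t2" "t2 \<le> t3"
      show "?P t1 t3"
      proof
        assume t: "0 \<le> t1 \<and> t3 \<le> 1"
        obtain d1 where d1: "d1 > 0" "\<And>s s'. 0 \<le> s \<and> s \<le> x \<and> x \<le> s' \<and> s' \<le> 1 \<and> s' - s < d1 \<Longrightarrow> lift_property C p h ({s..s'} \<times> {t1..t2})"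
          using trans t by (metis order_trans)
        obtain d2 where d2: "d2 > 0" "\<And>s s'. 0 \<le> s \<and> s \<le> x \<and> x \<le> s' \<and> s' \<le> 1 \<and> s' - s < d2 \<Longrightarrow> lift_property C p h ({s..s'} \<times> {t2..t3})"
          using trans t by (metis order_trans)
        have "lift_property C p h ({s..s'} \<times> {t1..t3})"
          if s: "0 \<le> s \<and> s \<le> x \<and> x \<le> s' \<and> s' \<le> 1 \<and> s' - s < min d1 d2" for s s'
        proof -
          have eq: "{s..s'} \<times> {t1..t3} = {s..s'} \<times> {t1..t2} \<union> {s..s'} \<times> {t2..t3}"
            "({s..s'} \<times> {t1..t2}) \<inter> ({s..s'} \<times> {t2..t3}) = {s..s'} \<times> {t2}"
            using trans(3,4) by auto
          show ?thesis
            unfolding eq(1)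
            by (rule lift_property_Un[OF cov d1(2) d2(2)])
              (use s in \<open>auto simp: eq(2) closed_Times connected_Times\<close>)
        qed
        then show "\<exists>d>0. \<forall>s s'. 0 \<le> s \<and> s \<le> x \<and> x \<le> s' \<and> s' \<le> 1 \<and> s' - s < d \<longrightarrow> lift_property C p h ({s..s'} \<times> {t1..t3})"
          using d1(1) d2(1) by (intro exI[of _ "min d1 d2"]) auto
      qed
    next
      fix y :: real assume local: "0 \<le> y" "y \<le> 1"
      have "(x, y) \<in> ?I" using x local by simp
      from small[OF this] obtain e where e: "e > 0"
        "\<And>D. D \<subseteq> ?I \<and> (\<forall>(s, t)\<in>D. \<bar>s - x\<bar> < e \<and> \<bar>t - y\<bar> < e) \<Longrightarrow> lift_property C p h D"
        by blast
      have "lift_property C p h ({s..s'} \<times> {t..t'})"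
        if "t \<le> y" "y \<le> t'" "t' - t < e" "0 \<le> t" "t' \<le> 1" "0 \<le> s" "s \<le> x" "x \<le> s'" "s' \<le> 1" "s' - s < e" for s s' t t'
        by (rule e(2)) (use that in auto)
      then show "\<exists>d>0. \<forall>a b. a \<le> y \<and> y \<le> b \<and> b - a < d \<longrightarrow> ?P a b"
        using e(1) by (intro exI[of _ e] conjI allI impI) auto
    qed simp
    then show ?thesis by simp
  qed
  let ?R = "\<lambda>s s'. 0 \<le> s \<and> s' \<le> 1 \<longrightarrow> lift_property C p h ({s..s'} \<times> {0..1})"
  have "?R 0 1"
  proof (rule Bolzano[where P = ?R])
    fix s1 s2 s3 assume trans: "?R s1 s2" "?R s2 s3" "s1 \<le> s2" "s2 \<le> s3"
    show "?R s1 s3"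
    proof
      assume s: "0 \<le> s1 \<and> s3 \<le> 1"
      have eq: "{s1..s3} \<times> {0..1::real} = {s1..s2} \<times> {0..1} \<union> {s2..s3} \<times> {0..1}"
        "({s1..s2} \<times> {0..1::real}) \<inter> ({s2..s3} \<times> {0..1}) = {s2} \<times> {0..1}"
        using trans(3,4) by auto
      show "lift_property C p h ({s1..s3} \<times> {0..1})"
        unfolding eq(1)
        by (rule lift_property_Un[OF cov]) (use s trans in \<open>auto simp: eq(2) closed_Times connected_Times\<close>)
    qed
  next
    fix x :: real assume "0 \<le> x" "x \<le> 1"
    then show "\<exists>d>0. \<forall>a b. a \<le> x \<and> x \<le> b \<and> b - a < d \<longrightarrow> ?R a b"
      using strip[of x] by meson
  qed simp
  then show ?thesis by simp
qed

lemma covering_lift_square: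
  fixes h :: "real \<times> real \<Rightarrow> 'a::topological_space" and C :: "'c::topological_space set"
  assumes cov: "covering_space C p S" and h: "continuous_on ({0..1} \<times> {0..1}) h" "h \<in> {0..1} \<times> {0..1} \<rightarrow> S"
    and a: "a \<in> C" "p a = h (0, 0)"
  obtains k where "continuous_on ({0..1} \<times> {0..1}) k" "k \<in> {0..1} \<times> {0..1} \<rightarrow> C"
    "\<And>s t. s \<in> {0..1} \<Longrightarrow> t \<in> {0..1} \<Longrightarrow> p (k (s, t)) = h (s, t)" "k (0, 0) = a"
proof -
  have "\<exists>k. continuous_on ({0..1} \<times> {0..1}) k \<and> k \<in> {0..1} \<times> {0..1} \<rightarrow> C \<and>
      (\<forall>w\<in>{0..1} \<times> {0..1}. p (k w) = h w) \<and> k (0, 0) = a"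
    using lift_property_square[OF cov h] a unfolding lift_property_def by force
  then show ?thesis using that by auto
qed

section \<open>Lifts of paths and homotopies\<close>

definition lifted_path :: "'c::topological_space set \<Rightarrow> ('c \<Rightarrow> 'a) \<Rightarrow> 'c \<Rightarrow> (real \<Rightarrow> 'a) \<Rightarrow> (real \<Rightarrow> 'c) \<Rightarrow> bool" where
  "lifted_path C p a \<gamma> \<eta> \<longleftrightarrow> path \<eta> \<and> path_image \<eta> \<subseteq> C \<and> pathstart \<eta> = a \<and> (\<forall>t\<in>{0..1}. p (\<eta> t) = \<gamma> t)"

lemma path_imageD: "path_image \<eta> \<subseteq> C \<Longrightarrow> t \<in> {0..1} \<Longrightarrow> \<eta> t \<in> C"
  by (auto simp: path_image_def)

lemma continuous_on_slice:
  assumes "continuous_on ({0..1} \<times> {0..1}) k" "continuous_on {0..1} f" "continuous_on {0..1} g"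
    "f \<in> {0..1} \<rightarrow> {0..1}" "g \<in> {0..1} \<rightarrow> {0..1}"
  shows "continuous_on {0..1::real} (\<lambda>t. k (f t :: real, g t :: real))"
  by (rule continuous_on_compose2[OF assms(1)]) (use assms in \<open>auto intro!: continuous_on_Pair\<close>)

lemma lifted_path_exists:
  fixes \<gamma> :: "real \<Rightarrow> 'a::topological_space" and C :: "'c::topological_space set"
  assumes cov: "covering_space C p S" and \<gamma>: "path \<gamma>" "path_image \<gamma> \<subseteq> S" and a: "a \<in> C" "p a = pathstart \<gamma>"
  shows "\<exists>\<eta>. lifted_path C p a \<gamma> \<eta>"
proof -
  \<comment> \<open>The path is read as a map of the square that ignores the first
    coordinate.\<close>
  have c: "continuous_on ({0..1} \<times> {0..1}) (\<lambda>z :: real \<times> real. \<gamma> (snd z))"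
    by (rule continuous_on_compose2[of "{0..1}" \<gamma>]) (use \<gamma>(1) in \<open>auto simp: path_def intro: continuous_on_snd\<close>)
  have i: "(\<lambda>z :: real \<times> real. \<gamma> (snd z)) \<in> {0..1} \<times> {0..1} \<rightarrow> S"
    using path_imageD[OF \<gamma>(2)] by auto
  obtain k :: "real \<times> real \<Rightarrow> 'c" where k: "continuous_on ({0..1} \<times> {0..1}) k" "k \<in> {0..1} \<times> {0..1} \<rightarrow> C"
    "\<And>s t. s \<in> {0..1} \<Longrightarrow> t \<in> {0..1} \<Longrightarrow> p (k (s, t)) = \<gamma> (snd (s, t))" "k (0, 0) = a"
    by (rule covering_lift_square[OF cov c i a(1)]) (use a(2) in \<open>auto simp: pathstart_def\<close>)
  have "lifted_path C p a \<gamma> (\<lambda>t. k (0, t))"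
    using k continuous_on_slice[OF k(1), of "\<lambda>_. 0" "\<lambda>t. t"]
    by (auto simp: lifted_path_def path_def path_image_def pathstart_def)
  then show ?thesis by blast
qed

lemma lifted_path_unique:
  assumes cov: "covering_space C p S" and \<eta>: "lifted_path C p a \<gamma> \<eta>"
    and k: "continuous_on {0..1} k" "k \<in> {0..1} \<rightarrow> C" "\<And>t. t \<in> {0..1} \<Longrightarrow> p (k t) = \<gamma> t" "k 0 = a"
  shows "k 1 = pathfinish \<eta>"
  using covering_lift_unique[OF cov, of "{0..1::real}" k \<eta> 0 1] \<eta> k path_imageD[of \<eta> C]
  by (auto simp: lifted_path_def path_def pathstart_def pathfinish_def)

lemma lift_of_constant:
  assumes cov: "covering_space C p S" and k: "continuous_on {0..1::real} k" "k \<in> {0..1} \<rightarrow> C"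
    and c: "\<And>t. t \<in> {0..1} \<Longrightarrow> p (k t) = b"
  shows "k 1 = k 0"
proof -
  have "k 0 \<in> C" using k(2) by auto
  then show ?thesis
    using covering_lift_unique[OF cov, of "{0..1::real}" k "\<lambda>_. k 0" 0 1] k c by auto
qed

text \<open>The homotopy lifts to the square. Two edges of the lift lie over the fixed endpoints and
  are therefore constant; the other two are the lifts of \<gamma> and \<delta>.\<close>

lemma lifted_path_homotopic:
  fixes \<gamma> \<delta> :: "real \<Rightarrow> 'a::topological_space" and C :: "'c::topological_space set"
  assumes cov: "covering_space C p S" and hom: "homotopic_paths S \<gamma> \<delta>" and a: "a \<in> C"
    and \<eta>: "lifted_path C p a \<gamma> \<eta>" and \<theta>: "lifted_path C p a \<delta> \<theta>"
  shows "pathfinish \<eta> = pathfinish \<theta>"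
proof -
  obtain h :: "real \<times> real \<Rightarrow> 'a" where h: "continuous_on ({0..1} \<times> {0..1}) h" "h \<in> {0..1} \<times> {0..1} \<rightarrow> S"
    "\<And>x. x \<in> {0..1} \<Longrightarrow> h (0, x) = \<gamma> x" "\<And>x. x \<in> {0..1} \<Longrightarrow> h (1, x) = \<delta> x"
    "\<And>t. t \<in> {0..1} \<Longrightarrow> h (t, 0) = \<gamma> 0" "\<And>t. t \<in> {0..1} \<Longrightarrow> h (t, 1) = \<gamma> 1"
  proof -
    obtain h :: "real \<times> real \<Rightarrow> 'a" where "continuous_on ({0..1} \<times> {0..1}) h" "h \<in> {0..1} \<times> {0..1} \<rightarrow> S"
      "\<forall>x\<in>{0..1}. h (0, x) = \<gamma> x" "\<forall>x\<in>{0..1}. h (1, x) = \<delta> x"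
      "\<forall>t\<in>{0..1}. pathstart (h \<circ> Pair t) = pathstart \<gamma> \<and> pathfinish (h \<circ> Pair t) = pathfinish \<gamma>"
      using hom unfolding homotopic_paths by metis
    then show ?thesis by (intro that[of h]) (auto simp: pathstart_def pathfinish_def)
  qed
  have "p a = h (0, 0)" using h(3)[of 0] \<eta> by (auto simp: lifted_path_def pathstart_def)
  then obtain k :: "real \<times> real \<Rightarrow> 'c" where k: "continuous_on ({0..1} \<times> {0..1}) k" "k \<in> {0..1} \<times> {0..1} \<rightarrow> C"
    "\<And>s t. s \<in> {0..1} \<Longrightarrow> t \<in> {0..1} \<Longrightarrow> p (k (s, t)) = h (s, t)" "k (0, 0) = a"
    using covering_lift_square[OF cov h(1,2) a] by blast
  note sl = continuous_on_slice[OF k(1)]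
  have 0: "k (1, 0) = k (0, 0)"
    by (rule lift_of_constant[OF cov, of "\<lambda>s. k (s, 0)"]) (use sl[of "\<lambda>t. t" "\<lambda>_. 0"] k h in auto)
  have 1: "k (1, 1) = k (0, 1)"
    by (rule lift_of_constant[OF cov, of "\<lambda>s. k (s, 1)"]) (use sl[of "\<lambda>t. t" "\<lambda>_. 1"] k h in auto)
  have "k (0, 1) = pathfinish \<eta>"
    by (rule lifted_path_unique[OF cov \<eta>, of "\<lambda>t. k (0, t)"]) (use sl[of "\<lambda>_. 0" "\<lambda>t. t"] k h in auto)
  moreover have "k (1, 1) = pathfinish \<theta>"
    by (rule lifted_path_unique[OF cov \<theta>, of "\<lambda>t. k (1, t)"]) (use sl[of "\<lambda>_. 1" "\<lambda>t. t"] k h 0 in auto)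
  ultimately show ?thesis using 1 by simp
qed

section \<open>Loops and paths in simply connected spaces\<close>

lemma homotopic_loopsE:
  fixes \<gamma> \<delta> :: "real \<Rightarrow> 'a::topological_space"
  assumes "homotopic_loops S \<gamma> \<delta>"
  obtains h :: "real \<times> real \<Rightarrow> 'a" where "continuous_on ({0..1} \<times> {0..1}) h" "h \<in> {0..1} \<times> {0..1} \<rightarrow> S"
    "\<And>x. x \<in> {0..1} \<Longrightarrow> h (0, x) = \<gamma> x" "\<And>x. x \<in> {0..1} \<Longrightarrow> h (1, x) = \<delta> x"
    "\<And>t. t \<in> {0..1} \<Longrightarrow> h (t, 1) = h (t, 0)"
proof -
  obtain h :: "real \<times> real \<Rightarrow> 'a" where "continuous_on ({0..1} \<times> {0..1}) h" "h \<in> {0..1} \<times> {0..1} \<rightarrow> S"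
    "\<forall>x\<in>{0..1}. h (0, x) = \<gamma> x" "\<forall>x\<in>{0..1}. h (1, x) = \<delta> x"
    "\<forall>t\<in>{0..1}. pathfinish (h \<circ> Pair t) = pathstart (h \<circ> Pair t)"
    using assms unfolding homotopic_loops by metis
  then show ?thesis by (intro that[of h]) (auto simp: pathstart_def pathfinish_def)
qed

lemma simply_connectedD:
  "simply_connected S \<Longrightarrow> path \<gamma> \<Longrightarrow> pathfinish \<gamma> = pathstart \<gamma> \<Longrightarrow> path_image \<gamma> \<subseteq> S \<Longrightarrow>
    path \<delta> \<Longrightarrow> pathfinish \<delta> = pathstart \<delta> \<Longrightarrow> path_image \<delta> \<subseteq> S \<Longrightarrow> homotopic_loops S \<gamma> \<delta>"
  unfolding simply_connected_def by blast

text \<open>Simple connectedness is phrased by free homotopies of loops; a homotopy between two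
  constant loops traces a path from one point to the other.\<close>

lemma simply_connected_imp_paths:
  fixes C :: "'c::topological_space set"
  assumes "simply_connected C" "x \<in> C" "y \<in> C"
  shows "\<exists>\<gamma>. path \<gamma> \<and> path_image \<gamma> \<subseteq> C \<and> pathstart \<gamma> = x \<and> pathfinish \<gamma> = y"
proof -
  have "homotopic_loops C (\<lambda>_. x) (\<lambda>_. y)"
    by (rule simply_connectedD[OF assms(1)])
      (use assms in \<open>auto simp: path_def path_image_def pathstart_def pathfinish_def\<close>)
  then obtain h :: "real \<times> real \<Rightarrow> 'c" where h: "continuous_on ({0..1} \<times> {0..1}) h" "h \<in> {0..1} \<times> {0..1} \<rightarrow> C"
    "\<And>t. t \<in> {0..1} \<Longrightarrow> h (0, t) = x" "\<And>t. t \<in> {0..1} \<Longrightarrow> h (1, t) = y"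
    by (rule homotopic_loopsE) blast
  then show ?thesis
    using continuous_on_slice[OF h(1), of "\<lambda>t. t" "\<lambda>_. 0"]
    by (intro exI[of _ "\<lambda>t. h (t, 0)"]) (auto simp: path_def path_image_def pathstart_def pathfinish_def)
qed

lemma homotopic_paths_reversepath_cancel:
  fixes \<sigma> :: "real \<Rightarrow> 'a::topological_space"
  assumes \<sigma>: "path \<sigma>" "path_image \<sigma> \<subseteq> S"
  shows "homotopic_paths S (\<sigma> +++ reversepath \<sigma>) (\<lambda>_. pathstart \<sigma>)"
proof -
  \<comment> \<open>At stage \<open>s\<close> only the part of \<sigma> up to the parameter
    \<open>1 - s\<close> is run through and back; the second factor is the tent function that goes
    there and back.\<close>
  let ?f = "\<lambda>z :: real \<times> real. (1 - fst z) * (1 - \<bar>2 * snd z - 1\<bar>)"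
  have f: "?f z \<in> {0..1}" if "z \<in> {0..1} \<times> {0..1}" for z
    using that by (auto intro!: mult_nonneg_nonneg mult_le_one)
  have "continuous_on ({0..1} \<times> {0..1}) (\<lambda>z. \<sigma> (?f z))"
    by (rule continuous_on_compose2[of "{0..1}" \<sigma>])
      (use \<sigma>(1) f in \<open>auto simp: path_def image_subset_iff intro!: continuous_intros\<close>)
  moreover have "\<sigma> (?f z) \<in> S" if "z \<in> {0..1} \<times> {0..1}" for z
    using path_imageD[OF \<sigma>(2) f[OF that]] .
  moreover have "\<sigma> (?f (0, t)) = (\<sigma> +++ reversepath \<sigma>) t" if "t \<in> {0..1}" for t
    using that by (auto simp: joinpaths_def reversepath_def intro!: arg_cong[of _ _ \<sigma>])
  ultimately show ?thesis
    unfolding homotopic_paths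
    by (intro exI[of _ "\<lambda>z. \<sigma> (?f z)"]) (auto simp: pathstart_def pathfinish_def joinpaths_def reversepath_def)
qed

lemma homotopic_paths_const_join:
  fixes \<sigma> :: "real \<Rightarrow> 'a::topological_space"
  assumes \<sigma>: "path \<sigma>" "path_image \<sigma> \<subseteq> S"
  shows "homotopic_paths S \<sigma> ((\<lambda>_. pathstart \<sigma>) +++ \<sigma>)"
proof (rule homotopic_paths_reparametrize[OF \<sigma>, where f = "\<lambda>t. max 0 (2 * t - 1)"])
  show "continuous_on {0..1} (\<lambda>t::real. max 0 (2 * t - 1))" by (intro continuous_intros)
  show "((\<lambda>_. pathstart \<sigma>) +++ \<sigma>) t = \<sigma> (max 0 (2 * t - 1))" for t
    by (cases "t \<le> 1 / 2") (simp_all add: joinpaths_def pathstart_def max_absorb1 max_absorb2)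
qed auto

text \<open>
  The image of the square under a free homotopy from \<open>\<eta>\<close> to a constant loop gives a homotopy from
  its lower edge \<open>\<eta>\<close> to its three other edges.
\<close>

lemma simply_connected_loop_null:
  fixes C :: "'c::topological_space set"
  assumes sc: "simply_connected C" and \<eta>: "path \<eta>" "path_image \<eta> \<subseteq> C" "pathfinish \<eta> = pathstart \<eta>"
  shows "homotopic_paths C \<eta> (\<lambda>_. pathstart \<eta>)"
proof -
  let ?x = "pathstart \<eta>" and ?I = "{0..1::real} \<times> {0..1::real}"
  have xC: "?x \<in> C" using \<eta>(2) by auto
  then have "homotopic_loops C \<eta> (\<lambda>_. ?x)"
    by (intro simply_connectedD[OF sc] \<eta>)
      (auto simp: path_def path_image_def pathstart_def pathfinish_def)
  then obtain h where h: "continuous_on ?I h" "h \<in> ?I \<rightarrow> C"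
    "\<And>x. x \<in> {0..1} \<Longrightarrow> h (0, x) = \<eta> x" "\<And>x. x \<in> {0..1} \<Longrightarrow> h (1, x) = ?x"
    "\<And>t. t \<in> {0..1} \<Longrightarrow> h (t, 1) = h (t, 0)"
    by (rule homotopic_loopsE) blast
  define \<sigma> where "\<sigma> s = h (s, 0)" for s
  have \<sigma>: "path \<sigma>" "path_image \<sigma> \<subseteq> C" "pathstart \<sigma> = ?x" "pathfinish \<sigma> = ?x"
    using continuous_on_slice[OF h(1), of "\<lambda>t. t" "\<lambda>_. 0"] h
    by (auto simp: \<sigma>_def path_def path_image_def pathstart_def pathfinish_def)
  have cx: "path (\<lambda>_. ?x)" "path_image (\<lambda>_. ?x) \<subseteq> C"
    using xC by (auto simp: path_def path_image_def)
  let ?b = "linepath (0, 0) (0, 1) :: real \<Rightarrow> real \<times> real"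
  let ?z = "linepath (0, 0) (1, 0) +++ (linepath (1, 0) (1, 1) +++ linepath (1, 1) (0, 1)) :: real \<Rightarrow> real \<times> real"
  have conv: "convex ?I" by (intro convex_Times) auto
  then have seg: "path_image (linepath a b) \<subseteq> ?I" if "a \<in> ?I" "b \<in> ?I" for a b
    using that by (simp add: closed_segment_subset)
  have z: "path_image ?z \<subseteq> ?I"
    by (intro subset_path_image_join seg) auto
  have "homotopic_paths ?I ?b ?z"
    using convex_imp_simply_connected[OF conv] seg[of "(0, 0)" "(0, 1)"] z
    unfolding simply_connected_eq_homotopic_paths by auto
  from homotopic_paths_continuous_image[OF this h(1,2)]
  have "homotopic_paths C (h \<circ> ?b) (h \<circ> ?z)" .
  moreover have "homotopic_paths C \<eta> (h \<circ> ?b)"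
    by (rule homotopic_paths_eq[OF \<eta>(1,2)]) (simp add: h(3) linepath_def)
  \<comment> \<open>The three edges carry the track \<sigma> of the base point, a constant path, and
    \<sigma> backwards, the last because every stage of the homotopy is a loop.\<close>
  moreover have "homotopic_paths C (h \<circ> ?z) (\<sigma> +++ ((\<lambda>_. ?x) +++ reversepath \<sigma>))"
  proof (rule homotopic_paths_eq)
    show "path (h \<circ> ?z)" "path_image (h \<circ> ?z) \<subseteq> C"
      using \<open>homotopic_paths C (h \<circ> ?b) (h \<circ> ?z)\<close> homotopic_paths_imp_path homotopic_paths_imp_subset by blast+
    show "(h \<circ> ?z) t = (\<sigma> +++ ((\<lambda>_. ?x) +++ reversepath \<sigma>)) t" if "t \<in> {0..1}" for t
      using that h(4)[of "4 * t - 2"] h(5)[of "3 - 4 * t + 1"]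
      by (auto simp: joinpaths_def linepath_def reversepath_def \<sigma>_def h(4,5) algebra_simps
          not_le field_simps intro!: arg_cong[of _ _ h])
  qed
  moreover have "homotopic_paths C (\<sigma> +++ ((\<lambda>_. ?x) +++ reversepath \<sigma>)) (\<sigma> +++ reversepath \<sigma>)"
  proof (rule homotopic_paths_join)
    show "homotopic_paths C \<sigma> \<sigma>" using \<sigma> by simp
    show "homotopic_paths C ((\<lambda>_. ?x) +++ reversepath \<sigma>) (reversepath \<sigma>)"
      using homotopic_paths_const_join[of "reversepath \<sigma>" C] \<sigma> by (simp add: homotopic_paths_sym)
    show "pathfinish \<sigma> = pathstart ((\<lambda>_. ?x) +++ reversepath \<sigma>)"
      using \<sigma>(4) by (simp add: pathstart_def joinpaths_def)
  qed
  moreover have "homotopic_paths C (\<sigma> +++ reversepath \<sigma>) (\<lambda>_. ?x)"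
    using homotopic_paths_reversepath_cancel[OF \<sigma>(1,2)] \<sigma>(3) by simp
  ultimately show ?thesis by (meson homotopic_paths_trans)
qed

subsection \<open>Covering transformations of a simply connected covering space\<close>

text \<open>Local path connectedness of \<open>C\<close>, the assumption \<open>lpc\<close>, makes
  maps defined through endpoints of lifted paths continuous.\<close>

locale simply_connected_covering =
  fixes C :: "'c::topological_space set" and p :: "'c \<Rightarrow> 'a::topological_space" and S :: "'a set"
  assumes cov: "covering_space C p S" and sc: "simply_connected C"
    and lpc: "\<And>U x. openin (top_of_set C) U \<Longrightarrow> x \<in> U \<Longrightarrow>
      \<exists>V. openin (top_of_set C) V \<and> x \<in> V \<and> V \<subseteq> U \<and> path_connected V"
begin

lemma p_image: "p ` C = S"
  using cov by (rule covering_space_imp_surjective)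

lemma p_continuous: "continuous_on C p"
  using cov by (rule covering_space_imp_continuous)

lemma connected_C: "connected C"
proof -
  have "path_connected C" unfolding path_connected_def using simply_connected_imp_paths[OF sc] by auto
  then show ?thesis by (rule path_connected_imp_connected)
qed

text \<open>The loop formed by \<alpha> and the reverse of \<beta> is freely homotopic to a
  constant, and the projected homotopy is lifted from \<open>x\<close>. The lift of the projected
  loop turns out to be closed, so its first half and its reversed second half both start at
  \<open>x\<close>; they are \<open>\<alpha>'\<close> and \<open>\<beta>'\<close> and meet in the
  middle.\<close>

lemma lifted_path_endpoint:
  assumes a: "path \<alpha>" "path_image \<alpha> \<subseteq> C" and b: "path \<beta>" "path_image \<beta> \<subseteq> C"
    and ab: "pathstart \<alpha> = pathstart \<beta>" "pathfinish \<alpha> = pathfinish \<beta>" and xC: "x \<in> C"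
    and \<alpha>': "lifted_path C p x (p \<circ> \<alpha>) \<alpha>'" and \<beta>': "lifted_path C p x (p \<circ> \<beta>) \<beta>'"
  shows "pathfinish \<alpha>' = pathfinish \<beta>'"
proof -
  let ?l = "\<alpha> +++ reversepath \<beta>"
  have l: "path ?l" "path_image ?l \<subseteq> C" "pathfinish ?l = pathstart ?l"
    using a b ab by (auto simp: subset_path_image_join)
  have y: "\<alpha> 0 \<in> C" using path_imageD[OF a(2)] by simp
  have "homotopic_loops C ?l (\<lambda>_. \<alpha> 0)"
    by (intro simply_connectedD[OF sc] l)
      (use y in \<open>auto simp: path_def path_image_def pathstart_def pathfinish_def\<close>)
  then obtain h :: "real \<times> real \<Rightarrow> 'c" where h: "continuous_on ({0..1} \<times> {0..1}) h" "h \<in> {0..1} \<times> {0..1} \<rightarrow> C"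
    "\<And>x. x \<in> {0..1} \<Longrightarrow> h (0, x) = ?l x" "\<And>x. x \<in> {0..1} \<Longrightarrow> h (1, x) = \<alpha> 0"
    "\<And>t. t \<in> {0..1} \<Longrightarrow> h (t, 1) = h (t, 0)"
    by (rule homotopic_loopsE) blast
  have ph: "continuous_on ({0..1} \<times> {0..1}) (p \<circ> h)"
    by (rule continuous_on_compose[OF h(1)]) (use h(2) in \<open>auto intro: continuous_on_subset[OF p_continuous]\<close>)
  have ph2: "p \<circ> h \<in> {0..1} \<times> {0..1} \<rightarrow> S" using h(2) p_image by auto
  have l_a: "?l (t / 2) = \<alpha> t" if "t \<in> {0..1}" for t
    using that by (simp add: joinpaths_def)
  have l_b: "?l (1 - t / 2) = \<beta> t" if "t \<in> {0..1}" for t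
  proof (cases "t = 1")
    case True
    then show ?thesis using ab(2) by (simp add: joinpaths_def pathfinish_def)
  next
    case False
    then show ?thesis using that by (simp add: joinpaths_def reversepath_def)
  qed
  have "p x = (p \<circ> h) (0, 0)"
    using \<alpha>' h(3)[of 0] l_a[of 0] by (auto simp: lifted_path_def pathstart_def)
  then obtain k :: "real \<times> real \<Rightarrow> 'c" where k: "continuous_on ({0..1} \<times> {0..1}) k" "k \<in> {0..1} \<times> {0..1} \<rightarrow> C"
    "\<And>s t. s \<in> {0..1} \<Longrightarrow> t \<in> {0..1} \<Longrightarrow> p (k (s, t)) = (p \<circ> h) (s, t)" "k (0, 0) = x"
    using covering_lift_square[OF cov ph ph2 xC] by blast
  note sl = continuous_on_slice[OF k(1)]
  have 1: "k (1, 1) = k (1, 0)"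
    by (rule lift_of_constant[OF cov, of "\<lambda>t. k (1, t)"]) (use sl[of "\<lambda>_. 1" "\<lambda>t. t"] k h in auto)
  \<comment> \<open>The two edges lift the same path, as every stage of the homotopy is a loop, and
    they agree at the end \<open>s = 1\<close> by the previous step.\<close>
  have "k (0, 0) = k (0, 1)"
    by (rule covering_lift_unique[OF cov, of "{0..1::real}" "\<lambda>s. k (s, 0)" "\<lambda>s. k (s, 1)" 1 0])
      (use sl[of "\<lambda>t. t" "\<lambda>_. 0"] sl[of "\<lambda>t. t" "\<lambda>_. 1"] k h 1 in auto)
  then have 2: "k (0, 1) = x" using k(4) by simp
  have half: "continuous_on {0..1} (\<lambda>t::real. t / 2)" "continuous_on {0..1} (\<lambda>t::real. 1 - t / 2)"
    by (intro continuous_intros; simp)+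
  have "k (0, 1 / 2) = pathfinish \<alpha>'"
    by (rule lifted_path_unique[OF cov \<alpha>', of "\<lambda>t. k (0, t / 2)"])
      (use sl[of "\<lambda>_. 0" "\<lambda>t. t / 2"] half k h l_a in auto)
  moreover have "k (0, 1 - 1 / 2) = pathfinish \<beta>'"
    by (rule lifted_path_unique[OF cov \<beta>', of "\<lambda>t. k (0, 1 - t / 2)"])
      (use sl[of "\<lambda>_. 0" "\<lambda>t. 1 - t / 2"] half k h l_b 2 in auto)
  ultimately show ?thesis by simp
qed

text \<open>The map \<open>p\<close> is lifted through itself: \<open>f y\<close> is the endpoint of
  the lift, starting at \<open>x'\<close>, of the projection of a path from \<open>x\<close> to
  \<open>y\<close>. The preceding lemma makes this independent of the path.\<close>

lemma lift_of_projection: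
  assumes x: "x \<in> C" "x' \<in> C" "p x = p x'"
  obtains f where "continuous_on C f" "f \<in> C \<rightarrow> C" "\<And>y. y \<in> C \<Longrightarrow> p (f y) = p y" "f x = x'"
proof -
  define Path where "Path y \<alpha> \<alpha>' \<longleftrightarrow> path \<alpha> \<and> path_image \<alpha> \<subseteq> C \<and> pathstart \<alpha> = x \<and> pathfinish \<alpha> = y \<and>
    lifted_path C p x' (p \<circ> \<alpha>) \<alpha>'" for y \<alpha> \<alpha>'
  have ex: "\<exists>\<alpha> \<alpha>'. Path y \<alpha> \<alpha>'" if y: "y \<in> C" for y
  proof -
    obtain \<alpha> where \<alpha>: "path \<alpha>" "path_image \<alpha> \<subseteq> C" "pathstart \<alpha> = x" "pathfinish \<alpha> = y"
      using simply_connected_imp_paths[OF sc x(1) y] by blast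
    have "\<exists>\<alpha>'. lifted_path C p x' (p \<circ> \<alpha>) \<alpha>'"
    proof (rule lifted_path_exists[OF cov _ _ x(2)])
      show "path (p \<circ> \<alpha>)"
        using \<alpha>(1) continuous_on_subset[OF p_continuous \<alpha>(2)] by (rule path_continuous_image)
      show "path_image (p \<circ> \<alpha>) \<subseteq> S" using \<alpha>(2) p_image by (auto simp: path_image_compose)
      show "p x' = pathstart (p \<circ> \<alpha>)" using x(3) \<alpha>(3) by (simp add: pathstart_compose)
    qed
    then show ?thesis using \<alpha> by (auto simp: Path_def)
  qed
  have uniq: "pathfinish \<alpha>' = pathfinish \<beta>'" if "Path y \<alpha> \<alpha>'" "Path y \<beta> \<beta>'" for y \<alpha> \<alpha>' \<beta> \<beta>'
    by (rule lifted_path_endpoint[of \<alpha> \<beta> x']) (use that x in \<open>auto simp: Path_def\<close>)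
  define f where "f y = (SOME z. \<exists>\<alpha> \<alpha>'. Path y \<alpha> \<alpha>' \<and> z = pathfinish \<alpha>')" for y
  have f: "f y = pathfinish \<alpha>'" if "Path y \<alpha> \<alpha>'" for y \<alpha> \<alpha>'
    unfolding f_def by (rule some_equality) (use that uniq in blast)+
  have pf: "p (f y) = p y" "f y \<in> C" if "y \<in> C" for y
  proof -
    from ex[OF that] obtain \<alpha> \<alpha>' where P: "Path y \<alpha> \<alpha>'" by blast
    then have "p (\<alpha>' 1) = p (\<alpha> 1)" "\<alpha>' 1 \<in> C" "\<alpha> 1 = y"
      using path_imageD[of \<alpha>' C 1] by (auto simp: Path_def lifted_path_def pathfinish_def)
    then show "p (f y) = p y" "f y \<in> C" using f[OF P] by (auto simp: pathfinish_def)
  qed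
  have "f x = x'"
  proof -
    have "Path x (\<lambda>_. x) (\<lambda>_. x')"
      using x by (auto simp: Path_def lifted_path_def path_def path_image_def pathstart_def pathfinish_def)
    from f[OF this] show ?thesis by (simp add: pathfinish_def)
  qed
  moreover have "continuous_on C f"
    unfolding continuous_on_def
  proof
    fix y assume y: "y \<in> C"
    obtain T \<V> where T: "p (f y) \<in> T" "openin (top_of_set S) T" "\<Union>\<V> = C \<inter> p -` T"
      and hom: "\<And>u. u \<in> \<V> \<Longrightarrow> \<exists>q. homeomorphism u T p q"
      by (rule covering_space_sheets[OF cov, of "p (f y)"]) (use pf[OF y] p_image in blast)+
    have "f y \<in> \<Union>\<V>" using T pf[OF y] by auto
    then obtain u q where u: "u \<in> \<V>" "f y \<in> u" and q: "homeomorphism u T p q" using hom by blast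
    have uC: "u \<subseteq> C" using T(3) u by blast
    have "openin (top_of_set C) (C \<inter> p -` T)"
      by (rule continuous_openin_preimage[OF p_continuous _ T(2)]) (use p_image in auto)
    moreover have "y \<in> C \<inter> p -` T" using y pf(1)[OF y] T(1) by simp
    ultimately obtain V where V: "openin (top_of_set C) V" "y \<in> V" "V \<subseteq> C \<inter> p -` T" "path_connected V"
      using lpc by metis
    obtain \<alpha> \<alpha>' where P: "Path y \<alpha> \<alpha>'" using ex[OF y] by blast
    \<comment> \<open>A path to \<open>y\<close> is prolonged inside \<open>V\<close> and its lift
      is continued in the sheet \<open>u\<close>, so near \<open>y\<close> the map is
      \<open>p\<close> followed by the inverse \<open>q\<close> of that sheet, which is
      continuous.\<close>
    have fz: "f z = q (p z)" if z: "z \<in> V" for z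
    proof -
      obtain \<delta> where \<delta>: "path \<delta>" "path_image \<delta> \<subseteq> V" "pathstart \<delta> = y" "pathfinish \<delta> = z"
        using V(4) V(2) z unfolding path_connected_def by blast
      have \<delta>T: "\<delta> t \<in> C" "p (\<delta> t) \<in> T" if "t \<in> {0..1}" for t
        using path_imageD[OF \<delta>(2) that] V(3) by auto
      let ?e = "q \<circ> (p \<circ> \<delta>)"
      have p\<delta>: "path (p \<circ> \<delta>)"
        using \<delta>(1) by (rule path_continuous_image) (use \<delta>(2) V(3) in \<open>auto intro: continuous_on_subset[OF p_continuous]\<close>)
      have e: "path ?e"
        using p\<delta> by (rule path_continuous_image)
          (use q \<delta>T in \<open>auto simp: homeomorphism_def path_image_def intro: continuous_on_subset\<close>)
      have et: "?e t \<in> C" "p (?e t) = p (\<delta> t)" if "t \<in> {0..1}" for t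
        using q \<delta>T(2)[OF that] uC by (auto simp: homeomorphism_def)
      have e0: "pathstart ?e = pathfinish \<alpha>'"
        using f[OF P] q u(2) pf(1)[OF y] \<delta>(3) by (metis comp_apply homeomorphism_apply1 pathstart_def)
      have \<alpha>: "path \<alpha>" "path_image \<alpha> \<subseteq> C" "pathstart \<alpha> = x" "pathfinish \<alpha> = y"
        and \<alpha>': "path \<alpha>'" "path_image \<alpha>' \<subseteq> C" "pathstart \<alpha>' = x'" "\<And>t. t \<in> {0..1} \<Longrightarrow> p (\<alpha>' t) = p (\<alpha> t)"
        using P by (auto simp: Path_def lifted_path_def)
      have "Path z (\<alpha> +++ \<delta>) (\<alpha>' +++ ?e)"
        unfolding Path_def lifted_path_def
      proof (intro conjI ballI)
        show "path_image (\<alpha> +++ \<delta>) \<subseteq> C"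
          using \<alpha>(2) \<delta>(2) V(3) by (intro subset_path_image_join) auto
        show "path_image (\<alpha>' +++ ?e) \<subseteq> C"
          using \<alpha>'(2) et(1) by (intro subset_path_image_join) (auto simp: path_image_def)
        show "p ((\<alpha>' +++ ?e) t) = (p \<circ> (\<alpha> +++ \<delta>)) t" if "t \<in> {0..1}" for t
          using that \<alpha>'(4)[of "2 * t"] et(2)[of "2 * t - 1"] by (simp add: joinpaths_def)
      qed (use \<alpha> \<alpha>' \<delta> e e0 in auto)
      from f[OF this] show ?thesis using \<delta>(4) by (simp add: pathfinish_compose)
    qed
    have "continuous_on V f"
    proof (subst continuous_on_cong[OF refl fz])
      show "continuous_on V (\<lambda>z. q (p z))"
        by (rule continuous_on_compose2[of T q])
          (use q V(3) continuous_on_subset[OF p_continuous] in \<open>auto simp: homeomorphism_def\<close>)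
    qed
    then have "(f \<longlongrightarrow> f y) (at y within V)" using V(2) by (simp add: continuous_on_def)
    moreover obtain N where N: "open N" "V = C \<inter> N" using V(1) by (auto simp: openin_open)
    moreover have "at y within V = at y within C"
      by (rule at_within_nhd[of y N]) (use N V(2) in auto)
    ultimately show "(f \<longlongrightarrow> f y) (at y within C)" by simp
  qed
  ultimately show ?thesis using that[of f] pf by auto
qed

section \<open>Existence and uniqueness of deck transformations\<close>

abbreviation deck :: "('c \<Rightarrow> 'c) set" where "deck \<equiv> covering_transformations C p"

lemma deckD:
  assumes "f \<in> deck"
  shows "continuous_on C f" "f \<in> C \<rightarrow> C" "\<And>y. y \<in> C \<Longrightarrow> p (f y) = p y" "bij_betw f C C" "f \<in> extensional C"
  using assms by (auto simp: covering_transformations_def Bij_def homeomorphism_def bij_betw_def)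

lemma deck_unique:
  assumes f: "f \<in> deck" and g: "g \<in> deck" and x: "x \<in> C" "f x = g x"
  shows "f = g"
proof (rule extensionalityI[OF deckD(5)[OF f] deckD(5)[OF g]])
  fix y assume "y \<in> C"
  then show "f y = g y"
    by (intro covering_lift_unique[OF cov connected_C deckD(1,2)[OF f] deckD(1,2)[OF g] _ x])
      (simp_all add: deckD(3)[OF f] deckD(3)[OF g])
qed

text \<open>The lifts of \<open>p\<close> that send \<open>x\<close> to \<open>x'\<close> and
  \<open>x'\<close> to \<open>x\<close> are mutually inverse, because their composites lift
  \<open>p\<close> and fix a point.\<close>

lemma deck_exists:
  assumes x: "x \<in> C" "x' \<in> C" "p x = p x'"
  shows "\<exists>f\<in>deck. f x = x'"
proof -
  obtain f where f: "continuous_on C f" "f \<in> C \<rightarrow> C" "\<And>y. y \<in> C \<Longrightarrow> p (f y) = p y" "f x = x'"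
    using lift_of_projection[OF x] by blast
  obtain g where g: "continuous_on C g" "g \<in> C \<rightarrow> C" "\<And>y. y \<in> C \<Longrightarrow> p (g y) = p y" "g x' = x"
    using lift_of_projection[OF x(2,1) x(3)[symmetric]] by blast
  have inv: "g (f y) = y" if y: "y \<in> C"
    and f: "continuous_on C f" "f \<in> C \<rightarrow> C" "\<And>y. y \<in> C \<Longrightarrow> p (f y) = p y" "f x = x'"
    and g: "continuous_on C g" "g \<in> C \<rightarrow> C" "\<And>y. y \<in> C \<Longrightarrow> p (g y) = p y" "g x' = x" and x: "x \<in> C"
    for f g x x' y
  proof (rule covering_lift_unique[OF cov connected_C, of "\<lambda>y. g (f y)" "\<lambda>y. y" x])
    show "continuous_on C (\<lambda>y. g (f y))"
      by (rule continuous_on_compose2[OF g(1) f(1)]) (use f(2) in auto)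
    have fC: "f y \<in> C" if "y \<in> C" for y using f(2) that by auto
    then show "(\<lambda>y. g (f y)) \<in> C \<rightarrow> C" using g(2) by auto
    show "p (g (f y)) = p y" if "y \<in> C" for y by (simp only: g(3)[OF fC[OF that]] f(3)[OF that])
  qed (use f g x y in \<open>auto intro: continuous_on_id\<close>)
  note gf = inv[OF _ f g x(1)] and fg = inv[OF _ g f x(2)]
  have bij: "bij_betw f C C"
    by (rule bij_betw_byWitness[where f' = g]) (use gf fg f(2) g(2) in auto)
  \<comment> \<open>Elements of \<open>Bij C\<close> must be extensional, so the lift is restricted
    to \<open>C\<close>.\<close>
  define F where "F = restrict f C"
  have bF: "bij_betw F C C" using bij by (simp add: F_def bij_betw_restrict_eq)
  have "inv_into C F y = g y" if "y \<in> C" for y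
    using inv_into_f_eq[OF bij_betw_imp_inj_on[OF bF], of "g y" y] that fg[OF that] g(2) by (auto simp: F_def)
  moreover have "f y \<in> C" "g y \<in> C" if "y \<in> C" for y
    using f(2) g(2) that by auto
  ultimately have "homeomorphism C C F (inv_into C F)"
    using f(1) g(1) gf fg bF bij_betw_inv_into[OF bF]
    by (intro homeomorphismI) (auto simp: F_def bij_betw_def cong: continuous_on_cong)
  then have "F \<in> deck"
    using bF f(3) by (auto simp: covering_transformations_def Bij_def F_def)
  then show ?thesis using f(4) x(1) by (intro bexI[of _ F]) (auto simp: F_def)
qed

text \<open>Instead of checking the composite directly, the deck transformation with the right value
  at one point is taken; uniqueness of lifts makes it agree with the composite on
  \<open>C\<close>.\<close>

lemma deck_compose:
  assumes f: "f \<in> deck" and g: "g \<in> deck"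
  shows "\<exists>h\<in>deck. \<forall>y\<in>C. h y = f (g y)"
proof (cases "C = {}")
  case False
  then obtain x where x: "x \<in> C" by blast
  have gx: "g x \<in> C" "f (g x) \<in> C" using deckD(2)[OF f] deckD(2)[OF g] x by auto
  then have "p x = p (f (g x))" by (simp add: deckD(3)[OF f] deckD(3)[OF g] x)
  from deck_exists[OF x gx(2) this] obtain h where h: "h \<in> deck" "h x = f (g x)" by blast
  have "h y = f (g y)" if "y \<in> C" for y
  proof (rule covering_lift_unique[OF cov connected_C deckD(1,2)[OF h(1)], of "\<lambda>y. f (g y)" x])
    show "continuous_on C (\<lambda>y. f (g y))"
      by (rule continuous_on_compose2[OF deckD(1)[OF f] deckD(1)[OF g]]) (use deckD(2)[OF g] in auto)
    show "(\<lambda>y. f (g y)) \<in> C \<rightarrow> C" using deckD(2)[OF f] deckD(2)[OF g] by auto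
    show "p (h y) = p (f (g y))" if "y \<in> C" for y
      using deckD(2)[OF g] that by (subst deckD(3)[OF h(1) that], subst deckD(3)[OF f]) (auto simp: deckD(3)[OF g])
  qed (use h x that in auto)
  then show ?thesis using h(1) by blast
qed (use f in auto)

end

subsection \<open>The action of the fundamental group\<close>

lemma mem_path_class: "\<delta> \<in> path_class S \<gamma> \<longleftrightarrow> homotopic_paths S \<gamma> \<delta>"
  by (simp add: path_class_def)

lemma path_class_eqI: "homotopic_paths S \<gamma> \<delta> \<Longrightarrow> path_class S \<gamma> = path_class S \<delta>"
proof (intro subset_antisym subsetI; unfold mem_path_class)
  show "homotopic_paths S \<delta> \<epsilon>" if "homotopic_paths S \<gamma> \<delta>" "homotopic_paths S \<gamma> \<epsilon>" for \<epsilon>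
    using homotopic_paths_trans[OF homotopic_paths_sym[OF that(1)] that(2)] .
  show "homotopic_paths S \<gamma> \<epsilon>" if "homotopic_paths S \<gamma> \<delta>" "homotopic_paths S \<delta> \<epsilon>" for \<epsilon>
    using homotopic_paths_trans[OF that] .
qed

definition loop_at :: "'a::topological_space set \<Rightarrow> 'a \<Rightarrow> (real \<Rightarrow> 'a) \<Rightarrow> bool" where
  "loop_at S b \<gamma> \<longleftrightarrow> path \<gamma> \<and> path_image \<gamma> \<subseteq> S \<and> pathstart \<gamma> = b \<and> pathfinish \<gamma> = b"

lemma carrier_fundamental_group:
  "g \<in> carrier (fundamental_group S b) \<longleftrightarrow> (\<exists>\<gamma>. loop_at S b \<gamma> \<and> g = path_class S \<gamma>)"
  by (auto simp: fundamental_group_def loop_at_def)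

lemma loop_at_join: "loop_at S b \<gamma> \<Longrightarrow> loop_at S b \<delta> \<Longrightarrow> loop_at S b (\<gamma> +++ \<delta>)"
  by (simp add: loop_at_def subset_path_image_join)

lemma loop_at_reversepath: "loop_at S b \<gamma> \<Longrightarrow> loop_at S b (reversepath \<gamma>)"
  by (simp add: loop_at_def)

lemma loop_at_const: "b \<in> S \<Longrightarrow> loop_at S b (\<lambda>_. b)"
  by (auto simp: loop_at_def path_def path_image_def pathstart_def pathfinish_def)

text \<open>The product is a union over all representatives; concatenation respects homotopy, so all
  members of this union are the same class.\<close>

lemma mult_fundamental_group:
  assumes "loop_at S b \<gamma>" "loop_at S b \<delta>"
  shows "path_class S \<gamma> \<otimes>\<^bsub>fundamental_group S b\<^esub> path_class S \<delta> = path_class S (\<gamma> +++ \<delta>)"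
proof -
  have "path_class S (\<gamma>' +++ \<delta>') = path_class S (\<gamma> +++ \<delta>)"
    if "\<gamma>' \<in> path_class S \<gamma>" "\<delta>' \<in> path_class S \<delta>" for \<gamma>' \<delta>'
    using homotopic_paths_join[of S \<gamma> \<gamma>' \<delta> \<delta>'] that assms
    by (intro path_class_eqI[symmetric]) (simp add: loop_at_def mem_path_class)
  then have "(\<Union>\<gamma>'\<in>path_class S \<gamma>. \<Union>\<delta>'\<in>path_class S \<delta>. path_class S (\<gamma>' +++ \<delta>'))
      = (\<Union>\<gamma>'\<in>path_class S \<gamma>. \<Union>\<delta>'\<in>path_class S \<delta>. path_class S (\<gamma> +++ \<delta>))"
    by (intro SUP_cong refl)
  moreover have "\<gamma> \<in> path_class S \<gamma>" "\<delta> \<in> path_class S \<delta>"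
    using assms by (simp_all add: loop_at_def mem_path_class)
  then have "path_class S \<gamma> \<noteq> {}" "path_class S \<delta> \<noteq> {}" by blast+
  ultimately show ?thesis by (simp add: fundamental_group_def)
qed

lemma one_fundamental_group: "\<one>\<^bsub>fundamental_group S b\<^esub> = path_class S (\<lambda>_. b)"
  by (simp add: fundamental_group_def)

lemma fundamental_group_closed:
  assumes "g \<in> carrier (fundamental_group S b)" "h \<in> carrier (fundamental_group S b)"
  shows "g \<otimes>\<^bsub>fundamental_group S b\<^esub> h \<in> carrier (fundamental_group S b)"
  using assms mult_fundamental_group loop_at_join unfolding carrier_fundamental_group by metis

lemma fundamental_group_one_closed: "b \<in> S \<Longrightarrow> \<one>\<^bsub>fundamental_group S b\<^esub> \<in> carrier (fundamental_group S b)"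
  unfolding carrier_fundamental_group one_fundamental_group using loop_at_const by blast

text \<open>Idempotence is what forces the unit to act as the identity, both through
  \<open>act\<close> and through \<rho>: an injective idempotent map is the identity.\<close>

lemma fundamental_group_one_one:
  assumes "b \<in> S"
  shows "\<one>\<^bsub>fundamental_group S b\<^esub> \<otimes>\<^bsub>fundamental_group S b\<^esub> \<one>\<^bsub>fundamental_group S b\<^esub> = \<one>\<^bsub>fundamental_group S b\<^esub>"
proof -
  have "(\<lambda>_. b) +++ (\<lambda>_. b) = (\<lambda>_. b)" by (simp add: joinpaths_def)
  then show ?thesis
    using mult_fundamental_group[OF loop_at_const[OF assms] loop_at_const[OF assms]]
    by (simp add: one_fundamental_group)
qed

lemma fundamental_group_inverse:
  assumes g: "g \<in> carrier (fundamental_group S b)"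
  shows "\<exists>g'\<in>carrier (fundamental_group S b). g \<otimes>\<^bsub>fundamental_group S b\<^esub> g' = \<one>\<^bsub>fundamental_group S b\<^esub> \<and>
    g' \<otimes>\<^bsub>fundamental_group S b\<^esub> g = \<one>\<^bsub>fundamental_group S b\<^esub>"
proof -
  obtain \<gamma> where \<gamma>: "loop_at S b \<gamma>" "g = path_class S \<gamma>"
    using g unfolding carrier_fundamental_group by blast
  note r = loop_at_reversepath[OF \<gamma>(1)]
  have "path_class S (\<delta> +++ reversepath \<delta>) = \<one>\<^bsub>fundamental_group S b\<^esub>" if "loop_at S b \<delta>" for \<delta>
    using homotopic_paths_reversepath_cancel[of \<delta> S] that
    unfolding one_fundamental_group by (intro path_class_eqI) (simp add: loop_at_def)
  from this[OF \<gamma>(1)] this[OF r] show ?thesis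
    using r \<gamma> mult_fundamental_group[OF \<gamma>(1) r] mult_fundamental_group[OF r \<gamma>(1)]
    unfolding carrier_fundamental_group by (intro bexI[of _ "path_class S (reversepath \<gamma>)"]) (auto simp: carrier_fundamental_group)
qed

locale pointed_covering = simply_connected_covering C p S
  for C :: "'c::topological_space set" and p :: "'c \<Rightarrow> 'a::topological_space" and S :: "'a set" +
  fixes e :: 'c
  assumes base: "e \<in> C"
begin

abbreviation G :: "(real \<Rightarrow> 'a) set monoid" where "G \<equiv> fundamental_group S (p e)"
abbreviation act :: "(real \<Rightarrow> 'a) set \<Rightarrow> 'c \<Rightarrow> 'c" where "act \<equiv> deck_action C p e"

lemma pe_S: "p e \<in> S" using base p_image by blast

text \<open>The definite description is met only by \<open>f\<close>: homotopic loops have lifts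
  from \<open>e\<close> with a common endpoint, and a deck transformation is determined by its value
  at \<open>e\<close>.\<close>

lemma act_eqI:
  assumes \<gamma>: "loop_at S (p e) \<gamma>" and \<eta>: "lifted_path C p e \<gamma> \<eta>" and f: "f \<in> deck" "f e = pathfinish \<eta>"
  shows "act (path_class S \<gamma>) = f"
proof -
  have "act (path_class S \<gamma>) = (THE f. f \<in> deck \<and> (\<exists>\<delta>\<in>path_class S \<gamma>. \<exists>\<eta>. lifted_path C p e \<delta> \<eta> \<and> f e = pathfinish \<eta>))"
    by (simp add: deck_action_def lifted_path_def)
  also have "\<dots> = f"
  proof (rule the_equality)
    have "\<gamma> \<in> path_class S \<gamma>" using \<gamma> by (simp add: mem_path_class loop_at_def)
    then show "f \<in> deck \<and> (\<exists>\<delta>\<in>path_class S \<gamma>. \<exists>\<eta>. lifted_path C p e \<delta> \<eta> \<and> f e = pathfinish \<eta>)"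
      using \<eta> f by blast
    fix f' assume "f' \<in> deck \<and> (\<exists>\<delta>\<in>path_class S \<gamma>. \<exists>\<eta>. lifted_path C p e \<delta> \<eta> \<and> f' e = pathfinish \<eta>)"
    then obtain \<delta> \<theta> where f': "f' \<in> deck" "f' e = pathfinish \<theta>" and \<delta>: "homotopic_paths S \<gamma> \<delta>" "lifted_path C p e \<delta> \<theta>"
      by (auto simp: mem_path_class)
    have "f' e = f e" using lifted_path_homotopic[OF cov \<delta>(1) base \<eta> \<delta>(2)] f(2) f'(2) by simp
    then show "f' = f" by (rule deck_unique[OF f'(1) f(1) base])
  qed
  finally show ?thesis .
qed

lemma act_lift:
  assumes \<gamma>: "loop_at S (p e) \<gamma>"
  obtains \<eta> where "lifted_path C p e \<gamma> \<eta>" "act (path_class S \<gamma>) \<in> deck" "act (path_class S \<gamma>) e = pathfinish \<eta>"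
proof -
  obtain \<eta> where \<eta>: "lifted_path C p e \<gamma> \<eta>"
    using lifted_path_exists[OF cov _ _ base] \<gamma> unfolding loop_at_def by metis
  have "pathfinish \<eta> \<in> C" "p e = p (pathfinish \<eta>)"
    using \<eta> \<gamma> path_imageD[of \<eta> C 1] by (auto simp: lifted_path_def loop_at_def pathfinish_def)
  from deck_exists[OF base this] obtain f where "f \<in> deck" "f e = pathfinish \<eta>" by blast
  with act_eqI[OF \<gamma> \<eta>] \<eta> that show ?thesis by metis
qed

lemma act_deck: "g \<in> carrier G \<Longrightarrow> act g \<in> deck"
  unfolding carrier_fundamental_group using act_lift by metis

text \<open>The lift of the concatenated loop is the lift of \<gamma> followed by the image under
  \<open>act g\<close> of the lift of \<delta>. This is why running through \<gamma> first gives a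
  left action.\<close>

lemma act_mult:
  assumes g: "g \<in> carrier G" and h: "h \<in> carrier G" and x: "x \<in> C"
  shows "act (g \<otimes>\<^bsub>G\<^esub> h) x = act g (act h x)"
proof -
  obtain \<gamma> where \<gamma>: "loop_at S (p e) \<gamma>" "g = path_class S \<gamma>" using g unfolding carrier_fundamental_group by blast
  obtain \<delta> where \<delta>: "loop_at S (p e) \<delta>" "h = path_class S \<delta>" using h unfolding carrier_fundamental_group by blast
  obtain \<eta> where \<eta>: "lifted_path C p e \<gamma> \<eta>" "act g \<in> deck" "act g e = pathfinish \<eta>"
    using act_lift[OF \<gamma>(1)] \<gamma>(2) by metis
  obtain \<theta> where \<theta>: "lifted_path C p e \<delta> \<theta>" "act h \<in> deck" "act h e = pathfinish \<theta>"
    using act_lift[OF \<delta>(1)] \<delta>(2) by metis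
  obtain m where m: "m \<in> deck" "\<And>y. y \<in> C \<Longrightarrow> m y = act g (act h y)"
    using deck_compose[OF \<eta>(2) \<theta>(2)] by blast
  note f = deckD[OF \<eta>(2)]
  have \<theta>C: "\<theta> t \<in> C" if "t \<in> {0..1}" for t using \<theta>(1) that path_imageD by (auto simp: lifted_path_def)
  have "lifted_path C p e (\<gamma> +++ \<delta>) (\<eta> +++ (act g \<circ> \<theta>))"
    unfolding lifted_path_def
  proof (intro conjI ballI)
    have s: "pathfinish \<eta> = pathstart (act g \<circ> \<theta>)"
      using \<theta>(1) \<eta>(3) by (simp add: lifted_path_def pathstart_compose)
    moreover have "path (act g \<circ> \<theta>)"
      using \<theta>(1) f(1) by (intro path_continuous_image) (auto simp: lifted_path_def intro: continuous_on_subset)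
    ultimately show "path (\<eta> +++ (act g \<circ> \<theta>))" using \<eta>(1) by (simp add: lifted_path_def)
    show "path_image (\<eta> +++ (act g \<circ> \<theta>)) \<subseteq> C"
      using \<eta>(1) \<theta>C f(2) by (intro subset_path_image_join) (auto simp: lifted_path_def path_image_def)
    show "pathstart (\<eta> +++ (act g \<circ> \<theta>)) = e" using \<eta>(1) by (simp add: lifted_path_def)
    show "p ((\<eta> +++ (act g \<circ> \<theta>)) t) = (\<gamma> +++ \<delta>) t" if "t \<in> {0..1}" for t
      using that \<eta>(1) \<theta>(1) f(3)[OF \<theta>C[of "2 * t - 1"]] by (simp add: lifted_path_def joinpaths_def)
  qed
  moreover have "m e = pathfinish (\<eta> +++ (act g \<circ> \<theta>))"
    using m(2)[OF base] \<theta>(3) by (simp add: pathfinish_compose)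
  ultimately have "act (path_class S (\<gamma> +++ \<delta>)) = m"
    by (intro act_eqI loop_at_join \<gamma>(1) \<delta>(1) m(1))
  then show ?thesis using m(2)[OF x] \<gamma> \<delta> by (simp add: mult_fundamental_group)
qed

lemma act_one: "x \<in> C \<Longrightarrow> act \<one>\<^bsub>G\<^esub> x = x"
proof -
  assume x: "x \<in> C"
  note 1 = fundamental_group_one_closed[OF pe_S]
  note f = deckD[OF act_deck[OF 1]]
  have "act \<one>\<^bsub>G\<^esub> (act \<one>\<^bsub>G\<^esub> x) = act \<one>\<^bsub>G\<^esub> x"
    using act_mult[OF 1 1 x] by (simp add: fundamental_group_one_one[OF pe_S])
  moreover have "act \<one>\<^bsub>G\<^esub> x \<in> C" using f(2) x by auto
  ultimately show ?thesis using f(4) x by (auto simp: bij_betw_def inj_on_def)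
qed

text \<open>A deck transformation with a fixed point is the identity, so the lift of the loop at
  \<open>e\<close> closes up. It is then null-homotopic in \<open>C\<close>, and projecting the
  homotopy contracts the loop itself.\<close>

lemma act_free:
  assumes g: "g \<in> carrier G" and x: "x \<in> C" "act g x = x"
  shows "g = \<one>\<^bsub>G\<^esub>"
proof -
  note 1 = fundamental_group_one_closed[OF pe_S]
  have "act g = act \<one>\<^bsub>G\<^esub>"
    by (rule deck_unique[OF act_deck[OF g] act_deck[OF 1] x(1)]) (simp add: x act_one)
  then have "act g e = e" using act_one[OF base] by simp
  moreover obtain \<gamma> where \<gamma>: "loop_at S (p e) \<gamma>" "g = path_class S \<gamma>"
    using g unfolding carrier_fundamental_group by blast
  moreover obtain \<eta> where \<eta>: "lifted_path C p e \<gamma> \<eta>" "act g e = pathfinish \<eta>"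
    using act_lift[OF \<gamma>(1)] \<gamma>(2) by metis
  ultimately have l: "path \<eta>" "path_image \<eta> \<subseteq> C" "pathfinish \<eta> = pathstart \<eta>" "pathstart \<eta> = e"
    by (auto simp: lifted_path_def)
  have "homotopic_paths S (p \<circ> \<eta>) (p \<circ> (\<lambda>_. pathstart \<eta>))"
    by (rule homotopic_paths_continuous_image[OF simply_connected_loop_null[OF sc l(1-3)] p_continuous])
      (use p_image in auto)
  moreover have "homotopic_paths S \<gamma> (p \<circ> \<eta>)"
    using \<gamma>(1) \<eta>(1) by (intro homotopic_paths_eq) (auto simp: loop_at_def lifted_path_def)
  ultimately have "homotopic_paths S \<gamma> (\<lambda>_. p e)"
    using l(4) homotopic_paths_trans by (fastforce simp: o_def)
  then show ?thesis unfolding \<gamma>(2) one_fundamental_group by (rule path_class_eqI)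
qed

text \<open>The deck transformation from \<open>x\<close> to \<open>x'\<close> is induced by the
  projection of a path from \<open>e\<close> to its value at \<open>e\<close>.\<close>

lemma act_transitive:
  assumes x: "x \<in> C" "x' \<in> C" "p x = p x'"
  shows "\<exists>g\<in>carrier G. act g x = x'"
proof -
  obtain f where f: "f \<in> deck" "f x = x'" using deck_exists[OF x] by blast
  have fe: "f e \<in> C" "p (f e) = p e" using deckD(2,3)[OF f(1)] base by auto
  obtain \<eta> where \<eta>: "path \<eta>" "path_image \<eta> \<subseteq> C" "pathstart \<eta> = e" "pathfinish \<eta> = f e"
    using simply_connected_imp_paths[OF sc base fe(1)] by blast
  have l: "loop_at S (p e) (p \<circ> \<eta>)"
    unfolding loop_at_def
  proof (intro conjI)
    show "path (p \<circ> \<eta>)"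
      using \<eta>(1) continuous_on_subset[OF p_continuous \<eta>(2)] by (rule path_continuous_image)
    show "path_image (p \<circ> \<eta>) \<subseteq> S" using \<eta>(2) p_image by (auto simp: path_image_compose)
  qed (use \<eta> fe in \<open>auto simp: pathstart_compose pathfinish_compose\<close>)
  have "act (path_class S (p \<circ> \<eta>)) = f"
    by (rule act_eqI[OF l _ f(1)]) (use \<eta> in \<open>auto simp: lifted_path_def\<close>)
  moreover have "path_class S (p \<circ> \<eta>) \<in> carrier G"
    using l carrier_fundamental_group by metis
  ultimately show ?thesis using f(2) by (intro bexI[of _ "path_class S (p \<circ> \<eta>)"]) simp_all
qed

end

section \<open>Flat bundles\<close>

text \<open>Preimages of small balls under a chart are open and path connected; this discharges the
  assumption \<open>lpc\<close>.\<close>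

lemma smooth_manifold_locally_path_connected:
  fixes M :: "('a::topological_space, 'e::euclidean_space) manifold"
  assumes M: "smooth_manifold M" and top: "mtop M = top_of_set (pts M)"
    and U: "openin (top_of_set (pts M)) U" "x \<in> U"
  shows "\<exists>V. openin (top_of_set (pts M)) V \<and> x \<in> V \<and> V \<subseteq> U \<and> path_connected V"
proof -
  have oU: "openin (mtop M) U" using U(1) top by metis
  have x: "x \<in> pts M" using openin_subset[OF oU] U(2) by blast
  define c where "c = chart_at M x"
  have c: "c \<in> atlas M" "x \<in> fst c" using chart_at_atlas[OF M x] chart_at_mem[OF M x] by (auto simp: c_def)
  have "open (snd c ` (U \<inter> fst c))" "snd c x \<in> snd c ` (U \<inter> fst c)"
    using open_chart_image[OF M c(1) oU] U(2) c(2) by auto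
  then obtain r where r: "r > 0" "ball (snd c x) r \<subseteq> snd c ` (U \<inter> fst c)"
    using open_contains_ball by blast
  let ?V = "fst c \<inter> snd c -` ball (snd c x) r"
  have V: "openin (mtop M) ?V" by (rule openin_chart_vimage[OF M c(1)]) simp
  have sub: "?V \<subseteq> U"
  proof
    fix y assume y: "y \<in> ?V"
    then obtain z where "z \<in> U" "z \<in> fst c" "snd c y = snd c z" using r(2) by auto
    then show "y \<in> U" using chart_inj[OF M c(1)] y by (auto simp: inj_on_def)
  qed
  obtain g where g: "homeomorphic_maps (subtopology (mtop M) (fst c)) (top_of_set (snd c ` fst c)) (snd c) g"
    using chart_homeomorphic[OF M c(1)] unfolding homeomorphic_map_maps by blast
  then have "continuous_map (top_of_set (snd c ` fst c)) (subtopology (top_of_set (pts M)) (fst c)) g"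
    unfolding homeomorphic_maps_def top[symmetric] by blast
  then have cg: "continuous_on (snd c ` fst c) g"
    by (simp add: continuous_map_in_subtopology)
  have gc: "g (snd c y) = y" if "y \<in> fst c" for y
    using g that chart_subset[OF M c(1)] by (auto simp: homeomorphic_maps_def)
  have rim: "ball (snd c x) r \<subseteq> snd c ` fst c" using r(2) by blast
  have "path_connected (g ` ball (snd c x) r)"
    by (rule path_connected_continuous_image[OF continuous_on_subset[OF cg rim]])
      (simp add: convex_imp_path_connected)
  moreover have "g ` ball (snd c x) r = ?V"
  proof (intro subset_antisym subsetI)
    fix y assume "y \<in> g ` ball (snd c x) r"
    then obtain s where s: "s \<in> ball (snd c x) r" "y = g s" by blast
    then obtain z where "z \<in> fst c" "s = snd c z" using rim by blast
    then show "y \<in> ?V" using s gc by simp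
  next
    fix y assume "y \<in> ?V"
    then have "y = g (snd c y)" "snd c y \<in> ball (snd c x) r" using gc by simp_all
    then show "y \<in> g ` ball (snd c x) r" by (rule image_eqI)
  qed
  ultimately show ?thesis
    using V sub c(2) r(1) top by (intro exI[of _ ?V]) auto
qed

lemma tangent_map_id: "smooth_manifold M \<Longrightarrow> x \<in> pts M \<Longrightarrow> tangent_map M M id x v = v"
  by (simp add: tangent_map_eq chart_deriv_id chart_at_atlas chart_at_mem)

locale flat_contact_bundle =
  fixes B :: "('a::topological_space, 'e::euclidean_space) manifold"
    and E :: "('c::topological_space, 'e) manifold"
    and F :: "('f, 'g::euclidean_space) manifold"
    and h k :: nat and p :: "'c \<Rightarrow> 'a" and e :: 'c
    and \<alpha>1 :: "'a \<Rightarrow> 'e \<Rightarrow> real" and Z1 :: "'a \<Rightarrow> 'e" and \<phi>1 :: "'a \<Rightarrow> 'e \<Rightarrow> 'e"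
    and \<alpha>2 :: "'f \<Rightarrow> 'g \<Rightarrow> real" and Z2 :: "'f \<Rightarrow> 'g" and \<phi>2 :: "'f \<Rightarrow> 'g \<Rightarrow> 'g"
    and \<rho> :: "(real \<Rightarrow> 'a) set \<Rightarrow> 'f \<Rightarrow> 'f"
  assumes contact_B: "contact_manifold h B \<alpha>1 Z1 \<phi>1" and contact_F: "contact_manifold k F \<alpha>2 Z2 \<phi>2"
    and covering: "universal_covering E p B" and base_point: "e \<in> pts E"
    and rep: "\<rho> \<in> hom (fundamental_group (pts B) (p e)) (Cont F \<alpha>2 \<phi>2)"
begin

lemma smooth_B: "smooth_manifold B" and smooth_E: "smooth_manifold E" and smooth_F: "smooth_manifold F"
  and top_B: "mtop B = top_of_set (pts B)" and top_E: "mtop E = top_of_set (pts E)"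
  and local_diffeo_p: "local_diffeo E B p"
  using covering contact_F by (auto simp: universal_covering_def contact_manifold_def)

end

sublocale flat_contact_bundle \<subseteq> pointed_covering "pts E" p "pts B" e
proof
  show "covering_space (pts E) p (pts B)" "simply_connected (pts E)" "e \<in> pts E"
    using covering base_point by (auto simp: universal_covering_def)
  show "\<exists>V. openin (top_of_set (pts E)) V \<and> x \<in> V \<and> V \<subseteq> U \<and> path_connected V"
    if "openin (top_of_set (pts E)) U" "x \<in> U" for U x
    using smooth_manifold_locally_path_connected[OF smooth_E top_E that] .
qed

context flat_contact_bundle
begin

lemma p_diffeo:
  assumes "x \<in> pts E"
  obtains U where "x \<in> U" "U \<subseteq> pts E" "diffeo_pair E B U (p ` U) p (inv_into U p)" "inj_on p U"
proof -
  obtain U where U: "x \<in> U" and D: "diffeo_pair E B U (p ` U) p (inv_into U p)"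
    using local_diffeo_pair[OF smooth_E smooth_B local_diffeo_p assms] by blast
  have "inj_on p U" using D unfolding diffeo_pair_def by (auto intro: inj_on_inverseI)
  then show ?thesis using that[OF U _ D] diffeo_pair_pts[OF D] by blast
qed

lemma act_pts: "g \<in> carrier G \<Longrightarrow> x \<in> pts E \<Longrightarrow> act g x \<in> pts E"
  and p_act: "g \<in> carrier G \<Longrightarrow> x \<in> pts E \<Longrightarrow> p (act g x) = p x"
  using deckD(2,3)[OF act_deck] by auto

lemma act_openin_vimage:
  assumes g: "g \<in> carrier G" and U: "openin (mtop E) U"
  shows "openin (mtop E) (pts E \<inter> act g -` U)"
  using continuous_openin_preimage[OF deckD(1,2)[OF act_deck[OF g]], of U] U unfolding top_E[symmetric] .

text \<open>Near \<open>x\<close> the deck transformation is \<open>p\<close> followed by the local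
  inverse of \<open>p\<close> around \<open>act g x\<close>, so its smoothness comes from that of
  \<open>p\<close> and its local inverses.\<close>

lemma act_smooth:
  assumes g: "g \<in> carrier G" and x: "x \<in> pts E"
  shows "\<exists>U. x \<in> U \<and> smooth_map_on U E E (act g)"
proof -
  obtain U where U: "x \<in> U" "U \<subseteq> pts E" "diffeo_pair E B U (p ` U) p (inv_into U p)"
    using p_diffeo[OF x] by metis
  obtain V where V: "act g x \<in> V" "diffeo_pair E B V (p ` V) p (inv_into V p)" "inj_on p V"
    using p_diffeo[OF act_pts[OF g x]] by metis
  define N where "N = U \<inter> (pts E \<inter> act g -` V)"
  have o: "openin (mtop E) U" "openin (mtop E) V"
    using U V by (auto simp: diffeo_pair_def smooth_map_on_open)
  have N: "openin (mtop E) N" "x \<in> N"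
    unfolding N_def using o U V x act_openin_vimage[OF g] by auto
  have pN: "p y \<in> p ` V" "inv_into V p (p y) = act g y" if "y \<in> N" for y
  proof -
    have y: "y \<in> pts E" "act g y \<in> V" using that by (auto simp: N_def)
    then show "p y \<in> p ` V" "inv_into V p (p y) = act g y"
      using p_act[OF g y(1)] V(3) by (metis imageI, metis inv_into_f_f)
  qed
  have "smooth_map_on N E B p"
    by (rule smooth_map_on_subset[OF _ N(1)]) (use U(3) in \<open>auto simp: diffeo_pair_def N_def\<close>)
  moreover have "smooth_map_on (p ` V) B E (inv_into V p)" using V by (simp add: diffeo_pair_def)
  ultimately have "smooth_map_on N E E (inv_into V p \<circ> p)"
    by (rule smooth_map_on_compose[OF smooth_E smooth_B smooth_E]) (use pN(1) in auto)
  from smooth_map_on_cong[OF smooth_E smooth_E this, of "act g"] pN(2) N(2) show ?thesis by auto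
qed

lemma rho_Cont:
  assumes "g \<in> carrier G"
  shows "\<rho> g \<in> Bij (pts F)" "smooth_map_on (pts F) F F (\<rho> g)"
    "\<And>y v. y \<in> pts F \<Longrightarrow> \<alpha>2 (\<rho> g y) (tangent_map F F (\<rho> g) y v) = \<alpha>2 y v"
    "\<And>y v. y \<in> pts F \<Longrightarrow> tangent_map F F (\<rho> g) y (\<phi>2 y v) = \<phi>2 (\<rho> g y) (tangent_map F F (\<rho> g) y v)"
    "\<And>y. y \<in> pts F \<Longrightarrow> \<rho> g y \<in> pts F"
proof -
  have "\<rho> g \<in> carrier (Cont F \<alpha>2 \<phi>2)" using rep assms by (auto simp: hom_def)
  then show b: "\<rho> g \<in> Bij (pts F)" and "smooth_map_on (pts F) F F (\<rho> g)"
    and "\<And>y v. y \<in> pts F \<Longrightarrow> \<alpha>2 (\<rho> g y) (tangent_map F F (\<rho> g) y v) = \<alpha>2 y v"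
    and "\<And>y v. y \<in> pts F \<Longrightarrow> tangent_map F F (\<rho> g) y (\<phi>2 y v) = \<phi>2 (\<rho> g y) (tangent_map F F (\<rho> g) y v)"
    by (simp_all add: Cont_def pullback_form_def)
  show "\<And>y. y \<in> pts F \<Longrightarrow> \<rho> g y \<in> pts F" using Bij_imp_funcset[OF b] by auto
qed

lemma rho_mult:
  assumes "g \<in> carrier G" "g' \<in> carrier G" "y \<in> pts F"
  shows "\<rho> (g \<otimes>\<^bsub>G\<^esub> g') y = \<rho> g (\<rho> g' y)"
proof -
  have "\<rho> (g \<otimes>\<^bsub>G\<^esub> g') = \<rho> g \<otimes>\<^bsub>Cont F \<alpha>2 \<phi>2\<^esub> \<rho> g'" using rep assms by (auto simp: hom_def)
  then show ?thesis
    using rho_Cont(1)[OF assms(1)] rho_Cont(1)[OF assms(2)] assms(3)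
    by (simp add: Cont_def BijGroup_def compose_def)
qed

lemma one_G: "\<one>\<^bsub>G\<^esub> \<in> carrier G"
  by (rule fundamental_group_one_closed[OF pe_S])

text \<open>Membership in \<open>hom\<close> speaks only of products; the unit goes to an idempotent
  bijection, hence to the identity.\<close>

lemma rho_one:
  assumes y: "y \<in> pts F"
  shows "\<rho> \<one>\<^bsub>G\<^esub> y = y"
proof -
  have "\<rho> \<one>\<^bsub>G\<^esub> (\<rho> \<one>\<^bsub>G\<^esub> y) = \<rho> \<one>\<^bsub>G\<^esub> y"
    using rho_mult[OF one_G one_G y] by (simp add: fundamental_group_one_one[OF pe_S])
  then show ?thesis
    using rho_Cont(1)[OF one_G] rho_Cont(5)[OF one_G y] y by (auto simp: Bij_def bij_betw_def inj_on_def)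
qed

section \<open>The orbit relation of the diagonal action\<close>

abbreviation P :: "('c \<times> 'f, 'e \<times> 'g) manifold" where "P \<equiv> prod_manifold E F"
abbreviation R :: "('c \<times> 'f) rel" where "R \<equiv> orbit_rel E p e F \<rho>"

lemma mem_R: "(z, z') \<in> R \<longleftrightarrow> fst z \<in> pts E \<and> snd z \<in> pts F \<and>
    (\<exists>g\<in>carrier G. z' = (act g (fst z), \<rho> g (snd z)))"
  unfolding orbit_rel_def p_image by (cases z) auto

lemma smooth_P: "smooth_manifold P"
  by (rule smooth_manifold_prod[OF smooth_E smooth_F])

lemma R_local:
  assumes g: "g \<in> carrier G" and x: "x \<in> pts E" and y: "y \<in> pts F"
  obtains U where "x \<in> U" "smooth_map_on U E E (act g)"
    "smooth_map_on (U \<times> pts F) P P (map_prod (act g) (\<rho> g))"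
    "\<And>z. z \<in> U \<times> pts F \<Longrightarrow> (z, map_prod (act g) (\<rho> g) z) \<in> R"
proof -
  obtain U where U: "x \<in> U" "smooth_map_on U E E (act g)" using act_smooth[OF g x] by blast
  have "smooth_map_on (U \<times> pts F) P P (map_prod (act g) (\<rho> g))"
    by (rule smooth_map_on_map_prod[OF smooth_E smooth_F smooth_E smooth_F U(2) rho_Cont(2)[OF g]])
  moreover have "(z, map_prod (act g) (\<rho> g) z) \<in> R" if "z \<in> U \<times> pts F" for z
    using that g openin_subset[OF smooth_map_on_open[OF U(2)]] by (cases z) (auto simp: mem_R)
  ultimately show ?thesis using that U by blast
qed

end

sublocale flat_contact_bundle \<subseteq> smooth_quotient "prod_manifold E F" "orbit_rel E p e F \<rho>"
proof
  show "smooth_manifold P" by (rule smooth_P)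
  show "equiv (pts P) R"
  proof (rule equivI)
    show "R \<subseteq> pts P \<times> pts P"
      using act_pts rho_Cont(5) by (auto simp: mem_R)
    show "refl_on (pts P) R"
    proof (rule refl_onI)
      fix z assume "z \<in> pts P"
      then show "(z, z) \<in> R"
        unfolding mem_R using one_G act_one rho_one by (auto intro!: bexI[of _ "\<one>\<^bsub>G\<^esub>"])
    qed
    show "sym R"
    proof (rule symI)
      fix z z' assume z: "(z, z') \<in> R"
      then obtain g where g: "g \<in> carrier G" "z' = (act g (fst z), \<rho> g (snd z))" by (auto simp: mem_R)
      obtain g' where g': "g' \<in> carrier G" "g' \<otimes>\<^bsub>G\<^esub> g = \<one>\<^bsub>G\<^esub>"
        using fundamental_group_inverse[OF g(1)] by blast
      have zp: "fst z \<in> pts E" "snd z \<in> pts F" using z by (auto simp: mem_R)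
      have "z = (act g' (fst z'), \<rho> g' (snd z'))"
        using act_mult[OF g'(1) g(1) zp(1)] rho_mult[OF g'(1) g(1) zp(2)] act_one[OF zp(1)] rho_one[OF zp(2)] g g'
        by (simp add: prod_eq_iff)
      then show "(z', z) \<in> R"
        using act_pts[OF g(1) zp(1)] rho_Cont(5)[OF g(1) zp(2)] g'(1) g(2) by (auto simp: mem_R)
    qed
    show "trans R"
    proof (rule transI)
      fix z z' z'' assume zz: "(z, z') \<in> R" "(z', z'') \<in> R"
      then obtain g g' where g: "g \<in> carrier G" "z' = (act g (fst z), \<rho> g (snd z))"
        and g': "g' \<in> carrier G" "z'' = (act g' (fst z'), \<rho> g' (snd z'))" by (auto simp: mem_R)
      have zp: "fst z \<in> pts E" "snd z \<in> pts F" using zz by (auto simp: mem_R)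
      have "z'' = (act (g' \<otimes>\<^bsub>G\<^esub> g) (fst z), \<rho> (g' \<otimes>\<^bsub>G\<^esub> g) (snd z))"
        using act_mult[OF g'(1) g(1) zp(1)] rho_mult[OF g'(1) g(1) zp(2)] g g' by simp
      then show "(z, z'') \<in> R"
        using zp fundamental_group_closed[OF g'(1) g(1)] unfolding mem_R by blast
    qed
  qed
  show "\<exists>U s. z \<in> U \<and> smooth_map_on U P P s \<and> s z = z' \<and> (\<forall>y\<in>U. (y, s y) \<in> R)" if z: "(z, z') \<in> R" for z z'
  proof -
    obtain g where g: "g \<in> carrier G" "z' = (act g (fst z), \<rho> g (snd z))" and zp: "fst z \<in> pts E" "snd z \<in> pts F"
      using z by (auto simp: mem_R)
    obtain U where U: "fst z \<in> U" "smooth_map_on (U \<times> pts F) P P (map_prod (act g) (\<rho> g))"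
      "\<And>z. z \<in> U \<times> pts F \<Longrightarrow> (z, map_prod (act g) (\<rho> g) z) \<in> R"
      by (rule R_local[OF g(1) zp]) blast
    have "z \<in> U \<times> pts F" "map_prod (act g) (\<rho> g) z = z'"
      using U(1) zp g(2) by (simp_all add: map_prod_def case_prod_unfold mem_Times_iff)
    with U(2,3) show ?thesis
      by (intro exI[of _ "U \<times> pts F"] exI[of _ "map_prod (act g) (\<rho> g)"] conjI ballI) simp_all
  qed
  show "\<exists>W. openin (mtop P) W \<and> z \<in> W \<and> inj_on (\<lambda>x. R `` {x}) W" if z: "z \<in> pts P" for z
  proof -
    have zp: "fst z \<in> pts E" "snd z \<in> pts F" using z by auto
    obtain U where U: "fst z \<in> U" "U \<subseteq> pts E" "diffeo_pair E B U (p ` U) p (inv_into U p)" "inj_on p U"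
      using p_diffeo[OF zp(1)] by metis
    have "openin (mtop P) (U \<times> pts F)"
      using U(3) smooth_map_on_open[of U E B p] by (auto simp: openin_prod_Times_iff diffeo_pair_def)
    \<comment> \<open>Equivalent points have first components over the same point of
      \<open>B\<close>; as \<open>p\<close> is injective on \<open>U\<close>, these components are
      equal, and freeness makes the group element trivial.\<close>
    moreover have "inj_on (\<lambda>x. R `` {x}) (U \<times> pts F)"
    proof (rule inj_onI)
      fix a b assume ab: "a \<in> U \<times> pts F" "b \<in> U \<times> pts F" "R `` {a} = R `` {b}"
      have bp: "fst b \<in> pts E" "snd b \<in> pts F" using ab(2) U(2) by auto
      have "(b, b) \<in> R" using bp one_G act_one rho_one unfolding mem_R by (auto intro!: bexI[of _ "\<one>\<^bsub>G\<^esub>"])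
      then have "(a, b) \<in> R" using ab(3) by blast
      then obtain g where g: "g \<in> carrier G" "b = (act g (fst a), \<rho> g (snd a))"
        and ap: "fst a \<in> pts E" "snd a \<in> pts F" by (auto simp: mem_R)
      have "p (fst b) = p (fst a)" using g p_act[OF g(1) ap(1)] by simp
      then have "fst b = fst a" using U(4) ab(1,2) by (auto simp: inj_on_def)
      then have "g = \<one>\<^bsub>G\<^esub>" using act_free[OF g(1) ap(1)] g(2) by simp
      then show "a = b" using g(2) act_one[OF ap(1)] rho_one[OF ap(2)] by simp
    qed
    ultimately show ?thesis using U(1) zp(2) by (intro exI[of _ "U \<times> pts F"]) (auto simp: mem_Times_iff)
  qed
  show "\<exists>V V'. openin (mtop P) V \<and> openin (mtop P) V' \<and> z \<in> V \<and> z' \<in> V' \<and> (\<forall>y\<in>V. \<forall>y'\<in>V'. (y, y') \<notin> R)"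
    if z: "z \<in> pts P" "z' \<in> pts P" "(z, z') \<notin> R" for z z'
  proof -
    have zp: "fst z \<in> pts E" "snd z \<in> pts F" "fst z' \<in> pts E" "snd z' \<in> pts F" using z by auto
    show ?thesis
    proof (cases "p (fst z) = p (fst z')")
      \<comment> \<open>The projection to \<open>B\<close> is constant on orbits, so disjoint
        neighbourhoods in \<open>B\<close> pull back to neighbourhoods with no equivalent
        points.\<close>
      case False
      have "p (fst z) \<in> pts B" "p (fst z') \<in> pts B" using zp p_image by blast+
      moreover have "Hausdorff_space (mtop B)" using smooth_B by (simp add: smooth_manifold_def)
      ultimately obtain V V' where V: "openin (mtop B) V" "openin (mtop B) V'" "p (fst z) \<in> V" "p (fst z') \<in> V'" "disjnt V V'"
        using False unfolding Hausdorff_space_def by metis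
      have "openin (mtop E) (pts E \<inter> p -` V)" "openin (mtop E) (pts E \<inter> p -` V')"
        using V(1,2) continuous_openin_preimage[OF p_continuous, of "pts B"] p_image
        unfolding top_B[symmetric] top_E[symmetric] by auto
      moreover have "(y, y') \<notin> R" if "y \<in> (pts E \<inter> p -` V) \<times> pts F" "y' \<in> (pts E \<inter> p -` V') \<times> pts F" for y y'
        using that V(5) p_act by (auto simp: mem_R disjnt_iff)
      ultimately show ?thesis
        using zp V by (intro exI[of _ "(pts E \<inter> p -` V) \<times> pts F"] exI[of _ "(pts E \<inter> p -` V') \<times> pts F"])
          (simp add: openin_prod_Times_iff mem_Times_iff)
    next
      case True
      \<comment> \<open>Over the same point of \<open>B\<close> some \<open>g\<close> matches the
        first components; as the points are not equivalent, \<open>\<rho> g (snd z)\<close> differs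
        from \<open>snd z'\<close> and the two are separated in \<open>F\<close>.\<close>
      obtain g where g: "g \<in> carrier G" "act g (fst z) = fst z'" using act_transitive[OF zp(1,3) True] by blast
      have "\<rho> g (snd z) \<noteq> snd z'" using z(3) g zp by (auto simp: mem_R prod_eq_iff)
      moreover have "Hausdorff_space (mtop F)" using smooth_F by (simp add: smooth_manifold_def)
      ultimately obtain V V' where V: "openin (mtop F) V" "openin (mtop F) V'" "\<rho> g (snd z) \<in> V" "snd z' \<in> V'" "disjnt V V'"
        using rho_Cont(5)[OF g(1) zp(2)] zp(4) unfolding Hausdorff_space_def by metis
      obtain U where U: "fst z' \<in> U" "U \<subseteq> pts E" "diffeo_pair E B U (p ` U) p (inv_into U p)" "inj_on p U"
        using p_diffeo[OF zp(3)] by metis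
      have oU: "openin (mtop E) U" using U(3) smooth_map_on_open[of U E B p] by (simp add: diffeo_pair_def)
      let ?N = "(pts E \<inter> act g -` U) \<times> (pts F \<inter> \<rho> g -` V)"
      have "openin (mtop P) ?N"
        using act_openin_vimage[OF g(1) oU] smooth_map_on_openin_vimage[OF rho_Cont(2)[OF g(1)] V(1)]
        by (simp add: openin_prod_Times_iff)
      moreover have "openin (mtop P) (U \<times> V')" using oU V(2) by (simp add: openin_prod_Times_iff)
      moreover have "(y, y') \<notin> R" if y: "y \<in> ?N" "y' \<in> U \<times> V'" for y y'
      proof
        assume "(y, y') \<in> R"
        then obtain g2 where g2: "g2 \<in> carrier G" "y' = (act g2 (fst y), \<rho> g2 (snd y))" by (auto simp: mem_R)
        have yp: "fst y \<in> pts E" "snd y \<in> pts F" "act g (fst y) \<in> U" "act g2 (fst y) \<in> U"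
          "\<rho> g (snd y) \<in> V" "\<rho> g2 (snd y) \<in> V'" using y g2 by auto
        \<comment> \<open>Both images lie in \<open>U\<close> over the same point of
          \<open>B\<close>, so by freeness \<open>g2\<close> acts on \<open>F\<close> like
          \<open>g\<close>. Then a single point would lie in both \<open>V\<close> and
          \<open>V'\<close>.\<close>
        have "act g (fst y) = act g2 (fst y)"
          using U(4) yp p_act[OF g(1) yp(1)] p_act[OF g2(1) yp(1)] by (auto simp: inj_on_def)
        moreover obtain g' where g': "g' \<in> carrier G" "g \<otimes>\<^bsub>G\<^esub> g' = \<one>\<^bsub>G\<^esub>" "g' \<otimes>\<^bsub>G\<^esub> g = \<one>\<^bsub>G\<^esub>"
          using fundamental_group_inverse[OF g(1)] by blast
        ultimately have "act (g' \<otimes>\<^bsub>G\<^esub> g2) (fst y) = fst y"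
          using act_mult[OF g'(1) g2(1) yp(1)] act_mult[OF g'(1) g(1) yp(1)] act_one[OF yp(1)] by simp
        then have 1: "g' \<otimes>\<^bsub>G\<^esub> g2 = \<one>\<^bsub>G\<^esub>"
          by (rule act_free[OF fundamental_group_closed[OF g'(1) g2(1)] yp(1)])
        note r2 = rho_Cont(5)[OF g2(1) yp(2)]
        have "\<rho> g2 (snd y) = \<rho> g (\<rho> g' (\<rho> g2 (snd y)))"
          using rho_mult[OF g(1) g'(1) r2] rho_one[OF r2] g'(2) by simp
        also have "\<dots> = \<rho> g (snd y)"
          using rho_mult[OF g'(1) g2(1) yp(2)] rho_one[OF yp(2)] 1 by simp
        finally show False using yp V(5) by (auto simp: disjnt_iff)
      qed
      ultimately show ?thesis
        using zp V U(1) g(2) by (intro exI[of _ ?N] exI[of _ "U \<times> V'"]) (simp add: mem_Times_iff)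
    qed
  qed
qed

context flat_contact_bundle
begin

section \<open>Explicit form of the structure on the product with the universal covering\<close>

definition A1 where "A1 = pullback_form P E fst (pullback_form E B p \<alpha>1)"
definition A2 where "A2 = pullback_form P F snd \<alpha>2"
definition \<Phi> where "\<Phi> = sum_endo (lift_endo E B p \<phi>1) \<phi>2"

lemma mem_P: "z \<in> pts P \<longleftrightarrow> fst z \<in> pts E \<and> snd z \<in> pts F"
  by (cases z) simp

lemma A1_eq: "z \<in> pts P \<Longrightarrow> A1 z w = \<alpha>1 (p (fst z)) (tangent_map E B p (fst z) (fst w))"
  using tangent_map_fst_snd(1)[OF smooth_E smooth_F, of "fst z" "snd z"] unfolding mem_P
  by (simp add: A1_def pullback_form_def)

lemma A2_eq: "z \<in> pts P \<Longrightarrow> A2 z w = \<alpha>2 (snd z) (snd w)"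
  using tangent_map_fst_snd(2)[OF smooth_E smooth_F, of "fst z" "snd z"] unfolding mem_P
  by (simp add: A2_def pullback_form_def)

lemma Phi_eq: "\<Phi> z w = (inv_into UNIV (tangent_map E B p (fst z)) (\<phi>1 (p (fst z)) (tangent_map E B p (fst z) (fst w))),
    \<phi>2 (snd z) (snd w))"
  by (simp add: \<Phi>_def sum_endo_def lift_endo_def case_prod_unfold)

lemma tangent_p_bij: "x \<in> pts E \<Longrightarrow> bij (tangent_map E B p x)"
  using p_diffeo diffeo_pair_tangent_map(3) by metis

subsection \<open>The structure on the product\<close>

abbreviation BF :: "('a \<times> 'f, 'e \<times> 'g) manifold" where "BF \<equiv> prod_manifold B F"

lemma smooth_BF: "smooth_manifold BF"
  by (rule smooth_manifold_prod[OF smooth_B smooth_F])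

lemma r_local_diffeo: "local_diffeo P BF (map_prod p id)"
  by (rule local_diffeo_map_prod_id[OF smooth_E smooth_B smooth_F local_diffeo_p])

lemma r_image: "map_prod p id ` pts P = pts BF"
  using p_image by (simp add: map_prod_surj_on)

lemma tangent_r:
  assumes "z \<in> pts P"
  shows "tangent_map P BF (map_prod p id) z w = (tangent_map E B p (fst z) (fst w), snd w)"
proof -
  have z: "fst z \<in> pts E" "snd z \<in> pts F" using assms mem_P by auto
  obtain U where U: "fst z \<in> U" "diffeo_pair E B U (p ` U) p (inv_into U p)" using p_diffeo[OF z(1)] by metis
  have f: "smooth_map_on U E B p" using U(2) by (simp add: diffeo_pair_def)
  show ?thesis
    using tangent_map_map_prod[OF smooth_E smooth_F smooth_B smooth_F f U(1)
        smooth_map_on_id[OF smooth_F openin_topspace] z(2), of "fst w" "snd w"] tangent_map_id[OF smooth_F z(2)]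
    by simp
qed

lemma r_related:
  assumes z: "z \<in> pts P"
  shows "A1 z w = \<alpha>1 (fst (map_prod p id z)) (fst (tangent_map P BF (map_prod p id) z w))"
    and "A2 z w = \<alpha>2 (snd (map_prod p id z)) (snd (tangent_map P BF (map_prod p id) z w))"
    and "tangent_map P BF (map_prod p id) z (\<Phi> z w) = sum_endo \<phi>1 \<phi>2 (map_prod p id z) (tangent_map P BF (map_prod p id) z w)"
proof -
  have "fst z \<in> pts E" using z mem_P by auto
  note s = surj_f_inv_f[OF bij_is_surj[OF tangent_p_bij[OF this]]]
  show "A1 z w = \<alpha>1 (fst (map_prod p id z)) (fst (tangent_map P BF (map_prod p id) z w))"
    "A2 z w = \<alpha>2 (snd (map_prod p id z)) (snd (tangent_map P BF (map_prod p id) z w))"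
    "tangent_map P BF (map_prod p id) z (\<Phi> z w) = sum_endo \<phi>1 \<phi>2 (map_prod p id z) (tangent_map P BF (map_prod p id) z w)"
    unfolding tangent_r[OF z] A1_eq[OF z] A2_eq[OF z] Phi_eq
    by (simp_all add: sum_endo_def s case_prod_unfold map_prod_def)
qed

lemma normal_B_iff: "normal_almost_contact B \<alpha>1 Z1 \<phi>1 \<longleftrightarrow> (\<forall>x\<in>pts B. normal_at B \<alpha>1 Z1 \<phi>1 x)"
  using normal_almost_contact_iff[OF smooth_B contact_manifoldD(3,8)[OF contact_B]] by simp

lemma normal_F_iff: "normal_almost_contact F \<alpha>2 Z2 \<phi>2 \<longleftrightarrow> (\<forall>y\<in>pts F. normal_at F \<alpha>2 Z2 \<phi>2 y)"
  using normal_almost_contact_iff[OF smooth_F contact_manifoldD(3,8)[OF contact_F]] by simp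

lemma contact_pair_P:
  shows "contact_pair_on (pts P) h k P A1 A2 \<Phi>"
    and "pts F \<noteq> {} \<Longrightarrow> integrable_structure P (pair_J P A1 A2 \<Phi>) \<longleftrightarrow>
      normal_almost_contact B \<alpha>1 Z1 \<phi>1 \<and> normal_almost_contact F \<alpha>2 Z2 \<phi>2"
    and "pts F \<noteq> {} \<Longrightarrow> integrable_structure P (pair_T P A1 A2 \<Phi>) \<longleftrightarrow>
      normal_almost_contact B \<alpha>1 Z1 \<phi>1 \<and> normal_almost_contact F \<alpha>2 Z2 \<phi>2"
proof -
  let ?a = "\<lambda>z w. \<alpha>1 (fst z) (fst w)" and ?b = "\<lambda>z w. \<alpha>2 (snd z) (snd w)"
  note bf = contact_pair_on_prod[OF contact_B contact_F]
  let ?c = "sum_endo \<phi>1 \<phi>2"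
  have rel: "contact_pair_on (pts P) h k P A1 A2 \<Phi> \<longleftrightarrow> contact_pair_on (pts BF) h k BF ?a ?b ?c"
    by (rule contact_pair_on_related(1)[OF smooth_P smooth_BF r_local_diffeo r_image]) (erule r_related)+
  have J: "integrable_structure P (pair_J P A1 A2 \<Phi>) \<longleftrightarrow> integrable_structure BF (pair_J BF ?a ?b ?c)"
    by (rule contact_pair_on_related(2)[OF smooth_P smooth_BF r_local_diffeo r_image]) (erule r_related | rule bf(1))+
  have T: "integrable_structure P (pair_T P A1 A2 \<Phi>) \<longleftrightarrow> integrable_structure BF (pair_T BF ?a ?b ?c)"
    by (rule contact_pair_on_related(3)[OF smooth_P smooth_BF r_local_diffeo r_image]) (erule r_related | rule bf(1))+
  show "contact_pair_on (pts P) h k P A1 A2 \<Phi>" using bf(1) rel by simp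
  \<comment> \<open>With both factors nonempty, the joint condition on all pairs of points splits
    into one condition on each factor.\<close>
  have "pts B \<noteq> {}" using pe_S by blast
  then show "integrable_structure P (pair_J P A1 A2 \<Phi>) \<longleftrightarrow>
      normal_almost_contact B \<alpha>1 Z1 \<phi>1 \<and> normal_almost_contact F \<alpha>2 Z2 \<phi>2"
    and "integrable_structure P (pair_T P A1 A2 \<Phi>) \<longleftrightarrow>
      normal_almost_contact B \<alpha>1 Z1 \<phi>1 \<and> normal_almost_contact F \<alpha>2 Z2 \<phi>2" if "pts F \<noteq> {}"
    using that unfolding J T bf(2,3) normal_B_iff normal_F_iff by blast+
qed

subsection \<open>Descent to the flat bundle\<close>

text \<open>Invariance under the diagonal action: \<open>A1\<close> and the lift of
  \<open>\<phi>1\<close> are preserved because \<open>p\<close> is unchanged by deck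
  transformations, \<open>A2\<close> and \<open>\<phi>2\<close> because \<open>\<rho> g\<close> lies
  in \<open>Cont\<close>. The first claim is the chain rule for \<open>proj\<close> composed with
  the action.\<close>

lemma tangent_act:
  assumes g: "g \<in> carrier G" and z: "z \<in> pts P"
  defines "s \<equiv> map_prod (act g) (\<rho> g)"
  shows "tangent_map P Q proj (s z) (tangent_map P P s z w) = tangent_map P Q proj z w"
    and "A1 (s z) (tangent_map P P s z w) = A1 z w"
    and "A2 (s z) (tangent_map P P s z w) = A2 z w"
    and "tangent_map P P s z (\<Phi> z w) = \<Phi> (s z) (tangent_map P P s z w)"
    and "s z \<in> pts P"
proof -
  have zp: "fst z \<in> pts E" "snd z \<in> pts F" using z mem_P by auto
  obtain U where U: "fst z \<in> U" "smooth_map_on U E E (act g)" "smooth_map_on (U \<times> pts F) P P s"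
    "\<And>z. z \<in> U \<times> pts F \<Longrightarrow> (z, s z) \<in> R"
    unfolding s_def by (rule R_local[OF g zp]) blast
  have zU: "z \<in> U \<times> pts F" using U(1) zp(2) by (simp add: mem_Times_iff)
  show sz: "s z \<in> pts P" by (rule smooth_map_on_pts[OF U(3) zU])
  have Ts: "tangent_map P P s z w = (tangent_map E E (act g) (fst z) (fst w), tangent_map F F (\<rho> g) (snd z) (snd w))" for w
    using tangent_map_map_prod[OF smooth_E smooth_F smooth_E smooth_F U(2,1) rho_Cont(2)[OF g] zp(2), of "fst w" "snd w"]
    by (simp add: s_def)
  have szc: "fst (s z) = act g (fst z)" "snd (s z) = \<rho> g (snd z)" by (cases z; simp add: s_def)+
  show "tangent_map P Q proj (s z) (tangent_map P P s z w) = tangent_map P Q proj z w"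
  proof -
    obtain V where V: "s z \<in> V" "diffeo_pair P Q V (proj ` V) proj (inv_into V proj)"
      using local_diffeo_pair[OF smooth_P smooth_Q proj_local_diffeo sz] by blast
    have "tangent_map P Q proj (s z) (tangent_map P P s z w) = tangent_map P Q (proj \<circ> s) z w"
      by (rule tangent_map_compose[OF smooth_P smooth_P smooth_Q U(3) _ zU V(1), symmetric])
        (use V(2) in \<open>simp add: diffeo_pair_def\<close>)
    also have "tangent_map P Q (proj \<circ> s) z = tangent_map P Q proj z"
      by (rule tangent_map_cong[OF smooth_P smooth_map_on_open[OF U(3)] zU])
        (use U(4) proj_rel in \<open>metis comp_apply\<close>)
    finally show ?thesis .
  qed
  have Tp: "tangent_map E B p (act g (fst z)) (tangent_map E E (act g) (fst z) u) = tangent_map E B p (fst z) u" for u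
  proof -
    obtain V where V: "act g (fst z) \<in> V" "diffeo_pair E B V (p ` V) p (inv_into V p)"
      using p_diffeo[OF act_pts[OF g zp(1)]] by metis
    have "tangent_map E B p (act g (fst z)) (tangent_map E E (act g) (fst z) u) = tangent_map E B (p \<circ> act g) (fst z) u"
      by (rule tangent_map_compose[OF smooth_E smooth_E smooth_B U(2) _ U(1) V(1), symmetric])
        (use V(2) in \<open>simp add: diffeo_pair_def\<close>)
    also have "tangent_map E B (p \<circ> act g) (fst z) = tangent_map E B p (fst z)"
      by (rule tangent_map_cong[OF smooth_E smooth_map_on_open[OF U(2)] U(1)])
        (use p_act[OF g] openin_subset[OF smooth_map_on_open[OF U(2)]] in auto)
    finally show ?thesis .
  qed
  show "A1 (s z) (tangent_map P P s z w) = A1 z w"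
    by (simp add: A1_eq[OF sz] A1_eq[OF z] szc Ts Tp p_act[OF g zp(1)])
  show "A2 (s z) (tangent_map P P s z w) = A2 z w"
    by (simp add: A2_eq[OF sz] A2_eq[OF z] szc Ts rho_Cont(3)[OF g zp(2)])
  let ?T = "tangent_map E B p (fst z)" and ?T' = "tangent_map E B p (act g (fst z))"
  \<comment> \<open>The lift of \<open>\<phi>1\<close> is conjugation by the tangent map of
    \<open>p\<close>, so its compatibility with the action needs the inverses of these tangent maps
    to be intertwined as well.\<close>
  have "tangent_map E E (act g) (fst z) (inv_into UNIV ?T v) = inv_into UNIV ?T' v" for v
  proof -
    have "?T' (tangent_map E E (act g) (fst z) (inv_into UNIV ?T v)) = v"
      unfolding Tp using tangent_p_bij[OF zp(1)] by (simp add: bij_is_surj surj_f_inv_f)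
    then show ?thesis
      using tangent_p_bij[OF act_pts[OF g zp(1)]] by (metis bij_is_inj inv_f_f)
  qed
  then show "tangent_map P P s z (\<Phi> z w) = \<Phi> (s z) (tangent_map P P s z w)"
    by (simp add: Phi_eq szc Ts Tp p_act[OF g zp(1)] rho_Cont(4)[OF g zp(2)])
qed

text \<open>Tensors on the quotient are read off at a chosen representative of each class; any other
  representative differs by the action, under which they are invariant.\<close>

lemma descended_structure:
  "\<exists>\<beta>1 \<beta>2 \<psi>. descends P Q proj A1 A2 \<Phi> \<beta>1 \<beta>2 \<psi>"
proof -
  let ?T = "tangent_map P Q proj"
  \<comment> \<open>An arbitrary representative of the class; no continuity is asked of the choice,
    as smoothness follows later from the relations along \<open>proj\<close>.\<close>
  define lift where "lift m = (SOME z. z \<in> pts P \<and> proj z = m)" for m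
  define \<beta>1 where "\<beta>1 m w = A1 (lift m) (inv_into UNIV (?T (lift m)) w)" for m w
  define \<beta>2 where "\<beta>2 m w = A2 (lift m) (inv_into UNIV (?T (lift m)) w)" for m w
  define \<psi> where "\<psi> m w = ?T (lift m) (\<Phi> (lift m) (inv_into UNIV (?T (lift m)) w))" for m w
  have bij: "bij (?T z)" if z: "z \<in> pts P" for z
    using local_diffeo_pair[OF smooth_P smooth_Q proj_local_diffeo z] diffeo_pair_tangent_map(3) by metis
  have main: "\<beta>1 (proj z) (?T z w) = A1 z w \<and> \<beta>2 (proj z) (?T z w) = A2 z w \<and> \<psi> (proj z) (?T z w) = ?T z (\<Phi> z w)"
    if z: "z \<in> pts P" for z w
  proof -
    define z' where "z' = lift (proj z)"
    have "z' \<in> pts P \<and> proj z' = proj z"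
      unfolding z'_def lift_def by (rule someI_ex) (use z in blast)
    then have z': "z' \<in> pts P" "(z, z') \<in> R" using proj_eq[OF z, of z'] z by (simp_all del: split_paired_All)
    then obtain g where g: "g \<in> carrier G" "z' = (act g (fst z), \<rho> g (snd z))" by (auto simp: mem_R)
    let ?s = "map_prod (act g) (\<rho> g)"
    have sz: "?s z = z'" using g(2) by (cases z) simp
    note t = tangent_act[OF g(1) z, unfolded sz]
    have inv: "inv_into UNIV (?T z') (?T z w) = tangent_map P P ?s z w"
      using t(1)[of w] bij[OF z'(1)] by (metis bij_is_inj inv_f_f)
    have "\<beta>1 (proj z) (?T z w) = A1 z w" "\<beta>2 (proj z) (?T z w) = A2 z w"
      unfolding \<beta>1_def \<beta>2_def z'_def[symmetric] inv by (rule t(2) t(3))+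
    moreover have "\<psi> (proj z) (?T z w) = ?T z (\<Phi> z w)"
      unfolding \<psi>_def z'_def[symmetric] inv t(4)[symmetric] by (rule t(1))
    ultimately show ?thesis by blast
  qed
  have "descends P Q proj A1 A2 \<Phi> \<beta>1 \<beta>2 \<psi>"
    unfolding descends_def pullback_form_def
    using proj_local_diffeo proj_image main by simp
  then show ?thesis by blast
qed

lemma dim: "DIM('e \<times> 'g) = 2 * h + 2 * k + 2"
  using contact_manifoldD(2)[OF contact_B] contact_manifoldD(2)[OF contact_F] by simp

text \<open>Stated for every triple to which the structure descends: the relations along
  \<open>proj\<close> alone carry the contact pair conditions and integrability from the product to
  the quotient.\<close>

lemma descends_contact_pair:
  assumes D: "descends P Q proj A1 A2 \<Phi> \<beta>1 \<beta>2 \<psi>"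
  shows "contact_pair_structure h k Q \<beta>1 \<beta>2 \<psi>"
    and "pts F \<noteq> {} \<Longrightarrow> normal_contact_pair h k Q \<beta>1 \<beta>2 \<psi> \<longleftrightarrow>
      normal_almost_contact B \<alpha>1 Z1 \<phi>1 \<and> normal_almost_contact F \<alpha>2 Z2 \<phi>2"
proof -
  have r: "\<And>z w. z \<in> pts P \<Longrightarrow> A1 z w = \<beta>1 (proj z) (tangent_map P Q proj z w)"
    "\<And>z w. z \<in> pts P \<Longrightarrow> A2 z w = \<beta>2 (proj z) (tangent_map P Q proj z w)"
    "\<And>z w. z \<in> pts P \<Longrightarrow> tangent_map P Q proj z (\<Phi> z w) = \<psi> (proj z) (tangent_map P Q proj z w)"
    using D unfolding descends_def pullback_form_def by auto
  have rel: "contact_pair_on (pts P) h k P A1 A2 \<Phi> \<longleftrightarrow> contact_pair_on (pts Q) h k Q \<beta>1 \<beta>2 \<psi>"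
    by (rule contact_pair_on_related(1)[OF smooth_P smooth_Q proj_local_diffeo proj_image]) (erule r)+
  have C: "contact_pair_on (pts Q) h k Q \<beta>1 \<beta>2 \<psi>" using contact_pair_P(1) unfolding rel .
  have J: "integrable_structure P (pair_J P A1 A2 \<Phi>) \<longleftrightarrow> integrable_structure Q (pair_J Q \<beta>1 \<beta>2 \<psi>)"
    by (rule contact_pair_on_related(2)[OF smooth_P smooth_Q proj_local_diffeo proj_image]) (erule r | rule C)+
  have T: "integrable_structure P (pair_T P A1 A2 \<Phi>) \<longleftrightarrow> integrable_structure Q (pair_T Q \<beta>1 \<beta>2 \<psi>)"
    by (rule contact_pair_on_related(3)[OF smooth_P smooth_Q proj_local_diffeo proj_image]) (erule r | rule C)+
  show c: "contact_pair_structure h k Q \<beta>1 \<beta>2 \<psi>"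
    by (rule contact_pair_structureI[OF smooth_Q dim C])
  show "normal_contact_pair h k Q \<beta>1 \<beta>2 \<psi> \<longleftrightarrow>
      normal_almost_contact B \<alpha>1 Z1 \<phi>1 \<and> normal_almost_contact F \<alpha>2 Z2 \<phi>2" if "pts F \<noteq> {}"
    unfolding normal_contact_pair_def J[symmetric] T[symmetric] contact_pair_P(2,3)[OF that] using c by simp
qed

end

theorem theorem26:
  fixes B :: "('a::topological_space, 'e::euclidean_space) manifold"
    and B' :: "('c::topological_space, 'e) manifold"
    and F :: "('f, 'g::euclidean_space) manifold"
    and h k :: nat and p :: "'c \<Rightarrow> 'a" and b' :: 'c
    and \<alpha>\<^sub>1 :: "'a \<Rightarrow> 'e \<Rightarrow> real" and Z\<^sub>1 :: "'a \<Rightarrow> 'e" and \<phi>\<^sub>1 :: "'a \<Rightarrow> 'e \<Rightarrow> 'e"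
    and \<alpha>\<^sub>2 :: "'f \<Rightarrow> 'g \<Rightarrow> real" and Z\<^sub>2 :: "'f \<Rightarrow> 'g" and \<phi>\<^sub>2 :: "'f \<Rightarrow> 'g \<Rightarrow> 'g"
    and \<rho> :: "(real \<Rightarrow> 'a) set \<Rightarrow> 'f \<Rightarrow> 'f"
  assumes "contact_manifold h B \<alpha>\<^sub>1 Z\<^sub>1 \<phi>\<^sub>1" and "connected_space (mtop B)" and "pts B \<noteq> {}"
    and "contact_manifold k F \<alpha>\<^sub>2 Z\<^sub>2 \<phi>\<^sub>2" and "connected_space (mtop F)" and "pts F \<noteq> {}"
    and "universal_covering B' p B" and "b' \<in> pts B'"
    and "\<rho> \<in> hom (fundamental_group (pts B) (p b')) (Cont F \<alpha>\<^sub>2 \<phi>\<^sub>2)"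
  defines "P \<equiv> prod_manifold B' F"
    and "A\<^sub>1 \<equiv> pullback_form (prod_manifold B' F) B' fst (pullback_form B' B p \<alpha>\<^sub>1)"
    and "A\<^sub>2 \<equiv> pullback_form (prod_manifold B' F) F snd \<alpha>\<^sub>2"
    and "\<Phi> \<equiv> sum_endo (lift_endo B' B p \<phi>\<^sub>1) \<phi>\<^sub>2"
    and "M \<equiv> flat_bundle B' p b' F \<rho>"
    and "q \<equiv> flat_bundle_proj B' p b' F \<rho>"
  shows "contact_pair_structure h k P A\<^sub>1 A\<^sub>2 \<Phi> \<and>
    (\<exists>\<beta>\<^sub>1 \<beta>\<^sub>2 \<psi>. descends P M q A\<^sub>1 A\<^sub>2 \<Phi> \<beta>\<^sub>1 \<beta>\<^sub>2 \<psi> \<and> contact_pair_structure h k M \<beta>\<^sub>1 \<beta>\<^sub>2 \<psi>) \<and>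
    (\<forall>\<beta>\<^sub>1 \<beta>\<^sub>2 \<psi>. descends P M q A\<^sub>1 A\<^sub>2 \<Phi> \<beta>\<^sub>1 \<beta>\<^sub>2 \<psi> \<longrightarrow>
       contact_pair_structure h k M \<beta>\<^sub>1 \<beta>\<^sub>2 \<psi> \<and>
       (normal_contact_pair h k M \<beta>\<^sub>1 \<beta>\<^sub>2 \<psi> \<longleftrightarrow>
          normal_almost_contact B \<alpha>\<^sub>1 Z\<^sub>1 \<phi>\<^sub>1 \<and> normal_almost_contact F \<alpha>\<^sub>2 Z\<^sub>2 \<phi>\<^sub>2))"
proof -
  interpret X: flat_contact_bundle B B' F h k p b' \<alpha>\<^sub>1 Z\<^sub>1 \<phi>\<^sub>1 \<alpha>\<^sub>2 Z\<^sub>2 \<phi>\<^sub>2 \<rho>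
    by (intro flat_contact_bundle.intro assms)
  have eqs: "A\<^sub>1 = X.A1" "A\<^sub>2 = X.A2" "\<Phi> = X.\<Phi>" "M = X.Q" "q = X.proj"
    by (simp_all add: A\<^sub>1_def A\<^sub>2_def \<Phi>_def M_def q_def X.A1_def X.A2_def X.\<Phi>_def flat_bundle_def
        flat_bundle_proj_def[abs_def] X.proj_def)
  have "contact_pair_structure h k P A\<^sub>1 A\<^sub>2 \<Phi>"
    unfolding eqs P_def by (rule contact_pair_structureI[OF X.smooth_P X.dim X.contact_pair_P(1)])
  moreover have "\<exists>\<beta>\<^sub>1 \<beta>\<^sub>2 \<psi>. descends P M q A\<^sub>1 A\<^sub>2 \<Phi> \<beta>\<^sub>1 \<beta>\<^sub>2 \<psi> \<and> contact_pair_structure h k M \<beta>\<^sub>1 \<beta>\<^sub>2 \<psi>"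
    unfolding eqs P_def using X.descended_structure X.descends_contact_pair(1) by blast
  moreover have "contact_pair_structure h k M \<beta>\<^sub>1 \<beta>\<^sub>2 \<psi> \<and>
       (normal_contact_pair h k M \<beta>\<^sub>1 \<beta>\<^sub>2 \<psi> \<longleftrightarrow>
          normal_almost_contact B \<alpha>\<^sub>1 Z\<^sub>1 \<phi>\<^sub>1 \<and> normal_almost_contact F \<alpha>\<^sub>2 Z\<^sub>2 \<phi>\<^sub>2)"
    if "descends P M q A\<^sub>1 A\<^sub>2 \<Phi> \<beta>\<^sub>1 \<beta>\<^sub>2 \<psi>" for \<beta>\<^sub>1 \<beta>\<^sub>2 \<psi>
    using X.descends_contact_pair[OF that[unfolded eqs P_def]] assms(6) unfolding eqs by blast
  ultimately show ?thesis by blast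
qed

end
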